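(* Let $l,m,n$ be positive integers with $m\le n$, let $U$ be an open subset of $\mathbb R^n$, let $V$ be an $m$-dimensional rectifiable varifold in $U$ such that $\|\delta V\|$ is a Radon measure, let $G$ be a relatively open subset of $\operatorname{Bdry}U$, and let $B=(\operatorname{Bdry}U)\setminus G$. Suppose $f\in\mathbf T_G(V,\mathbb R^l)$, $g:U\to\mathbb R$, and $$\int_{U\cap K}|f|+|V\mathbf Df|\,d\|V\|<\infty,\qquad\operatorname{Lip}(g|U\cap K)<\infty$$ whenever $K$ is a compact subset of $\mathbb R^n\setminus B$. Then $gf\in\mathbf T_G(V,\mathbb R^l)$.
   Context: $\mathbf G(n,m)$ is the set of $m$-dimensional linear subspaces of $\mathbb R^n$; $S_\natural$ is the orthogonal projection onto $S$; $\sigma\bullet\tau=\operatorname{trace}(\sigma^*\circ\tau)$, $|\sigma|^2=\sigma\bullet\sigma$; $\langle v,\lambda\rangle=\lambda(v)$. $\operatorname{Bdry}U$ is the topological boundary; $\operatorname{Lip}$ is the Lipschitz constant. Measurable functions may be defined only almost everywhere. An $m$-dimensional varifold $V$ in $U$ is a Radon measure over $U\times\mathbf G(n,m)$, with weight $\|V\|(A)=V(A\times\mathbf G(n,m))$. It is rectifiable if $V(k)=\sum_{i=1}^\infty c_i\int_{E_i}k(z,\operatorname{Tan}(M_i,z))\,d\mathscr H^m z$ for continuous compactly supported $k$, with $0<c_i<\infty$ and $E_i$ Borel subsets of $m$-dimensional $C^1$ submanifolds $M_i$. First variation $\delta V(g)=\int Dg(z)\bullet S_\natural\,dV(z,S)$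 for $g\in C_c^\infty(U,\mathbb R^n)$. For $S\in\mathscr D'(U,\mathbb R^n)$, $\|S\|$ is the largest Borel regular measure with $\|S\|(C)=\sup\{S(\theta):\theta\in C_c^\infty(U,\mathbb R^n),\operatorname{spt}\theta\subset C,|\theta|\le1\}$ for open $C$. If $\|S\|$ is Radon, $S(\theta)$ for $\theta\in\mathbf L_1(\|S\|,\mathbb R^n)$ denotes the unique $\mathbf L_1(\|S\|)$-continuous extension. For $E$ $\|V\|+\|\delta V\|$ measurable, $((\delta V)\llcorner E)(\theta)=\delta V(\chi_E\theta)$ and $V\,\partial E=(\delta V)\llcorner E-\delta(V\llcorner(E\times\mathbf G(n,m)))\in\mathscr D'(U,\mathbb R^n)$. $\mathbf T(V,\mathbb R^l)$ is the set of $\mathbb R^l$ valued $\|V\|+\|\delta V\|$ measurable functions $f$ with domain contained in $U$ for which there is a $\|V\|$ measurable $\operatorname{Hom}(\mathbb R^n,\mathbb R^l)$ valued $F$ such that (i) $\int_{K\cap\{|f|\le s\}}|F|\,d\|V\|<\infty$ for compact $K\subset U$, $0\le s<\infty$; (ii) for $\theta\in C_c^\infty(U,\mathbb R^n)$ and $\eta\in C^\infty(\mathbb R^l,\mathbb R)$ with $\operatorname{spt}D\eta$ compact, $$\delta V((\eta\circ f)\theta)=\int\eta(f(z))S_\natural\bullet D\theta(z)\,dV(z,S)+\int\langle\theta(z),D\eta(f(z))\circ F(z)\rangle\,d\|V\|z.$$ $F$ is $\|V\|$ almost unique and is denoted $V\mathbf Df$. $\mathbf T_G(V,\mathbb R^l)$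 is the set of $f\in\mathbf T(V,\mathbb R^l)$ such that, with $E(t)=\{z:|f(z)|>t\}$, for $\mathscr L^1$ almost all $0<t<\infty$: $\|V\|(E(t)\cap K)+\|\delta V\|(E(t)\cap K)+\|V\,\partial E(t)\|(U\cap K)<\infty$ and $\int_{E(t)\times\mathbf G(n,m)}D\theta(z)\bullet S_\natural\,dV(z,S)=((\delta V)\llcorner E(t))(\theta|U)-(V\,\partial E(t))(\theta|U)$ whenever $K\subset\mathbb R^n\setminus B$ is compact and $\theta\in C_c^\infty(\mathbb R^n\setminus B,\mathbb R^n)$. *)

theory Defs
  imports "HOL-Analysis.Analysis"
begin

section \<open>Borel and Radon measures\<close>

definition borel_of :: "'a topology \<Rightarrow> 'a measure" where
  "borel_of X = sigma (topspace X) {W. openin X W}"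

text \<open>
  Radon measures in the sense of Federer are outer measures; here they are represented by their
  restrictions to the Borel sets, from which they are recovered by outer regularity.  Sets and
  functions that are measurable with respect to the outer measure are those measurable with respect
  to the completion of the Borel measure.
\<close>

definition radon_measure_on :: "'a topology \<Rightarrow> 'a measure \<Rightarrow> bool" where
  "radon_measure_on X M \<longleftrightarrow>
     space M = topspace X \<and> sets M = sets (borel_of X) \<and>
     (\<forall>K. compactin X K \<longrightarrow> emeasure M K < \<infinity>) \<and>
     (\<forall>W. openin X W \<longrightarrow> emeasure M W = (SUP K\<in>{K. compactin X K \<and> K \<subseteq> W}. emeasure M K)) \<and>
     (\<forall>A\<in>sets M. emeasure M A = (INF W\<in>{W. openin X W \<and> A \<subseteq> W}. emeasure M W))"

definition sum_measure :: "'a measure \<Rightarrow> 'a measure \<Rightarrow> 'a measure" where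
  "sum_measure M N = measure_of (space M) (sets M) (\<lambda>A. emeasure M A + emeasure N A)"

text \<open>
  Measurable functions which need only be defined almost everywhere, as partial functions.  Integrals
  of expressions in \<open>the (f z)\<close> do not depend on the value of \<open>the None\<close>, the complement of the
  domain being a null set.
\<close>

definition ae_measurable :: "'a measure \<Rightarrow> ('a \<Rightarrow> 'b::topological_space option) \<Rightarrow> bool" where
  "ae_measurable M f \<longleftrightarrow>
     dom f \<subseteq> space M \<and> (AE z in M. z \<in> dom f) \<and>
     (\<forall>W. open W \<longrightarrow> {z \<in> dom f. the (f z) \<in> W} \<in> sets (completion M))"

section \<open>Smooth functions and distributions\<close>

fun Ck_on :: "nat \<Rightarrow> 'a::real_normed_vector set \<Rightarrow> ('a \<Rightarrow> 'b::real_normed_vector) \<Rightarrow> bool" where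
  "Ck_on 0 S f \<longleftrightarrow> continuous_on S f"
| "Ck_on (Suc k) S f \<longleftrightarrow>
     (\<forall>x\<in>S. f differentiable (at x)) \<and> (\<forall>v. Ck_on k S (\<lambda>x. frechet_derivative f (at x) v))"

definition smooth :: "('a::real_normed_vector \<Rightarrow> 'b::real_normed_vector) \<Rightarrow> bool" where
  "smooth f \<longleftrightarrow> (\<forall>k. Ck_on k UNIV f)"

definition spt :: "('a::topological_space \<Rightarrow> 'b::zero) \<Rightarrow> 'a set" where
  "spt f = closure {x. f x \<noteq> 0}"

text \<open>
  For open \<open>U\<close>, members of \<open>C\<^sub>c\<^sup>\<infinity>(U)\<close> are identified with their extensions by zero
  to the whole space.
\<close>

definition test_functions :: "'a::euclidean_space set \<Rightarrow> ('a \<Rightarrow> 'b::real_normed_vector) set" where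
  "test_functions U = {\<theta>. smooth \<theta> \<and> compact (spt \<theta>) \<and> spt \<theta> \<subseteq> U}"

text \<open>
  Federer's Borel regular measures over an open set \<open>U\<close>.  An outer measure is defined only for
  subsets of \<open>U\<close>; the first clause fixes its (irrelevant) values at other sets.
\<close>

definition borel_regular_measure ::
    "'a::topological_space set \<Rightarrow> ('a set \<Rightarrow> ennreal) \<Rightarrow> bool" where
  "borel_regular_measure U \<phi> \<longleftrightarrow>
     (\<forall>A. \<phi> A = \<phi> (A \<inter> U)) \<and>
     outer_measure_space (Pow U) \<phi> \<and>
     (\<forall>C. open C \<and> C \<subseteq> U \<longrightarrow> C \<in> lambda_system U (Pow U) \<phi>) \<and>
     (\<forall>A. A \<subseteq> U \<longrightarrow> (\<exists>A'\<in>sets borel. A \<subseteq> A' \<and> A' \<subseteq> U \<and> \<phi> A' = \<phi> A))"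

definition variation_outer ::
    "'a::euclidean_space set \<Rightarrow> (('a \<Rightarrow> 'b::real_normed_vector) \<Rightarrow> real) \<Rightarrow> 'a set \<Rightarrow> ennreal" where
  "variation_outer U S =
     (GREATEST \<phi>. borel_regular_measure U \<phi> \<and>
        (\<forall>C. open C \<and> C \<subseteq> U \<longrightarrow>
           \<phi> C = (SUP \<theta>\<in>{\<theta> \<in> test_functions U. spt \<theta> \<subseteq> C \<and> (\<forall>z. norm (\<theta> z) \<le> 1)}.
                    ennreal (S \<theta>))))"

definition variation ::
    "'a::euclidean_space set \<Rightarrow> (('a \<Rightarrow> 'b::real_normed_vector) \<Rightarrow> real) \<Rightarrow> 'a measure" where
  "variation U S = measure_of U (sets (borel_of (top_of_set U))) (variation_outer U S)"

text \<open>
  The extension of a distribution \<open>S\<close> in \<open>U\<close>, for which \<open>variation U S\<close> is Radon, to the functions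
  that are integrable with respect to \<open>variation U S\<close>.  Only the values of functions almost
  everywhere in \<open>U\<close> matter.
\<close>

definition L1_functions ::
    "'a measure \<Rightarrow> ('a \<Rightarrow> 'b::{banach, second_countable_topology}) set" where
  "L1_functions M = {\<theta>. integrable (completion M) \<theta>}"

definition L1_continuous ::
    "'a measure \<Rightarrow> (('a \<Rightarrow> 'b::{banach, second_countable_topology}) \<Rightarrow> real) \<Rightarrow> bool" where
  "L1_continuous M T \<longleftrightarrow>
     (\<forall>\<theta>\<in>L1_functions M. \<forall>e>0. \<exists>d>0. \<forall>\<xi>\<in>L1_functions M.
        (LINT z|completion M. norm (\<xi> z - \<theta> z)) < d \<longrightarrow> \<bar>T \<xi> - T \<theta>\<bar> < e)"

definition L1_extension ::
    "'a::euclidean_space set \<Rightarrow> (('a \<Rightarrow> 'b::{banach, second_countable_topology}) \<Rightarrow> real) \<Rightarrow>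
      ('a \<Rightarrow> 'b) \<Rightarrow> real" where
  "L1_extension U S =
     (THE T. T \<in> extensional (L1_functions (variation U S)) \<and>
        L1_continuous (variation U S) T \<and> (\<forall>\<theta>\<in>test_functions U. T \<theta> = S \<theta>))"

section \<open>The Grassmannian\<close>

definition grassmannian :: "nat \<Rightarrow> (real^'n) set set" where
  "grassmannian m = {S. subspace S \<and> dim S = m}"

definition orth_projection :: "(real^'n) set \<Rightarrow> real^'n^'n" where
  "orth_projection S = matrix (\<lambda>x. THE y. y \<in> S \<and> (\<forall>s\<in>S. orthogonal (x - y) s))"

definition grassmannian_topology :: "nat \<Rightarrow> (real^'n) set topology" where
  "grassmannian_topology m = pullback_topology (grassmannian m) orth_projection euclidean"

text \<open>
  Linear maps between Euclidean spaces are represented by matrices; the inner product and the norm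
  of the type \<open>real^'n^'l\<close> are the required ones on \<open>Hom(\<real>\<^sup>n, \<real>\<^sup>l)\<close>:
\<close>

lemma inner_matrix_eq_trace:
  fixes A B :: "real^'n^'l"
  shows "A \<bullet> B = trace (transpose A ** B)"
  unfolding trace_def transpose_def matrix_matrix_mult_def inner_vec_def
  by (simp, subst sum.swap, rule refl)

section \<open>Varifolds\<close>

definition varifold :: "(real^'n) set \<Rightarrow> nat \<Rightarrow> ((real^'n) \<times> (real^'n) set) measure \<Rightarrow> bool" where
  "varifold U m V \<longleftrightarrow>
     radon_measure_on (prod_topology (top_of_set U) (grassmannian_topology m)) V"

definition weight ::
    "(real^'n) set \<Rightarrow> ((real^'n) \<times> (real^'n) set) measure \<Rightarrow> (real^'n) measure" where
  "weight U V = distr V (borel_of (top_of_set U)) fst"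

text \<open>
  Normalised \<open>m\<close> dimensional Hausdorff measure, for \<open>m \<ge> 1\<close>.  Boundedness of the covering sets has
  to be required since \<open>diameter\<close> has no meaningful value at unbounded sets.
\<close>

definition hausdorff_outer :: "nat \<Rightarrow> 'a::euclidean_space set \<Rightarrow> ennreal" where
  "hausdorff_outer m A =
     (SUP \<delta>\<in>{0<..}. INF S\<in>{S :: nat \<Rightarrow> 'a set.
          (\<forall>i. bounded (S i) \<and> diameter (S i) \<le> \<delta>) \<and> A \<subseteq> (\<Union>i. S i)}.
        (\<Sum>i. ennreal (unit_ball_vol (real m) * (diameter (S i) / 2) ^ m)))"

definition hausdorff_measure :: "nat \<Rightarrow> 'a::euclidean_space measure" where
  "hausdorff_measure m = measure_of UNIV (sets borel) (hausdorff_outer m)"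

definition C1_submanifold :: "nat \<Rightarrow> (real^'n) set \<Rightarrow> bool" where
  "C1_submanifold m M \<longleftrightarrow>
     (\<forall>a\<in>M. \<exists>T W Z. \<exists>\<sigma> :: real^'n \<Rightarrow> real^'n. \<exists>\<tau>.
        open T \<and> a \<in> T \<and> open W \<and> homeomorphism T W \<sigma> \<tau> \<and>
        Ck_on 1 T \<sigma> \<and> Ck_on 1 W \<tau> \<and> subspace Z \<and> dim Z = m \<and>
        \<sigma> ` (M \<inter> T) = W \<inter> Z)"

definition Tan :: "'a::real_normed_vector set \<Rightarrow> 'a \<Rightarrow> 'a set" where
  "Tan M a = {v. \<forall>e>0. \<exists>x\<in>M. \<exists>r>0. norm (x - a) < e \<and> norm (r *\<^sub>R (x - a) - v) < e}"

text \<open>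
  The integrability requirement excludes that divergent integrals are read as \<open>0\<close>.
\<close>

definition rectifiable_varifold ::
    "(real^'n) set \<Rightarrow> nat \<Rightarrow> ((real^'n) \<times> (real^'n) set) measure \<Rightarrow> bool" where
  "rectifiable_varifold U m V \<longleftrightarrow> varifold U m V \<and>
     (\<exists>(c :: nat \<Rightarrow> real) E M.
        (\<forall>i. 0 < c i \<and> C1_submanifold m (M i) \<and> E i \<in> sets borel \<and> E i \<subseteq> U \<inter> M i) \<and>
        (\<forall>k :: (real^'n) \<times> (real^'n) set \<Rightarrow> real.
           let X = prod_topology (top_of_set U) (grassmannian_topology m) in
           continuous_map X euclideanreal k \<and>
           (\<exists>C. compactin X C \<and> (\<forall>p \<in> topspace X - C. k p = 0)) \<longrightarrow>
             (\<forall>i. set_integrable (hausdorff_measure m) (E i) (\<lambda>z. k (z, Tan (M i) z))) \<and>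
             (\<lambda>i. c i * (\<integral>z\<in>E i. k (z, Tan (M i) z) \<partial>hausdorff_measure m)) sums
               (LINT p|V. k p)))"

definition first_variation ::
    "((real^'n) \<times> (real^'n) set) measure \<Rightarrow> (real^'n \<Rightarrow> real^'n) \<Rightarrow> real" where
  "first_variation V g = (LINT (z, S)|V. jacobian g (at z) \<bullet> orth_projection S)"

definition total_variation ::
    "(real^'n) set \<Rightarrow> ((real^'n) \<times> (real^'n) set) measure \<Rightarrow> (real^'n) measure" where
  "total_variation U V = variation U (first_variation V)"

definition first_variation_ext ::
    "(real^'n) set \<Rightarrow> ((real^'n) \<times> (real^'n) set) measure \<Rightarrow> (real^'n \<Rightarrow> real^'n) \<Rightarrow> real" where
  "first_variation_ext U V = L1_extension U (first_variation V)"

definition first_variation_restrict ::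
    "(real^'n) set \<Rightarrow> ((real^'n) \<times> (real^'n) set) measure \<Rightarrow> (real^'n) set \<Rightarrow>
      (real^'n \<Rightarrow> real^'n) \<Rightarrow> real" where
  "first_variation_restrict U V E \<theta> = first_variation_ext U V (\<lambda>z. indicator E z *\<^sub>R \<theta> z)"

text \<open>
  The restriction of \<open>V\<close> to \<open>E \<times> G(n,m)\<close>.  The set \<open>E\<close> need only be measurable with respect to the
  completion of the weight, whence the completion on the right hand side.
\<close>

definition varifold_restrict ::
    "((real^'n) \<times> (real^'n) set) measure \<Rightarrow> (real^'n) set \<Rightarrow> ((real^'n) \<times> (real^'n) set) measure" where
  "varifold_restrict V E =
     measure_of (space V) (sets V) (\<lambda>A. emeasure (completion V) (A \<inter> (E \<times> UNIV)))"

definition varifold_boundary ::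
    "(real^'n) set \<Rightarrow> ((real^'n) \<times> (real^'n) set) measure \<Rightarrow> (real^'n) set \<Rightarrow>
      (real^'n \<Rightarrow> real^'n) \<Rightarrow> real" where
  "varifold_boundary U V E \<theta> =
     first_variation_restrict U V E \<theta> - first_variation (varifold_restrict V E) \<theta>"

section \<open>Generalised weakly differentiable functions\<close>

definition is_weak_derivative ::
    "(real^'n) set \<Rightarrow> ((real^'n) \<times> (real^'n) set) measure \<Rightarrow> (real^'n \<Rightarrow> (real^'l) option) \<Rightarrow>
      (real^'n \<Rightarrow> (real^'n^'l) option) \<Rightarrow> bool" where
  "is_weak_derivative U V f F \<longleftrightarrow>
     ae_measurable (weight U V) F \<and>
     (\<forall>K s. compact K \<and> K \<subseteq> U \<and> 0 \<le> s \<longrightarrow>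
        (\<integral>\<^sup>+z\<in>{z \<in> K \<inter> dom f. norm (the (f z)) \<le> s}. ennreal (norm (the (F z)))
           \<partial>completion (weight U V)) < \<infinity>) \<and>
     (\<forall>\<theta> \<in> test_functions U. \<forall>\<eta> :: real^'l \<Rightarrow> real.
        smooth \<eta> \<and> compact (closure {y. frechet_derivative \<eta> (at y) \<noteq> (\<lambda>_. 0)}) \<longrightarrow>
        first_variation_ext U V (\<lambda>z. \<eta> (the (f z)) *\<^sub>R \<theta> z) =
          (LINT (z, S)|completion V.
             \<eta> (the (f z)) * (orth_projection S \<bullet> jacobian \<theta> (at z))) +
          (LINT z|completion (weight U V).
             frechet_derivative \<eta> (at (the (f z))) (the (F z) *v \<theta> z)))"

definition weakly_differentiable ::
    "(real^'n) set \<Rightarrow> ((real^'n) \<times> (real^'n) set) measure \<Rightarrow> (real^'n \<Rightarrow> (real^'l) option) set" where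
  "weakly_differentiable U V =
     {f. ae_measurable (sum_measure (weight U V) (total_variation U V)) f \<and>
         (\<exists>F. is_weak_derivative U V f F)}"

definition weak_derivative ::
    "(real^'n) set \<Rightarrow> ((real^'n) \<times> (real^'n) set) measure \<Rightarrow> (real^'n \<Rightarrow> (real^'l) option) \<Rightarrow>
      real^'n \<Rightarrow> (real^'n^'l) option" where
  "weak_derivative U V f = (SOME F. is_weak_derivative U V f F)"

definition superlevel :: "('a \<Rightarrow> 'b::real_normed_vector option) \<Rightarrow> real \<Rightarrow> 'a set" where
  "superlevel f t = {z \<in> dom f. norm (the (f z)) > t}"

text \<open>
  The class \<open>T\<^sub>G(V,\<real>\<^sup>l)\<close> of functions with zero boundary values on \<open>G\<close>.
  The restriction of \<open>\<theta>\<close> to \<open>U\<close> need not have compact support in \<open>U\<close>; it is admissible in the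
  extended distributions by the finiteness condition.
\<close>

definition weakly_differentiable_zero_boundary ::
    "(real^'n) set \<Rightarrow> ((real^'n) \<times> (real^'n) set) measure \<Rightarrow> (real^'n) set \<Rightarrow>
      (real^'n \<Rightarrow> (real^'l) option) set" where
  "weakly_differentiable_zero_boundary U V G =
     {f \<in> weakly_differentiable U V.
        AE t in lborel. 0 < t \<longrightarrow>
          (let B = frontier U - G; E = superlevel f t in
           \<forall>K \<theta>. compact K \<and> K \<subseteq> - B \<and> \<theta> \<in> test_functions (- B) \<longrightarrow>
             emeasure (completion (weight U V)) (E \<inter> K)
               + emeasure (completion (total_variation U V)) (E \<inter> K)
               + emeasure (variation U (varifold_boundary U V E)) (U \<inter> K) < \<infinity> \<and>
             (LINT (z, S):E \<times> UNIV|completion V. jacobian \<theta> (at z) \<bullet> orth_projection S) =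
               L1_extension U (first_variation_restrict U V E) \<theta>
                 - L1_extension U (varifold_boundary U V E) \<theta>)}"

end

theory Submission
  imports Defs "HOL-Analysis.Analysis"
begin

text \<open>
  Zero boundary values on \<open>G\<close> are first reformulated without reference to superlevel sets: by the
  layer cake formula, for radial \<open>\<eta>\<close> vanishing near \<open>0\<close>, they mean that \<open>\<eta> \<circ> f\<close> can be integrated
  by parts against vector fields with compact support in the complement of \<open>B\<close> rather than in \<open>U\<close>.
  In the opposite direction, the boundary of \<open>{|f| > t}\<close> is controlled by the lower derivative at \<open>t\<close>
  of the integral of \<open>|V D f|\<close> over \<open>{|f| \<le> t}\<close>, which is finite, and small near \<open>Bdry U\<close>, for
  almost every \<open>t\<close>.  Integration by parts is stable under multiplication of \<open>f\<close> by smooth functions,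
  and under their limits: a Lipschitz function is locally a uniform limit of smooth functions whose
  gradients are bounded and, after passing to convex combinations, converge \<open>\<parallel>V\<parallel>\<close> almost everywhere.
\<close>

section \<open>Preliminaries: smooth functions, cutoffs and smooth approximation of Lipschitz
  functions\<close>

section \<open>Smooth functions\<close>

text \<open>The hypothesis concerns the sets where |f| is large, the conclusion those where |g f| is
  large, and neither family determines the other; integrals involving \<eta> \<circ> f, in contrast,
  can be followed under multiplication by \<open>g\<close>. The radial \<eta> vanishing near
  \<open>0\<close> form a class closed under dilations, which is the key to the product rule for
  smooth multipliers; the class of all \<eta> with compactly supported derivative shares this
  property, so that one argument yields both the weak differentiability of g f in \<open>U\<close>
  and its boundary values. Vanishing near \<open>0\<close> matters because compact sets meeting the
  boundary of \<open>U\<close> may have infinite measure, while the superlevel sets within them have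
  finite measure. The tangent plane occurs linearly in all identities, multiplied by functions of
  the point, so it can be replaced by its mean \<open>P\<close>; the derivative of the product
  becomes g (V D f) + f (P \<Gamma>), where \<Gamma> is a limit of gradients of smooth
  approximations of \<open>g\<close>. Distributions are turned into integrals by a Riesz
  representation with the crude constant \<open>16\<close> in place of \<open>1\<close>, since only
  boundedness of the density matters.\<close>

abbreviation Df :: "('a::real_normed_vector => 'b::real_normed_vector) => 'a => 'a => 'b" where
  "Df f x \<equiv> frechet_derivative f (at x)"

abbreviation Borel :: "('a::topological_space => 'b::topological_space) set" where
  "Borel \<equiv> borel_measurable borel"

text \<open>Openness of \<open>S\<close> matters: \<open>Ck_on\<close> speaks of derivatives with
  respect to the whole space, and these are determined by the values near the point.\<close>

lemma Ck_on_cong: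
  assumes "open S" "\<And>x. x \<in> S ==> f x = g x" "Ck_on k S f"
  shows "Ck_on k S g"
  using assms(2,3)
proof (induction k arbitrary: f g)
  case 0
  thus ?case by (simp cong: continuous_on_cong)
next
  case (Suc k)
  have d: "(g has_derivative Df f x) (at x)" if "x \<in> S" for x
  proof (rule has_derivative_transform_within_open[OF _ assms(1) that])
    show "(f has_derivative Df f x) (at x)"
      using Suc.prems(2) that by (simp add: frechet_derivative_works[symmetric])
  qed (rule Suc.prems(1))
  have "Ck_on k S (\<lambda>x. Df g x v)" for v
  proof (rule Suc.IH)
    show "Df f x v = Df g x v" if "x \<in> S" for x
      using frechet_derivative_at[OF d[OF that]] by simp
    show "Ck_on k S (\<lambda>x. Df f x v)" using Suc.prems(2) by simp
  qed
  moreover have "\<forall>x\<in>S. g differentiable (at x)"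
    using d unfolding differentiable_def by blast
  ultimately show ?case by simp
qed

lemma Ck_on_SucI:
  assumes "open S" "\<And>x. x \<in> S ==> (f has_derivative D x) (at x)" "\<And>v. Ck_on k S (\<lambda>x. D x v)"
  shows "Ck_on (Suc k) S f"
proof -
  have "Df f x = D x" if "x \<in> S" for x
    using frechet_derivative_at[OF assms(2)[OF that]] by simp
  hence "Ck_on k S (\<lambda>x. Df f x v)" for v
    by (intro Ck_on_cong[OF assms(1) _ assms(3)[of v]]) simp
  moreover have "\<forall>x\<in>S. f differentiable (at x)"
    using assms(2) unfolding differentiable_def by blast
  ultimately show ?thesis by simp
qed

lemma Ck_on_SucD:
  assumes "Ck_on (Suc k) S f"
  shows "x \<in> S ==> (f has_derivative Df f x) (at x)"
    and "Ck_on k S (\<lambda>x. Df f x v)"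
  using assms by (simp_all add: frechet_derivative_works[symmetric])

lemma Ck_on_Suc_imp: "Ck_on (Suc k) S f ==> Ck_on k S f"
proof (induction k arbitrary: f)
  case 0
  thus ?case
    by (auto intro!: differentiable_imp_continuous_on simp: differentiable_on_def differentiable_at_withinI)
next
  case (Suc k)
  thus ?case by simp
qed

lemma Ck_on_const: "Ck_on k S (\<lambda>x. c)"
proof (induction k arbitrary: c)
  case (Suc k)
  thus ?case by (simp add: frechet_derivative_const)
qed simp

lemma Ck_on_add:
  assumes "Ck_on k S f" "Ck_on k S g" "open S"
  shows "Ck_on k S (\<lambda>x. f x + g x)"
  using assms(1,2)
proof (induction k arbitrary: f g)
  case 0
  thus ?case by (simp add: continuous_on_add)
next
  case (Suc k)
  show ?case
  proof (rule Ck_on_SucI[OF assms(3)])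
    show "((\<lambda>x. f x + g x) has_derivative
      (\<lambda>v. Df f x v + Df g x v)) (at x)" if "x \<in> S" for x
      by (intro has_derivative_add Ck_on_SucD(1)[OF Suc.prems(1) that] Ck_on_SucD(1)[OF Suc.prems(2) that])
    show "Ck_on k S (\<lambda>x. Df f x v + Df g x v)" for v
      by (intro Suc.IH Ck_on_SucD(2)[OF Suc.prems(1)] Ck_on_SucD(2)[OF Suc.prems(2)])
  qed
qed

lemma (in bounded_bilinear) Ck_on:
  assumes "Ck_on k S f" "Ck_on k S g" "open S"
  shows "Ck_on k S (\<lambda>x. prod (f x) (g x))"
  using assms(1,2)
proof (induction k arbitrary: f g)
  case 0
  thus ?case by (simp add: continuous_on)
next
  case (Suc k)
  show ?case
  proof (rule Ck_on_SucI[OF assms(3)])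
    show "((\<lambda>x. prod (f x) (g x)) has_derivative
      (\<lambda>v. prod (f x) (Df g x v) + prod (Df f x v) (g x))) (at x)"
      if "x \<in> S" for x
      by (intro FDERIV Ck_on_SucD(1)[OF Suc.prems(1) that] Ck_on_SucD(1)[OF Suc.prems(2) that])
    show "Ck_on k S (\<lambda>x. prod (f x) (Df g x v) + prod (Df f x v) (g x))" for v
      by (intro Ck_on_add assms(3) Suc.IH Ck_on_SucD(2)[OF Suc.prems(1)] Ck_on_SucD(2)[OF Suc.prems(2)]
        Suc.prems[THEN Ck_on_Suc_imp])
  qed
qed

lemma Ck_on_compose_linear:
  assumes "bounded_linear A" "Ck_on k T f" "open S" "A ` S \<subseteq> T"
  shows "Ck_on k S (\<lambda>x. f (A x))"
  using assms(2)
proof (induction k arbitrary: f)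
  case 0
  thus ?case using assms
    by (simp add: continuous_on_compose2[OF _ linear_continuous_on])
next
  case (Suc k)
  show ?case
  proof (rule Ck_on_SucI[OF assms(3)])
    show "((\<lambda>x. f (A x)) has_derivative (\<lambda>v. Df f (A x) (A v))) (at x)"
      if "x \<in> S" for x
      using that assms(4)
      by (intro has_derivative_compose[OF bounded_linear_imp_has_derivative[OF assms(1)]]
        Ck_on_SucD(1)[OF Suc.prems(1)]) blast
    show "Ck_on k S (\<lambda>x. Df f (A x) (A v))" for v
      by (intro Suc.IH Ck_on_SucD(2)[OF Suc.prems(1)])
  qed
qed

lemma Ck_on_linear_compose:
  assumes "bounded_linear A" "Ck_on k S f" "open S"
  shows "Ck_on k S (\<lambda>x. A (f x))"
  using assms(2)
proof (induction k arbitrary: f)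
  case 0
  thus ?case using bounded_linear.continuous_on[OF assms(1)] by simp
next
  case (Suc k)
  show ?case
  proof (rule Ck_on_SucI[OF assms(3)])
    show "((\<lambda>x. A (f x)) has_derivative (\<lambda>v. A (Df f x v))) (at x)"
      if "x \<in> S" for x
      by (intro bounded_linear.has_derivative[OF assms(1)] Ck_on_SucD(1)[OF Suc.prems that])
    show "Ck_on k S (\<lambda>x. A (Df f x v))" for v
      by (intro Suc.IH Ck_on_SucD(2)[OF Suc.prems])
  qed
qed

text \<open>For outer functions of one real variable, the derivative of \<open>h\<close> is a
  multiple of a single function, again of one variable, so that the induction on \<open>k\<close>
  stays within the class.\<close>

lemma Ck_on_compose_real:
  fixes h :: "real => 'b::real_normed_vector" and f :: "'a::real_normed_vector => real"
  assumes "Ck_on k T h" "Ck_on k S f" "open S" "f ` S \<subseteq> T"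
  shows "Ck_on k S (\<lambda>x. h (f x))"
  using assms(1,2)
proof (induction k arbitrary: h)
  case 0
  thus ?case using assms
    by (auto intro!: continuous_on_compose2[of T h])
next
  case (Suc k)
  show ?case
  proof (rule Ck_on_SucI[OF assms(3)])
    show "((\<lambda>x. h (f x)) has_derivative
      (\<lambda>v. Df f x v *\<^sub>R Df h (f x) 1)) (at x)"
      if "x \<in> S" for x
    proof -
      have h: "(h has_derivative Df h (f x)) (at (f x))"
        using assms(4) that by (intro Ck_on_SucD(1)[OF Suc.prems(1)]) blast
      have lin: "Df h (f x) r = r *\<^sub>R Df h (f x) 1" for r
        using linear_scale[OF has_derivative_linear[OF h], of r 1] by simp
      have "((\<lambda>x. h (f x)) has_derivative
        (\<lambda>v. Df h (f x) (Df f x v))) (at x)"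
        by (rule has_derivative_compose[OF Ck_on_SucD(1)[OF Suc.prems(2) that] h])
      thus ?thesis unfolding lin[of "Df f x _"] .
    qed
    show "Ck_on k S (\<lambda>x. Df f x v *\<^sub>R Df h (f x) 1)" for v
      by (intro bounded_bilinear.Ck_on[OF bounded_bilinear_scaleR] assms(3) Suc.IH
        Ck_on_SucD(2)[OF Suc.prems(1)] Ck_on_SucD(2)[OF Suc.prems(2)] Ck_on_Suc_imp[OF Suc.prems(2)])
  qed
qed

lemma smooth_const: "smooth (\<lambda>x. c)"
  by (simp add: smooth_def Ck_on_const)

lemma smooth_add: "smooth f ==> smooth g ==> smooth (\<lambda>x. f x + g x)"
  by (simp add: smooth_def Ck_on_add)

lemma (in bounded_bilinear) smooth: "smooth f ==> smooth g ==> smooth (\<lambda>x. prod (f x) (g x))"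
  by (simp add: smooth_def Ck_on)

lemmas smooth_scaleR = bounded_bilinear.smooth[OF bounded_bilinear_scaleR]
lemmas smooth_mult = bounded_bilinear.smooth[OF bounded_bilinear_mult]
lemmas smooth_inner = bounded_bilinear.smooth[OF bounded_bilinear_inner]

lemma smooth_compose_linear: "smooth f ==> bounded_linear A ==> smooth (\<lambda>x. f (A x))"
  using Ck_on_compose_linear[of A _ UNIV f UNIV] by (simp add: smooth_def)

lemma smooth_linear_compose: "smooth f ==> bounded_linear A ==> smooth (\<lambda>x. A (f x))"
  using Ck_on_linear_compose[of A _ UNIV f] by (simp add: smooth_def)

lemma smooth_compose_real:
  "smooth f ==> (\<And>k. Ck_on k T h) ==> range f \<subseteq> T ==> smooth (\<lambda>x. h (f x :: real))"
  using Ck_on_compose_real[of _ T h UNIV f] by (simp add: smooth_def)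

lemma smooth_ident: "smooth (\<lambda>x. x)"
proof -
  have "Ck_on k UNIV (\<lambda>x::'a. x)" for k
    by (cases k) (auto simp: Ck_on_const continuous_on_id)
  thus ?thesis by (simp add: smooth_def)
qed

lemma smooth_uminus: "smooth f ==> smooth (\<lambda>x. - f x)"
  using smooth_linear_compose[OF _ bounded_linear_minus[OF bounded_linear_ident], of f] by simp

lemma smooth_diff: "smooth f ==> smooth g ==> smooth (\<lambda>x. f x - g x)"
  using smooth_add[OF _ smooth_uminus, of f g] by simp

lemma smooth_sum: "(\<And>i. i \<in> I ==> smooth (f i)) ==> smooth (\<lambda>x. \<Sum>i\<in>I. f i x)"
  by (induction I rule: infinite_finite_induct) (simp_all add: smooth_const smooth_add)

lemma smooth_prod:
  fixes f :: "'i => 'a::real_normed_vector => real"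
  shows "(\<And>i. i \<in> I ==> smooth (f i)) ==> smooth (\<lambda>x. \<Prod>i\<in>I. f i x)"
  by (induction I rule: infinite_finite_induct) (simp_all add: smooth_const smooth_mult)

lemma smooth_power:
  fixes f :: "'a::real_normed_vector => real"
  shows "smooth f ==> smooth (\<lambda>x. f x ^ k)"
  by (induction k) (simp_all add: smooth_const smooth_mult)

lemma smooth_norm_sq: "smooth f ==> smooth (\<lambda>x. (norm (f x :: 'b::real_inner))\<^sup>2)"
  using smooth_inner[of f f] by (simp add: power2_norm_eq_inner)

lemma smooth_differentiable: "smooth f ==> f differentiable (at x)"
  by (auto simp: smooth_def dest!: spec[of _ "Suc 0"])

lemma smooth_has_derivative: "smooth f ==> (f has_derivative Df f x) (at x)"
  using smooth_differentiable frechet_derivative_works by blast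

lemma smooth_frechet_derivative: "smooth f ==> smooth (\<lambda>x. Df f x v)"
  unfolding smooth_def by (intro allI Ck_on_SucD(2)) (erule spec)

lemma smooth_continuous: "smooth f ==> continuous_on UNIV f"
  by (auto simp: smooth_def dest!: spec[of _ 0])

lemma smooth_borel [measurable_dest]: "smooth f ==> f \<in> Borel"
  by (intro borel_measurable_continuous_onI smooth_continuous)

text \<open>Real exponents make the family closed under differentiation; the exponents
  \<open>1/2\<close> and \<open>- 1\<close> then give square roots and inverses of positive
  functions.\<close>

lemma Ck_on_powr: "Ck_on k {0<..} (\<lambda>x::real. x powr a)"
proof (induction k arbitrary: a)
  case 0
  thus ?case by (auto intro!: continuous_intros)
next
  case (Suc k)
  show ?case
  proof (rule Ck_on_SucI)
    show "((\<lambda>x. x powr a) has_derivative (\<lambda>v. v *\<^sub>R (a *\<^sub>R (x powr (a - 1))))) (at x)"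
      if "x \<in> {0<..}" for x :: real
      using has_real_derivative_powr[of x a] that
      by (simp add: has_field_derivative_def mult_commute_abs)
    show "Ck_on k {0<..} (\<lambda>x. v *\<^sub>R (a *\<^sub>R (x powr (a - 1))))" for v :: real
      by (intro Ck_on_linear_compose[OF bounded_linear_scaleR_right] Suc.IH open_greaterThan)
  qed simp
qed

lemma Ck_on_ln: "Ck_on k {0<..} (ln :: real => real)"
proof (cases k)
  case 0
  thus ?thesis by (auto intro!: continuous_intros)
next
  case (Suc j)
  show ?thesis unfolding Suc
  proof (rule Ck_on_SucI)
    show "(ln has_derivative (\<lambda>v. v *\<^sub>R (x powr (- 1)))) (at x)" if "x \<in> {0<..}" for x :: real
    proof -
      have "(*) (inverse x) = (\<lambda>v. v *\<^sub>R (x powr (- 1)))"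
        using that by (auto simp: powr_minus)
      thus ?thesis using DERIV_ln[of x] that by (simp add: has_field_derivative_def)
    qed
    show "Ck_on j {0<..} (\<lambda>x::real. v *\<^sub>R (x powr (- 1)))" for v :: real
      by (rule Ck_on_linear_compose[OF bounded_linear_scaleR_right Ck_on_powr open_greaterThan])
  qed simp
qed

lemma Ck_on_exp: "Ck_on k UNIV (exp :: real => real)"
proof (induction k)
  case 0
  thus ?case by (auto intro!: continuous_intros)
next
  case (Suc k)
  show ?case
  proof (rule Ck_on_SucI)
    show "(exp has_derivative (\<lambda>v. v *\<^sub>R exp x)) (at x)" for x :: real
      using DERIV_exp[of x] by (simp add: has_field_derivative_def mult_commute_abs)
    show "Ck_on k UNIV (\<lambda>x::real. v *\<^sub>R exp x)" for v :: real
      by (intro Ck_on_linear_compose[OF bounded_linear_scaleR_right] Suc open_UNIV)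
  qed simp
qed

lemma smooth_sqrt_pos: "smooth f ==> (\<And>x. 0 < f x) ==> smooth (\<lambda>x. sqrt (f x))"
  using smooth_compose_real[of f "{0<..}" "\<lambda>x. x powr (1/2)", OF _ Ck_on_powr]
  by (auto simp: powr_half_sqrt less_imp_le)

lemma smooth_inverse_pos:
  assumes "smooth f" "\<And>x. 0 < f x" shows "smooth (\<lambda>x. inverse (f x :: real))"
proof -
  have "(\<lambda>x. inverse (f x)) = (\<lambda>x. f x powr (- 1))"
    using assms(2) by (auto simp: powr_minus less_imp_le)
  thus ?thesis
    using smooth_compose_real[of f "{0<..}" "\<lambda>x. x powr (- 1)", OF assms(1) Ck_on_powr] assms by auto
qed

subsection \<open>A smooth step\<close>

text \<open>The exponent \<open>k\<close> makes the family essentially closed under differentiation: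
  derivatives are linear combinations of members, so that smoothness of all members follows by one
  induction.\<close>

definition flat :: "nat => real => real" where
  "flat k x = (if 0 < x then exp (- inverse x) * inverse x ^ k else 0)"

lemma flat_at_0: "((\<lambda>x. flat k x) \<longlongrightarrow> 0) (at 0)"
proof -
  have "((\<lambda>x. x ^ k / exp x) \<longlongrightarrow> 0) (at_top :: real filter)"
    by (rule tendsto_power_div_exp_0)
  \<comment> \<open>Substituting \<open>1/x\<close> turns the limit of \<open>x ^ k / exp x\<close>
    at infinity into one at \<open>0\<close> from the right.\<close>
  hence "((\<lambda>x. inverse x ^ k / exp (inverse x)) \<longlongrightarrow> 0) (at_right (0::real))"
    by (rule filterlim_compose[OF _ filterlim_inverse_at_top_right])
  hence "((\<lambda>x. flat k x) \<longlongrightarrow> 0) (at_right 0)"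
    by (rule tendsto_cong[THEN iffD1, rotated])
      (auto simp: flat_def eventually_at_right_less field_simps exp_minus intro!: eventually_mono[OF eventually_at_right_less])
  moreover have "((\<lambda>x. flat k x) \<longlongrightarrow> 0) (at_left 0)"
    by (rule tendsto_eventually) (auto simp: flat_def eventually_at_filter)
  ultimately show ?thesis
    by (simp add: filterlim_split_at)
qed

lemma flat_has_derivative:
  "(flat k has_field_derivative (flat (k + 2) x - real k * flat (k + 1) x)) (at x)"
proof -
  consider "x < 0" | "x = 0" | "0 < x" by linarith
  thus ?thesis
  proof cases
    case 1
    have "((\<lambda>_. 0) has_field_derivative 0) (at x)" by simp
    hence "(flat k has_field_derivative 0) (at x)"
      by (rule DERIV_cong_ev[THEN iffD1, rotated 3])
        (use 1 in \<open>auto simp: flat_def eventually_nhds intro!: exI[of _ "{..<0}"]\<close>)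
    thus ?thesis using 1 by (simp add: flat_def)
  next
    case 2
    \<comment> \<open>The difference quotient of \<open>flat k\<close> at \<open>0\<close> is
      \<open>flat (k + 1)\<close>.\<close>
    have "((\<lambda>h. (flat k (0 + h) - flat k 0) / h) \<longlongrightarrow> 0) (at 0)"
      using flat_at_0[of "k + 1"]
      by (rule tendsto_cong[THEN iffD1, rotated]) (auto simp: flat_def eventually_at_filter field_simps)
    thus ?thesis using 2 by (simp add: DERIV_def flat_def)
  next
    case 3
    have "((\<lambda>x. exp (- inverse x) * inverse x ^ k) has_field_derivative
        (flat (k + 2) x - real k * flat (k + 1) x)) (at x)"
      using 3 by (auto intro!: derivative_eq_intros simp: flat_def power2_eq_square field_simps)
        (cases k; simp add: field_simps)
    thus ?thesis
      by (rule DERIV_cong_ev[THEN iffD1, rotated 3])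
        (use 3 in \<open>auto simp: flat_def eventually_nhds intro!: exI[of _ "{0<..}"]\<close>)
  qed
qed

lemma smooth_flat: "smooth (flat k)"
proof -
  have "Ck_on j UNIV (flat k)" for j
  proof (induction j arbitrary: k)
    case 0
    thus ?case
      using flat_has_derivative by (auto intro!: continuous_at_imp_continuous_on DERIV_isCont)
  next
    case (Suc j)
    show ?case
    proof (rule Ck_on_SucI)
      show "(flat k has_derivative (\<lambda>v. v *\<^sub>R (flat (k + 2) x + (- real k) *\<^sub>R flat (k + 1) x))) (at x)" for x
        using flat_has_derivative[of k x] by (simp add: has_field_derivative_def mult_commute_abs)
      show "Ck_on j UNIV (\<lambda>x. v *\<^sub>R (flat (k + 2) x + (- real k) *\<^sub>R flat (k + 1) x))" for v :: real
        by (intro Ck_on_linear_compose[OF bounded_linear_scaleR_right] Ck_on_add Suc.IH open_UNIV)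
    qed simp
  qed
  thus ?thesis by (simp add: smooth_def)
qed

definition step :: "real => real" where
  "step x = flat 0 x * inverse (flat 0 x + flat 0 (1 - x))"

text \<open>The first summand is positive for \<open>0 < x\<close>, the second for
  \<open>x < 1\<close>.\<close>

lemma step_denom_pos: "0 < flat 0 x + flat 0 (1 - x)"
  by (cases "0 < x") (auto simp: flat_def add_pos_nonneg)

lemma smooth_step: "smooth step"
proof -
  have "Ck_on k UNIV (\<lambda>x. flat 0 x)" for k using smooth_flat by (auto simp: smooth_def)
  hence "smooth (\<lambda>x. flat 0 (1 - x))"
    by (intro smooth_compose_real[where T=UNIV and h="flat 0"] smooth_diff smooth_const smooth_ident) auto
  hence "smooth (\<lambda>x. flat 0 x * inverse (flat 0 x + flat 0 (1 - x)))"
    using step_denom_pos by (intro smooth_mult smooth_inverse_pos smooth_add smooth_flat)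
  thus ?thesis by (simp add: step_def[abs_def])
qed

lemma step_0: "x \<le> 0 ==> step x = 0"
  by (simp add: step_def flat_def)

lemma step_1: "1 \<le> x ==> step x = 1"
  by (simp add: step_def flat_def)

lemma step_range: "0 \<le> step x" "step x \<le> 1"
proof -
  have "0 \<le> flat 0 x" "0 \<le> flat 0 (1 - x)" by (auto simp: flat_def)
  thus "0 \<le> step x" "step x \<le> 1"
    using step_denom_pos[of x] by (auto simp: step_def divide_inverse[symmetric])
qed

text \<open>Differentiability is not presupposed: the two functions have the same candidates for a
  derivative at \<open>x\<close>, hence the definition chooses the same value for both.\<close>

lemma frechet_derivative_local:
  assumes "open S" "x \<in> S" "\<And>y. y \<in> S ==> f y = g y"
  shows "Df f x = Df g x"
proof -
  have "(f has_derivative D) (at x) = (g has_derivative D) (at x)" for D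
    using assms has_derivative_transform_within_open[of f D x UNIV S g]
      has_derivative_transform_within_open[of g D x UNIV S f] by auto
  thus ?thesis by (simp add: frechet_derivative_def)
qed

lemma step_derivative_bounded:
  obtains C where "0 < C" "\<And>x v. \<bar>Df step x v\<bar> \<le> C * \<bar>v\<bar>"
    "\<And>x v. x \<notin> {0..1} ==> Df step x v = 0"
proof -
  have z: "Df step x v = 0" if "x \<notin> {0..1}" for x v
  proof (cases "x < 0")
    case True
    hence "Df step x = Df (\<lambda>x. 0) x"
      by (intro frechet_derivative_local[of "{..<0}"]) (auto simp: step_0)
    thus ?thesis by (simp add: frechet_derivative_const)
  next
    case False
    hence "Df step x = Df (\<lambda>x. 1) x"
      using that by (intro frechet_derivative_local[of "{1<..}"]) (auto simp: step_1)
    thus ?thesis by (simp add: frechet_derivative_const)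
  qed
  have "continuous_on {0..1} (\<lambda>x. Df step x 1)"
    using smooth_continuous[OF smooth_frechet_derivative[OF smooth_step]]
    by (rule continuous_on_subset) auto
  hence "bounded ((\<lambda>x. Df step x 1) ` {0..1})"
    by (intro compact_imp_bounded compact_continuous_image) auto
  then obtain C where C: "0 < C" "\<And>x. x \<in> {0..1} ==> \<bar>Df step x 1\<bar> \<le> C"
    by (auto simp: bounded_pos)
  have lin: "Df step x v = v * Df step x 1" for x v
    using linear_scale[OF linear_frechet_derivative[OF smooth_differentiable[OF smooth_step]], of x v 1] by simp
  have "\<bar>Df step x v\<bar> \<le> C * \<bar>v\<bar>" for x v
  proof (cases "x \<in> {0..1}")
    case True
    thus ?thesis using C(2)[OF True] by (subst lin) (simp add: abs_mult mult.commute[of C] mult_left_mono)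
  next
    case False
    thus ?thesis using z C by simp
  qed
  thus ?thesis using that C z by blast
qed

subsection \<open>Test functions\<close>

lemma test_functionsI: "smooth u ==> compact K ==> K \<subseteq> U ==> (\<And>z. z \<notin> K ==> u z = 0) ==> u \<in> test_functions U"
proof -
  assume a: "smooth u" "compact K" "K \<subseteq> U" "\<And>z. z \<notin> K ==> u z = 0"
  have "spt u \<subseteq> K"
    unfolding spt_def by (rule closure_minimal) (use a in \<open>auto simp: compact_imp_closed\<close>)
  moreover have "compact (spt u)"
    using a(2) calculation bounded_subset[of K] by (auto simp: compact_eq_bounded_closed spt_def)
  ultimately show ?thesis using a by (auto simp: test_functions_def)
qed

lemma spt_subset: "closed K ==> (\<And>z. z \<notin> K ==> u z = 0) ==> spt u \<subseteq> K"
  unfolding spt_def by (rule closure_minimal) auto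

lemma not_in_spt: "z \<notin> spt u ==> u z = 0"
  using closure_subset[of "{x. u x \<noteq> 0}"] by (auto simp: spt_def)

lemma test_functionsD:
  assumes "u \<in> test_functions U"
  shows "smooth u" "compact (spt u)" "spt u \<subseteq> U" "z \<notin> U ==> u z = 0"
  using assms not_in_spt[of z u] by (auto simp: test_functions_def)

lemma test_functions_mono: "U \<subseteq> W ==> u \<in> test_functions U ==> u \<in> test_functions W"
  by (auto simp: test_functions_def)

lemma test_functions_zero: "(\<lambda>z. 0) \<in> test_functions U"
  by (rule test_functionsI[of _ "{}"]) (auto simp: smooth_const)

lemma test_functions_add:
  assumes "u \<in> test_functions U" "\<xi> \<in> test_functions U"
  shows "(\<lambda>z. u z + \<xi> z) \<in> test_functions U"
  by (rule test_functionsI[of _ "spt u \<union> spt \<xi>"])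
    (use assms in \<open>auto simp: test_functions_def not_in_spt intro: smooth_add\<close>)

lemma test_functions_smult:
  assumes "u \<in> test_functions U" "smooth \<phi>"
  shows "(\<lambda>z. \<phi> z *\<^sub>R u z) \<in> test_functions U"
  by (rule test_functionsI[of _ "spt u"])
    (use assms in \<open>auto simp: test_functions_def not_in_spt intro: smooth_scaleR\<close>)

lemma test_functions_scaleR:
  "u \<in> test_functions U ==> (\<lambda>z. c *\<^sub>R u z) \<in> test_functions U"
  using test_functions_smult[OF _ smooth_const] .

lemma test_functions_linear:
  assumes "u \<in> test_functions U" "bounded_linear A"
  shows "(\<lambda>z. A (u z)) \<in> test_functions U"
  by (rule test_functionsI[of _ "spt u"])
    (use assms in \<open>auto simp: test_functions_def not_in_spt linear_simps(3) intro: smooth_linear_compose\<close>)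

lemma test_functions_diff:
  "u \<in> test_functions U ==> \<xi> \<in> test_functions U ==> (\<lambda>z. u z - \<xi> z) \<in> test_functions U"
  using test_functions_add[OF _ test_functions_scaleR[of \<xi> U "- 1"]] by simp

lemma test_functions_sum:
  "(\<And>i. i \<in> I ==> u i \<in> test_functions U) ==> (\<lambda>z. \<Sum>i\<in>I. u i z) \<in> test_functions U"
  by (induction I rule: infinite_finite_induct) (simp_all add: test_functions_zero test_functions_add)

lemma frechet_derivative_notin_spt:
  assumes "z \<notin> spt u"
  shows "Df u z = (\<lambda>v. 0)"
proof -
  have "closed (spt u)" by (simp add: spt_def)
  hence "Df u z = Df (\<lambda>z. 0) z"
    using assms by (intro frechet_derivative_local[of "- spt u"]) (simp_all add: open_Compl not_in_spt)
  thus ?thesis by (simp add: frechet_derivative_const)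
qed

lemma test_functions_frechet_derivative:
  assumes "u \<in> test_functions U"
  shows "(\<lambda>z. Df u z v) \<in> test_functions U"
  by (rule test_functionsI[of _ "spt u"])
    (use assms in \<open>auto simp: test_functions_def frechet_derivative_notin_spt intro: smooth_frechet_derivative\<close>)

text \<open>The Jacobian is a sum of directional derivatives, each inserted into one column by a
  linear map.\<close>

lemma test_functions_jacobian:
  fixes u :: "real^'n => real^'m"
  assumes "u \<in> test_functions U"
  shows "(\<lambda>z. jacobian u (at z)) \<in> test_functions U"
proof -
  define A :: "'n => real^'m => real^'n^'m" where "A j w = (\<chi> i j'. if j' = j then w $ i else 0)" for j w
  have A: "bounded_linear (A j)" for j
    by (rule linear_conv_bounded_linear[THEN iffD1], rule linearI) (auto simp: A_def vec_eq_iff)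
  have "jacobian u (at z) = (\<Sum>j\<in>UNIV. A j (Df u z (axis j 1)))" for z
    by (simp add: jacobian_def matrix_def A_def vec_eq_iff if_distrib sum.delta cong: if_cong)
  thus ?thesis
    using assms by (auto intro!: test_functions_sum test_functions_linear[OF _ A] test_functions_frechet_derivative)
qed

lemma test_functions_bounded:
  fixes u :: "'a::euclidean_space => 'b::real_normed_vector"
  assumes "u \<in> test_functions U"
  obtains C where "0 < C" "\<And>z. norm (u z) \<le> C"
proof -
  have "bounded (u ` spt u)"
    using assms smooth_continuous[of u]
    by (intro compact_imp_bounded compact_continuous_image)
      (auto simp: test_functions_def intro: continuous_on_subset)
  then obtain C where "0 < C" "\<And>z. z \<in> spt u ==> norm (u z) \<le> C"
    by (auto simp: bounded_pos)
  hence "norm (u z) \<le> C" for z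
    by (cases "z \<in> spt u") (auto simp: not_in_spt)
  thus ?thesis using \<open>0 < C\<close> that by blast
qed

lemma test_functions_borel [measurable_dest]:
  "u \<in> test_functions U ==> u \<in> Borel"
  by (auto simp: test_functions_def intro: smooth_borel)

lemma smooth_step_compose: "smooth f ==> smooth (\<lambda>x. step (f x))"
  using smooth_compose_real[of f UNIV step] smooth_step by (simp add: smooth_def)

text \<open>Finitely many bumps around points of \<open>K\<close> are combined: one minus the
  product of the complementary factors equals \<open>1\<close> wherever some bump does, hence on a
  whole neighbourhood \<open>N\<close> of \<open>K\<close>.\<close>

lemma cutoff_exists:
  fixes K :: "'a::euclidean_space set"
  assumes "compact K" "open W" "K \<subseteq> W"
  obtains \<zeta> :: "'a => real" and N where "\<zeta> \<in> test_functions W" "\<And>z. 0 \<le> \<zeta> z" "\<And>z. \<zeta> z \<le> 1"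
    "open N" "K \<subseteq> N" "\<And>z. z \<in> N ==> \<zeta> z = 1"
proof -
  have "\<forall>x\<in>K. \<exists>r>0. cball x (2 * r) \<subseteq> W"
  proof
    fix x assume "x \<in> K"
    then obtain r where "0 < r" "cball x r \<subseteq> W"
      using assms by (meson open_contains_cball subsetD)
    thus "\<exists>r>0. cball x (2 * r) \<subseteq> W" by (intro exI[of _ "r/2"]) auto
  qed
  then obtain r where r: "\<And>x. x \<in> K ==> 0 < r x" "\<And>x. x \<in> K ==> cball x (2 * r x) \<subseteq> W"
    by metis
  obtain F where F: "F \<subseteq> K" "finite F" "K \<subseteq> (\<Union>x\<in>F. ball x (r x))"
  proof (rule compactE_image[OF assms(1), of K "\<lambda>x. ball x (r x)"])
    show "K \<subseteq> (\<Union>x\<in>K. ball x (r x))" using r by force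
  qed auto
  \<comment> \<open>The argument of \<open>step\<close> is at least \<open>1\<close> within distance
    \<open>r x\<close> of \<open>x\<close> and at most \<open>0\<close> outside distance
    \<open>sqrt 2 * r x\<close>; the squared norm keeps \<open>b x\<close> smooth at its
    centre.\<close>
  define b where "b x z = step (2 - inverse ((r x)\<^sup>2) * (norm (z - x))\<^sup>2)" for x z
  have bs: "smooth (b x)" for x
    unfolding b_def by (intro smooth_step_compose smooth_diff smooth_const smooth_mult smooth_norm_sq smooth_ident)
  have b1: "b x z = 1" if "x \<in> F" "z \<in> ball x (r x)" for x z
  proof -
    have "(norm (z - x))\<^sup>2 \<le> (r x)\<^sup>2"
      using that by (intro power_mono) (auto simp: dist_norm norm_minus_commute)
    moreover have "0 < r x" using that F r by auto
    ultimately show ?thesis unfolding b_def by (intro step_1) (simp add: field_simps)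
  qed
  have b0: "b x z = 0" if "x \<in> F" "z \<notin> cball x (2 * r x)" for x z
  proof -
    have p: "0 < r x" using that F r by auto
    hence "(2 * r x)\<^sup>2 \<le> (norm (z - x))\<^sup>2"
      using that by (intro power_mono) (auto simp: dist_norm norm_minus_commute)
    moreover have "(2 * r x)\<^sup>2 = 4 * (r x)\<^sup>2" by (simp add: power_mult_distrib)
    ultimately have "2 * (r x)\<^sup>2 \<le> (norm (z - x))\<^sup>2"
      using zero_le_power2[of "r x"] by linarith
    thus ?thesis unfolding b_def using p by (intro step_0) (simp add: field_simps)
  qed
  define \<zeta> where "\<zeta> z = 1 - (\<Prod>x\<in>F. 1 - b x z)" for z
  have "0 \<le> (\<Prod>x\<in>F. 1 - b x z)" "(\<Prod>x\<in>F. 1 - b x z) \<le> 1" for z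
    by (auto intro!: prod_nonneg prod_le_1 simp: b_def step_range)
  hence "0 \<le> \<zeta> z" "\<zeta> z \<le> 1" for z by (auto simp: \<zeta>_def)
  moreover have "\<zeta> \<in> test_functions W"
  proof (rule test_functionsI[of _ "\<Union>x\<in>F. cball x (2 * r x)"])
    show "smooth \<zeta>"
      unfolding \<zeta>_def by (intro smooth_diff smooth_const smooth_prod bs)
    show "(\<Union>x\<in>F. cball x (2 * r x)) \<subseteq> W" using r F by blast
    show "\<zeta> z = 0" if "z \<notin> (\<Union>x\<in>F. cball x (2 * r x))" for z
      using that b0[of _ z] by (auto simp: \<zeta>_def)
  qed (auto intro: F)
  moreover have "\<zeta> z = 1" if "z \<in> (\<Union>x\<in>F. ball x (r x))" for z
    using that b1 F(2) by (fastforce simp: \<zeta>_def)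
  ultimately show ?thesis using that[of \<zeta> "\<Union>x\<in>F. ball x (r x)"] F(3) by blast
qed

text \<open>Monotonicity in \<open>j\<close> lets an estimate at one index serve for all later ones
  in \<open>levels_from_parts\<close>.\<close>

lemma cutoff_sequence:
  fixes W :: "'a::euclidean_space set"
  assumes "open W"
  obtains \<zeta> :: "nat => 'a => real" where "\<And>j. \<zeta> j \<in> test_functions W" "\<And>j z. 0 \<le> \<zeta> j z" "\<And>j z. \<zeta> j z \<le> 1"
    "\<And>i j z. i \<le> j ==> \<zeta> i z \<le> \<zeta> j z"
    "\<And>K. compact K ==> K \<subseteq> W ==> \<exists>N. \<forall>j\<ge>N. \<forall>z\<in>K. \<zeta> j z = 1"
proof -
  obtain C where C: "\<And>n::nat. compact (C n)" "\<And>n. C n \<subseteq> W" "\<And>n. C n \<subseteq> interior (C (Suc n))"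
      "\<And>K. \<lbrakk>compact K; K \<subseteq> W\<rbrakk> \<Longrightarrow> \<exists>N. \<forall>n\<ge>N. K \<subseteq> C n"
    using open_Union_compact_subsets[OF assms] by metis
  have "\<exists>\<zeta>::'a => real. \<zeta> \<in> test_functions (interior (C (Suc n))) \<and> (\<forall>z. 0 \<le> \<zeta> z \<and> \<zeta> z \<le> 1) \<and> (\<forall>z\<in>C n. \<zeta> z = 1)" for n
    using cutoff_exists[OF C(1)[of n] open_interior C(3)[of n]] by (metis subsetD)
  then obtain \<zeta> :: "nat => 'a => real" where \<zeta>: "\<And>n. \<zeta> n \<in> test_functions (interior (C (Suc n)))"
    "\<And>n z. 0 \<le> \<zeta> n z" "\<And>n z. \<zeta> n z \<le> 1" "\<And>n z. z \<in> C n ==> \<zeta> n z = 1"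
    by metis
  \<comment> \<open>Outside \<open>C (Suc n)\<close> the function \<open>\<zeta> n\<close> vanishes,
    and inside it \<open>\<zeta> (Suc n)\<close> equals \<open>1\<close>.\<close>
  have s: "\<zeta> n z \<le> \<zeta> (Suc n) z" for n z
  proof (cases "z \<in> C (Suc n)")
    case False
    hence "z \<notin> interior (C (Suc n))" using interior_subset by blast
    thus ?thesis using test_functionsD(4)[OF \<zeta>(1)[of n]] \<zeta> by simp
  qed (use \<zeta> in simp)
  show ?thesis
  proof (rule that[of \<zeta>])
    show "\<zeta> j \<in> test_functions W" for j
      using \<zeta>(1)[of j] by (rule test_functions_mono[rotated]) (meson C(2) interior_subset order_trans)
    show "\<zeta> i z \<le> \<zeta> j z" if "i \<le> j" for i j z
      using lift_Suc_mono_le[of "\<lambda>n. \<zeta> n z", OF s that] .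
    show "\<exists>N. \<forall>j\<ge>N. \<forall>z\<in>K. \<zeta> j z = 1" if "compact K" "K \<subseteq> W" for K
      using C(4)[OF that] \<zeta>(4) by (meson subsetD)
  qed (use \<zeta> in auto)
qed

subsection \<open>Smooth approximation of Lipschitz functions\<close>

lemma lipschitz_derivative_bound:
  fixes f :: "'a::real_normed_vector => real"
  assumes "(f has_derivative D) (at x)" "\<And>y. \<bar>f y - f x\<bar> \<le> L * norm (y - x)"
  shows "\<bar>D v\<bar> \<le> L * norm v"
proof -
  have "((\<lambda>h. f (x + h *\<^sub>R v)) has_derivative (\<lambda>h. D (h *\<^sub>R v))) (at 0)"
  proof (rule has_derivative_compose[where g=f])
    show "((\<lambda>h. x + h *\<^sub>R v) has_derivative (\<lambda>h. h *\<^sub>R v)) (at 0)"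
      by (auto intro!: derivative_eq_intros)
  qed (use assms(1) in simp)
  moreover have "D (h *\<^sub>R v) = D v * h" for h
    using linear_scale[OF has_derivative_linear[OF assms(1)], of h v] by simp
  ultimately have "((\<lambda>h. f (x + h *\<^sub>R v)) has_field_derivative D v) (at 0)"
    by (simp add: has_field_derivative_def mult_commute_abs)
  hence lim: "((\<lambda>h. (f (x + h *\<^sub>R v) - f x) / h) \<longlongrightarrow> D v) (at 0)"
    by (simp add: DERIV_def)
  show ?thesis
  proof (rule tendsto_upperbound[OF tendsto_rabs[OF lim]])
    have "\<bar>(f (x + h *\<^sub>R v) - f x) / h\<bar> \<le> L * norm v" if "h \<noteq> 0" for h
      using assms(2)[of "x + h *\<^sub>R v"] that by (simp add: abs_div field_simps)
    thus "\<forall>\<^sub>F h in at 0. \<bar>(f (x + h *\<^sub>R v) - f x) / h\<bar> \<le> L * norm v"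
      by (auto simp: eventually_at_filter)
  qed simp
qed

text \<open>The approximation is a soft minimum of smoothed cones over a finite net; it inherits the
  Lipschitz constant since the soft minimum is monotone and commutes with the addition of constants.\<close>

lemma lipschitz_smooth_approx:
  fixes g :: "'a::euclidean_space => real"
  assumes "bounded X" "L-lipschitz_on X g" "0 < e"
  obtains \<phi> where "smooth \<phi>" "\<And>x v. \<bar>Df \<phi> x v\<bar> \<le> L * norm v"
    "\<And>x. x \<in> X ==> \<bar>\<phi> x - g x\<bar> \<le> e"
proof (cases "X = {}")
  case True
  thus ?thesis
    using that[of "\<lambda>_. 0"] assms by (auto simp: smooth_const frechet_derivative_const lipschitz_on_def)
next
  case False
  have L: "0 \<le> L" using assms(2) by (auto simp: lipschitz_on_def)
  \<comment> \<open>The error is at most \<open>2 * L * \<epsilon>\<close> from the smoothed cone at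
    a net point \<open>y\<close> within \<open>\<epsilon>\<close> of \<open>x\<close>, plus
    \<open>L * \<epsilon>\<close> from \<open>g y - g x\<close>; the summand \<open>1\<close> covers
    \<open>L = 0\<close>.\<close>
  define \<epsilon> where "\<epsilon> = e / (3 * L + 1)"
  have \<epsilon>: "0 < \<epsilon>" "3 * L * \<epsilon> \<le> e" using assms(3) L by (auto simp: \<epsilon>_def field_simps)
  have "compact (closure X)" using assms(1) by auto
  then obtain Y where Y: "Y \<subseteq> X" "finite Y" "closure X \<subseteq> (\<Union>y\<in>Y. ball y \<epsilon>)"
  proof (rule compactE_image[of _ X "\<lambda>y. ball y \<epsilon>"])
    show "closure X \<subseteq> (\<Union>y\<in>X. ball y \<epsilon>)"
      using \<epsilon>(1) by (auto simp: closure_approachable)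
  qed auto
  have Yne: "Y \<noteq> {}" using False Y(3) closure_subset[of X] by auto
  hence N: "1 \<le> real (card Y)" using Y(2) by (simp add: Suc_leI card_gt_0_iff)
  \<comment> \<open>The soft minimum lies below the minimum by at most
    \<open>d * ln (card Y)\<close>; the summand \<open>1\<close> covers a net consisting of one
    point.\<close>
  define d where "d = e / (1 + ln (card Y))"
  have d: "0 < d" "d * ln (card Y) \<le> e"
  proof -
    have "0 \<le> ln (card Y)" using N by simp
    thus "0 < d" "d * ln (card Y) \<le> e" using assms(3) by (auto simp: d_def field_simps)
  qed
  define f where "f y x = g y + L * sqrt ((norm (x - y))\<^sup>2 + \<epsilon>\<^sup>2)" for y x :: 'a
  have fs: "smooth (f y)" for y
    unfolding f_def using \<epsilon>
    by (intro smooth_add smooth_const smooth_mult smooth_sqrt_pos smooth_norm_sq smooth_diff smooth_ident)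
      (auto simp: add_nonneg_pos)
  \<comment> \<open>Written as a norm on the product with the real line, the smoothed cone inherits
    the Lipschitz constant \<open>L\<close> from the triangle inequality.\<close>
  have f_pair: "f y x = g y + L * norm (x - y, \<epsilon>)" for y x
    by (simp add: f_def norm_Pair)
  have f_lip: "f y x \<le> f y x' + L * norm (x - x')" for y x x'
  proof -
    have "norm (x - y, \<epsilon>) \<le> norm (x' - y, \<epsilon>) + norm (x - x', 0::real)"
      using norm_triangle_ineq[of "(x' - y, \<epsilon>)" "(x - x', 0)"] by simp
    thus ?thesis using mult_left_mono[OF _ L] by (fastforce simp: f_pair norm_Pair algebra_simps)
  qed
  define s where "s x = (\<Sum>y\<in>Y. exp (- inverse d * f y x))" for x
  have s_pos: "0 < s x" for x unfolding s_def using Y Yne by (intro sum_pos) auto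
  have "smooth (\<lambda>x. exp (- inverse d * f y x))" for y
    using smooth_compose_real[OF _ Ck_on_exp] smooth_mult[OF smooth_const fs] by blast
  hence s_smooth: "smooth s" unfolding s_def by (intro smooth_sum)
  define \<phi> where "\<phi> x = - d * ln (s x)" for x
  have \<phi>_smooth: "smooth \<phi>"
    unfolding \<phi>_def using smooth_compose_real[OF s_smooth Ck_on_ln] s_pos
    by (intro smooth_mult smooth_const) auto
  have \<phi>_lip1: "\<phi> x \<le> \<phi> x' + L * norm (x - x')" for x x'
  proof -
    have "exp (- inverse d * (L * norm (x - x'))) * s x' \<le> s x"
      unfolding s_def sum_distrib_left
    proof (rule sum_mono)
      fix y
      have "inverse d * f y x \<le> inverse d * (f y x' + L * norm (x - x'))"
        using f_lip d by (intro mult_left_mono) auto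
      thus "exp (- inverse d * (L * norm (x - x'))) * exp (- inverse d * f y x') \<le> exp (- inverse d * f y x)"
        by (simp add: exp_add[symmetric] algebra_simps)
    qed
    hence "ln (exp (- inverse d * (L * norm (x - x'))) * s x') \<le> ln (s x)"
      using s_pos by (simp add: mult_pos_pos)
    hence "- inverse d * (L * norm (x - x')) + ln (s x') \<le> ln (s x)"
      using s_pos[of x'] by (simp add: ln_mult)
    from mult_left_mono[OF this, of d] d(1)
    have "d * (- inverse d * (L * norm (x - x')) + ln (s x')) \<le> d * ln (s x)" by simp
    moreover have "d * (- inverse d * (L * norm (x - x')) + ln (s x')) = d * ln (s x') - L * norm (x - x')"
      using d(1) by (simp add: field_simps)
    ultimately show ?thesis by (simp add: \<phi>_def)
  qed
  have "\<bar>\<phi> y - \<phi> x\<bar> \<le> L * norm (y - x)" for x y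
    using \<phi>_lip1[of x y] \<phi>_lip1[of y x] by (simp add: norm_minus_commute abs_le_iff)
  hence deriv: "\<bar>Df \<phi> x v\<bar> \<le> L * norm v" for x v
    using lipschitz_derivative_bound[OF smooth_has_derivative[OF \<phi>_smooth]] by blast
  have g_lip: "g x \<le> g y + L * norm (x - y)" if "x \<in> X" "y \<in> X" for x y
    using lipschitz_onD[OF assms(2) that] by (simp add: dist_norm)
  have "\<bar>\<phi> x - g x\<bar> \<le> e" if x: "x \<in> X" for x
  proof -
    obtain y where y: "y \<in> Y" "norm (x - y) < \<epsilon>"
    proof -
      have "x \<in> (\<Union>y\<in>Y. ball y \<epsilon>)" using Y(3) x closure_subset[of X] by blast
      thus ?thesis using that by (auto simp: dist_norm norm_minus_commute)
    qed
    have "norm (x - y, \<epsilon>) \<le> norm (x - y, 0::real) + norm (0::'a, \<epsilon>)"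
      using norm_triangle_ineq[of "(x - y, 0)" "(0, \<epsilon>)"] by simp
    hence "norm (x - y, \<epsilon>) \<le> 2 * \<epsilon>" using y \<epsilon> by (simp add: norm_Pair)
    hence "L * norm (x - y, \<epsilon>) \<le> L * (2 * \<epsilon>)" using L by (rule mult_left_mono)
    moreover have "g y \<le> g x + L * norm (x - y)"
      using g_lip[of y x] y x Y(1) by (simp add: norm_minus_commute subset_iff)
    moreover have "L * norm (x - y) \<le> L * \<epsilon>" using y L by (intro mult_left_mono) auto
    ultimately have u: "f y x \<le> g x + e" using \<epsilon>(2) by (simp add: f_pair)
    have "exp (- inverse d * (g x + e)) \<le> exp (- inverse d * f y x)"
      using u d(1) by simp
    also have "\<dots> \<le> s x" unfolding s_def
      using y(1) Y(2) by (intro member_le_sum) auto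
    finally have "- inverse d * (g x + e) \<le> ln (s x)"
      using s_pos[of x] by (simp add: ln_ge_iff)
    hence "d * (- inverse d * (g x + e)) \<le> d * ln (s x)" using d(1) by (intro mult_left_mono) auto
    moreover have "d * (- inverse d * (g x + e)) = - (g x + e)" using d(1) by (simp add: mult.assoc[symmetric])
    ultimately have 1: "\<phi> x \<le> g x + e" by (simp add: \<phi>_def)
    \<comment> \<open>Every smoothed cone lies above \<open>g\<close> on \<open>X\<close>, so each
      of the \<open>card Y\<close> summands is at most
      \<open>exp (- inverse d * g x)\<close>.\<close>
    have "s x \<le> (\<Sum>y\<in>Y. exp (- inverse d * g x))"
      unfolding s_def
    proof (rule sum_mono)
      fix y assume "y \<in> Y"
      hence "g x \<le> g y + L * norm (x - y)" using g_lip x Y by blast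
      also have "\<dots> \<le> f y x"
        using L by (auto simp: f_def intro!: mult_left_mono real_le_rsqrt)
      finally show "exp (- inverse d * f y x) \<le> exp (- inverse d * g x)"
        using d(1) by simp
    qed
    hence "s x \<le> real (card Y) * exp (- inverse d * g x)" by simp
    hence "ln (s x) \<le> ln (card Y) + (- inverse d * g x)"
      using s_pos[of x] N by (subst (asm) ln_le_cancel_iff[symmetric]) (auto simp: ln_mult simp del: ln_le_cancel_iff)
    hence "d * ln (s x) \<le> d * (ln (card Y) + (- inverse d * g x))" using d(1) by (intro mult_left_mono) auto
    moreover have "d * (ln (card Y) + (- inverse d * g x)) = d * ln (card Y) - g x"
      using d(1) by (simp add: algebra_simps)
    ultimately have "g x - e \<le> \<phi> x" using d(2) by (simp add: \<phi>_def)
    thus ?thesis using 1 by (simp add: abs_le_iff)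
  qed
  thus ?thesis using that[OF \<phi>_smooth deriv] by blast
qed

section \<open>Variation measures of distributions and their representation by densities\<close>

section \<open>The variation of a distribution\<close>

text \<open>Only linearity is required, so that the variation may be infinite on compact sets. This
  covers the boundary functionals of superlevel sets, whose variation is finite for almost all
  levels only.\<close>

locale test_functional =
  fixes U :: "'a::euclidean_space set" and S :: "('a => 'b::euclidean_space) => real"
  assumes open_U: "open U"
    and add: "u \<in> test_functions U ==> \<xi> \<in> test_functions U ==> S (\<lambda>z. u z + \<xi> z) = S u + S \<xi>"
    and scale: "u \<in> test_functions U ==> S (\<lambda>z. c *\<^sub>R u z) = c * S u"
begin

lemma zero: "S (\<lambda>z. 0) = 0"
  using scale[OF test_functions_zero, of 0] by simp

lemma sum: "finite I ==> (\<And>i. i \<in> I ==> u i \<in> test_functions U) ==> S (\<lambda>z. \<Sum>i\<in>I. u i z) = (\<Sum>i\<in>I. S (u i))"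
  by (induction I rule: finite_induct) (simp_all add: zero add test_functions_sum)

definition adm :: "'a set => ('a => 'b) set" where
  "adm C = {u \<in> test_functions U. spt u \<subseteq> C \<and> (\<forall>z. norm (u z) \<le> 1)}"

definition vopen :: "'a set => ennreal" where
  "vopen C = (SUP u\<in>adm C. ennreal (S u))"

text \<open>Intersecting \<open>A\<close> with \<open>U\<close> complies with the first clause of
  \<open>borel_regular_measure\<close>.\<close>

definition vout :: "'a set => ennreal" where
  "vout A = (INF C\<in>{C. open C \<and> C \<subseteq> U \<and> A \<inter> U \<subseteq> C}. vopen C)"

lemma adm_mono: "C \<subseteq> D ==> adm C \<subseteq> adm D"
  by (auto simp: adm_def)

lemma zero_adm: "(\<lambda>z. 0) \<in> adm C"
  by (auto simp: adm_def test_functions_zero spt_def)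

lemma vopen_mono: "C \<subseteq> D ==> vopen C \<le> vopen D"
  unfolding vopen_def by (rule SUP_subset_mono[OF adm_mono]) auto

lemma le_vopen: "u \<in> adm C ==> ennreal (S u) \<le> vopen C"
  unfolding vopen_def by (rule SUP_upper)

lemma vopen_empty: "vopen {} = 0"
proof -
  have "S u = 0" if "u \<in> adm {}" for u
  proof -
    have "u = (\<lambda>z. 0)" using that not_in_spt[of _ u] by (auto simp: adm_def)
    thus ?thesis by (simp add: zero)
  qed
  thus ?thesis unfolding vopen_def by (intro antisym SUP_least) auto
qed

lemma vout_le: "open C ==> C \<subseteq> U ==> A \<inter> U \<subseteq> C ==> vout A \<le> vopen C"
  unfolding vout_def by (rule INF_lower) auto

lemma vout_open: "open C ==> C \<subseteq> U ==> vout C = vopen C"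
  by (intro antisym vout_le) (auto simp: vout_def intro!: INF_greatest vopen_mono)

lemma vout_mono: "A \<inter> U \<subseteq> B ==> vout A \<le> vout B"
  unfolding vout_def by (rule INF_superset_mono) auto

text \<open>Since the supports are disjoint, the sum is again admissible. The cases arise because
  \<open>ennreal\<close> truncates negative values to \<open>0\<close>.\<close>

lemma adm_add_disjoint:
  assumes "u \<in> adm D" "\<xi> \<in> adm (D - spt u)"
  shows "ennreal (S u) + ennreal (S \<xi>) \<le> vopen D"
proof -
  have tf: "u \<in> test_functions U" "\<xi> \<in> test_functions U" using assms by (auto simp: adm_def)
  have n: "norm (u z + \<xi> z) \<le> 1" for z
  proof (cases "z \<in> spt u")
    case True
    hence "\<xi> z = 0" using assms(2) not_in_spt[of z \<xi>] by (auto simp: adm_def)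
    thus ?thesis using assms(1) by (simp add: adm_def)
  next
    case False
    thus ?thesis using assms(2) by (simp add: adm_def not_in_spt)
  qed
  have "spt (\<lambda>z. u z + \<xi> z) \<subseteq> spt u \<union> spt \<xi>"
    by (rule spt_subset) (auto simp: not_in_spt, auto simp: spt_def intro: closed_Un)
  hence sum: "(\<lambda>z. u z + \<xi> z) \<in> adm D"
    using assms n tf by (auto simp: adm_def test_functions_add)
  have \<xi>D: "\<xi> \<in> adm D" using assms(2) adm_mono[of "D - spt u" D] by auto
  consider "S u < 0" | "S \<xi> < 0" | "0 \<le> S u" "0 \<le> S \<xi>" by linarith
  thus ?thesis
  proof cases
    case 1
    thus ?thesis using le_vopen[OF \<xi>D] by (simp add: ennreal_neg)
  next
    case 2
    thus ?thesis using le_vopen[OF assms(1)] by (simp add: ennreal_neg)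
  next
    case 3
    thus ?thesis using le_vopen[OF sum] by (simp add: add tf)
  qed
qed

text \<open>A cutoff \<zeta> supported in \<open>C\<close> that is \<open>1\<close> near the part of
  the support of \<open>u\<close> outside \<open>D\<close> splits \<open>u\<close> into \<zeta> u,
  admissible for \<open>C\<close>, and (1 - \<zeta>) u, admissible for \<open>D\<close>.\<close>

lemma adm_le_split:
  assumes "open C" "open D" "u \<in> adm (C \<union> D)"
  shows "ennreal (S u) \<le> vopen C + vopen D"
proof -
  have tf: "u \<in> test_functions U" and n: "norm (u z) \<le> 1" for z using assms by (auto simp: adm_def)
  have c: "compact (spt u - D)"
    using assms(2) tf by (intro compact_diff) (auto simp: test_functions_def)
  have "spt u - D \<subseteq> C" using assms(3) by (auto simp: adm_def)
  then obtain \<zeta> :: "'a => real" and N where \<zeta>: "\<zeta> \<in> test_functions C" "\<And>z. 0 \<le> \<zeta> z" "\<And>z. \<zeta> z \<le> 1"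
      "open N" "spt u - D \<subseteq> N" "\<And>z. z \<in> N ==> \<zeta> z = 1"
    using cutoff_exists[OF c assms(1)] by blast
  have sm: "smooth \<zeta>" "smooth (\<lambda>z. 1 - \<zeta> z)"
    using \<zeta>(1) by (auto simp: test_functions_def intro: smooth_diff smooth_const)
  have 1: "(\<lambda>z. \<zeta> z *\<^sub>R u z) \<in> adm C"
  proof -
    have "spt (\<lambda>z. \<zeta> z *\<^sub>R u z) \<subseteq> spt \<zeta>"
      by (rule spt_subset) (auto simp: not_in_spt, simp add: spt_def)
    moreover have "norm (\<zeta> z *\<^sub>R u z) \<le> 1" for z
      using \<zeta>(2)[of z] \<zeta>(3)[of z] n[of z] by (auto intro: mult_le_one)
    ultimately show ?thesis
      using \<zeta>(1) test_functions_smult[OF tf sm(1)] by (auto simp: adm_def test_functions_def)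
  qed
  have 2: "(\<lambda>z. (1 - \<zeta> z) *\<^sub>R u z) \<in> adm D"
  proof -
    have "spt (\<lambda>z. (1 - \<zeta> z) *\<^sub>R u z) \<subseteq> spt u - N"
      by (rule spt_subset) (use \<zeta>(4,6) in \<open>auto simp: not_in_spt intro!: closed_Diff\<close>, simp add: spt_def)
    moreover have "norm ((1 - \<zeta> z) *\<^sub>R u z) \<le> 1" for z
      using \<zeta>(2)[of z] \<zeta>(3)[of z] n[of z] by (auto intro: mult_le_one)
    ultimately show ?thesis
      using \<zeta>(5) test_functions_smult[OF tf sm(2)] by (auto simp: adm_def)
  qed
  have "S (\<lambda>z. \<zeta> z *\<^sub>R u z + (1 - \<zeta> z) *\<^sub>R u z) = S (\<lambda>z. \<zeta> z *\<^sub>R u z) + S (\<lambda>z. (1 - \<zeta> z) *\<^sub>R u z)"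
    using 1 2 by (intro add) (auto simp: adm_def)
  hence "S u = S (\<lambda>z. \<zeta> z *\<^sub>R u z) + S (\<lambda>z. (1 - \<zeta> z) *\<^sub>R u z)"
    by (simp add: scaleR_left_distrib[symmetric])
  hence "ennreal (S u) \<le> ennreal (S (\<lambda>z. \<zeta> z *\<^sub>R u z)) + ennreal (S (\<lambda>z. (1 - \<zeta> z) *\<^sub>R u z))"
    by (cases "0 \<le> S (\<lambda>z. \<zeta> z *\<^sub>R u z)"; cases "0 \<le> S (\<lambda>z. (1 - \<zeta> z) *\<^sub>R u z)")
      (auto simp: ennreal_neg ennreal_plus[symmetric] simp del: ennreal_plus intro!: ennreal_leI)
  also have "\<dots> \<le> vopen C + vopen D" by (intro add_mono le_vopen 1 2)
  finally show ?thesis .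
qed

lemma vopen_Un_le: "open C ==> open D ==> vopen (C \<union> D) \<le> vopen C + vopen D"
  unfolding vopen_def[of "C \<union> D"] by (intro SUP_least adm_le_split)

lemma vopen_finite_UN_le:
  "finite I ==> (\<And>i. i \<in> I ==> open (C i)) ==> vopen (\<Union>i\<in>I. C i) \<le> (\<Sum>i\<in>I. vopen (C i))"
proof (induction I rule: finite_induct)
  case empty
  thus ?case by (simp add: vopen_empty)
next
  case (insert i I)
  have "vopen (C i \<union> (\<Union>i\<in>I. C i)) \<le> vopen (C i) + vopen (\<Union>i\<in>I. C i)"
    using insert by (intro vopen_Un_le) auto
  also have "\<dots> \<le> vopen (C i) + (\<Sum>i\<in>I. vopen (C i))"
    using insert by (intro add_left_mono) auto
  finally show ?case using insert by simp
qed

text \<open>Compactness of the support of a test function reduces countable unions to finite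
  ones.\<close>

lemma vopen_UN_le:
  assumes "\<And>i::nat. open (C i)"
  shows "vopen (\<Union>i. C i) \<le> (\<Sum>i. vopen (C i))"
  unfolding vopen_def[of "\<Union>i. C i"]
proof (rule SUP_least)
  fix u assume u: "u \<in> adm (\<Union>i. C i)"
  hence "compact (spt u)" "spt u \<subseteq> (\<Union>i\<in>UNIV. C i)" by (auto simp: adm_def test_functions_def)
  then obtain I where I: "finite I" "spt u \<subseteq> (\<Union>i\<in>I. C i)"
    using assms by (metis compactE_image)
  hence "u \<in> adm (\<Union>i\<in>I. C i)" using u by (auto simp: adm_def)
  hence "ennreal (S u) \<le> vopen (\<Union>i\<in>I. C i)" by (rule le_vopen)
  also have "\<dots> \<le> (\<Sum>i\<in>I. vopen (C i))" using I assms by (intro vopen_finite_UN_le)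
  also have "\<dots> \<le> (\<Sum>i. vopen (C i))" using I by (intro sum_le_suminf) auto
  finally show "ennreal (S u) \<le> (\<Sum>i. vopen (C i))" .
qed

lemma vout_countably_subadditive:
  assumes "\<And>i::nat. A i \<subseteq> U"
  shows "vout (\<Union>i. A i) \<le> (\<Sum>i. vout (A i))"
proof (rule ennreal_le_epsilon)
  fix e :: real assume e: "0 < e" and fin: "(\<Sum>i. vout (A i)) < top"
  have f: "vout (A i) < top" for i
    using fin ennreal_suminf_lessD by blast
  have "\<exists>C. open C \<and> C \<subseteq> U \<and> A i \<subseteq> C \<and> vopen C \<le> vout (A i) + ennreal (e * (1/2) ^ Suc i)" for i
  proof -
    have "vout (A i) < vout (A i) + ennreal (e * (1/2) ^ Suc i)"
      using f[of i] e by (simp add: ennreal_add_left_cancel_less less_top)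
    then obtain C where "open C" "C \<subseteq> U" "A i \<inter> U \<subseteq> C" "vopen C < vout (A i) + ennreal (e * (1/2) ^ Suc i)"
      by (subst (asm) vout_def) (auto simp: INF_less_iff)
    thus ?thesis using assms[of i] by (intro exI[of _ C]) auto
  qed
  then obtain C where C: "\<And>i. open (C i)" "\<And>i. C i \<subseteq> U" "\<And>i. A i \<subseteq> C i"
      "\<And>i. vopen (C i) \<le> vout (A i) + ennreal (e * (1/2) ^ Suc i)"
    by metis
  have "vout (\<Union>i. A i) \<le> vopen (\<Union>i. C i)" using C by (intro vout_le) blast+
  also have "\<dots> \<le> (\<Sum>i. vopen (C i))" using C by (intro vopen_UN_le)
  also have "\<dots> \<le> (\<Sum>i. vout (A i) + ennreal (e * (1/2) ^ Suc i))" using C by (intro suminf_le) auto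
  also have "\<dots> = (\<Sum>i. vout (A i)) + (\<Sum>i. ennreal (e * (1/2) ^ Suc i))" by (subst suminf_add) auto
  also have "(\<Sum>i. ennreal (e * (1/2) ^ Suc i)) = ennreal e"
    using e sums_mult[OF power_half_series, of e]
    by (intro suminf_ennreal_eq) auto
  finally show "vout (\<Union>i. A i) \<le> (\<Sum>i. vout (A i)) + ennreal e" .
qed

text \<open>Caratheodory's criterion for open \<open>C\<close>. If \<open>D\<close> is open and
  contains \<open>A\<close>, and \<open>u\<close> is admissible for \<open>D \<inter> C\<close>,
  then \<open>A - C\<close> lies in the open set \<open>D - spt u\<close>, whose admissible
  functions can be added to \<open>u\<close>.\<close>

lemma vout_split:
  assumes "A \<subseteq> U" "open C" "C \<subseteq> U"
  shows "vout (A \<inter> C) + vout (A - C) = vout A"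
proof (rule antisym)
  show "vout (A \<inter> C) + vout (A - C) \<le> vout A"
    unfolding vout_def[of A]
  proof (rule INF_greatest, safe)
    fix D assume D: "open D" "D \<subseteq> U" "A \<inter> U \<subseteq> D"
    have "vout (A \<inter> C) + vout (A - C) \<le> vopen (D \<inter> C) + vout (A - C)"
      using D assms by (intro add_right_mono vout_le) auto
    also have "\<dots> = (SUP u\<in>adm (D \<inter> C). ennreal (S u) + vout (A - C))"
      unfolding vopen_def using zero_adm by (intro ennreal_SUP_add_left[symmetric]) blast
    also have "\<dots> \<le> vopen D"
    proof (rule SUP_least)
      fix u assume u: "u \<in> adm (D \<inter> C)"
      have cl: "closed (spt u)" by (simp add: spt_def)
      have "ennreal (S u) + vout (A - C) \<le> ennreal (S u) + vopen (D - spt u)"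
        using D u assms cl by (intro add_left_mono vout_le open_Diff) (auto simp: adm_def)
      also have "\<dots> = (SUP \<xi>\<in>adm (D - spt u). ennreal (S u) + ennreal (S \<xi>))"
        unfolding vopen_def using zero_adm by (intro ennreal_SUP_add_right) blast
      also have "\<dots> \<le> vopen D"
        using u adm_mono[of "D \<inter> C" D] by (intro SUP_least adm_add_disjoint) auto
      finally show "ennreal (S u) + vout (A - C) \<le> vopen D" .
    qed
    finally show "vout (A \<inter> C) + vout (A - C) \<le> vopen D" .
  qed
  \<comment> \<open>Two sets, padded with empty ones so that countable subadditivity
    applies.\<close>
  define B where "B i = (if i = 0 then A \<inter> C else if i = 1 then A - C else {})" for i :: nat
  have "vout (\<Union>i. B i) \<le> (\<Sum>i. vout (B i))"
    using assms by (intro vout_countably_subadditive) (auto simp: B_def)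
  also have "(\<Union>i. B i) = A" by (auto simp: B_def split: if_splits)
  also have "(\<Sum>i. vout (B i)) = (\<Sum>i<2. vout (B i))"
    using vout_open[of "{}"] by (intro suminf_finite) (auto simp: B_def vopen_empty)
  finally show "vout A \<le> vout (A \<inter> C) + vout (A - C)"
    by (simp add: B_def numeral_2_eq_2)
qed

lemma borel_regular_vout: "borel_regular_measure U vout"
  unfolding borel_regular_measure_def
proof (intro conjI allI impI)
  show "vout A = vout (A \<inter> U)" for A by (simp add: vout_def)
  show "outer_measure_space (Pow U) vout"
    unfolding outer_measure_space_def positive_def increasing_def countably_subadditive_def
  proof (intro conjI allI impI ballI)
    show "vout {} = 0" using vout_open[of "{}"] by (simp add: vopen_empty)
    show "vout A \<le> vout B" if "A \<subseteq> B" for A B using that by (intro vout_mono) auto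
    show "vout (\<Union>i. A i) \<le> (\<Sum>i. vout (A i))" if "range A \<subseteq> Pow U" for A
      using that by (intro vout_countably_subadditive) auto
  qed
  show "C \<in> lambda_system U (Pow U) vout" if "open C \<and> C \<subseteq> U" for C
    unfolding lambda_system_def
  proof safe
    fix A assume A: "A \<subseteq> U"
    have "(U - C) \<inter> A = A - C" "C \<inter> A = A \<inter> C" using A by auto
    thus "vout (C \<inter> A) + vout ((U - C) \<inter> A) = vout A"
      using vout_split[OF A] that by simp
  qed (use that in auto)
  fix A assume A: "A \<subseteq> U"
  show "\<exists>A'\<in>sets borel. A \<subseteq> A' \<and> A' \<subseteq> U \<and> vout A' = vout A"
  proof (cases "vout A = top")
    case True
    thus ?thesis using open_U A vout_mono[of A U] by (intro bexI[of _ U]) (auto simp: top_unique)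
  next
    case False
    have "\<exists>C. open C \<and> C \<subseteq> U \<and> A \<subseteq> C \<and> vopen C \<le> vout A + ennreal (inverse (real (Suc i)))" for i
    proof -
      have "vout A < vout A + ennreal (inverse (real (Suc i)))"
        using False by (simp add: ennreal_add_left_cancel_less less_top)
      then obtain C where "open C" "C \<subseteq> U" "A \<inter> U \<subseteq> C" "vopen C < vout A + ennreal (inverse (real (Suc i)))"
        by (subst (asm) vout_def) (auto simp: INF_less_iff)
      thus ?thesis using A by (intro exI[of _ C]) auto
    qed
    then obtain C where C: "\<And>i. open (C i)" "\<And>i. C i \<subseteq> U" "\<And>i. A \<subseteq> C i"
        "\<And>i. vopen (C i) \<le> vout A + ennreal (inverse (real (Suc i)))"
      by metis
    \<comment> \<open>The Borel hull of \<open>A\<close> is a countable intersection of almost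
      optimal open sets.\<close>
    have "vout (\<Inter>i. C i) \<le> vout A"
    proof (rule ennreal_le_epsilon)
      fix e :: real assume "0 < e"
      then obtain i where i: "inverse (real (Suc i)) < e" using reals_Archimedean by blast
      have "vout (\<Inter>i. C i) \<le> vopen (C i)" using C by (intro vout_le) blast+
      also have "\<dots> \<le> vout A + ennreal (inverse (real (Suc i)))" by (rule C)
      also have "\<dots> \<le> vout A + ennreal e" using i by (intro add_left_mono ennreal_leI) auto
      finally show "vout (\<Inter>i. C i) \<le> vout A + ennreal e" .
    qed
    moreover have "vout A \<le> vout (\<Inter>i. C i)" using C(3) by (intro vout_mono) blast
    ultimately show ?thesis
      using C(3) C(2)[of 0] C(1) by (intro bexI[of _ "\<Inter>i. C i"]) (auto simp: subset_iff intro!: borel_open)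
  qed
qed

text \<open>Every competitor agrees with \<open>vopen\<close> on open subsets of \<open>U\<close>
  and is monotone, hence lies below the infimum \<open>vout\<close>, which is itself a
  competitor.\<close>

lemma variation_outer_eq: "variation_outer U S = vout"
  unfolding variation_outer_def
proof (rule Greatest_equality)
  show "borel_regular_measure U vout \<and> (\<forall>C. open C \<and> C \<subseteq> U \<longrightarrow> vout C =
      (SUP u\<in>{u \<in> test_functions U. spt u \<subseteq> C \<and> (\<forall>z. norm (u z) \<le> 1)}. ennreal (S u)))"
    using borel_regular_vout vout_open by (simp add: vopen_def adm_def)
  fix \<phi> assume \<phi>: "borel_regular_measure U \<phi> \<and> (\<forall>C. open C \<and> C \<subseteq> U \<longrightarrow> \<phi> C =
      (SUP u\<in>{u \<in> test_functions U. spt u \<subseteq> C \<and> (\<forall>z. norm (u z) \<le> 1)}. ennreal (S u)))"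
  show "\<phi> \<le> vout"
  proof (rule le_funI)
    fix A
    show "\<phi> A \<le> vout A"
      unfolding vout_def
    proof (rule INF_greatest, safe)
      fix C assume C: "open C" "C \<subseteq> U" "A \<inter> U \<subseteq> C"
      have inc: "increasing (Pow U) \<phi>" and eq: "\<phi> A = \<phi> (A \<inter> U)"
        using \<phi> by (auto simp: borel_regular_measure_def outer_measure_space_def)
      have "\<phi> (A \<inter> U) \<le> \<phi> C"
        using C by (intro increasingD[OF inc]) auto
      thus "\<phi> A \<le> vopen C" using \<phi> C eq by (simp add: vopen_def adm_def)
    qed
  qed
qed

lemma space_variation: "space (variation U S) = U"
  and sets_variation: "sets (variation U S) = sets (borel_of (top_of_set U))"
proof -
  have "sets (borel_of (top_of_set U)) \<subseteq> Pow U"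
    using sets.sets_into_space[of _ "borel_of (top_of_set U)"]
    by (auto simp: borel_of_def space_measure_of_conv)
  moreover have "sigma_sets U (sets (borel_of (top_of_set U))) = sets (borel_of (top_of_set U))"
    using sets.sigma_sets_eq[of "borel_of (top_of_set U)"] by (simp add: borel_of_def space_measure_of_conv)
  ultimately show "space (variation U S) = U" "sets (variation U S) = sets (borel_of (top_of_set U))"
    by (simp_all add: variation_def space_measure_of sets_measure_of)
qed

text \<open>\<open>measure_of\<close> attains the prescribed values provided that they are countably
  additive on the sigma-algebra. This is Caratheodory's theorem: \<open>lambda_system\<close>
  contains the open subsets of \<open>U\<close>, hence the Borel ones.\<close>

lemma emeasure_variation:
  assumes "A \<in> sets (borel_of (top_of_set U))"
  shows "emeasure (variation U S) A = vout A"
proof -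
  have s: "sets (borel_of (top_of_set U)) \<subseteq> Pow U"
    using sets.sets_into_space[of _ "borel_of (top_of_set U)"]
    by (auto simp: borel_of_def space_measure_of_conv)
  interpret P: sigma_algebra U "Pow U" by (rule sigma_algebra_Pow)
  have oms: "outer_measure_space (Pow U) vout"
    using borel_regular_vout by (simp add: borel_regular_measure_def)
  have ms: "measure_space U (lambda_system U (Pow U) vout) vout"
    by (rule P.caratheodory_lemma[OF oms])
  interpret L: sigma_algebra U "lambda_system U (Pow U) vout"
    using ms by (simp add: measure_space_def)
  have "{W. openin (top_of_set U) W} \<subseteq> lambda_system U (Pow U) vout"
    using borel_regular_vout open_U openin_open_eq[of U] by (auto simp: borel_regular_measure_def)
  hence sub: "sets (borel_of (top_of_set U)) \<subseteq> lambda_system U (Pow U) vout"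
    unfolding borel_of_def by (subst sets_measure_of)
      (use openin_imp_subset in \<open>auto intro!: L.sigma_sets_subset simp del: sets_measure_of\<close>, fastforce)
  have "countably_additive (lambda_system U (Pow U) vout) vout" "positive (lambda_system U (Pow U) vout) vout"
    using ms by (auto simp: measure_space_def)
  hence "countably_additive (sets (variation U S)) vout" "positive (sets (variation U S)) vout"
    unfolding sets_variation countably_additive_def positive_def
    using sub by (blast, blast)
  hence "emeasure (measure_of U (sets (borel_of (top_of_set U))) vout) A = vout A"
    using s assms by (intro emeasure_measure_of[where M="measure_of U (sets (borel_of (top_of_set U))) vout" and \<Omega>=U and A="sets (borel_of (top_of_set U))"])
      (auto simp: sets_variation variation_def variation_outer_eq)
  thus ?thesis by (simp add: variation_def variation_outer_eq)
qed

end

section \<open>Measures that are finite on compact subsets of an open set\<close>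

lemma measure_less: "emeasure M A < ennreal e ==> 0 < e ==> measure M A < e"
  by (cases "emeasure M A") (auto simp: measure_def ennreal_less_iff)

text \<open>A Radon measure over \<open>U\<close>, extended by zero to the Borel sets of the whole
  space, so that Borel functions and test functions given on the whole space can be integrated
  directly.\<close>

locale open_measure =
  fixes U :: "'a::euclidean_space set" and \<beta> :: "'a measure"
  assumes open_U: "open U"
    and sets_eq [simp, measurable_cong]: "sets \<beta> = sets borel"
    and null: "emeasure \<beta> (- U) = 0"
    and compact_finite: "compact K ==> K \<subseteq> U ==> emeasure \<beta> K < \<infinity>"
begin

lemma space_eq [simp]: "space \<beta> = UNIV"
  using sets_eq_imp_space_eq[OF sets_eq] by simp

lemma AE_U: "AE z in \<beta>. z \<in> U"
  by (rule AE_I[of _ _ "- U"]) (use null open_U in auto)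

sublocale sigma_finite_measure \<beta>
proof
  obtain C where C: "\<And>n::nat. compact (C n)" "\<And>n. C n \<subseteq> U" "\<Union>(range C) = U"
    using open_Union_compact_subsets[OF open_U] by metis
  show "\<exists>A. countable A \<and> A \<subseteq> sets \<beta> \<and> \<Union> A = space \<beta> \<and> (\<forall>a\<in>A. emeasure \<beta> a \<noteq> \<infinity>)"
  proof (intro exI[of _ "insert (- U) (range C)"] conjI ballI)
    show "insert (- U) (range C) \<subseteq> sets \<beta>"
      using open_U C by (auto intro: borel_compact)
    show "\<Union> (insert (- U) (range C)) = space \<beta>" using C by auto
    show "emeasure \<beta> a \<noteq> \<infinity>" if "a \<in> insert (- U) (range C)" for a
      using that null compact_finite[OF C(1,2)] by (auto simp: less_top)
  qed auto
qed

lemma integrable_bounded_compact: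
  fixes h :: "'a => 'b::{banach, second_countable_topology}"
  assumes "h \<in> Borel" "compact K" "K \<subseteq> U" "\<And>z. z \<in> K ==> norm (h z) \<le> B" "\<And>z. z \<notin> K ==> h z = 0"
  shows "integrable \<beta> h"
  by (rule integrableI_bounded_set[of K _ _ B]) (use assms compact_finite in \<open>auto intro: borel_compact\<close>)

lemma integrable_test:
  fixes u :: "'a => 'b::euclidean_space"
  assumes "u \<in> test_functions U"
  shows "integrable \<beta> u"
proof -
  obtain B where "0 < B" "\<And>z. norm (u z) \<le> B" using test_functions_bounded[OF assms] by blast
  thus ?thesis
    using assms by (intro integrable_bounded_compact[of _ "spt u" B])
      (auto simp: test_functions_def not_in_spt intro: smooth_borel)
qed

lemma ex_compact_neighbourhood:
  assumes "compact K" "K \<subseteq> U"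
  obtains W K' where "open W" "K \<subseteq> W" "W \<subseteq> K'" "compact K'" "K' \<subseteq> U"
proof -
  obtain \<zeta> :: "'a => real" and N where \<zeta>: "\<zeta> \<in> test_functions U" "\<And>z. 0 \<le> \<zeta> z" "\<And>z. \<zeta> z \<le> 1" "open N" "K \<subseteq> N" "\<And>z. z \<in> N ==> \<zeta> z = 1"
    using cutoff_exists[OF assms(1) open_U assms(2)] by blast
  have "z \<in> spt \<zeta>" if "z \<in> N" for z using \<zeta>(6)[OF that] not_in_spt[of z \<zeta>] by auto
  hence "N \<subseteq> spt \<zeta>" by blast
  thus ?thesis using that[of N "spt \<zeta>"] \<zeta> by (auto simp: test_functions_def)
qed

text \<open>Regularity of finite Borel measures, applied to the restriction \<open>N\<close> of
  \<beta> to \<open>A\<close>; the compact set can be taken inside \<open>U\<close> as the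
  complement of \<open>U\<close> is null.\<close>

lemma inner_approx:
  assumes "A \<in> sets borel" "emeasure \<beta> A < \<infinity>" "0 < e"
  obtains K where "compact K" "K \<subseteq> A \<inter> U" "measure \<beta> (A - K) < e"
proof -
  define N where "N = density \<beta> (indicator A)"
  have s: "sets N = sets borel" by (simp add: N_def)
  have eN: "emeasure N B = emeasure \<beta> (A \<inter> B)" if "B \<in> sets borel" for B
    using that assms(1) by (simp add: N_def emeasure_restricted)
  have "emeasure N (space N) \<noteq> \<infinity>"
    using assms by (simp add: eN N_def[THEN arg_cong[of _ _ space]] less_top)
  moreover have AU: "A \<inter> U \<in> sets borel" using assms(1) open_U by auto
  ultimately have "emeasure N (A \<inter> U) = (SUP K\<in>{K. K \<subseteq> A \<inter> U \<and> compact K}. emeasure N K)"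
    by (intro inner_regular s) auto
  moreover have "emeasure N (A \<inter> U) = emeasure \<beta> A"
    using AU assms(1) AE_U by (simp add: eN) (intro emeasure_eq_AE, auto)
  ultimately have sup: "emeasure \<beta> A = (SUP K\<in>{K. K \<subseteq> A \<inter> U \<and> compact K}. emeasure N K)" by simp
  obtain K where K: "K \<subseteq> A \<inter> U" "compact K" "emeasure \<beta> A < emeasure N K + e"
  proof -
    have "{K. K \<subseteq> A \<inter> U \<and> compact K} \<noteq> {}" using compact_empty by blast
    moreover have "emeasure \<beta> A \<noteq> \<infinity>" using assms(2) by simp
    ultimately show ?thesis using SUP_approx_ennreal[OF assms(3) _ sup] that by blast
  qed
  have KB: "K \<in> sets borel" using K by (auto intro: borel_compact)
  have "A \<inter> K = K" using K by auto
  hence "emeasure \<beta> A < emeasure \<beta> K + e" using K(3) eN[OF KB] by simp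
  moreover have "emeasure \<beta> A = emeasure \<beta> (A - K) + emeasure \<beta> K"
    using K KB assms(1) by (subst plus_emeasure) (auto simp: Un_absorb2)
  moreover have "emeasure \<beta> K < \<infinity>" using compact_finite[OF K(2)] K by auto
  ultimately have "emeasure \<beta> (A - K) < e"
    by (simp add: add.commute ennreal_add_left_cancel_less)
  hence "measure \<beta> (A - K) < e"
    using assms(3) by (rule measure_less)
  thus ?thesis using that K by blast
qed

text \<open>As before with the restriction to a compact neighbourhood \<open>K'\<close> of
  \<open>K\<close>, on which \<beta> is finite; the open set obtained is cut down to lie in
  \<open>K'\<close>.\<close>

lemma outer_approx:
  assumes "compact K" "K \<subseteq> U" "0 < e"
  obtains W K' where "open W" "K \<subseteq> W" "W \<subseteq> K'" "compact K'" "K' \<subseteq> U" "measure \<beta> (W - K) < e"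
proof -
  obtain W K' where W: "open W" "K \<subseteq> W" "W \<subseteq> K'" "compact K'" "K' \<subseteq> U"
    using ex_compact_neighbourhood[OF assms(1,2)] .
  have KB: "K \<in> sets borel" "K' \<in> sets borel" using assms W by (auto intro: borel_compact)
  have fin: "emeasure \<beta> K' < \<infinity>" using compact_finite W by auto
  have "W - K \<in> sets borel" using W KB by auto
  define N where "N = density \<beta> (indicator K')"
  have s: "sets N = sets borel" by (simp add: N_def)
  have eN: "emeasure N B = emeasure \<beta> (K' \<inter> B)" if "B \<in> sets borel" for B
    using that KB by (simp add: N_def emeasure_restricted)
  have "emeasure N (space N) \<noteq> \<infinity>"
    using fin by (simp add: eN N_def[THEN arg_cong[of _ _ space]] less_top)
  hence inf: "emeasure N K = (INF W\<in>{W. K \<subseteq> W \<and> open W}. emeasure N W)"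
    by (intro outer_regular s KB)
  have NK: "emeasure N K = emeasure \<beta> K" using eN[OF KB(1)] W(2,3) by (simp add: Int_absorb1[OF order_trans[OF W(2,3)]])
  have finK: "emeasure \<beta> K < \<infinity>" using compact_finite assms by auto
  obtain V where V: "K \<subseteq> V" "open V" "emeasure N V < emeasure N K + e"
  proof -
    have "emeasure N K \<noteq> \<infinity>" using NK finK by auto
    from INF_approx_ennreal[OF assms(3) inf this] show ?thesis using that by blast
  qed
  have "emeasure \<beta> (V \<inter> W) \<le> emeasure N V"
    unfolding eN[OF borel_open[OF V(2)]] using V W KB by (intro emeasure_mono) auto
  hence "emeasure \<beta> (V \<inter> W) < emeasure \<beta> K + e" using V NK by simp
  moreover have "emeasure \<beta> (V \<inter> W) = emeasure \<beta> (V \<inter> W - K) + emeasure \<beta> K"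
    using V W KB by (subst plus_emeasure) (auto simp: Un_absorb2)
  ultimately have "emeasure \<beta> (V \<inter> W - K) < e"
    using finK by (simp add: add.commute ennreal_add_left_cancel_less)
  hence "measure \<beta> (V \<inter> W - K) < e"
    using assms(3) by (rule measure_less)
  thus ?thesis using that[of "V \<inter> W" K'] V W by auto
qed

text \<open>For indicators, a cutoff between a compact \<open>K\<close> inside \<open>A\<close> and
  an open \<open>W\<close> around \<open>K\<close> differs from the indicator of \<open>A\<close>
  only on \<open>W - K\<close> and \<open>A - K\<close>. Sums and limits follow by
  induction.\<close>

lemma test_functions_dense:
  fixes \<psi> :: "'a => 'b::euclidean_space"
  assumes "integrable \<beta> \<psi>" "0 < e"
  shows "\<exists>u\<in>test_functions U. (LINT z|\<beta>. norm (u z - \<psi> z)) < e"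
  using assms
proof (induction \<psi> arbitrary: e rule: integrable_induct)
  case (base A c)
  \<comment> \<open>The two exceptional sets contribute at most \<open>2 * e' * norm c\<close>; the
    summand \<open>1\<close> covers \<open>c = 0\<close>.\<close>
  define e' where "e' = e / (2 * (norm c + 1))"
  have e': "0 < e'" "2 * e' * norm c < e" using base
    by (auto simp: e'_def field_simps add_pos_nonneg add_nonneg_pos)
  have A: "A \<in> sets borel" using base by simp
  obtain K where K: "compact K" "K \<subseteq> A \<inter> U" "measure \<beta> (A - K) < e'"
    using inner_approx[OF A base(2) e'(1)] .
  then obtain W K' where W: "open W" "K \<subseteq> W" "W \<subseteq> K'" "compact K'" "K' \<subseteq> U" "measure \<beta> (W - K) < e'"
    using outer_approx[OF K(1) _ e'(1)] by auto
  obtain \<zeta> :: "'a => real" and N where \<zeta>: "\<zeta> \<in> test_functions W" "\<And>z. 0 \<le> \<zeta> z" "\<And>z. \<zeta> z \<le> 1"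
      "open N" "K \<subseteq> N" "\<And>z. z \<in> N ==> \<zeta> z = 1"
    using cutoff_exists[OF K(1) W(1,2)] by blast
  have KB: "K \<in> sets borel" using K by (auto intro: borel_compact)
  have fin: "emeasure \<beta> (A - K) < \<infinity>" "emeasure \<beta> (W - K) < \<infinity>"
  proof -
    show "emeasure \<beta> (A - K) < \<infinity>"
      using base emeasure_mono[of "A - K" A \<beta>] by (auto simp: le_less_trans)
    show "emeasure \<beta> (W - K) < \<infinity>"
      using W borel_compact[OF W(4)] by (intro le_less_trans[OF emeasure_mono compact_finite[OF W(4,5)]]) auto
  qed
  have "(\<lambda>z. \<zeta> z *\<^sub>R c) \<in> test_functions U"
    using test_functions_linear[OF test_functions_mono[OF _ \<zeta>(1)] bounded_linear_scaleR_left] W by blast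
  moreover have "(LINT z|\<beta>. norm (\<zeta> z *\<^sub>R c - indicator A z *\<^sub>R c)) < e"
  proof -
    have "(LINT z|\<beta>. norm (\<zeta> z *\<^sub>R c - indicator A z *\<^sub>R c)) \<le>
      (LINT z|\<beta>. norm c * (indicator (W - K) z + indicator (A - K) z))"
    proof (rule integral_mono')
      show "integrable \<beta> (\<lambda>z. norm c * (indicator (W - K) z + indicator (A - K) z))"
        using fin W KB A by auto
      fix z
      have "z \<notin> W ==> \<zeta> z = 0" using test_functionsD(4)[OF \<zeta>(1)] by blast
      hence "\<bar>\<zeta> z - indicator A z\<bar> \<le> indicator (W - K) z + indicator (A - K) z"
        using \<zeta>(2,3)[of z] \<zeta>(5,6) K by (auto simp: indicator_def)
      thus "norm (\<zeta> z *\<^sub>R c - indicator A z *\<^sub>R c) \<le> norm c * (indicator (W - K) z + indicator (A - K) z)"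
        by (simp add: scaleR_left_diff_distrib[symmetric] mult.commute mult_left_mono)
    qed simp
    also have "\<dots> = norm c * (measure \<beta> (W - K) + measure \<beta> (A - K))"
      using fin W KB A by simp
    also have "\<dots> \<le> norm c * (e' + e')" using K W by (intro mult_left_mono add_mono) auto
    also have "\<dots> < e" using e' by (simp add: field_simps)
    finally show ?thesis .
  qed
  ultimately show ?case by (intro bexI[of _ "\<lambda>z. \<zeta> z *\<^sub>R c"])
next
  case (add f g)
  obtain u where u: "u \<in> test_functions U" "(LINT z|\<beta>. norm (u z - f z)) < e/2"
    using add.IH(1)[of "e/2"] add.prems by auto
  obtain \<xi> where \<xi>: "\<xi> \<in> test_functions U" "(LINT z|\<beta>. norm (\<xi> z - g z)) < e/2"
    using add.IH(2)[of "e/2"] add.prems by auto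
  have "(LINT z|\<beta>. norm (u z + \<xi> z - (f z + g z))) \<le> (LINT z|\<beta>. norm (u z - f z) + norm (\<xi> z - g z))"
  proof (rule integral_mono)
    show "norm (u z + \<xi> z - (f z + g z)) \<le> norm (u z - f z) + norm (\<xi> z - g z)" for z
      using norm_triangle_ineq[of "u z - f z" "\<xi> z - g z"] by (simp add: algebra_simps)
  qed (use add.hyps integrable_test[OF u(1)] integrable_test[OF \<xi>(1)] in auto)
  also have "\<dots> = (LINT z|\<beta>. norm (u z - f z)) + (LINT z|\<beta>. norm (\<xi> z - g z))"
    using add.hyps integrable_test[OF u(1)] integrable_test[OF \<xi>(1)] by simp
  also have "\<dots> < e" using u \<xi> by simp
  finally show ?case using test_functions_add[OF u(1) \<xi>(1)] by (intro bexI[of _ "\<lambda>z. u z + \<xi> z"])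
next
  case (lim f s)
  have "(\<lambda>i. LINT z|\<beta>. norm (s i z - f z)) \<longlonglongrightarrow> (LINT z|\<beta>. 0::real)"
  proof (rule integral_dominated_convergence[where w="\<lambda>z. 3 * norm (f z)"])
    show "AE z in \<beta>. (\<lambda>i. norm (s i z - f z)) \<longlonglongrightarrow> 0"
      using lim.hyps(2) by (auto intro!: tendsto_norm_zero LIM_zero)
    show "AE z in \<beta>. norm (norm (s i z - f z)) \<le> 3 * norm (f z)" for i
    proof (rule AE_I2)
      fix z
      show "norm (norm (s i z - f z)) \<le> 3 * norm (f z)"
        using lim.hyps(3)[of z i] norm_triangle_ineq4[of "s i z" "f z"] by simp
    qed
  qed (use lim.hyps in auto)
  hence "\<forall>\<^sub>F i in sequentially. (LINT z|\<beta>. norm (s i z - f z)) < e/2"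
    using lim.prems by (intro order_tendstoD) auto
  then obtain i where i: "(LINT z|\<beta>. norm (s i z - f z)) < e/2"
    using eventually_happens'[OF sequentially_bot] by blast
  obtain u where u: "u \<in> test_functions U" "(LINT z|\<beta>. norm (u z - s i z)) < e/2"
    using lim.IH[of "e/2" i] lim.prems by auto
  have "(LINT z|\<beta>. norm (u z - f z)) \<le> (LINT z|\<beta>. norm (u z - s i z) + norm (s i z - f z))"
  proof (rule integral_mono)
    show "norm (u z - f z) \<le> norm (u z - s i z) + norm (s i z - f z)" for z
      using norm_triangle_ineq[of "u z - s i z" "s i z - f z"] by simp
  qed (use lim.hyps integrable_test[OF u(1)] in auto)
  also have "\<dots> = (LINT z|\<beta>. norm (u z - s i z)) + (LINT z|\<beta>. norm (s i z - f z))"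
    using lim.hyps integrable_test[OF u(1)] by simp
  also have "\<dots> < e" using u i by simp
  finally show ?case using u(1) by blast
qed

end

section \<open>Representation of bounded functionals\<close>

text \<open>Integrability of \<open>w\<close> lets weighted square norms control L1 norms although
  \<beta> may be infinite; the lower bounds on compact sets make the square norms of test functions,
  which carry the factor \<open>1 / w\<close>, finite.\<close>

lemma (in open_measure) weight_exists:
  "\<exists>w::'a => real. w \<in> Borel \<and> (\<forall>z. 0 < w z) \<and> integrable \<beta> w \<and>
    (\<forall>K. compact K \<longrightarrow> K \<subseteq> U \<longrightarrow> (\<exists>c>0. \<forall>z\<in>K. c \<le> w z))"
proof -
  obtain C where C: "\<And>n::nat. compact (C n)" "\<And>n. C n \<subseteq> U" "\<Union>(range C) = U"
      "\<And>K. \<lbrakk>compact K; K \<subseteq> U\<rbrakk> \<Longrightarrow> \<exists>N. \<forall>n\<ge>N. K \<subseteq> C n"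
    using open_Union_compact_subsets[OF open_U] by metis
  have CB [measurable]: "C n \<in> sets borel" for n using C(1) by (rule borel_compact)
  have UB [measurable]: "U \<in> sets borel" using open_U by simp
  \<comment> \<open>The denominator makes the sum of the \<open>c n * measure \<beta> (C n)\<close>
    finite, and the numerator alone makes the series converge pointwise.\<close>
  define c where "c n = (1/2) ^ n / (1 + measure \<beta> (C n))" for n
  have c: "0 < c n" "c n \<le> (1/2) ^ n" "c n * measure \<beta> (C n) \<le> (1/2) ^ n" for n
    using measure_nonneg[of \<beta> "C n"] by (auto simp: c_def field_simps add_pos_nonneg)
  have summ: "summable (\<lambda>n. c n * indicator (C n) z)" for z
    by (rule summable_comparison_test'[of "\<lambda>n. (1/2) ^ n" 0]) (use c in \<open>auto simp: indicator_def less_imp_le intro: summable_geometric\<close>)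
  \<comment> \<open>The last term makes \<open>w\<close> positive off \<open>U\<close> too; it has
    integral \<open>0\<close>.\<close>
  define w where "w z = (\<Sum>n. c n * indicator (C n) z) + indicator (- U) z" for z
  have wm [measurable]: "w \<in> Borel" unfolding w_def by measurable
  have lower: "c n \<le> w z" if "z \<in> C n" for n z
  proof -
    have "c n = (\<Sum>k\<in>{n}. c k * indicator (C k) z)" using that by simp
    also have "\<dots> \<le> (\<Sum>n. c n * indicator (C n) z)"
      using c by (intro sum_le_suminf summ) (auto simp: less_imp_le)
    also have "\<dots> \<le> w z" by (simp add: w_def)
    finally show ?thesis .
  qed
  have pos: "0 < w z" for z
  proof (cases "z \<in> U")
    case True
    then obtain n where "z \<in> C n" using C(3) by auto
    thus ?thesis using lower c(1)[of n] by (meson less_le_trans)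
  next
    case False
    hence "z \<notin> C n" for n using C(2) by blast
    thus ?thesis using False by (simp add: w_def)
  qed
  have "(\<integral>\<^sup>+z. ennreal (w z) \<partial>\<beta>) = (\<integral>\<^sup>+z. (\<Sum>n. ennreal (c n * indicator (C n) z)) \<partial>\<beta>)"
  proof (rule nn_integral_cong_AE)
    show "AE z in \<beta>. ennreal (w z) = (\<Sum>n. ennreal (c n * indicator (C n) z))"
      using AE_U
    proof eventually_elim
      case (elim z)
      thus ?case using summ[of z] c by (simp add: w_def suminf_ennreal2 less_imp_le)
    qed
  qed
  also have "\<dots> = (\<Sum>n. \<integral>\<^sup>+z. ennreal (c n * indicator (C n) z) \<partial>\<beta>)"
    by (rule nn_integral_suminf) measurable
  also have "\<dots> \<le> (\<Sum>n. ennreal ((1/2) ^ n))"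
  proof (rule suminf_le)
    fix n
    have "emeasure \<beta> (C n) = ennreal (measure \<beta> (C n))"
      using compact_finite[OF C(1,2)] by (intro emeasure_eq_ennreal_measure) (auto simp: less_top)
    moreover have "(\<integral>\<^sup>+z. ennreal (c n * indicator (C n) z) \<partial>\<beta>) = ennreal (c n) * emeasure \<beta> (C n)"
      using c(1)[of n] by (simp add: ennreal_mult' less_imp_le ennreal_indicator nn_integral_cmult)
    ultimately show "(\<integral>\<^sup>+z. ennreal (c n * indicator (C n) z) \<partial>\<beta>) \<le> ennreal ((1/2) ^ n)"
      using c(1)[of n] c(3)[of n] by (simp add: ennreal_mult[symmetric] less_imp_le ennreal_leI del: ennreal_half)
  qed auto
  also have "\<dots> < \<infinity>"
    by (subst suminf_ennreal2) (auto intro: summable_geometric)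
  finally have "integrable \<beta> w"
    using pos by (intro integrableI_nonneg) (auto simp: less_imp_le)
  moreover have "\<exists>c>0. \<forall>z\<in>K. c \<le> w z" if "compact K" "K \<subseteq> U" for K
    using C(4)[OF that] lower c(1) by (meson order_refl subsetD)
  ultimately show ?thesis using wm pos by blast
qed

lemma norm_sq_parallelogram:
  fixes a b :: "'b::real_inner"
  shows "(norm (a - b))\<^sup>2 = 2 * (norm a)\<^sup>2 + 2 * (norm b)\<^sup>2 - 4 * (norm ((1/2) *\<^sub>R (a + b)))\<^sup>2"
  by (simp add: power2_norm_eq_inner inner_diff inner_add algebra_simps inner_commute)

lemma real_le_add_half_sq: "0 < s ==> x \<le> (x\<^sup>2 / s + s) / 2" for x s :: real
  using zero_le_power2[of "x - s"] by (simp add: field_simps power2_eq_square)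

text \<open>The density is obtained from the minimiser of \<open>\<integral> |u|\<^sup>2 / (2 w) d\<beta> - S u\<close>, where \<open>w\<close>
  is an integrable weight.\<close>

theorem (in open_measure) riesz_representation:
  fixes S :: "('a => 'b::euclidean_space) => real"
  assumes S: "test_functional U S"
    and bound: "\<And>u. u \<in> test_functions U ==> S u \<le> C * (LINT z|\<beta>. norm (u z))"
    and C: "0 \<le> C"
  obtains \<nu> :: "'a => 'b" where "\<nu> \<in> Borel" "\<And>z. norm (\<nu> z) \<le> C"
    "\<And>u. u \<in> test_functions U ==> S u = (LINT z|\<beta>. u z \<bullet> \<nu> z)"
proof -
  interpret S: test_functional U S by fact
  obtain w :: "'a => real" where "w \<in> Borel \<and> (\<forall>z. 0 < w z) \<and> integrable \<beta> w \<and>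
      (\<forall>K. compact K \<longrightarrow> K \<subseteq> U \<longrightarrow> (\<exists>c>0. \<forall>z\<in>K. c \<le> w z))"
    using weight_exists by blast
  hence w [measurable]: "w \<in> Borel" and w_pos: "\<And>z. 0 < w z" and w_int: "integrable \<beta> w"
    and w_low: "\<And>K. compact K ==> K \<subseteq> U ==> \<exists>c>0. \<forall>z\<in>K. c \<le> w z"
    by simp_all
  define Q where "Q u z = (norm (u z :: 'b))\<^sup>2 / w z" for u z
  have Q0: "0 \<le> Q u z" for u z using w_pos[of z] by (simp add: Q_def less_imp_le)
  define q where "q u = (LINT z|\<beta>. Q u z)" for u
  have q0: "0 \<le> q u" for u unfolding q_def using Q0 by simp
  have q_int: "integrable \<beta> (\<lambda>z. Q u z)" if th: "u \<in> test_functions U" for u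
  proof -
    obtain B where B: "0 < B" "\<And>z. norm (u z) \<le> B" using test_functions_bounded[OF th] by blast
    obtain c where c: "0 < c" "\<And>z. z \<in> spt u ==> c \<le> w z"
      using w_low[of "spt u"] test_functionsD[OF th] by blast
    note [measurable] = test_functions_borel[OF th]
    show ?thesis
      unfolding Q_def
    proof (rule integrable_bounded_compact[of _ "spt u" "B\<^sup>2 / c"])
      show "norm ((norm (u z))\<^sup>2 / w z) \<le> B\<^sup>2 / c" if "z \<in> spt u" for z
        using B c(1) c(2)[OF that] w_pos[of z] by (auto intro!: frac_le power_mono)
    qed (use test_functionsD[OF th] in \<open>auto simp: not_in_spt\<close>)
  qed
  note t_int = integrable_test
  define J where "J u = q u / 2 - S u" for u
  define W where "W = (LINT z|\<beta>. w z)"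
  have W0: "0 \<le> W" unfolding W_def using w_pos by (intro Bochner_Integration.integral_nonneg) (auto simp: less_imp_le)
  \<comment> \<open>The inequality of arithmetic and geometric means with a free parameter
    \<open>s\<close> takes the place of the Cauchy-Schwarz inequality: \<open>s = C\<close> bounds
    \<open>J\<close> from below, and small \<open>s\<close> gives the Cauchy property in
    mean.\<close>
  have L1: "(LINT z|\<beta>. norm (u z)) \<le> (q u / s + s * W) / 2" if "u \<in> test_functions U" "0 < s" for u s
  proof -
    have "(LINT z|\<beta>. norm (u z)) \<le> (LINT z|\<beta>. (1 / s * Q u z + s * w z) / 2)"
    proof (rule integral_mono)
      show "norm (u z) \<le> (1 / s * Q u z + s * w z) / 2" for z
        using real_le_add_half_sq[of "s * w z" "norm (u z)"] w_pos[of z] that by (simp add: Q_def mult.commute)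
    qed (use q_int[OF that(1)] t_int[OF that(1)] w_int in auto)
    also have "\<dots> = (q u / s + s * W) / 2"
      using q_int[OF that(1)] w_int by (simp add: q_def W_def)
    finally show ?thesis .
  qed
  have J_low: "- (C\<^sup>2 * W / 2) \<le> J u" if "u \<in> test_functions U" for u
  proof (cases "C = 0")
    case True
    thus ?thesis using bound[OF that] q0[of u] by (simp add: J_def)
  next
    case False
    hence "0 < C" using C by simp
    hence "C * (LINT z|\<beta>. norm (u z)) \<le> C * ((q u / C + C * W) / 2)"
      using L1[OF that, of C] by (intro mult_left_mono) auto
    also have "\<dots> = q u / 2 + C\<^sup>2 * W / 2" using \<open>0 < C\<close> by (simp add: field_simps power2_eq_square)
    finally show ?thesis using bound[OF that] by (simp add: J_def)
  qed
  define m where "m = (INF u\<in>test_functions U. J u)"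
  have bdd: "bdd_below (J ` test_functions U)"
    by (rule bdd_belowI2[OF J_low])
  have m_le: "m \<le> J u" if "u \<in> test_functions U" for u
    unfolding m_def by (rule cINF_lower[OF bdd that])
  have "\<exists>u\<in>test_functions U. J u < m + 1 / real (Suc j)" for j
  proof -
    have "(INF u\<in>test_functions U. J u) < m + 1 / real (Suc j)" by (simp add: m_def)
    thus ?thesis using test_functions_zero by (subst (asm) cINF_less_iff[OF _ bdd]) auto
  qed
  then obtain t where t: "\<And>j::nat. t j \<in> test_functions U" "\<And>j. J (t j) < m + 1 / real (Suc j)"
    by metis
  \<comment> \<open>The midpoint of two almost minimisers is a competitor, so the parallelogram law
    bounds the energy of their difference by their excess over \<open>m\<close>.\<close>
  have q_diff: "q (\<lambda>z. t i z - t j z) \<le> 4 * (1 / real (Suc i) + 1 / real (Suc j))" for i j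
  proof -
    let ?a = "\<lambda>z. (1/2) *\<^sub>R (t i z + t j z)"
    have a: "?a \<in> test_functions U" by (intro test_functions_scaleR test_functions_add t)
    have "Q (\<lambda>z. t i z - t j z) z = 2 * Q (t i) z + 2 * Q (t j) z - 4 * Q ?a z" for z
      unfolding Q_def norm_sq_parallelogram[of "t i z"] by (simp only: diff_divide_distrib add_divide_distrib times_divide_eq_right)
    hence "q (\<lambda>z. t i z - t j z) = 2 * q (t i) + 2 * q (t j) - 4 * q ?a"
      using q_int[OF t(1)] q_int[OF a] by (simp add: q_def)
    also have "\<dots> = 4 * (J (t i) + J (t j) - 2 * J ?a)"
      using S.scale[OF test_functions_add[OF t(1) t(1)], of "1/2" i j] S.add[OF t(1) t(1), of i j]
      by (simp add: J_def field_simps)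
    also have "\<dots> \<le> 4 * (1 / real (Suc i) + 1 / real (Suc j))"
      using t(2)[of i] t(2)[of j] m_le[OF a] by (intro mult_left_mono) auto
    finally show ?thesis .
  qed
  have small: "\<exists>N. \<forall>i\<ge>N. \<forall>j\<ge>N. (LINT z|\<beta>. norm (t i z - t j z)) < e" if e: "0 < e" for e
  proof -
    define s where "s = e / (W + 1)"
    have s: "0 < s" "s * W < e" using e W0 by (auto simp: s_def field_simps)
    obtain N where N: "8 / (s * e) < real N" using reals_Archimedean2 by blast
    have "(LINT z|\<beta>. norm (t i z - t j z)) < e" if ij: "N \<le> i" "N \<le> j" for i j
    proof -
      have Np: "0 < real N" using N s e by (meson divide_pos_pos less_trans mult_pos_pos zero_less_numeral)
      have "1 / real (Suc i) \<le> 1 / real N" "1 / real (Suc j) \<le> 1 / real N"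
        using ij Np by (auto intro!: divide_left_mono)
      hence "q (\<lambda>z. t i z - t j z) \<le> 8 / real N" using q_diff[of i j] by simp
      also have "8 / real N < s * e" using N Np s e by (simp add: field_simps)
      finally have "q (\<lambda>z. t i z - t j z) / s < e" using s by (simp add: field_simps)
      thus ?thesis using L1[OF test_functions_diff[OF t(1)[of i] t(1)[of j]] s(1)] s(2) by simp
    qed
    thus ?thesis by blast
  qed
  obtain r where r: "strict_mono r" "AE z in \<beta>. Cauchy (\<lambda>i. t (r i) z)"
    using cauchy_L1_AE_cauchy_subseq[OF t_int[OF t(1)] small] by blast
  have [measurable]: "t j \<in> Borel" for j using t(1) by measurable
  define v where "v z = lim (\<lambda>i. t (r i) z)" for z
  have v [measurable]: "v \<in> Borel" unfolding v_def by measurable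
  have conv: "AE z in \<beta>. (\<lambda>i. t (r i) z) \<longlonglongrightarrow> v z"
    using r(2) by eventually_elim (simp add: v_def Cauchy_convergent_iff convergent_LIMSEQ_iff)
  \<comment> \<open>This upgrades convergence of a subsequence almost everywhere to convergence in
    mean to \<open>v\<close>.\<close>
  have Fatou: "(\<integral>\<^sup>+z. norm (t (r j) z - v z) \<partial>\<beta>) \<le> ennreal e"
    if "\<And>i. N \<le> i ==> (LINT z|\<beta>. norm (t (r j) z - t (r i) z)) < e" for j N e
  proof -
    have "(\<integral>\<^sup>+z. norm (t (r j) z - v z) \<partial>\<beta>) = (\<integral>\<^sup>+z. liminf (\<lambda>i. ennreal (norm (t (r j) z - t (r i) z))) \<partial>\<beta>)"
    proof (rule nn_integral_cong_AE)
      show "AE z in \<beta>. ennreal (norm (t (r j) z - v z)) = liminf (\<lambda>i. ennreal (norm (t (r j) z - t (r i) z)))"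
        using conv
      proof eventually_elim
        case (elim z)
        have "(\<lambda>i. ennreal (norm (t (r j) z - t (r i) z))) \<longlonglongrightarrow> ennreal (norm (t (r j) z - v z))"
          by (intro tendsto_ennrealI tendsto_norm tendsto_diff tendsto_const elim)
        from lim_imp_Liminf[OF _ this] show ?case by simp
      qed
    qed
    also have "\<dots> \<le> liminf (\<lambda>i. \<integral>\<^sup>+z. ennreal (norm (t (r j) z - t (r i) z)) \<partial>\<beta>)"
      by (rule nn_integral_liminf) measurable
    also have "\<dots> \<le> ennreal e"
    proof (rule Liminf_le)
      show "\<forall>\<^sub>F i in sequentially. (\<integral>\<^sup>+z. ennreal (norm (t (r j) z - t (r i) z)) \<partial>\<beta>) \<le> ennreal e"
        using eventually_ge_at_top[of N]
      proof eventually_elim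
        case (elim i)
        have "integrable \<beta> (\<lambda>z. norm (t (r j) z - t (r i) z))"
          using t_int[OF test_functions_diff[OF t(1) t(1)], of "r j" "r i"] by simp
        thus ?case using that[OF elim] by (subst nn_integral_eq_integral) (auto simp: ennreal_leI)
      qed
    qed simp
    finally show ?thesis .
  qed
  have v_lim: "\<exists>N. \<forall>j\<ge>N. (\<integral>\<^sup>+z. norm (t (r j) z - v z) \<partial>\<beta>) \<le> ennreal e" if e: "0 < e" for e
  proof -
    obtain N where N: "\<And>i j. N \<le> i ==> N \<le> j ==> (LINT z|\<beta>. norm (t i z - t j z)) < e" using small[OF e] by blast
    have "N \<le> i ==> N \<le> r i" for i using seq_suble[OF r(1), of i] by simp
    thus ?thesis using N by (intro exI[of _ N] allI impI Fatou) auto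
  qed
  have dv_int: "integrable \<beta> (\<lambda>z. t (r j) z - v z)" if "(\<integral>\<^sup>+z. norm (t (r j) z - v z) \<partial>\<beta>) \<le> ennreal e" for j e
    using that by (intro integrableI_bounded) (auto simp: le_less_trans)
  have v_int: "integrable \<beta> v"
  proof -
    obtain j where "(\<integral>\<^sup>+z. norm (t (r j) z - v z) \<partial>\<beta>) \<le> ennreal 1" using v_lim[of 1] by auto
    from Bochner_Integration.integrable_diff[OF t_int[OF t(1)[of "r j"]] dv_int[OF this]] show ?thesis by simp
  qed
  have rep0: "S u = (LINT z|\<beta>. u z \<bullet> ((1 / w z) *\<^sub>R v z))" if th: "u \<in> test_functions U" for u
  proof -
    note [measurable] = test_functions_borel[OF th]
    obtain B where B: "0 < B" "\<And>z. norm (u z) \<le> B" using test_functions_bounded[OF th] by blast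
    obtain c where c: "0 < c" "\<And>z. z \<in> spt u ==> c \<le> w z"
      using w_low[of "spt u"] test_functionsD[OF th] by blast
    have bd: "norm ((1 / w z) *\<^sub>R u z) \<le> B / c" for z
    proof (cases "z \<in> spt u")
      case True
      thus ?thesis using B(1) B(2)[of z] c(1) c(2)[OF True] w_pos[of z] by (auto intro!: frac_le)
    qed (use B c in \<open>auto simp: not_in_spt\<close>)
    have pair_int: "integrable \<beta> (\<lambda>z. (1 / w z) *\<^sub>R u z \<bullet> v z)" if "integrable \<beta> v" for v :: "'a => 'b"
    proof (rule Bochner_Integration.integrable_bound[of _ "\<lambda>z. B / c * norm (v z)"])
      show "integrable \<beta> (\<lambda>z. B / c * norm (v z))" using that by simp
      show "(\<lambda>z. (1 / w z) *\<^sub>R u z \<bullet> v z) \<in> borel_measurable \<beta>" using borel_measurable_integrable[OF that] by measurable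
      show "AE z in \<beta>. norm ((1 / w z) *\<^sub>R u z \<bullet> v z) \<le> norm (B / c * norm (v z))"
      proof (rule AE_I2)
        fix z
        have "norm ((1 / w z) *\<^sub>R u z \<bullet> v z) \<le> norm ((1 / w z) *\<^sub>R u z) * norm (v z)"
          by (simp only: real_norm_def Cauchy_Schwarz_ineq2)
        also have "\<dots> \<le> B / c * norm (v z)" using bd by (intro mult_right_mono) auto
        finally show "norm ((1 / w z) *\<^sub>R u z \<bullet> v z) \<le> norm (B / c * norm (v z))"
          using B c by simp
      qed
    qed
    define P where "P v z = (1 / w z) *\<^sub>R u z \<bullet> (v z :: 'b)" for v z
    have P_int: "integrable \<beta> (\<lambda>z. P v z)" if "integrable \<beta> v" for v
      unfolding P_def by (rule pair_int[OF that])
    have P_bound: "\<bar>P v z\<bar> \<le> B / c * norm (v z)" for v z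
    proof -
      have "\<bar>P v z\<bar> \<le> norm ((1 / w z) *\<^sub>R u z) * norm (v z)"
        unfolding P_def by (rule Cauchy_Schwarz_ineq2)
      also have "\<dots> \<le> B / c * norm (v z)" using bd by (intro mult_right_mono) auto
      finally show ?thesis .
    qed
    let ?p = "\<lambda>v. LINT z|\<beta>. P v z"
    \<comment> \<open>An approximate Euler-Lagrange equation: \<open>J\<close> at
      \<open>t j + x u\<close> is at least \<open>J (t j) - 1 / real (Suc j)\<close>, a quadratic
      inequality in \<open>x\<close>, which is used for \<open>x = d\<close> and
      \<open>x = - d\<close>.\<close>
    have EL: "\<bar>?p (t j) - S u\<bar> \<le> 1 / real (Suc j) / d + d * q u / 2" if d: "0 < d" for j d
    proof -
      have 1: "0 \<le> 1 / real (Suc j) + x * (?p (t j) - S u) + x\<^sup>2 * q u / 2" for x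
      proof -
        have s: "(\<lambda>z. t j z + x *\<^sub>R u z) \<in> test_functions U" by (intro test_functions_add test_functions_scaleR t th)
        have "(t j z + x *\<^sub>R u z) \<bullet> (t j z + x *\<^sub>R u z) = t j z \<bullet> t j z + 2 * x * (u z \<bullet> t j z) + x\<^sup>2 * (u z \<bullet> u z)" for z
          by (simp add: inner_add_left inner_add_right inner_commute power2_eq_square algebra_simps del: dot_square_norm)
        hence e: "Q (\<lambda>z. t j z + x *\<^sub>R u z) z = Q (t j) z + 2 * x * P (t j) z + x\<^sup>2 * Q u z" for z
          unfolding Q_def P_def power2_norm_eq_inner by (simp add: add_divide_distrib)
        have "q (\<lambda>z. t j z + x *\<^sub>R u z) = q (t j) + 2 * x * ?p (t j) + x\<^sup>2 * q u"
          unfolding q_def e using q_int[OF t(1)] q_int[OF th] P_int[OF t_int[OF t(1)]] by simp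
        moreover have "S (\<lambda>z. t j z + x *\<^sub>R u z) = S (t j) + x * S u"
          using S.add[OF t(1) test_functions_scaleR[OF th]] S.scale[OF th] by simp
        ultimately show ?thesis using m_le[OF s] t(2)[of j] by (simp add: J_def algebra_simps)
      qed
      have 2: "x * \<bar>y\<bar> \<le> z ==> 0 < x ==> \<bar>y\<bar> \<le> z / x" for x y z :: real by (simp add: field_simps)
      have "d * \<bar>?p (t j) - S u\<bar> \<le> 1 / real (Suc j) + d\<^sup>2 * q u / 2"
        using 1[of d] 1[of "- d"] d by (cases "0 \<le> ?p (t j) - S u") (auto simp: abs_if algebra_simps)
      from 2[OF this d] show ?thesis using d by (simp add: add_divide_distrib power2_eq_square)
    qed
    have "\<bar>?p v - S u\<bar> \<le> e" if e: "0 < e" for e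
    proof -
      \<comment> \<open>The errors are \<open>e / 4\<close> for replacing \<open>t (r j)\<close> by
        \<open>v\<close>, \<open>e / 4\<close> for the failure of exact minimality and
        \<open>e / 2\<close> for the quadratic term; the summand \<open>1\<close> covers
        \<open>q u = 0\<close>.\<close>
      define d where "d = e / (q u + 1)"
      have d: "0 < d" "d * q u \<le> e" using e q0[of u] by (auto simp: d_def field_simps)
      obtain N1 where N1: "\<And>j. N1 \<le> j ==> (\<integral>\<^sup>+z. norm (t (r j) z - v z) \<partial>\<beta>) \<le> ennreal (e / 4 * c / B)"
        using v_lim[of "e / 4 * c / B"] e c B by auto
      obtain N2 where N2: "4 / (d * e) < real N2" using reals_Archimedean2 by blast
      define j where "j = max N1 N2"
      have nn: "(\<integral>\<^sup>+z. norm (t (r j) z - v z) \<partial>\<beta>) \<le> ennreal (e / 4 * c / B)" by (rule N1) (simp add: j_def)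
      have dvi: "integrable \<beta> (\<lambda>z. t (r j) z - v z)" by (rule dv_int[OF nn])
      have "(LINT z|\<beta>. norm (t (r j) z - v z)) \<le> e / 4 * c / B"
        using nn dvi e c B by (subst (asm) nn_integral_eq_integral) auto
      hence s1: "B / c * (LINT z|\<beta>. norm (t (r j) z - v z)) \<le> e / 4"
        using B c by (simp add: field_simps)
      have "P (\<lambda>z. t (r j) z - v z) z = P (t (r j)) z - P v z" for z by (simp add: P_def inner_diff_right)
      hence "\<bar>?p (t (r j)) - ?p v\<bar> = \<bar>?p (\<lambda>z. t (r j) z - v z)\<bar>"
        using P_int[OF t_int[OF t(1)]] P_int[OF v_int] by simp
      also have "\<dots> \<le> (LINT z|\<beta>. \<bar>P (\<lambda>z. t (r j) z - v z) z\<bar>)"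
        using integral_norm_bound[of \<beta> "\<lambda>z. P (\<lambda>z. t (r j) z - v z) z"] by simp
      also have "\<dots> \<le> (LINT z|\<beta>. B / c * norm (t (r j) z - v z))"
        by (rule integral_mono) (use P_int[OF dvi] dvi P_bound in auto)
      also have "\<dots> \<le> e / 4" using s1 by simp
      finally have "\<bar>?p (t (r j)) - ?p v\<bar> \<le> e / 4" .
      moreover have "1 / real (Suc (r j)) / d \<le> e / 4"
      proof -
        have p: "0 < 4 / (d * e)" using d e by simp
        have "real N2 \<le> real (Suc (r j))" using seq_suble[OF r(1), of j] by (simp add: j_def)
        hence "4 / (d * e) \<le> real (Suc (r j))" using N2 by simp
        hence "1 / real (Suc (r j)) \<le> 1 / (4 / (d * e))" using p by (intro divide_left_mono) auto
        hence "1 / real (Suc (r j)) \<le> d * (e / 4)" by simp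
        thus ?thesis using d(1) by (subst pos_divide_le_eq) (simp_all add: mult.commute)
      qed
      ultimately show ?thesis using EL[OF d(1), of "r j"] d(2) e by linarith
    qed
    hence "\<bar>?p v - S u\<bar> \<le> 0" by (rule field_le_epsilon) simp
    thus ?thesis by (simp add: P_def inner_commute)
  qed
  \<comment> \<open>\<open>\<nu>0\<close> already represents \<open>S\<close>. The bound
    \<open>C\<close> is derived by testing with approximations of \<open>sgn \<nu>0\<close> on the
    set where it fails.\<close>
  define \<nu>0 where "\<nu>0 z = (1 / w z) *\<^sub>R v z" for z
  have [measurable]: "\<nu>0 \<in> Borel" unfolding \<nu>0_def by measurable
  have \<nu>0_loc: "(\<integral>\<^sup>+z\<in>K. norm (\<nu>0 z) \<partial>\<beta>) < \<infinity>" if K: "compact K" "K \<subseteq> U" for K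
  proof -
    obtain c where c: "0 < c" "\<And>z. z \<in> K ==> c \<le> w z" using w_low[OF K] by blast
    have "(\<integral>\<^sup>+z\<in>K. norm (\<nu>0 z) \<partial>\<beta>) \<le> (\<integral>\<^sup>+z. ennreal (1 / c * norm (v z)) \<partial>\<beta>)"
    proof (rule nn_integral_mono)
      fix z
      show "ennreal (norm (\<nu>0 z)) * indicator K z \<le> ennreal (1 / c * norm (v z))"
      proof (cases "z \<in> K")
        case True
        hence "norm (\<nu>0 z) \<le> 1 / c * norm (v z)"
          using c w_pos[of z] by (auto simp: \<nu>0_def intro!: divide_left_mono mult_pos_pos)
        thus ?thesis using True by (simp add: ennreal_leI)
      qed simp
    qed
    also have "\<dots> < \<infinity>"
    proof -
      have "integrable \<beta> (\<lambda>z. 1 / c * norm (v z))" using v_int by simp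
      thus ?thesis using c(1) unfolding integrable_iff_bounded by simp
    qed
    finally show ?thesis .
  qed
  \<comment> \<open>Approximation in mean with respect to \<open>\<beta>'\<close> controls the
    integrals of \<open>norm (u z - \<psi> z)\<close> and of
    \<open>norm (\<nu>0 z) * norm (u z - \<psi> z)\<close> at once, although \<open>\<nu>0\<close>
    is not yet known to be bounded.\<close>
  define \<beta>' where "\<beta>' = density \<beta> (\<lambda>z. ennreal (1 + norm (\<nu>0 z)))"
  interpret b: open_measure U \<beta>'
  proof
    have "(\<integral>\<^sup>+z. ennreal (1 + norm (\<nu>0 z)) * indicator (- U) z \<partial>\<beta>) = (\<integral>\<^sup>+z. 0 \<partial>\<beta>)"
      by (rule nn_integral_cong_AE, rule eventually_mono[OF AE_U]) simp
    thus "emeasure \<beta>' (- U) = 0"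
      using open_U unfolding \<beta>'_def by (subst emeasure_density) auto
    fix K assume K: "compact K" "K \<subseteq> U"
    have "emeasure \<beta>' K = (\<integral>\<^sup>+z. ennreal 1 * indicator K z + ennreal (norm (\<nu>0 z)) * indicator K z \<partial>\<beta>)"
      using borel_compact[OF K(1)] unfolding \<beta>'_def
      by (subst emeasure_density) (auto intro!: nn_integral_cong simp: distrib_right ennreal_plus)
    also have "\<dots> = emeasure \<beta> K + (\<integral>\<^sup>+z\<in>K. norm (\<nu>0 z) \<partial>\<beta>)"
      using borel_compact[OF K(1)] by (subst nn_integral_add) auto
    also have "\<dots> < \<infinity>" using compact_finite[OF K] \<nu>0_loc[OF K] by simp
    finally show "emeasure \<beta>' K < \<infinity>" .
  qed (use open_U in \<open>auto simp: \<beta>'_def\<close>)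
  have K_bound: "emeasure \<beta> {z \<in> K. C < norm (\<nu>0 z)} = 0" if K: "compact K" "K \<subseteq> U" for K
  proof -
    have KB [measurable]: "K \<in> sets borel" using K by (auto intro: borel_compact)
    define A where "A = {z \<in> K. C < norm (\<nu>0 z)}"
    have A [measurable]: "A \<in> sets borel" unfolding A_def by measurable
    define \<psi> where "\<psi> z = indicator A z *\<^sub>R sgn (\<nu>0 z)" for z
    have [measurable]: "\<psi> \<in> Borel" unfolding \<psi>_def sgn_div_norm by measurable
    have \<psi>1: "norm (\<psi> z) = indicator A z" for z
      using C by (auto simp: \<psi>_def A_def norm_sgn indicator_def)
    have \<psi>_int': "integrable \<beta>' \<psi>"
      by (rule b.integrable_bounded_compact[of _ K 1]) (use K \<psi>1 in \<open>auto simp: A_def indicator_def \<psi>_def\<close>)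
    have \<psi>_int: "integrable \<beta> \<psi>"
      by (rule integrable_bounded_compact[of _ K 1]) (use K \<psi>1 in \<open>auto simp: A_def indicator_def \<psi>_def\<close>)
    have Aint: "integrable \<beta> (\<lambda>z. indicator A z * norm (\<nu>0 z))"
    proof (rule integrableI_bounded)
      have "(\<integral>\<^sup>+z. ennreal (norm (indicator A z * norm (\<nu>0 z))) \<partial>\<beta>) \<le> (\<integral>\<^sup>+z\<in>K. norm (\<nu>0 z) \<partial>\<beta>)"
        by (intro nn_integral_mono) (auto simp: A_def indicator_def)
      thus "(\<integral>\<^sup>+z. ennreal (norm (indicator A z * norm (\<nu>0 z))) \<partial>\<beta>) < \<infinity>"
        using \<nu>0_loc[OF K] by (rule le_less_trans)
    qed measurable
    have \<psi>\<nu>: "\<psi> z \<bullet> \<nu>0 z = indicator A z * norm (\<nu>0 z)" for z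
      by (cases "\<nu>0 z = 0") (simp_all add: \<psi>_def sgn_div_norm power2_norm_eq_inner[symmetric] power2_eq_square)
    have finA: "emeasure \<beta> A < \<infinity>"
      by (rule le_less_trans[OF emeasure_mono compact_finite[OF K]]) (auto simp: A_def)
    \<comment> \<open>On \<open>A\<close> the integrand exceeds \<open>C\<close>, so this estimate
      for all positive \<open>e\<close> forces \<open>A\<close> to be a null set.\<close>
    have "(LINT z|\<beta>. indicator A z * norm (\<nu>0 z)) \<le> C * measure \<beta> A + e" if e: "0 < e" for e
    proof -
      define d where "d = e / (C + 1)"
      have "0 < d" using e C by (simp add: d_def)
      moreover have "C * d + d = (C + 1) * d" "(C + 1) * d = e"
        using C by (simp add: algebra_simps, simp add: d_def)
      ultimately have d: "0 < d" "C * d + d \<le> e" by simp_all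
      obtain u where th: "u \<in> test_functions U" and dist: "(LINT z|\<beta>'. norm (u z - \<psi> z)) < d"
        using b.test_functions_dense[OF \<psi>_int' d(1)] by blast
      note [measurable] = test_functions_borel[OF th]
      have di: "integrable \<beta> (\<lambda>z. (1 + norm (\<nu>0 z)) * norm (u z - \<psi> z))"
        using Bochner_Integration.integrable_diff[OF b.integrable_test[OF th] \<psi>_int']
        unfolding \<beta>'_def by (subst (asm) integrable_density) (auto dest: integrable_norm)
      have deq: "(LINT z|\<beta>. (1 + norm (\<nu>0 z)) * norm (u z - \<psi> z)) < d"
        using dist unfolding \<beta>'_def by (subst (asm) integral_density) auto
      have di1: "integrable \<beta> (\<lambda>z. norm (u z - \<psi> z))"
        using t_int[OF th] \<psi>_int by auto
      have di2: "integrable \<beta> (\<lambda>z. norm (\<nu>0 z) * norm (u z - \<psi> z))"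
        using Bochner_Integration.integrable_diff[OF di di1] by (simp add: algebra_simps)
      have u\<nu>: "integrable \<beta> (\<lambda>z. u z \<bullet> \<nu>0 z - \<psi> z \<bullet> \<nu>0 z)"
        using di2 by (rule Bochner_Integration.integrable_bound) 
          (use Cauchy_Schwarz_ineq2 in \<open>auto simp: inner_diff_left[symmetric] mult.commute[of "norm (\<nu>0 _)"]\<close>)
      have u\<nu>': "integrable \<beta> (\<lambda>z. u z \<bullet> \<nu>0 z)"
        using Bochner_Integration.integrable_add[OF u\<nu> Aint] by (simp add: \<psi>\<nu>)
      have "(LINT z|\<beta>. indicator A z * norm (\<nu>0 z)) - C * (LINT z|\<beta>. indicator A z)
          \<le> (LINT z|\<beta>. indicator A z * norm (\<nu>0 z)) - C * (LINT z|\<beta>. indicator A z) + C * (LINT z|\<beta>. norm (u z)) - (LINT z|\<beta>. u z \<bullet> \<nu>0 z)"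
        using bound[OF th] rep0[OF th] by (simp add: \<nu>0_def)
      also have "\<dots> = (LINT z|\<beta>. (indicator A z * norm (\<nu>0 z) - u z \<bullet> \<nu>0 z) + C * (norm (u z) - indicator A z))"
        using Aint u\<nu>' t_int[OF th] finA by (simp add: algebra_simps)
      also have "\<dots> \<le> (LINT z|\<beta>. (1 + C) * ((1 + norm (\<nu>0 z)) * norm (u z - \<psi> z)))"
      proof (rule integral_mono)
        fix z
        have "\<psi> z \<bullet> \<nu>0 z - u z \<bullet> \<nu>0 z \<le> norm (u z - \<psi> z) * norm (\<nu>0 z)"
          using Cauchy_Schwarz_ineq2[of "\<psi> z - u z" "\<nu>0 z"] by (simp add: inner_diff_left norm_minus_commute)
        moreover have "C * (norm (u z) - indicator A z) \<le> C * norm (u z - \<psi> z)"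
          using norm_triangle_ineq2[of "u z" "\<psi> z"] \<psi>1[of z] C by (intro mult_left_mono) auto
        moreover have "(1 + C) * ((1 + norm (\<nu>0 z)) * norm (u z - \<psi> z)) =
            C * norm (u z - \<psi> z) + norm (u z - \<psi> z) * norm (\<nu>0 z) + norm (u z - \<psi> z) + C * (norm (\<nu>0 z) * norm (u z - \<psi> z))"
          by (simp add: algebra_simps)
        moreover have "0 \<le> norm (u z - \<psi> z) + C * (norm (\<nu>0 z) * norm (u z - \<psi> z))" using C by simp
        ultimately show "indicator A z * norm (\<nu>0 z) - u z \<bullet> \<nu>0 z + C * (norm (u z) - indicator A z)
            \<le> (1 + C) * ((1 + norm (\<nu>0 z)) * norm (u z - \<psi> z))"
          unfolding \<psi>\<nu> by linarith
      qed (use Aint u\<nu>' t_int[OF th] finA di in auto)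
      also have "\<dots> \<le> (1 + C) * d" using deq C by (simp add: mult_left_mono)
      also have "\<dots> \<le> e" using d by (simp add: algebra_simps)
      finally show ?thesis using finA by simp
    qed
    hence "(LINT z|\<beta>. indicator A z * norm (\<nu>0 z)) \<le> C * measure \<beta> A" by (rule field_le_epsilon)
    hence "(LINT z|\<beta>. indicator A z * norm (\<nu>0 z) - C * indicator A z) \<le> 0"
      using Aint finA by simp
    moreover have nonneg: "0 \<le> indicator A z * norm (\<nu>0 z) - C * indicator A z" for z
      by (auto simp: A_def indicator_def)
    ultimately have "(LINT z|\<beta>. indicator A z * norm (\<nu>0 z) - C * indicator A z) = 0"
      by (intro antisym Bochner_Integration.integral_nonneg) auto
    hence "AE z in \<beta>. indicator A z * norm (\<nu>0 z) - C * indicator A z = 0"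
      using Aint finA nonneg by (subst (asm) integral_nonneg_eq_0_iff_AE) auto
    hence "AE z in \<beta>. z \<notin> A" by eventually_elim (auto simp: A_def)
    hence "emeasure \<beta> A = 0" using A by (subst (asm) AE_iff_measurable[of A]) auto
    thus ?thesis by (simp add: A_def)
  qed
  have AE_bound: "AE z in \<beta>. norm (\<nu>0 z) \<le> C"
  proof -
    obtain D where D: "\<And>n::nat. compact (D n)" "\<And>n. D n \<subseteq> U" "\<Union>(range D) = U"
      using open_Union_compact_subsets[OF open_U] by metis
    have "AE z in \<beta>. z \<in> D n \<longrightarrow> norm (\<nu>0 z) \<le> C" for n
      using K_bound[OF D(1,2)[of n]] borel_compact[OF D(1)[of n]]
      by (intro AE_I[of _ _ "{z \<in> D n. C < norm (\<nu>0 z)}"]) auto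
    hence "AE z in \<beta>. \<forall>n. z \<in> D n \<longrightarrow> norm (\<nu>0 z) \<le> C" by (simp only: AE_all_countable simp_thms)
    thus ?thesis using AE_U by eventually_elim (use D(3) in blast)
  qed
  \<comment> \<open>Changed on a null set so that the bound holds everywhere.\<close>
  define \<nu> where "\<nu> z = (if norm (\<nu>0 z) \<le> C then \<nu>0 z else 0)" for z
  have [measurable]: "\<nu> \<in> Borel" unfolding \<nu>_def by measurable
  have "S u = (LINT z|\<beta>. u z \<bullet> \<nu> z)" if "u \<in> test_functions U" for u
  proof -
    note [measurable] = test_functions_borel[OF that]
    have "S u = (LINT z|\<beta>. u z \<bullet> \<nu>0 z)" using rep0[OF that] by (simp add: \<nu>0_def)
    also have "\<dots> = (LINT z|\<beta>. u z \<bullet> \<nu> z)"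
      by (rule integral_cong_AE) (use AE_bound in \<open>auto simp: \<nu>_def\<close>)
    finally show ?thesis .
  qed
  thus ?thesis using that[of \<nu>] C by (auto simp: \<nu>_def)
qed

section \<open>Measures on an open set and their extensions to the whole space\<close>

lemma sets_borel_of_top_of_set:
  fixes U :: "'a::topological_space set"
  assumes "open U"
  shows "sets (borel_of (top_of_set U)) = sets (restrict_space borel U)"
proof
  have sp: "space (borel_of (top_of_set U)) = U" by (simp add: borel_of_def space_measure_of_conv)
  have gen: "{W. openin (top_of_set U) W} \<subseteq> Pow U" by (auto dest: openin_imp_subset)
  have m: "(\<lambda>x. x) \<in> borel_measurable (borel_of (top_of_set U))"
  proof (rule borel_measurableI)
    fix W :: "'a set" assume "open W"
    hence "openin (top_of_set U) (W \<inter> U)" by (simp add: openin_open_Int Int_commute)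
    thus "(\<lambda>x. x) -` W \<inter> space (borel_of (top_of_set U)) \<in> sets (borel_of (top_of_set U))"
      using gen by (auto simp: sp borel_of_def)
  qed
  show "sets (restrict_space borel U) \<subseteq> sets (borel_of (top_of_set U))"
    using measurable_sets[OF m] by (auto simp: sets_restrict_space sp Int_commute)
  have "{W. openin (top_of_set U) W} \<subseteq> sets (restrict_space borel U)"
  proof safe
    fix W assume "openin (top_of_set U) W"
    hence "open W" "W = U \<inter> W" using assms openin_open_eq[of U W] by auto
    thus "W \<in> sets (restrict_space borel U)"
      unfolding sets_restrict_space by (intro image_eqI[of _ _ W]) auto
  qed
  hence "sigma_sets (space (restrict_space borel U)) {W. openin (top_of_set U) W} \<subseteq> sets (restrict_space borel U)"
    by (rule sets.sigma_sets_subset)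
  thus "sets (borel_of (top_of_set U)) \<subseteq> sets (restrict_space borel U)"
    using gen by (simp add: borel_of_def space_restrict_space)
qed

lemma measurable_completion_AE:
  assumes f: "f \<in> borel_measurable M" and ae: "AE x in M. g x = f x"
  shows "g \<in> borel_measurable (completion M)"
proof (rule measurableI)
  fix A :: "'b set" assume A: "A \<in> sets borel"
  obtain N where N: "N \<in> null_sets M" "{x \<in> space M. g x \<noteq> f x} \<subseteq> N"
    using ae by (auto elim!: AE_E simp: null_sets_def)
  have "g -` A \<inter> space M = (f -` A \<inter> space M - N) \<union> (g -` A \<inter> space M \<inter> N)"
    using N(2) by auto
  moreover have "f -` A \<inter> space M - N \<in> sets (completion M)"
    using measurable_sets[OF f A] N by auto
  moreover have "g -` A \<inter> space M \<inter> N \<in> sets (completion M)"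
    by (rule sets_completionI_sub[OF N(1)]) auto
  ultimately show "g -` A \<inter> space (completion M) \<in> sets (completion M)"
    by (metis sets.Un space_completion)
qed auto

lemma completion_ex_borel_measurable_euclidean:
  fixes g :: "'a => 'b::euclidean_space"
  assumes g: "g \<in> borel_measurable (completion M)"
  shows "\<exists>g'\<in>borel_measurable M. (AE x in M. g x = g' x)"
proof -
  have "\<exists>h\<in>borel_measurable M. (AE x in M. g x \<bullet> b = h x)" for b
    using g by (intro completion_ex_borel_measurable_real) auto
  then obtain h where h: "\<And>b. h b \<in> borel_measurable M" "\<And>b. AE x in M. g x \<bullet> b = h b x"
    by metis
  have "AE x in M. \<forall>b\<in>Basis. g x \<bullet> b = h b x"
    using h(2) by (simp add: AE_finite_all)
  hence "AE x in M. g x = (\<Sum>b\<in>Basis. h b x *\<^sub>R b)"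
  proof eventually_elim
    case (elim x)
    have "g x = (\<Sum>b\<in>Basis. (g x \<bullet> b) *\<^sub>R b)" by (simp add: euclidean_representation)
    also have "\<dots> = (\<Sum>b\<in>Basis. h b x *\<^sub>R b)" using elim by (intro sum.cong) auto
    finally show ?case .
  qed
  moreover have "(\<lambda>x. \<Sum>b\<in>Basis. h b x *\<^sub>R b) \<in> borel_measurable M"
    using h(1) by measurable
  ultimately show ?thesis by (intro bexI)
qed

locale measure_within =
  fixes U :: "'a::euclidean_space set" and M :: "'a measure"
  assumes open_U': "open U" and sets_M: "sets M = sets (restrict_space borel U)"
begin

lemma space_M: "space M = U"
  using sets_eq_imp_space_eq[OF sets_M] by (simp add: space_restrict_space)

lemma borel_M: "f \<in> Borel ==> f \<in> borel_measurable M"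
  using measurable_restrict_space1[of f borel borel U] measurable_cong_sets[OF sets_M refl] by blast

lemma id_M [measurable]: "(\<lambda>x. x) \<in> measurable M borel"
  by (rule borel_M) simp

text \<open>The image under the inclusion of \<open>U\<close>: a measure with space \<open>U\<close>
  becomes a Borel measure of the whole space that vanishes off \<open>U\<close>.\<close>

definition ext :: "'a measure" where "ext = distr M borel (\<lambda>x. x)"

lemma sets_ext [simp, measurable_cong]: "sets ext = sets borel"
  by (simp add: ext_def)

lemma emeasure_ext: "A \<in> sets borel ==> emeasure ext A = emeasure M (A \<inter> U)"
  by (simp add: ext_def emeasure_distr space_M Int_commute vimage_def)

lemma integral_ext:
  fixes f :: "'a => 'b::{banach, second_countable_topology}"
  shows "f \<in> Borel ==> integral\<^sup>L ext f = integral\<^sup>L M f"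
  unfolding ext_def by (rule integral_distr) auto

lemma integrable_ext:
  fixes f :: "'a => 'b::{banach, second_countable_topology}"
  shows "f \<in> Borel ==> integrable ext f \<longleftrightarrow> integrable M f"
  unfolding ext_def by (rule integrable_distr_eq) auto

lemma nn_integral_ext: "f \<in> Borel ==> integral\<^sup>N ext f = integral\<^sup>N M f"
  unfolding ext_def by (rule nn_integral_distr) auto

text \<open>The bridge between integrals over completions, as in the definitions, and the Borel
  measures used in the proof: \<open>f\<close> is a Borel representative of
  \<open>g\<close>.\<close>

lemma completion_integral:
  fixes f :: "'a => 'b::{banach, second_countable_topology}"
  assumes "f \<in> Borel" "AE x in M. g x = f x"
  shows "integral\<^sup>L (completion M) g = integral\<^sup>L ext f"
    "integrable (completion M) g \<longleftrightarrow> integrable ext f"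
proof -
  have m: "f \<in> borel_measurable (completion M)" "g \<in> borel_measurable (completion M)"
    using measurable_completion[OF borel_M[OF assms(1)]] measurable_completion_AE[OF borel_M[OF assms(1)] assms(2)] by auto
  have "integral\<^sup>L (completion M) g = integral\<^sup>L (completion M) f"
    using m AE_completion[OF assms(2)] by (intro integral_cong_AE)
  thus "integral\<^sup>L (completion M) g = integral\<^sup>L ext f"
    using assms(1) by (simp add: integral_completion borel_M integral_ext)
  have "integrable (completion M) g \<longleftrightarrow> integrable (completion M) f"
    using m AE_completion[OF assms(2)] by (intro integrable_cong_AE)
  thus "integrable (completion M) g \<longleftrightarrow> integrable ext f"
    using assms(1) by (simp add: integrable_completion borel_M integrable_ext)
qed

lemma borel_representative:
  fixes g :: "'a => 'b::euclidean_space"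
  assumes "g \<in> borel_measurable (completion M)"
  obtains f where "f \<in> Borel" "AE x in M. g x = f x"
proof -
  obtain h where h: "h \<in> borel_measurable M" "AE x in M. g x = h x"
    using completion_ex_borel_measurable_euclidean[OF assms] by blast
  have "h \<in> borel_measurable (restrict_space borel U)"
    using h(1) measurable_cong_sets[OF sets_M refl] by blast
  hence "(\<lambda>x. indicator U x *\<^sub>R h x) \<in> Borel"
    using open_U' by (subst (asm) borel_measurable_restrict_space_iff) auto
  moreover have "AE x in M. g x = indicator U x *\<^sub>R h x"
    using h(2) AE_space by eventually_elim (simp add: space_M)
  ultimately show ?thesis using that by blast
qed

lemma open_measure_ext:
  assumes "\<And>K. compact K ==> K \<subseteq> U ==> emeasure M K < \<infinity>"
  shows "open_measure U ext"
proof
  show "emeasure ext (- U) = 0" using open_U' by (simp add: emeasure_ext)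
  show "emeasure ext K < \<infinity>" if "compact K" "K \<subseteq> U" for K
    using assms[OF that] that by (simp add: emeasure_ext borel_compact Int_absorb2)
qed (auto simp: open_U')

end

section \<open>Extension of a distribution to integrable functions\<close>

locale radon_functional = test_functional +
  assumes fin: "compact K ==> K \<subseteq> U ==> emeasure (variation U S) K < \<infinity>"
begin

sublocale var: measure_within U "variation U S"
  by unfold_locales (simp_all add: open_U sets_variation sets_borel_of_top_of_set)

definition vm :: "'a measure" where "vm = var.ext"

sublocale vm: open_measure U vm
  unfolding vm_def by (rule var.open_measure_ext[OF fin])

lemma vm_open: "open C ==> C \<subseteq> U ==> emeasure vm C = vopen C"
  by (simp add: vm_def var.emeasure_ext Int_absorb2 emeasure_variation sets_borel_of_top_of_set open_U
      sets_restrict_space vout_open image_iff) (metis Int_absorb1 borel_open emeasure_variation open_U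
      sets_borel_of_top_of_set sets_restrict_space image_eqI vout_open)

lemma test_bound_open:
  assumes "\<xi> \<in> test_functions U" "\<And>z. norm (\<xi> z) \<le> c" "0 < c" "spt \<xi> \<subseteq> C" "open C" "C \<subseteq> U"
    "emeasure vm C < \<infinity>"
  shows "S \<xi> \<le> c * measure vm C"
proof -
  have "spt (\<lambda>z. (1 / c) *\<^sub>R \<xi> z) \<subseteq> spt \<xi>"
    by (rule spt_subset) (auto simp: not_in_spt, simp add: spt_def)
  hence "(\<lambda>z. (1 / c) *\<^sub>R \<xi> z) \<in> adm C"
    using assms by (auto simp: adm_def test_functions_scaleR field_simps)
  from le_vopen[OF this] have "ennreal (S \<xi> / c) \<le> emeasure vm C"
    using scale[OF assms(1), of "1 / c"] assms by (simp add: vm_open)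
  also have "\<dots> = ennreal (measure vm C)"
    using assms(7) by (intro emeasure_eq_ennreal_measure) (auto simp: less_top)
  finally have "S \<xi> / c \<le> measure vm C" by (simp add: ennreal_le_iff)
  thus ?thesis using assms(3) by (simp add: field_simps)
qed

text \<open>The terms that occur form a geometric progression below \<open>x\<close>. The second
  bound in the minimum carries the induction: the sum before a term of size
  \<open>2 ^ m * \<epsilon>\<close> is at most that term.\<close>

lemma dyadic_sum_le:
  fixes \<epsilon> x :: real
  assumes "0 < \<epsilon>" "0 \<le> x"
  shows "(\<Sum>i<m. if 2 ^ i * \<epsilon> < x then 2 ^ i * \<epsilon> else 0) \<le> 2 * x"
proof -
  have "(\<Sum>i<m. if 2 ^ i * \<epsilon> < x then 2 ^ i * \<epsilon> else 0) \<le> min (2 * x) (2 ^ m * \<epsilon>)"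
  proof (induction m)
    case (Suc m)
    have "0 < 2 ^ m * \<epsilon>" "2 ^ Suc m * \<epsilon> = 2 * (2 ^ m * \<epsilon>)" using assms by simp_all
    moreover have "(\<Sum>i<m. if 2 ^ i * \<epsilon> < x then 2 ^ i * \<epsilon> else 0) \<le> 2 * x"
      "(\<Sum>i<m. if 2 ^ i * \<epsilon> < x then 2 ^ i * \<epsilon> else 0) \<le> 2 ^ m * \<epsilon>" using Suc by simp_all
    ultimately show ?case unfolding sum.lessThan_Suc
      by (cases "2 ^ m * \<epsilon> < x") (simp_all only: if_True if_False min.bounded_iff, linarith+)
  qed (use assms in auto)
  thus ?thesis by simp
qed

text \<open>The constant is not sharp: \<open>u\<close> is cut into pieces on which \<open>|u|\<close> is known up to a factor \<open>4\<close>.\<close>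

lemma test_bound:
  assumes th: "u \<in> test_functions U"
  shows "S u \<le> 16 * (LINT z|vm. norm (u z))"
proof (rule field_le_epsilon)
  fix e :: real assume e: "0 < e"
  have sm: "smooth u" and cpt: "compact (spt u)" "spt u \<subseteq> U" using test_functionsD[OF th] by auto
  obtain W K' where W: "open W" "spt u \<subseteq> W" "W \<subseteq> K'" "compact K'" "K' \<subseteq> U"
    using vm.ex_compact_neighbourhood[OF cpt] by blast
  have finK: "emeasure vm K' < \<infinity>" by (rule vm.compact_finite[OF W(4,5)])
  have finW: "emeasure vm C < \<infinity>" if "C \<subseteq> W" for C
    using W(3) that borel_compact[OF W(4)] by (intro le_less_trans[OF emeasure_mono finK]) auto
  obtain B where B: "0 < B" "\<And>z. norm (u z) \<le> B" using test_functions_bounded[OF th] by blast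
  define D where "D = measure vm W + 1"
  define \<epsilon> where "\<epsilon> = e / (2 * D)"
  have D: "0 < D" "measure vm W \<le> D" by (simp_all add: D_def add_nonneg_pos)
  have \<epsilon>: "0 < \<epsilon>" "2 * \<epsilon> * measure vm W \<le> e"
  proof -
    show "0 < \<epsilon>" unfolding \<epsilon>_def using e D by simp
    hence "2 * \<epsilon> * measure vm W \<le> 2 * \<epsilon> * D" using D by (intro mult_left_mono) auto
    also have "\<dots> = e" using D by (simp add: \<epsilon>_def)
    finally show "2 * \<epsilon> * measure vm W \<le> e" .
  qed
  define a where "a i = 2 ^ i * \<epsilon>" for i :: nat
  have a: "0 < a i" "a (Suc i) = 2 * a i" for i using \<epsilon> by (auto simp: a_def)
  \<comment> \<open>Rises from \<open>0\<close> to \<open>1\<close> while the norm of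
    \<open>u z\<close> runs from \<open>a i\<close> to \<open>2 * a i\<close>, since then the
    squared norm grows by \<open>3 * (a i)\<^sup>2\<close>; squares keep the function
    smooth.\<close>
  define \<tau> where "\<tau> i z = step (((norm (u z))\<^sup>2 - (a i)\<^sup>2) * inverse (3 * (a i)\<^sup>2))" for i z
  have \<tau>_smooth: "smooth (\<tau> i)" for i
    unfolding \<tau>_def by (intro smooth_step_compose smooth_mult smooth_diff smooth_const smooth_norm_sq sm)
  have \<tau>0: "\<tau> i z = 0" if "norm (u z) \<le> a i" for i z
  proof -
    have "(norm (u z))\<^sup>2 \<le> (a i)\<^sup>2" using that by (intro power_mono) auto
    thus ?thesis unfolding \<tau>_def by (intro step_0 mult_nonpos_nonneg) auto
  qed
  have \<tau>1: "\<tau> i z = 1" if "a (Suc i) \<le> norm (u z)" for i z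
  proof -
    have "(a (Suc i))\<^sup>2 \<le> (norm (u z))\<^sup>2" using that a(1)[of "Suc i"] by (intro power_mono) auto
    hence "4 * (a i)\<^sup>2 \<le> (norm (u z))\<^sup>2" by (simp add: a(2) power_mult_distrib)
    thus ?thesis unfolding \<tau>_def using a(1)[of i] by (intro step_1) (simp add: field_simps)
  qed
  have \<tau>_range: "0 \<le> \<tau> i z" "\<tau> i z \<le> 1" for i z unfolding \<tau>_def by (rule step_range)+
  have \<tau>_mono: "\<tau> (Suc i) z \<le> \<tau> i z" for i z
    using \<tau>0[of z "Suc i"] \<tau>1[of i z] \<tau>_range[of i z] \<tau>_range[of "Suc i" z] by linarith
  obtain m where m: "B < a m"
  proof -
    obtain m :: nat where "B / \<epsilon> < 2 ^ m" using real_arch_pow[of 2 "B / \<epsilon>"] by auto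
    thus ?thesis using that[of m] \<epsilon> by (simp add: a_def field_simps)
  qed
  define \<xi> where "\<xi> i z = (\<tau> i z - \<tau> (Suc i) z) *\<^sub>R u z" for i z
  have \<xi>_test: "\<xi> i \<in> test_functions U" for i
    unfolding \<xi>_def by (intro test_functions_smult th smooth_diff \<tau>_smooth)
  define \<xi>' where "\<xi>' z = (1 - \<tau> 0 z) *\<^sub>R u z" for z
  have \<xi>'_test: "\<xi>' \<in> test_functions U"
    unfolding \<xi>'_def by (intro test_functions_smult th smooth_diff smooth_const \<tau>_smooth)
  have decomp: "u z = \<xi>' z + (\<Sum>i<m. \<xi> i z)" for z
  proof -
    have "(\<Sum>i<m. \<xi> i z) = (\<tau> 0 z - \<tau> m z) *\<^sub>R u z"
      unfolding \<xi>_def scaleR_sum_left[symmetric] using sum_lessThan_telescope'[of "\<lambda>i. \<tau> i z" m] by simp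
    moreover have "\<tau> m z = 0" using \<tau>0[of z m] B(2)[of z] m by simp
    ultimately show ?thesis by (simp add: \<xi>'_def algebra_simps)
  qed
  have "S u = S (\<lambda>z. \<xi>' z + (\<Sum>i<m. \<xi> i z))" using decomp by (intro arg_cong[of _ _ S]) auto
  also have "\<dots> = S \<xi>' + (\<Sum>i<m. S (\<xi> i))"
    using \<xi>_test by (simp add: add \<xi>'_test test_functions_sum sum)
  finally have S_eq: "S u = S \<xi>' + (\<Sum>i<m. S (\<xi> i))" .
  have cl: "closed (spt u)" by (simp add: spt_def)
  \<comment> \<open>The part of \<open>u\<close> below the lowest level contributes at most
    \<open>e\<close>, by the choice of \<open>\<epsilon>\<close> relative to the measure of
    \<open>W\<close>.\<close>
  have first: "S \<xi>' \<le> 2 * \<epsilon> * measure vm W"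
  proof (rule test_bound_open[OF \<xi>'_test _ _ _ W(1)])
    show "norm (\<xi>' z) \<le> 2 * \<epsilon>" for z
    proof (cases "a 1 \<le> norm (u z)")
      case True
      thus ?thesis using \<tau>1[of 0 z] \<epsilon> by (simp add: \<xi>'_def)
    next
      case False
      have "norm (\<xi>' z) \<le> 1 * norm (u z)"
        unfolding \<xi>'_def norm_scaleR using \<tau>_range[of 0 z] by (intro mult_right_mono) auto
      thus ?thesis using False by (simp add: a_def)
    qed
    show "spt \<xi>' \<subseteq> W"
      using spt_subset[OF cl, of \<xi>'] W(2) by (auto simp: \<xi>'_def not_in_spt)
  qed (use \<epsilon> W finW[of W] in auto)
  \<comment> \<open>The factor \<open>2\<close> makes \<open>C i\<close> an open set that contains
    the part of \<open>spt u\<close> with \<open>a i \<le> norm (u z)\<close>, and hence the support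
    of \<open>\<xi> i\<close>.\<close>
  define C where "C i = W \<inter> {z. a i < 2 * norm (u z)}" for i
  have C_open: "open (C i)" for i
    unfolding C_def using W(1) smooth_continuous[OF sm]
    by (intro open_Int open_Collect_less continuous_intros) auto
  have each: "S (\<xi> i) \<le> 4 * a i * measure vm (C i)" for i
  proof (rule test_bound_open[OF \<xi>_test _ _ _ C_open])
    show "norm (\<xi> i z) \<le> 4 * a i" for z
    proof (cases "a (Suc (Suc i)) \<le> norm (u z)")
      case True
      hence "a (Suc i) \<le> norm (u z)" using a(1)[of "Suc i"] a(2)[of "Suc i"] by simp
      thus ?thesis using True \<tau>1 a(1)[of i] by (simp add: \<xi>_def)
    next
      case False
      have "norm (\<xi> i z) \<le> 1 * norm (u z)"
        unfolding \<xi>_def norm_scaleR using \<tau>_range[of i z] \<tau>_range[of "Suc i" z]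
        by (intro mult_right_mono) auto
      thus ?thesis using False by (simp add: a)
    qed
    have "closed (spt u \<inter> {z. a i \<le> norm (u z)})"
      using smooth_continuous[OF sm] by (intro closed_Int cl closed_Collect_le continuous_intros) auto
    hence "spt (\<xi> i) \<subseteq> spt u \<inter> {z. a i \<le> norm (u z)}"
    proof (rule spt_subset)
      fix z assume "z \<notin> spt u \<inter> {z. a i \<le> norm (u z)}"
      then consider "u z = 0" | "norm (u z) \<le> a i" using not_in_spt[of z u] by force
      thus "\<xi> i z = 0"
      proof cases
        case 2
        hence "norm (u z) \<le> a (Suc i)" using a[of i] by simp
        thus ?thesis using 2 by (simp add: \<xi>_def \<tau>0)
      qed (simp add: \<xi>_def)
    qed
    also have "\<dots> \<subseteq> C i"
    proof
      fix z assume "z \<in> spt u \<inter> {z. a i \<le> norm (u z)}"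
      thus "z \<in> C i" using W(2) a(1)[of i] by (auto simp: C_def)
    qed
    finally show "spt (\<xi> i) \<subseteq> C i" .
    show "emeasure vm (C i) < \<infinity>" by (rule finW) (auto simp: C_def)
  qed (use a W in \<open>auto simp: C_def\<close>)
  have tint: "integrable vm (\<lambda>z. norm (u z))" using vm.integrable_test[OF th] by simp
  have Cint: "integrable vm (\<lambda>z. 4 * a i * indicator (C i) z)" for i
    using C_open[of i] finW[of "C i"] by (auto simp: C_def)
  have "(\<Sum>i<m. 4 * a i * measure vm (C i)) = (LINT z|vm. (\<Sum>i<m. 4 * a i * indicator (C i) z))"
    using Cint C_open finW by (subst Bochner_Integration.integral_sum) (auto simp: C_def)
  also have "\<dots> \<le> (LINT z|vm. 16 * norm (u z))"
  proof (rule integral_mono)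
    fix z
    have "(\<Sum>i<m. 4 * a i * indicator (C i) z) \<le> (\<Sum>i<m. 4 * (if 2 ^ i * \<epsilon> < 2 * norm (u z) then 2 ^ i * \<epsilon> else 0))"
      using \<epsilon> by (intro sum_mono) (auto simp: C_def indicator_def a_def)
    also have "\<dots> = 4 * (\<Sum>i<m. if 2 ^ i * \<epsilon> < 2 * norm (u z) then 2 ^ i * \<epsilon> else 0)"
      by (simp add: sum_distrib_left)
    \<comment> \<open>The constant is \<open>4 * 2 * 2\<close>: the bound \<open>4 * a i\<close> for
      \<open>\<xi> i\<close>, the factor in \<open>dyadic_sum_le\<close>, and the factor in the
      definition of \<open>C i\<close>.\<close>
    also have "\<dots> \<le> 16 * norm (u z)"
      using dyadic_sum_le[OF \<epsilon>(1), of "2 * norm (u z)" m] by simp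
    finally show "(\<Sum>i<m. 4 * a i * indicator (C i) z) \<le> 16 * norm (u z)" .
  next
    show "integrable vm (\<lambda>z. \<Sum>i<m. 4 * a i * indicator (C i) z)"
      by (rule Bochner_Integration.integrable_sum) (rule Cint)
  qed (use tint in simp)
  finally have "(\<Sum>i<m. S (\<xi> i)) \<le> 16 * (LINT z|vm. norm (u z))"
    using sum_mono[of "{..<m}" "\<lambda>i. S (\<xi> i)" "\<lambda>i. 4 * a i * measure vm (C i)"] each by simp
  thus "S u \<le> 16 * (LINT z|vm. norm (u z)) + e"
    using S_eq first \<epsilon>(2) by linarith
qed

lemma representing_density:
  obtains \<nu> :: "'a => 'b" where "\<nu> \<in> Borel" "\<And>z. norm (\<nu> z) \<le> 16"
    "\<And>u. u \<in> test_functions U ==> S u = (LINT z|vm. u z \<bullet> \<nu> z)"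
  using vm.riesz_representation[OF test_functional_axioms test_bound] by auto

text \<open>Integration against a bounded density is continuous in mean and test functions are
  dense, so it is the only continuous extension; \<open>extensional\<close> fixes the values off the
  integrable functions, which makes the description by \<open>THE\<close> unambiguous.\<close>

lemma L1_extension_eq:
  assumes \<nu> [measurable]: "\<nu> \<in> Borel" and \<nu>_bound: "\<And>z. norm (\<nu> z) \<le> C"
    and rep: "\<And>u. u \<in> test_functions U ==> S u = (LINT z|vm. u z \<bullet> \<nu> z)"
    and \<psi>' [measurable]: "\<psi>' \<in> Borel" and \<psi>'_int: "integrable vm \<psi>'"
    and ae: "AE z in variation U S. \<psi> z = \<psi>' z"
  shows "L1_extension U S \<psi> = (LINT z|vm. \<psi>' z \<bullet> \<nu> z)"
proof -
  let ?M = "variation U S"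
  have C0: "0 \<le> C" using \<nu>_bound[of 0] norm_ge_zero[of "\<nu> 0"] by linarith
  define T where "T = restrict (\<lambda>\<psi>. LINT z|completion ?M. \<psi> z \<bullet> \<nu> z) (L1_functions ?M)"
  have pair: "integrable (completion ?M) (\<lambda>z. \<xi> z \<bullet> \<nu> z)" 
    and pair_le: "\<bar>LINT z|completion ?M. \<xi> z \<bullet> \<nu> z\<bar> \<le> C * (LINT z|completion ?M. norm (\<xi> z))"
    if \<xi>: "integrable (completion ?M) \<xi>" for \<xi> :: "'a => 'b"
  proof -
    have \<nu>c: "\<nu> \<in> borel_measurable (completion ?M)"
      by (rule measurable_completion[OF var.borel_M[OF \<nu>]])
    have b: "norm (\<xi> z \<bullet> \<nu> z) \<le> C * norm (\<xi> z)" for z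
    proof -
      have "norm (\<xi> z \<bullet> \<nu> z) \<le> norm (\<xi> z) * norm (\<nu> z)" by (simp add: Cauchy_Schwarz_ineq2)
      also have "\<dots> \<le> norm (\<xi> z) * C" using \<nu>_bound by (intro mult_left_mono) auto
      finally show ?thesis by (simp add: mult.commute)
    qed
    show i: "integrable (completion ?M) (\<lambda>z. \<xi> z \<bullet> \<nu> z)"
    proof (rule Bochner_Integration.integrable_bound[of _ "\<lambda>z. C * norm (\<xi> z)"])
      show "(\<lambda>z. \<xi> z \<bullet> \<nu> z) \<in> borel_measurable (completion ?M)"
        by (intro borel_measurable_inner borel_measurable_integrable[OF \<xi>] \<nu>c)
    qed (use \<xi> b C0 in auto)
    have "\<bar>LINT z|completion ?M. \<xi> z \<bullet> \<nu> z\<bar> \<le> (LINT z|completion ?M. norm (\<xi> z \<bullet> \<nu> z))"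
      using integral_norm_bound[of "completion ?M" "\<lambda>z. \<xi> z \<bullet> \<nu> z"] by simp
    also have "\<dots> \<le> (LINT z|completion ?M. C * norm (\<xi> z))"
      using i \<xi> b by (intro integral_mono) auto
    finally show "\<bar>LINT z|completion ?M. \<xi> z \<bullet> \<nu> z\<bar> \<le> C * (LINT z|completion ?M. norm (\<xi> z))" by simp
  qed
  have T_cont: "L1_continuous ?M T"
    unfolding L1_continuous_def
  proof (intro ballI allI impI)
    fix u :: "'a => 'b" and e assume u: "u \<in> L1_functions ?M" and e: "0 < (e::real)"
    show "\<exists>d>0. \<forall>\<xi>\<in>L1_functions ?M. (LINT z|completion ?M. norm (\<xi> z - u z)) < d \<longrightarrow> \<bar>T \<xi> - T u\<bar> < e"
    proof (intro exI[of _ "e / (C + 1)"] conjI ballI impI)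
      show "0 < e / (C + 1)" using e C0 by simp
      fix \<xi> :: "'a => 'b" assume \<xi>: "\<xi> \<in> L1_functions ?M" and lt: "(LINT z|completion ?M. norm (\<xi> z - u z)) < e / (C + 1)"
      have int: "integrable (completion ?M) \<xi>" "integrable (completion ?M) u" "integrable (completion ?M) (\<lambda>z. \<xi> z - u z)"
        using \<xi> u by (auto simp: L1_functions_def)
      have "T \<xi> - T u = (LINT z|completion ?M. (\<xi> z - u z) \<bullet> \<nu> z)"
        using \<xi> u pair[OF int(1)] pair[OF int(2)] by (simp add: T_def inner_diff_left)
      hence "\<bar>T \<xi> - T u\<bar> \<le> C * (LINT z|completion ?M. norm (\<xi> z - u z))"
        using pair_le[OF int(3)] by simp
      also have "\<dots> \<le> C * (e / (C + 1))" using lt C0 by (intro mult_left_mono) auto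
      also have "\<dots> < e" using e C0 by (simp add: field_simps)
      finally show "\<bar>T \<xi> - T u\<bar> < e" .
    qed
  qed
  have test_L1: "u \<in> L1_functions ?M" if "u \<in> test_functions U" for u :: "'a => 'b"
    using vm.integrable_test[OF that] var.completion_integral(2)[of u u] test_functions_borel[OF that]
    by (simp add: L1_functions_def vm_def)
  have T_test: "T u = S u" if "u \<in> test_functions U" for u
  proof -
    note [measurable] = test_functions_borel[OF that]
    have "T u = (LINT z|completion ?M. u z \<bullet> \<nu> z)" using test_L1[OF that] by (simp add: T_def)
    also have "\<dots> = (LINT z|vm. u z \<bullet> \<nu> z)"
      unfolding vm_def by (rule var.completion_integral(1)) auto
    finally show ?thesis using rep[OF that] by simp
  qed
  have "(THE T. T \<in> extensional (L1_functions ?M) \<and> L1_continuous ?M T \<and> (\<forall>u\<in>test_functions U. T u = S u)) = T"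
  proof (rule the_equality)
    show "T \<in> extensional (L1_functions ?M) \<and> L1_continuous ?M T \<and> (\<forall>u\<in>test_functions U. T u = S u)"
      using T_cont T_test by (simp add: T_def)
    fix T' assume T': "T' \<in> extensional (L1_functions ?M) \<and> L1_continuous ?M T' \<and> (\<forall>u\<in>test_functions U. T' u = S u)"
    show "T' = T"
    proof (rule extensionalityI[of _ "L1_functions ?M"])
      fix \<xi> :: "'a => 'b" assume \<xi>: "\<xi> \<in> L1_functions ?M"
      obtain \<xi>' where \<xi>' [measurable]: "\<xi>' \<in> Borel" and \<xi>ae: "AE z in ?M. \<xi> z = \<xi>' z"
      proof -
        have "\<xi> \<in> borel_measurable (completion ?M)" using \<xi> by (simp add: L1_functions_def)
        thus ?thesis using var.borel_representative[of \<xi>] that by blast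
      qed
      have \<xi>'_int: "integrable vm \<xi>'"
        using var.completion_integral(2)[OF \<xi>' \<xi>ae] \<xi> by (simp add: L1_functions_def vm_def)
      have "\<bar>T' \<xi> - T \<xi>\<bar> \<le> e" if e: "0 < e" for e
      proof -
        obtain d1 where d1: "0 < d1" "\<And>u. u \<in> L1_functions ?M ==> (LINT z|completion ?M. norm (u z - \<xi> z)) < d1 ==> \<bar>T' u - T' \<xi>\<bar> < e / 2"
          using T' \<xi> e unfolding L1_continuous_def by (metis half_gt_zero)
        obtain d2 where d2: "0 < d2" "\<And>u. u \<in> L1_functions ?M ==> (LINT z|completion ?M. norm (u z - \<xi> z)) < d2 ==> \<bar>T u - T \<xi>\<bar> < e / 2"
          using T_cont \<xi> e unfolding L1_continuous_def by (metis half_gt_zero)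
        obtain u where u: "u \<in> test_functions U" "(LINT z|vm. norm (u z - \<xi>' z)) < min d1 d2"
          using vm.test_functions_dense[OF \<xi>'_int, of "min d1 d2"] d1 d2 by auto
        note [measurable] = test_functions_borel[OF u(1)]
        have "(LINT z|completion ?M. norm (u z - \<xi> z)) = (LINT z|vm. norm (u z - \<xi>' z))"
          unfolding vm_def by (rule var.completion_integral(1)) (use \<xi>ae in auto)
        hence "\<bar>T' u - T' \<xi>\<bar> < e / 2" "\<bar>T u - T \<xi>\<bar> < e / 2"
          using d1(2)[OF test_L1] d2(2)[OF test_L1] u by auto
        moreover have "T' u = T u" using T' T_test u(1) by simp
        ultimately show ?thesis by linarith
      qed
      hence "\<bar>T' \<xi> - T \<xi>\<bar> \<le> 0" by (rule field_le_epsilon) simp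
      thus "T' \<xi> = T \<xi>" by simp
    qed (use T' in \<open>auto simp: T_def\<close>)
  qed
  hence "L1_extension U S = T" by (simp add: L1_extension_def)
  moreover have "\<psi> \<in> L1_functions ?M"
    using var.completion_integral(2)[OF \<psi>' ae] \<psi>'_int by (simp add: L1_functions_def vm_def)
  moreover have "(LINT z|completion ?M. \<psi> z \<bullet> \<nu> z) = (LINT z|vm. \<psi>' z \<bullet> \<nu> z)"
    unfolding vm_def by (rule var.completion_integral(1)) (use ae in auto)
  ultimately show ?thesis by (simp add: T_def)
qed

end

section \<open>Integration by parts under multiplication by smooth and by Lipschitz
  functions\<close>

section \<open>Bernstein approximation with derivatives\<close>

text \<open>The case \<open>i = 0\<close> is separate because \<open>0 - 1 = 0\<close> for natural
  numbers, whereas a polynomial of index \<open>- 1\<close> would be \<open>0\<close>.\<close>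

lemma Bernstein_has_derivative:
  "(Bernstein (Suc N) i has_real_derivative
      real (Suc N) * ((if i = 0 then 0 else Bernstein N (i - 1) x) - Bernstein N i x)) (at x)"
proof (cases i)
  case 0
  have "((\<lambda>x. (1 - x) ^ Suc N) has_real_derivative - (real (Suc N) * (1 - x) ^ N)) (at x)"
  proof -
    have "((\<lambda>x. 1 - x) has_real_derivative - 1) (at x)" by (auto intro!: derivative_eq_intros)
    from DERIV_power_Suc[OF this, of N] show ?thesis by simp
  qed
  thus ?thesis using 0 by (simp add: Bernstein_def[abs_def])
next
  case (Suc j)
  have c1: "real (Suc N choose Suc j) * real (Suc j) = real (Suc N) * real (N choose j)"
    using Suc_times_binomial[of j N] by (metis mult.commute of_nat_mult)
  show ?thesis
  proof (cases "j \<le> N")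
    case False
    hence "Bernstein (Suc N) i = (\<lambda>x. 0)" "Bernstein N (i - 1) x = 0" "Bernstein N i x = 0"
      using Suc by (auto simp: Bernstein_def fun_eq_iff binomial_eq_0)
    thus ?thesis by simp
  next
    case True
    have c2: "real (Suc N choose Suc j) * real (N - j) = real (Suc N) * real (N choose Suc j)"
      using binomial_absorb_comp[of "Suc N" "Suc j"] by (metis diff_Suc_1 diff_Suc_Suc mult.commute of_nat_mult)
    have d1: "((\<lambda>x. x ^ Suc j) has_real_derivative real (Suc j) * x ^ j) (at x)"
      using DERIV_pow[of "Suc j" x UNIV] by simp
    have "((\<lambda>x. 1 - x) has_real_derivative - 1) (at x)" by (auto intro!: derivative_eq_intros)
    from DERIV_power[OF this, of "N - j"]
    have d2: "((\<lambda>x. (1 - x) ^ (N - j)) has_real_derivative - (real (N - j) * (1 - x) ^ (N - Suc j))) (at x)" by simp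
    have "((\<lambda>x. real (Suc N choose Suc j) * x ^ Suc j * (1 - x) ^ (N - j)) has_real_derivative
        real (Suc N choose Suc j) * real (Suc j) * x ^ j * (1 - x) ^ (N - j)
        - real (Suc N choose Suc j) * real (N - j) * x ^ Suc j * (1 - x) ^ (N - Suc j)) (at x)"
      using DERIV_mult[OF DERIV_cmult[OF d1, of "real (Suc N choose Suc j)"] d2] by (simp only: mult_ac mult_minus_left mult_minus_right add_uminus_conv_diff)
    hence "((\<lambda>x. real (Suc N choose Suc j) * x ^ Suc j * (1 - x) ^ (N - j)) has_real_derivative
        real (Suc N) * real (N choose j) * x ^ j * (1 - x) ^ (N - j)
        - real (Suc N) * real (N choose Suc j) * x ^ Suc j * (1 - x) ^ (N - Suc j)) (at x)"
      unfolding c1 c2 .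
    thus ?thesis using Suc by (simp add: Bernstein_def[abs_def] algebra_simps)
  qed
qed

lemma Bernstein_tendsto:
  assumes "continuous_on {0..1} q" "x \<in> {0..1}"
  shows "(\<lambda>N. \<Sum>i\<le>Suc N. q (real i / real (Suc N)) * Bernstein (Suc N) i x) \<longlonglongrightarrow> q x"
proof (rule metric_LIMSEQ_I)
  fix e :: real assume "0 < e"
  then obtain N where N: "\<And>n y. N \<le> n ==> y \<in> {0..1} ==> \<bar>q y - (\<Sum>k\<le>n. q (real k / real n) * Bernstein n k y)\<bar> < e"
    using Bernstein_Weierstrass[OF assms(1)] by blast
  show "\<exists>no. \<forall>n\<ge>no. dist (\<Sum>i\<le>Suc n. q (real i / real (Suc n)) * Bernstein (Suc n) i x) (q x) < e"
    using N[OF _ assms(2)] by (intro exI[of _ N] allI impI) (simp add: dist_real_def abs_minus_commute del: sum.atMost_Suc of_nat_Suc)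
qed

text \<open>On the unit interval the Bernstein polynomials of degree \<open>n\<close> are
  nonnegative with sum \<open>1\<close>, so the sum is an average of the \<open>a i\<close>.\<close>

lemma Bernstein_average_bound:
  assumes "x \<in> {0..1}" "\<And>i. i \<le> n ==> \<bar>a i\<bar> \<le> (B::real)"
  shows "\<bar>\<Sum>i\<le>n. a i * Bernstein n i x\<bar> \<le> B"
proof -
  have "\<bar>\<Sum>i\<le>n. a i * Bernstein n i x\<bar> \<le> (\<Sum>i\<le>n. \<bar>a i * Bernstein n i x\<bar>)" by (rule sum_abs)
  also have "\<dots> \<le> (\<Sum>i\<le>n. B * Bernstein n i x)"
    using assms Bernstein_nonneg[of x n] by (intro sum_mono) (auto simp: abs_mult mult_right_mono)
  also have "\<dots> = B" by (simp add: sum_distrib_left[symmetric])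
  finally show ?thesis .
qed

context
  fixes q q' :: "real => real"
  assumes deriv: "\<And>x. x \<in> {0..1} ==> (q has_real_derivative q' x) (at x)"
begin

text \<open>Summation by parts turns the derivative of the Bernstein sum of \<open>q\<close> into a
  Bernstein sum of lower degree with difference quotients as coefficients, which are values of
  \<open>q'\<close> by the mean value theorem. The points \<open>\<xi> i\<close> do not depend on
  \<open>x\<close>.\<close>

lemma Bernstein_derivative_eq:
  "\<exists>\<xi>. (\<forall>i\<le>N. real i / real (Suc N) \<le> \<xi> i \<and> \<xi> i \<le> real (Suc i) / real (Suc N)) \<and>
    (\<forall>x. (\<Sum>i\<le>Suc N. q (real i / real (Suc N)) *
        (real (Suc N) * ((if i = 0 then 0 else Bernstein N (i - 1) x) - Bernstein N i x))) =
      (\<Sum>i\<le>N. q' (\<xi> i) * Bernstein N i x))"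
proof -
  define p where "p i = real i / real (Suc N)" for i
  have "\<exists>\<xi>. p i \<le> \<xi> \<and> \<xi> \<le> p (Suc i) \<and> real (Suc N) * (q (p (Suc i)) - q (p i)) = q' \<xi>" if "i \<le> N" for i
  proof -
    have lt: "p i < p (Suc i)" by (simp add: p_def divide_strict_right_mono)
    have "0 \<le> p i" by (simp add: p_def)
    have "p (Suc i) \<le> 1" using that by (simp add: p_def divide_le_eq)
    then obtain \<xi> where \<xi>: "p i < \<xi>" "\<xi> < p (Suc i)" "q (p (Suc i)) - q (p i) = (p (Suc i) - p i) * q' \<xi>"
      using MVT2[OF lt, of q q'] deriv \<open>0 \<le> p i\<close> by (metis atLeastAtMost_iff order_trans)
    moreover have "p (Suc i) - p i = 1 / real (Suc N)" by (simp add: p_def diff_divide_distrib[symmetric])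
    ultimately show ?thesis by (intro exI[of _ \<xi>]) (simp del: of_nat_Suc)
  qed
  then obtain \<xi> where \<xi>: "\<And>i. i \<le> N ==> p i \<le> \<xi> i \<and> \<xi> i \<le> p (Suc i) \<and> real (Suc N) * (q (p (Suc i)) - q (p i)) = q' (\<xi> i)"
    by metis
  have "(\<Sum>i\<le>Suc N. q (p i) * (real (Suc N) * ((if i = 0 then 0 else Bernstein N (i - 1) x) - Bernstein N i x))) =
      (\<Sum>i\<le>N. q' (\<xi> i) * Bernstein N i x)" for x
  proof -
    have "(\<Sum>i\<le>Suc N. q (p i) * (real (Suc N) * ((if i = 0 then 0 else Bernstein N (i - 1) x) - Bernstein N i x)))
      = real (Suc N) * ((\<Sum>i\<le>Suc N. q (p i) * (if i = 0 then 0 else Bernstein N (i - 1) x)) - (\<Sum>i\<le>Suc N. q (p i) * Bernstein N i x))"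
      by (simp add: sum_subtractf[symmetric] sum_distrib_left algebra_simps del: of_nat_Suc sum.atMost_Suc)
    also have "(\<Sum>i\<le>Suc N. q (p i) * (if i = 0 then 0 else Bernstein N (i - 1) x)) = (\<Sum>i\<le>N. q (p (Suc i)) * Bernstein N i x)"
      by (subst sum.atMost_Suc_shift) simp
    also have "(\<Sum>i\<le>Suc N. q (p i) * Bernstein N i x) = (\<Sum>i\<le>N. q (p i) * Bernstein N i x)"
      by (simp add: Bernstein_def)
    also have "real (Suc N) * ((\<Sum>i\<le>N. q (p (Suc i)) * Bernstein N i x) - (\<Sum>i\<le>N. q (p i) * Bernstein N i x))
      = (\<Sum>i\<le>N. (real (Suc N) * (q (p (Suc i)) - q (p i))) * Bernstein N i x)"
      by (simp add: sum_subtractf[symmetric] sum_distrib_left algebra_simps del: of_nat_Suc)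
    also have "\<dots> = (\<Sum>i\<le>N. q' (\<xi> i) * Bernstein N i x)"
      using \<xi> by (intro sum.cong) (auto simp del: of_nat_Suc)
    finally show ?thesis .
  qed
  thus ?thesis using \<xi> unfolding p_def by (intro exI[of _ \<xi>]) blast
qed

lemma Bernstein_derivative_bound:
  assumes "x \<in> {0..1}" "\<And>y. y \<in> {0..1} ==> \<bar>q' y\<bar> \<le> B"
  shows "\<bar>\<Sum>i\<le>Suc N. q (real i / real (Suc N)) *
      (real (Suc N) * ((if i = 0 then 0 else Bernstein N (i - 1) x) - Bernstein N i x))\<bar> \<le> B"
proof -
  obtain \<xi> where \<xi>: "\<And>i. i \<le> N ==> real i / real (Suc N) \<le> \<xi> i \<and> \<xi> i \<le> real (Suc i) / real (Suc N)"
    and eq: "(\<Sum>i\<le>Suc N. q (real i / real (Suc N)) *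
        (real (Suc N) * ((if i = 0 then 0 else Bernstein N (i - 1) x) - Bernstein N i x))) =
      (\<Sum>i\<le>N. q' (\<xi> i) * Bernstein N i x)"
    using Bernstein_derivative_eq[of N] by blast
  have "\<xi> i \<in> {0..1}" if "i \<le> N" for i
  proof -
    have "0 \<le> real i / real (Suc N)" "real (Suc i) / real (Suc N) \<le> 1" using that by auto
    thus ?thesis using \<xi>[OF that] by (meson atLeastAtMost_iff order_trans)
  qed
  thus ?thesis unfolding eq using assms by (intro Bernstein_average_bound) auto
qed

lemma Bernstein_derivative_tendsto:
  assumes cont: "continuous_on {0..1} q'" and x: "x \<in> {0..1}"
  shows "(\<lambda>N. \<Sum>i\<le>Suc N. q (real i / real (Suc N)) *
      (real (Suc N) * ((if i = 0 then 0 else Bernstein N (i - 1) x) - Bernstein N i x))) \<longlonglongrightarrow> q' x"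
proof (rule metric_LIMSEQ_I)
  fix e :: real assume e: "0 < e"
  obtain N1 where N1: "\<And>n y. N1 \<le> n ==> y \<in> {0..1} ==> \<bar>q' y - (\<Sum>k\<le>n. q' (real k / real n) * Bernstein n k y)\<bar> < e / 2"
    using Bernstein_Weierstrass[OF cont, of "e/2"] e by auto
  have "uniformly_continuous_on {0..1} q'" by (rule compact_uniformly_continuous[OF cont]) simp
  then obtain d where d: "0 < d" "\<And>y y'. y \<in> {0..1} ==> y' \<in> {0..1} ==> \<bar>y' - y\<bar> < d ==> \<bar>q' y' - q' y\<bar> < e / 2"
    unfolding uniformly_continuous_on_def dist_real_def using e by (metis half_gt_zero)
  obtain N2 :: nat where N2: "1 / d < real N2" using reals_Archimedean2 by blast
  define N0 where "N0 = max N1 (max N2 1)"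
  show "\<exists>no. \<forall>N\<ge>no. dist (\<Sum>i\<le>Suc N. q (real i / real (Suc N)) *
      (real (Suc N) * ((if i = 0 then 0 else Bernstein N (i - 1) x) - Bernstein N i x))) (q' x) < e"
  proof (intro exI[of _ N0] allI impI)
    fix N assume N: "N0 \<le> N"
    have Np: "0 < N" using N by (simp add: N0_def)
    obtain \<xi> where \<xi>: "\<And>i. i \<le> N ==> real i / real (Suc N) \<le> \<xi> i \<and> \<xi> i \<le> real (Suc i) / real (Suc N)"
      and eq: "(\<Sum>i\<le>Suc N. q (real i / real (Suc N)) *
          (real (Suc N) * ((if i = 0 then 0 else Bernstein N (i - 1) x) - Bernstein N i x))) =
        (\<Sum>i\<le>N. q' (\<xi> i) * Bernstein N i x)"
      using Bernstein_derivative_eq[of N] by blast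
    \<comment> \<open>Both \<open>\<xi> i\<close> and \<open>i / N\<close> lie between
      \<open>i / Suc N\<close> and \<open>Suc i / Suc N\<close>, so uniform continuity of
      \<open>q'\<close> permits replacing one by the other.\<close>
    have close: "\<bar>q' (\<xi> i) - q' (real i / real N)\<bar> \<le> e / 2" if i: "i \<le> N" for i
    proof -
      have 1: "0 \<le> real i / real (Suc N)" "real (Suc i) / real (Suc N) \<le> 1" using i by auto
      have 2: "real i / real (Suc N) \<le> real i / real N" using Np by (intro divide_left_mono) auto
      have 3: "real i / real N \<le> real (Suc i) / real (Suc N)"
        using i Np by (simp add: field_simps)
      have "real (Suc i) / real (Suc N) - real i / real (Suc N) = 1 / real (Suc N)"
        by (simp add: diff_divide_distrib[symmetric])
      moreover have "1 / real (Suc N) < d"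
      proof -
        have "1 / d < real (Suc N)" using N2 N by (simp add: N0_def)
        thus ?thesis using d(1) by (simp add: field_simps del: of_nat_Suc)
      qed
      ultimately have "\<bar>\<xi> i - real i / real N\<bar> < d" using \<xi>[OF i] 2 3 by linarith
      thus ?thesis using d(2)[of "real i / real N" "\<xi> i"] \<xi>[OF i] 1 2 3 by auto
    qed
    have near: "\<bar>q' x - (\<Sum>k\<le>N. q' (real k / real N) * Bernstein N k x)\<bar> < e / 2"
      using N x by (intro N1) (auto simp: N0_def)
    have "\<bar>(\<Sum>i\<le>N. q' (\<xi> i) * Bernstein N i x) - (\<Sum>i\<le>N. q' (real i / real N) * Bernstein N i x)\<bar>
        = \<bar>\<Sum>i\<le>N. (q' (\<xi> i) - q' (real i / real N)) * Bernstein N i x\<bar>"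
      by (simp add: sum_subtractf[symmetric] left_diff_distrib)
    also have "\<dots> \<le> e / 2" by (rule Bernstein_average_bound[OF x close])
    finally have "\<bar>(\<Sum>i\<le>N. q' (\<xi> i) * Bernstein N i x) - (\<Sum>i\<le>N. q' (real i / real N) * Bernstein N i x)\<bar> \<le> e / 2" .
    with near show "dist (\<Sum>i\<le>Suc N. q (real i / real (Suc N)) *
      (real (Suc N) * ((if i = 0 then 0 else Bernstein N (i - 1) x) - Bernstein N i x))) (q' x) < e"
      unfolding eq dist_real_def by linarith
  qed
qed

end

section \<open>Admissible outer functions\<close>

text \<open>The flag distinguishes the two classes of functions \<open>\<eta>\<close> for which \<open>\<eta> \<circ> f\<close> is
  tested: all functions occurring in the definition of weak derivatives, or only those depending
  on \<open>|y|\<close> and vanishing near the origin, which encode superlevel sets of \<open>|f|\<close>.\<close>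

definition admissible :: "bool => (real^'l => real) => bool" where
  "admissible flag \<eta> \<longleftrightarrow> smooth \<eta> \<and> compact (closure {y. Df \<eta> y \<noteq> (\<lambda>_. 0)}) \<and>
     (flag \<longrightarrow> (\<forall>y y'. norm y = norm y' \<longrightarrow> \<eta> y = \<eta> y') \<and> (\<exists>r>0. \<forall>y. norm y < r \<longrightarrow> \<eta> y = 0))"

lemma compact_closure_iff: "compact (closure S) \<longleftrightarrow> bounded (S :: 'a::euclidean_space set)"
  by (auto simp: compact_eq_bounded_closed intro: bounded_subset[OF _ closure_subset] bounded_closure)

text \<open>Joint continuity in the point and the direction, obtained by expanding the direction in
  the basis; it serves for measurability and limits of integrands in which both vary.\<close>

lemma smooth_continuous_derivative:
  fixes \<eta> :: "'a::euclidean_space => real"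
  assumes "smooth \<eta>"
  shows "continuous_on UNIV (\<lambda>p. Df \<eta> (fst p) (snd p))"
proof -
  have lin: "linear (Df \<eta> y)" for y
    using linear_frechet_derivative[OF smooth_differentiable[OF assms]] .
  have rep: "Df \<eta> y v = (\<Sum>b\<in>Basis. (v \<bullet> b) * Df \<eta> y b)" for y v
  proof -
    have "Df \<eta> y (\<Sum>b\<in>Basis. (v \<bullet> b) *\<^sub>R b) = (\<Sum>b\<in>Basis. (v \<bullet> b) * Df \<eta> y b)"
      by (simp add: linear_sum[OF lin] linear_scale[OF lin])
    thus ?thesis by (simp add: euclidean_representation)
  qed
  hence eq: "(\<lambda>p. Df \<eta> (fst p) (snd p)) = (\<lambda>p. \<Sum>b\<in>Basis. (snd p \<bullet> b) * Df \<eta> (fst p) b)"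
    by (intro ext rep)
  show ?thesis unfolding eq
    by (intro continuous_intros continuous_on_compose2[OF smooth_continuous[OF smooth_frechet_derivative[OF assms]]]) auto
qed

lemma derivative_measurable:
  fixes \<eta> :: "'a::euclidean_space => real"
  assumes "smooth \<eta>" "f \<in> borel_measurable M" "h \<in> borel_measurable M"
  shows "(\<lambda>z. Df \<eta> (f z) (h z)) \<in> borel_measurable M"
proof -
  have "(\<lambda>z. (f z, h z)) \<in> borel_measurable M" using assms by measurable
  from measurable_compose[OF this borel_measurable_continuous_onI[OF smooth_continuous_derivative[OF assms(1)]]]
  show ?thesis by simp
qed

lemma frechet_derivative_scaled:
  assumes "smooth \<eta>"
  shows "Df (\<lambda>y. \<eta> (b *\<^sub>R y)) y v = b * Df \<eta> (b *\<^sub>R y) (v :: 'a::real_normed_vector)"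
proof -
  have "((\<lambda>y. \<eta> (b *\<^sub>R y)) has_derivative (\<lambda>v. Df \<eta> (b *\<^sub>R y) (b *\<^sub>R v))) (at y)"
    by (rule has_derivative_compose[OF bounded_linear_imp_has_derivative[OF bounded_linear_scaleR_right] smooth_has_derivative[OF assms]])
  hence "Df (\<lambda>y. \<eta> (b *\<^sub>R y)) y = (\<lambda>v. Df \<eta> (b *\<^sub>R y) (b *\<^sub>R v))"
    using frechet_derivative_at by metis
  thus ?thesis
    using linear_scale[OF linear_frechet_derivative[OF smooth_differentiable[OF assms]], of "b *\<^sub>R y" b v] by simp
qed

text \<open>Invariance under dilations is what the Bernstein argument relies on: its coefficients
  \<eta> (s f) are compositions of \<open>f\<close> with functions that are again admissible, for
  either value of the flag.\<close>

lemma admissible_scale: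
  assumes "admissible flag (\<eta> :: real^'l => real)"
  shows "admissible flag (\<lambda>y. \<eta> (b *\<^sub>R y))"
proof -
  have sm: "smooth \<eta>" using assms by (simp add: admissible_def)
  have "bounded {y. Df (\<lambda>y. \<eta> (b *\<^sub>R y)) y \<noteq> (\<lambda>_. 0)}"
  proof (cases "b = 0")
    case True
    thus ?thesis by (simp add: frechet_derivative_const)
  next
    case False
    obtain R where R: "\<And>y. Df \<eta> y \<noteq> (\<lambda>_. 0) ==> norm y \<le> R"
      using assms by (auto simp: admissible_def compact_closure_iff bounded_iff)
    show ?thesis
    proof (rule boundedI[of _ "R / \<bar>b\<bar>"], clarify)
      fix y assume "Df (\<lambda>y. \<eta> (b *\<^sub>R y)) y \<noteq> (\<lambda>_. 0)"
      hence "Df \<eta> (b *\<^sub>R y) \<noteq> (\<lambda>_. 0)"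
        by (auto simp: frechet_derivative_scaled[OF sm] fun_eq_iff)
      from R[OF this] show "norm y \<le> R / \<bar>b\<bar>" using False by (simp add: field_simps)
    qed
  qed
  moreover have "\<exists>r>0. \<forall>y. norm y < r \<longrightarrow> \<eta> (b *\<^sub>R y) = 0" if fl: flag
  proof -
    have "\<exists>r>0. \<forall>y. norm y < r \<longrightarrow> \<eta> y = 0" using assms fl unfolding admissible_def by blast
    then obtain r where r: "0 < r" "\<And>y. norm y < r ==> \<eta> y = 0" by blast
    show ?thesis
    \<comment> \<open>The summand \<open>1\<close> admits \<open>b = 0\<close>.\<close>
    proof (intro exI[of _ "r / (\<bar>b\<bar> + 1)"] conjI allI impI)
      fix y :: "real^'l" assume "norm y < r / (\<bar>b\<bar> + 1)"
      hence "(\<bar>b\<bar> + 1) * norm y < r" by (simp add: field_simps)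
      moreover have "\<bar>b\<bar> * norm y \<le> (\<bar>b\<bar> + 1) * norm y" by (intro mult_right_mono) auto
      ultimately show "\<eta> (b *\<^sub>R y) = 0" by (intro r(2)) simp
    qed (use r in auto)
  qed
  moreover have "smooth (\<lambda>y. \<eta> (b *\<^sub>R y))" using smooth_compose_linear[OF sm bounded_linear_scaleR_right] .
  ultimately show ?thesis using assms by (auto simp: admissible_def compact_closure_iff)
qed

text \<open>\<eta> itself need not have compact support, but off a ball its derivative vanishes and
  it is constant along rays, so its values there are already taken on the boundary of the
  ball.\<close>

lemma admissible_bounds:
  assumes "admissible flag (\<eta> :: real^'l => real)"
  obtains C where "0 < C" "\<And>y. \<bar>\<eta> y\<bar> \<le> C" "\<And>y v. \<bar>Df \<eta> y v\<bar> \<le> C * norm v"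
proof -
  have sm: "smooth \<eta>" using assms by (simp add: admissible_def)
  obtain R where R: "0 < R" "\<And>y. Df \<eta> y \<noteq> (\<lambda>_. 0) ==> norm y \<le> R"
    using assms by (auto simp: admissible_def compact_closure_iff bounded_pos)
  have lin: "linear (Df \<eta> y)" for y
    using linear_frechet_derivative[OF smooth_differentiable[OF sm]] .
  have "compact ((\<lambda>y. \<eta> y) ` cball 0 R)"
    by (intro compact_continuous_image continuous_on_subset[OF smooth_continuous[OF sm]]) auto
  then obtain C1 where "\<forall>y\<in>cball 0 R. \<bar>\<eta> y\<bar> \<le> C1"
    by (auto dest!: compact_imp_bounded simp del: mem_cball_0 simp: bounded_iff)
  hence C1: "\<bar>\<eta> y\<bar> \<le> C1" if "norm y \<le> R" for y using that by simp
  have ray: "\<eta> y = \<eta> ((R / norm y) *\<^sub>R y)" if y: "R < norm y" for y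
  proof -
    define h where "h s = \<eta> (s *\<^sub>R y)" for s :: real
    have hd: "(h has_real_derivative Df \<eta> (s *\<^sub>R y) y) (at s)" for s
    proof -
      have "(h has_derivative (\<lambda>t. Df \<eta> (s *\<^sub>R y) (t *\<^sub>R y))) (at s)"
        unfolding h_def by (rule has_derivative_compose[OF bounded_linear_imp_has_derivative[OF bounded_linear_scaleR_left] smooth_has_derivative[OF sm]])
      thus ?thesis by (simp add: has_field_derivative_def linear_scale[OF lin] mult_commute_abs)
    qed
    have lt: "R / norm y < 1" using y R(1) by (simp add: divide_less_eq)
    obtain s where s: "R / norm y < s" "s < 1" "h 1 - h (R / norm y) = (1 - R / norm y) * Df \<eta> (s *\<^sub>R y) y"
      using MVT2[OF lt, of h "\<lambda>s. Df \<eta> (s *\<^sub>R y) y"] hd by blast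
    have p: "0 < norm y" using R(1) y by linarith
    hence "0 < R / norm y" using R(1) by simp
    hence "0 < s" using s(1) by linarith
    note p = this p
    have "R < norm (s *\<^sub>R y)" using s(1) p y R(1) by (simp add: field_simps)
    hence "Df \<eta> (s *\<^sub>R y) = (\<lambda>_. 0)" using R(2)[of "s *\<^sub>R y"] by auto
    thus ?thesis using s(3) by (simp add: h_def)
  qed
  have b1: "\<bar>\<eta> y\<bar> \<le> C1" for y
  proof (cases "norm y \<le> R")
    case False
    hence "norm ((R / norm y) *\<^sub>R y) \<le> R" using R(1) by auto
    thus ?thesis using C1 ray[of y] False by auto
  qed (rule C1)
  have "compact ((\<lambda>p. Df \<eta> (fst p) (snd p)) ` (cball 0 R \<times> cball 0 1))"
    by (intro compact_continuous_image continuous_on_subset[OF smooth_continuous_derivative[OF sm]] compact_Times) auto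
  then obtain C2 where C2: "\<And>y v. norm y \<le> R ==> norm v \<le> 1 ==> \<bar>Df \<eta> y v\<bar> \<le> C2"
    by (force dest!: compact_imp_bounded simp: bounded_iff)
  have C2_0: "0 \<le> C2" using C2[of 0 0] R(1) by auto
  have b2: "\<bar>Df \<eta> y v\<bar> \<le> C2 * norm v" for y v
  proof (cases "norm y \<le> R \<and> v \<noteq> 0")
    case True
    have "\<bar>Df \<eta> y ((1 / norm v) *\<^sub>R v)\<bar> \<le> C2" using True by (intro C2) auto
    thus ?thesis using True by (simp add: linear_scale[OF lin] abs_mult field_simps)
  next
    case False
    hence "v = 0 \<or> Df \<eta> y = (\<lambda>_. 0)" using R(2) by blast
    thus ?thesis using C2_0 linear_0[OF lin] by auto
  qed
  have C1_0: "0 \<le> C1" using b1[of 0] by simp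
  show ?thesis
  proof (rule that[of "C1 + C2 + 1"])
    show "\<bar>\<eta> y\<bar> \<le> C1 + C2 + 1" for y using b1[of y] C2_0 by simp
    show "\<bar>Df \<eta> y v\<bar> \<le> (C1 + C2 + 1) * norm v" for y v
    proof -
      have "C2 * norm v \<le> (C1 + C2 + 1) * norm v" using C1_0 by (intro mult_right_mono) auto
      thus ?thesis using b2[of y v] by simp
    qed
  qed (use C1_0 C2_0 in simp)
qed

section \<open>Integration by parts\<close>

lemma bounded_bilinear_vector_matrix: "bounded_bilinear ((v*) :: real^'m => real^'n^'m => real^'n)"
  unfolding bilinear_conv_bounded_bilinear[symmetric] bilinear_def
  by (auto intro!: linearI simp: vector_matrix_mult_def vec_eq_iff algebra_simps sum.distrib sum_distrib_left)

lemma bounded_bilinear_matrix_vector: "bounded_bilinear ((*v) :: real^'n^'m => real^'n => real^'m)"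
  unfolding bilinear_conv_bounded_bilinear[symmetric] bilinear_def
  by (auto intro!: linearI simp: matrix_vector_mult_def vec_eq_iff algebra_simps sum.distrib sum_distrib_left)


lemma vector_matrix_measurable [measurable (raw)]:
  fixes g :: "'a => real^'n^'m"
  assumes "f \<in> borel_measurable M" "g \<in> borel_measurable M"
  shows "(\<lambda>z. f z v* g z) \<in> borel_measurable M"
proof -
  have c: "continuous_on UNIV (\<lambda>p :: (real^'m) \<times> (real^'n^'m). fst p v* snd p)"
    by (intro bounded_bilinear.continuous_on[OF bounded_bilinear_vector_matrix] continuous_intros)
  have "(\<lambda>z. (f z, g z)) \<in> borel_measurable M" using assms by measurable
  from measurable_compose[OF this borel_measurable_continuous_onI[OF c]] show ?thesis by simp
qed

lemma matrix_vector_measurable [measurable (raw)]: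
  fixes f :: "'a => real^'n^'m"
  assumes "f \<in> borel_measurable M" "g \<in> borel_measurable M"
  shows "(\<lambda>z. f z *v g z) \<in> borel_measurable M"
proof -
  have c: "continuous_on UNIV (\<lambda>p :: (real^'n^'m) \<times> (real^'n). fst p *v snd p)"
    by (intro bounded_bilinear.continuous_on[OF bounded_bilinear_matrix_vector] continuous_intros)
  have "(\<lambda>z. (f z, g z)) \<in> borel_measurable M" using assms by measurable
  from measurable_compose[OF this borel_measurable_continuous_onI[OF c]] show ?thesis by simp
qed

lemma jacobian_notin_spt:
  fixes u :: "real^'n => real^'m"
  shows "z \<notin> spt u ==> jacobian u (at z) = 0"
  by (simp add: jacobian_def frechet_derivative_notin_spt matrix_def vec_eq_iff)

lemma test_bounds:
  fixes u :: "real^'n => real^'m"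
  assumes "u \<in> test_functions W"
  obtains B where "0 < B" "\<And>z. norm (u z) \<le> B" "\<And>z. norm (jacobian u (at z)) \<le> B"
proof -
  obtain B1 where B1: "0 < B1" "\<And>z. norm (u z) \<le> B1" using test_functions_bounded[OF assms] by blast
  obtain B2 where B2: "0 < B2" "\<And>z. norm (jacobian u (at z)) \<le> B2"
    using test_functions_bounded[OF test_functions_jacobian[OF assms]] by blast
  show ?thesis using B1 B2 by (intro that[of "max B1 B2"]) (auto simp: le_max_iff_disj)
qed

text \<open>The gradient term of the product rule is a rank-one matrix; its inner product with
  \<open>A\<close> is the derivative of \<phi> in the direction of the transpose of \<open>A\<close>
  applied to \<open>u z\<close>, written \<open>u z v* A\<close>.\<close>

lemma inner_jacobian_smult:
  fixes u :: "real^'n => real^'m" and A :: "real^'n^'m"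
  assumes "smooth \<phi>" "smooth u"
  shows "A \<bullet> jacobian (\<lambda>z. \<phi> z *\<^sub>R u z) (at z) =
    \<phi> z * (A \<bullet> jacobian u (at z)) + Df \<phi> z (u z v* A)"
proof -
  have lin: "linear (Df \<phi> z)"
    using linear_frechet_derivative[OF smooth_differentiable[OF assms(1)]] .
  have "((\<lambda>z. \<phi> z *\<^sub>R u z) has_derivative (\<lambda>v. \<phi> z *\<^sub>R Df u z v + Df \<phi> z v *\<^sub>R u z)) (at z)"
    by (intro has_derivative_scaleR smooth_has_derivative assms)
  hence fd: "Df (\<lambda>z. \<phi> z *\<^sub>R u z) z = (\<lambda>v. \<phi> z *\<^sub>R Df u z v + Df \<phi> z v *\<^sub>R u z)"
    by (rule frechet_derivative_at[symmetric])
  have "u z v* A = (\<Sum>j\<in>UNIV. ((u z v* A) $ j) *\<^sub>R axis j 1)"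
    using basis_expansion[of "u z v* A"] by (simp add: scalar_mult_eq_scaleR)
  hence "Df \<phi> z (u z v* A) = Df \<phi> z (\<Sum>j\<in>UNIV. ((u z v* A) $ j) *\<^sub>R axis j 1)"
    by simp
  also have "\<dots> = (\<Sum>j\<in>UNIV. ((u z v* A) $ j) * Df \<phi> z (axis j 1))"
    by (simp add: linear_sum[OF lin] linear_scale[OF lin])
  also have "\<dots> = (\<Sum>j\<in>UNIV. \<Sum>i\<in>UNIV. A $ i $ j * (Df \<phi> z (axis j 1) * u z $ i))"
    by (simp add: vector_matrix_mult_def sum_distrib_left sum_distrib_right mult_ac)
  also have "\<dots> = (\<Sum>i\<in>UNIV. \<Sum>j\<in>UNIV. A $ i $ j * (Df \<phi> z (axis j 1) * u z $ i))"
    by (rule sum.swap)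
  finally show ?thesis
    by (simp add: jacobian_def fd matrix_def inner_vec_def sum.distrib sum_distrib_left algebra_simps)
qed

text \<open>The analysis is carried out for these data alone; varifolds enter through
  \<open>varifold_fv\<close>, which provides them.\<close>

locale fv_data = \<alpha>: open_measure U \<alpha> + \<beta>: open_measure U \<beta>
  for U :: "(real^'n) set" and \<alpha> \<beta> +
  fixes P :: "real^'n => real^'n^'n" and \<nu> :: "real^'n => real^'n" and CP C\<nu> :: real
  assumes P_meas [measurable]: "P \<in> Borel" and P_bound: "norm (P z) \<le> CP"
    and \<nu>_meas [measurable]: "\<nu> \<in> Borel" and \<nu>_bound: "norm (\<nu> z) \<le> C\<nu>"
begin

abbreviation tdiv :: "(real^'n => real^'n) => real^'n => real" where
  "tdiv u z \<equiv> P z \<bullet> jacobian u (at z)"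

text \<open>With \<open>\<alpha> = \<parallel>V\<parallel>\<close>, \<open>\<beta> = \<parallel>\<delta>V\<parallel>\<close> and \<open>P\<close> the mean of the tangent planes,
  \<open>bdry \<phi> u\<close> is \<open>\<delta>V(\<phi>u) - \<integral> \<phi> Du \<bullet> S dV\<close>; for the characteristic function of \<open>E\<close>
  this is \<open>(V \<partial>E)(u)\<close>.\<close>

definition bdry :: "(real^'n => real) => (real^'n => real^'n) => real" where
  "bdry \<phi> u = (LINT z|\<beta>. \<phi> z * (u z \<bullet> \<nu> z)) - (LINT z|\<alpha>. \<phi> z * (tdiv u z))"

lemma CP_nonneg: "0 \<le> CP" using P_bound[of 0] norm_ge_zero[of "P 0"] by linarith

lemma inner_\<nu>_le: "norm v \<le> B ==> \<bar>v \<bullet> \<nu> z\<bar> \<le> B * C\<nu>"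
  by (rule order_trans[OF Cauchy_Schwarz_ineq2 mult_mono[OF _ \<nu>_bound]]) (auto intro: order_trans[OF norm_ge_zero])

lemma inner_P_le: "norm A \<le> B ==> \<bar>P z \<bullet> A\<bar> \<le> B * CP"
  using order_trans[OF Cauchy_Schwarz_ineq2 mult_mono[OF P_bound _ CP_nonneg norm_ge_zero]]
  by (simp add: mult.commute)

lemma bdry_integrable:
  assumes th: "u \<in> test_functions W" and \<phi> [measurable]: "\<phi> \<in> Borel"
    and A [measurable]: "A \<in> sets borel" and fin: "emeasure \<alpha> A < \<infinity>" "emeasure \<beta> A < \<infinity>"
    and bnd: "\<And>z. z \<in> A ==> \<bar>\<phi> z\<bar> \<le> C" and van: "\<And>z. z \<in> spt u ==> z \<notin> A ==> \<phi> z = 0"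
  shows "integrable \<beta> (\<lambda>z. \<phi> z * (u z \<bullet> \<nu> z))" "integrable \<alpha> (\<lambda>z. \<phi> z * (tdiv u z))"
proof -
  note [measurable] = test_functions_borel[OF th] test_functions_borel[OF test_functions_jacobian[OF th]]
  obtain B where B: "0 < B" "\<And>z. norm (u z) \<le> B" "\<And>z. norm (jacobian u (at z)) \<le> B"
    using test_bounds[OF th] by blast
  have z: "z \<notin> A ==> \<phi> z = 0 \<or> u z = 0 \<and> jacobian u (at z) = 0" for z
    using van[of z] not_in_spt[of z u] jacobian_notin_spt[of z u] by blast
  show "integrable \<beta> (\<lambda>z. \<phi> z * (u z \<bullet> \<nu> z))"
  proof (rule integrableI_bounded_set[of A _ _ "\<bar>C\<bar> * (B * C\<nu>)"])
    show "AE z in \<beta>. z \<in> A \<longrightarrow> norm (\<phi> z * (u z \<bullet> \<nu> z)) \<le> \<bar>C\<bar> * (B * C\<nu>)"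
      using bnd inner_\<nu>_le[OF B(2)] by (auto intro!: AE_I2 mult_mono simp: abs_mult intro: order_trans[OF bnd abs_ge_self])
    show "AE z in \<beta>. z \<notin> A \<longrightarrow> \<phi> z * (u z \<bullet> \<nu> z) = 0" using z by (intro AE_I2) fastforce
  qed (use fin in auto)
  show "integrable \<alpha> (\<lambda>z. \<phi> z * (tdiv u z))"
  proof (rule integrableI_bounded_set[of A _ _ "\<bar>C\<bar> * (B * CP)"])
    show "AE z in \<alpha>. z \<in> A \<longrightarrow> norm (\<phi> z * (tdiv u z)) \<le> \<bar>C\<bar> * (B * CP)"
      using bnd inner_P_le[OF B(3)] by (auto intro!: AE_I2 mult_mono simp: abs_mult intro: order_trans[OF bnd abs_ge_self])
    show "AE z in \<alpha>. z \<notin> A \<longrightarrow> \<phi> z * (tdiv u z) = 0" using z by (intro AE_I2) fastforce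
  qed (use fin in auto)
qed

text \<open>The measures live on \<open>U\<close>, but the support of \<open>u\<close> may leave it.
  For \<open>W = U\<close> this is the identity defining the weak derivative; for larger
  \<open>W\<close> it says in addition that nothing is contributed by the part of the boundary of
  \<open>U\<close> inside \<open>W\<close>.\<close>

definition parts :: "bool => (real^'n) set => (real^'n => real^'l) => (real^'n => real^'n^'l) => bool" where
  "parts flag W f F \<longleftrightarrow> (\<forall>\<eta> u. admissible flag \<eta> \<longrightarrow> u \<in> test_functions W \<longrightarrow>
     bdry (\<lambda>z. \<eta> (f z)) u = (LINT z|\<alpha>. Df \<eta> (f z) (F z *v u z)))"

text \<open>The set carrying \<eta> \<circ> f. If the flag is not set it is all of \<open>K\<close>,
  which has finite measure when \<open>W = U\<close>; if it is set, only superlevel sets count, and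
  \<open>K\<close> itself may have infinite measure where it meets the boundary of
  \<open>U\<close>.\<close>

definition superlevel_finite :: "bool => (real^'n) set => (real^'n => real^'l) => bool" where
  "superlevel_finite flag W f \<longleftrightarrow> (\<forall>K r. compact K \<longrightarrow> K \<subseteq> W \<longrightarrow> 0 < r \<longrightarrow>
     emeasure \<alpha> {z \<in> K. flag \<longrightarrow> r \<le> norm (f z)} < \<infinity> \<and> emeasure \<beta> {z \<in> K. flag \<longrightarrow> r \<le> norm (f z)} < \<infinity>)"

definition loc_integrable :: "(real^'n) set => (real^'n => 'b::euclidean_space) => bool" where
  "loc_integrable W f \<longleftrightarrow> (\<forall>K. compact K \<longrightarrow> K \<subseteq> W \<longrightarrow> integrable \<alpha> (\<lambda>z. indicator K z *\<^sub>R f z))"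

lemma loc_integrable_bound:
  assumes f: "loc_integrable W f" and K: "compact K" "K \<subseteq> W"
    and g [measurable]: "g \<in> Borel"
    and le: "\<And>z. z \<in> K ==> norm (g z) \<le> C * norm (f z)" and van: "\<And>z. z \<notin> K ==> g z = 0"
  shows "integrable \<alpha> (g :: _ => 'c::{banach, second_countable_topology})"
proof (rule Bochner_Integration.integrable_bound[of _ "\<lambda>z. C * norm (indicator K z *\<^sub>R f z)"])
  show "integrable \<alpha> (\<lambda>z. C * norm (indicator K z *\<^sub>R f z))"
    using f K by (intro integrable_mult_right integrable_norm) (auto simp: loc_integrable_def)
  show "AE z in \<alpha>. norm (g z) \<le> norm (C * norm (indicator K z *\<^sub>R f z))"
  proof (rule AE_I2)
    fix z show "norm (g z) \<le> norm (C * norm (indicator K z *\<^sub>R f z))"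
      using le[of z] van[of z] by (cases "z \<in> K") (auto intro: order_trans[OF _ abs_ge_self])
  qed
qed simp

text \<open>\<open>\<eta> (\<phi> f)\<close> is the limit of sums of Bernstein polynomials in \<open>\<phi>\<close> with coefficients
  \<open>\<eta> (s f)\<close>; in each term, the polynomial is absorbed by the vector field.\<close>

lemma parts_smooth_multiplier:
  fixes f :: "real^'n => real^'l" and F :: "real^'n => real^'n^'l"
  assumes f [measurable]: "f \<in> Borel" and F [measurable]: "F \<in> Borel"
    and parts: "parts flag W f F" and fin: "superlevel_finite flag W f"
    and fint: "loc_integrable W f" and Fint: "loc_integrable W F"
    and adm: "admissible flag \<eta>" and th: "u \<in> test_functions W" and sm: "smooth \<phi>"
    and M: "0 < M" "\<And>z. z \<in> spt u ==> \<bar>\<phi> z\<bar> \<le> M"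
    and L: "\<And>z v. z \<in> spt u ==> \<bar>Df \<phi> z v\<bar> \<le> L * norm v"
  shows "bdry (\<lambda>z. \<eta> (\<phi> z *\<^sub>R f z)) u = (LINT z|\<alpha>. Df \<eta> (\<phi> z *\<^sub>R f z)
     (\<phi> z *\<^sub>R (F z *v u z) + Df \<phi> z (u z v* P z) *\<^sub>R f z))"
proof -
  define K where "K = spt u"
  have K: "compact K" "K \<subseteq> W" using test_functionsD[OF th] by (auto simp: K_def)
  have KB [measurable]: "K \<in> sets borel" using K by (auto intro: borel_compact)
  have smth: "smooth u" and sm\<eta>: "smooth \<eta>" using test_functionsD[OF th] adm by (auto simp: admissible_def)
  note [measurable] = test_functions_borel[OF th] test_functions_borel[OF test_functions_jacobian[OF th]]
    smooth_borel[OF sm\<eta>] smooth_borel[OF sm]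
  have lin: "linear (Df \<eta> y)" for y
    using linear_frechet_derivative[OF smooth_differentiable[OF sm\<eta>]] .
  obtain B where B: "0 < B" "\<And>z. norm (u z) \<le> B" "\<And>z. norm (jacobian u (at z)) \<le> B"
    using test_bounds[OF th] by blast
  obtain C where C: "0 < C" "\<And>y. \<bar>\<eta> y\<bar> \<le> C" "\<And>y v. \<bar>Df \<eta> y v\<bar> \<le> C * norm v"
    using admissible_bounds[OF adm] by blast
  obtain Kv where Kv: "0 < Kv" "\<And>(v::real^'n) A::real^'n^'n. norm (v v* A) \<le> norm v * norm A * Kv"
    using bounded_bilinear.pos_bounded[OF bounded_bilinear_vector_matrix] by blast
  obtain Km where Km: "0 < Km" "\<And>(A::real^'n^'l) v. norm (A *v v) \<le> norm A * norm v * Km"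
    using bounded_bilinear.pos_bounded[OF bounded_bilinear_matrix_vector] by blast
  \<comment> \<open>If the flag is set, \<open>\<eta> (b *\<^sub>R f z)\<close> with
    \<open>\<bar>b\<bar> \<le> M\<close> vanishes unless \<open>r \<le> norm (f z)\<close>. Hence
    the integrands containing \<eta> live on the set \<open>A\<close> below, which has finite
    measure.\<close>
  obtain r where r: "0 < r" "\<And>z b. z \<in> K ==> \<not> (flag \<longrightarrow> r \<le> norm (f z)) ==> \<bar>b\<bar> \<le> M ==> \<eta> (b *\<^sub>R f z) = 0"
  proof (cases flag)
    case True
    then obtain r0 where r0: "0 < r0" "\<And>y. norm y < r0 ==> \<eta> y = 0"
      using adm unfolding admissible_def by blast
    show ?thesis
    proof (rule that[of "r0 / M"])
      fix z b assume "\<not> (flag \<longrightarrow> r0 / M \<le> norm (f z))" "\<bar>b\<bar> \<le> M"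
      hence "norm (f z) < r0 / M" by simp
      hence "M * norm (f z) < r0" using M by (simp add: field_simps)
      moreover have "\<bar>b\<bar> * norm (f z) \<le> M * norm (f z)" using \<open>\<bar>b\<bar> \<le> M\<close> by (intro mult_right_mono) auto
      ultimately show "\<eta> (b *\<^sub>R f z) = 0" by (intro r0(2)) simp
    qed (use r0 M in simp)
  qed (use that[of 1] in simp)
  define A where "A = {z \<in> K. flag \<longrightarrow> r \<le> norm (f z)}"
  have A [measurable]: "A \<in> sets borel" unfolding A_def by measurable
  have finA: "emeasure \<alpha> A < \<infinity>" "emeasure \<beta> A < \<infinity>"
    using fin K r(1) unfolding superlevel_finite_def A_def by blast+
  have A0: "\<eta> (b *\<^sub>R f z) = 0" if "z \<in> K" "z \<notin> A" "\<bar>b\<bar> \<le> M" for z b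
    using r(2)[OF that(1) _ that(3)] that by (auto simp: A_def)
  \<comment> \<open>Maps the interval from \<open>- M\<close> to \<open>M\<close>, which contains
    the values of \<phi> on the support of \<open>u\<close>, onto the unit interval.\<close>
  define x where "x z = inverse (2 * M) * (\<phi> z + M)" for z
  have x_sm: "smooth x" unfolding x_def by (intro smooth_mult smooth_add smooth_const sm)
  have x01: "x z \<in> {0..1}" if "z \<in> K" for z
    using M(2)[of z] that M(1) by (auto simp: x_def K_def field_simps abs_le_iff)
  have x\<phi>: "M * (2 * x z - 1) = \<phi> z" for z using M(1) by (simp add: x_def field_simps)
  \<comment> \<open>\<open>q z\<close> follows \<eta> along the segment from \<open>- M\<close> to
    \<open>M\<close> times \<open>f z\<close>, and its value at \<open>x z\<close> is the quantity
    of interest; \<open>q'\<close> is its derivative, and \<open>p\<close> the integrand on the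
    right-hand side for the corresponding dilation of \<eta>.\<close>
  define q where "q z s = \<eta> ((M * (2 * s - 1)) *\<^sub>R f z)" for z s
  define q' where "q' z s = 2 * M * Df \<eta> ((M * (2 * s - 1)) *\<^sub>R f z) (f z)" for z s
  define p where "p z s = (M * (2 * s - 1)) * Df \<eta> ((M * (2 * s - 1)) *\<^sub>R f z) (F z *v u z)" for z s
  have b_le: "\<bar>M * (2 * s - 1)\<bar> \<le> M" if "s \<in> {0..1}" for s
    using that M(1) by (auto simp: abs_mult abs_le_iff mult_le_cancel_left2)
  have qd: "(q z has_real_derivative q' z s) (at s)" for z s
  proof -
    have "((\<lambda>s. (M * (2 * s - 1)) *\<^sub>R f z) has_derivative (\<lambda>t. (M * (2 * t)) *\<^sub>R f z)) (at s)"
      by (auto intro!: derivative_eq_intros)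
    hence "(q z has_derivative (\<lambda>t. Df \<eta> ((M * (2 * s - 1)) *\<^sub>R f z) ((M * (2 * t)) *\<^sub>R f z))) (at s)"
      unfolding q_def by (rule has_derivative_compose[OF _ smooth_has_derivative[OF sm\<eta>]])
    moreover have "Df \<eta> ((M * (2 * s - 1)) *\<^sub>R f z) ((M * (2 * t)) *\<^sub>R f z) = q' z s * t" for t
      by (simp add: linear_scale[OF lin] q'_def)
    ultimately show ?thesis by (simp add: has_field_derivative_def mult_commute_abs)
  qed
  have cont_D: "continuous_on {0..1} (\<lambda>s. Df \<eta> ((M * (2 * s - 1)) *\<^sub>R f z) v)" for z v
    by (intro continuous_on_compose2[OF smooth_continuous[OF smooth_frechet_derivative[OF sm\<eta>]]] continuous_intros) auto
  have q_cont: "continuous_on {0..1} (q z)" for z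
    unfolding q_def by (intro continuous_on_compose2[OF smooth_continuous[OF sm\<eta>]] continuous_intros) auto
  have q'_cont: "continuous_on {0..1} (q' z)" for z unfolding q'_def by (intro continuous_intros cont_D)
  have p_cont: "continuous_on {0..1} (p z)" for z unfolding p_def by (intro continuous_intros cont_D)
  have q_le: "\<bar>q z s\<bar> \<le> C" for z s unfolding q_def by (rule C)
  have q_0: "q z s = 0" if "z \<in> K" "z \<notin> A" "s \<in> {0..1}" for z s
    unfolding q_def using A0[OF that(1,2) b_le[OF that(3)]] .
  have q'_le: "\<bar>q' z s\<bar> \<le> 2 * M * C * norm (f z)" for z s
    using C(3)[of "(M * (2 * s - 1)) *\<^sub>R f z" "f z"] M(1) by (simp add: q'_def abs_mult)
  have p_le: "\<bar>p z s\<bar> \<le> M * C * Km * B * norm (F z)" if "s \<in> {0..1}" for z s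
  proof -
    have "\<bar>p z s\<bar> \<le> M * (C * norm (F z *v u z))"
      unfolding p_def abs_mult[of "M * (2 * s - 1)"] using b_le[OF that] C(3) M(1) by (intro mult_mono) auto
    also have "\<dots> \<le> M * (C * (norm (F z) * B * Km))"
      using Km B(2)[of z] M(1) C(1)
      by (intro mult_left_mono order_trans[OF Km(2)] mult_right_mono) auto
    finally show ?thesis by (simp add: mult_ac)
  qed
  define k where "k z = Df \<phi> z (u z v* P z)" for z
  have k_le: "\<bar>k z\<bar> \<le> \<bar>L\<bar> * (B * CP * Kv)" for z
  proof (cases "z \<in> K")
    case True
    have "\<bar>k z\<bar> \<le> L * norm (u z v* P z)" unfolding k_def using L True by (simp add: K_def)
    also have "\<dots> \<le> \<bar>L\<bar> * norm (u z v* P z)" by (intro mult_right_mono) auto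
    also have "\<dots> \<le> \<bar>L\<bar> * (norm (u z) * norm (P z) * Kv)" by (intro mult_left_mono Kv) auto
    also have "\<dots> \<le> \<bar>L\<bar> * (B * CP * Kv)" using B(2)[of z] P_bound[of z] Kv(1) B(1) by (intro mult_left_mono mult_right_mono mult_mono) auto
    finally show ?thesis .
  next
    case False
    hence "u z = 0" by (simp add: K_def not_in_spt)
    thus ?thesis using Kv(1) B(1) CP_nonneg
      by (simp add: k_def linear_0[OF linear_frechet_derivative[OF smooth_differentiable[OF sm]]] vector_matrix_mult_def zero_vec_def[symmetric])
  qed
  have k0: "k z = 0" if "z \<notin> K" for z
    using not_in_spt[of z u] that
    by (simp add: K_def k_def linear_0[OF linear_frechet_derivative[OF smooth_differentiable[OF sm]]] vector_matrix_mult_def zero_vec_def[symmetric])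
  have km [measurable]: "k \<in> Borel"
    unfolding k_def by (intro derivative_measurable[OF sm]) measurable
  define D where "D N i s = real (Suc N) * ((if i = 0 then 0 else Bernstein N (i - 1) s) - Bernstein N i s)" for N i s
  define s where "s N i = real i / real (Suc N)" for N i :: nat
  have s01: "s N i \<in> {0..1}" if "i \<le> Suc N" for N i using that by (simp add: s_def)
  have Bm [measurable]: "Bernstein N i \<in> Borel" for N i
    unfolding Bernstein_def[abs_def] by measurable
  have Dm [measurable]: "D N i \<in> Borel" for N i unfolding D_def by measurable
  have xm [measurable]: "x \<in> Borel" by (rule smooth_borel[OF x_sm])
  have qm [measurable]: "(\<lambda>z. q z s) \<in> Borel" for s unfolding q_def by measurable
  have q'm [measurable]: "(\<lambda>z. q' z (g z)) \<in> Borel" if [measurable]: "g \<in> Borel" for g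
    unfolding q'_def by (intro borel_measurable_times borel_measurable_const derivative_measurable[OF sm\<eta>]) measurable
  have pm [measurable]: "(\<lambda>z. p z (g z)) \<in> Borel" if [measurable]: "g \<in> Borel" for g
    unfolding p_def by (intro borel_measurable_times borel_measurable_const derivative_measurable[OF sm\<eta>]) measurable
  define \<Phi> where "\<Phi> N z = (\<Sum>i\<le>Suc N. q z (s N i) * Bernstein (Suc N) i (x z))" for N z
  define \<Psi> where "\<Psi> N z = (\<Sum>i\<le>Suc N. q z (s N i) * D N i (x z))" for N z
  define \<Xi> where "\<Xi> N z = (\<Sum>i\<le>Suc N. p z (s N i) * Bernstein (Suc N) i (x z))" for N z
  have \<Phi>m [measurable]: "\<Phi> N \<in> Borel" for N unfolding \<Phi>_def by measurable
  have \<Psi>m [measurable]: "\<Psi> N \<in> Borel" for N unfolding \<Psi>_def by measurable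
  have \<Xi>m [measurable]: "\<Xi> N \<in> Borel" for N unfolding \<Xi>_def by measurable
  \<comment> \<open>The hypothesis for the dilations of \<eta> by \<open>M * (2 * s N i - 1)\<close>
    and the fields \<open>Bernstein (Suc N) i (x z) *\<^sub>R u z\<close>, summed over
    \<open>i\<close>; the third integral stems from differentiating the Bernstein factor.\<close>
  have eq: "(LINT z|\<beta>. \<Phi> N z * (u z \<bullet> \<nu> z)) - (LINT z|\<alpha>. \<Phi> N z * (tdiv u z))
      - (LINT z|\<alpha>. \<Psi> N z * (inverse (2 * M) * k z)) = (LINT z|\<alpha>. \<Xi> N z)" for N
  proof -
    define ui where "ui i z = Bernstein (Suc N) i (x z) *\<^sub>R u z" for i z
    have Bs: "smooth (\<lambda>z. Bernstein (Suc N) i (x z))" for i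
      unfolding Bernstein_def by (intro smooth_mult smooth_power smooth_diff smooth_const x_sm)
    have ui: "ui i \<in> test_functions W" for i
      unfolding ui_def by (intro test_functions_smult th Bs)
    have spt_i: "spt (ui i) \<subseteq> K" for i
      by (rule spt_subset) (use K in \<open>auto simp: compact_imp_closed ui_def K_def not_in_spt\<close>)
    have Bd: "Df (\<lambda>z. Bernstein (Suc N) i (x z)) z v = D N i (x z) * (inverse (2 * M) * Df \<phi> z v)" for i z v
    proof -
      have "((\<lambda>z. inverse (2 * M) * (\<phi> z + M)) has_derivative (\<lambda>v. inverse (2 * M) * (Df \<phi> z v + 0))) (at z)"
        by (intro has_derivative_mult_right has_derivative_add has_derivative_const smooth_has_derivative[OF sm])
      hence xd: "(x has_derivative (\<lambda>v. inverse (2 * M) * Df \<phi> z v)) (at z)"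
        by (simp add: x_def[abs_def])
      have bd: "(Bernstein (Suc N) i has_derivative (\<lambda>t. D N i (x z) * t)) (at (x z))"
        using Bernstein_has_derivative[of N i "x z"] unfolding has_field_derivative_def D_def .
      from frechet_derivative_at[OF has_derivative_compose[OF xd bd], symmetric] show ?thesis by simp
    qed
    have jac: "tdiv (ui i) z = Bernstein (Suc N) i (x z) * (tdiv u z) + D N i (x z) * (inverse (2 * M) * k z)" for i z
      unfolding ui_def inner_jacobian_smult[OF Bs smth] Bd k_def ..
    have Bb: "\<bar>Bernstein (Suc N) i (x z)\<bar> \<le> 1" if "z \<in> K" "i \<le> Suc N" for i z
    proof -
      have nn: "0 \<le> Bernstein (Suc N) j (x z)" for j using x01[OF that(1)] by (intro Bernstein_nonneg) auto
      have "Bernstein (Suc N) i (x z) \<le> (\<Sum>j\<le>Suc N. Bernstein (Suc N) j (x z))"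
        using that nn by (intro member_le_sum) auto
      thus ?thesis using nn by simp
    qed
    have i1: "integrable \<beta> (\<lambda>z. q z (s N i) * (ui i z \<bullet> \<nu> z))" "integrable \<alpha> (\<lambda>z. q z (s N i) * (tdiv (ui i) z))" if "i \<le> Suc N" for i
      using q_le q_0 s01[OF that] spt_i[of i] finA
      by (auto intro!: bdry_integrable[OF ui _ A, of _ C])
    have i2: "integrable \<alpha> (\<lambda>z. q z (s N i) * Bernstein (Suc N) i (x z) * (tdiv u z))" if "i \<le> Suc N" for i
    proof (rule bdry_integrable(2)[OF th _ A finA, of _ C])
      show "\<bar>q z (s N i) * Bernstein (Suc N) i (x z)\<bar> \<le> C" if "z \<in> A" for z
        using mult_mono[OF q_le[of z "s N i"] Bb[OF _ \<open>i \<le> Suc N\<close>, of z]] that C(1) by (simp add: abs_mult A_def)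
      show "q z (s N i) * Bernstein (Suc N) i (x z) = 0" if "z \<in> spt u" "z \<notin> A" for z
        using q_0[OF _ that(2) s01[OF \<open>i \<le> Suc N\<close>]] that by (simp add: K_def)
    qed simp
    \<comment> \<open>Integrability is inherited: this is the difference of the two preceding
      integrands.\<close>
    have i3: "integrable \<alpha> (\<lambda>z. q z (s N i) * D N i (x z) * (inverse (2 * M) * k z))" if "i \<le> Suc N" for i
      using Bochner_Integration.integrable_diff[OF i1(2)[OF that] i2[OF that]]
      by (simp add: jac algebra_simps)
    have i4: "integrable \<alpha> (\<lambda>z. p z (s N i) * Bernstein (Suc N) i (x z))" if "i \<le> Suc N" for i
    proof (rule loc_integrable_bound[OF Fint K, of _ "M * C * Km * B"])
      show "norm (p z (s N i) * Bernstein (Suc N) i (x z)) \<le> M * C * Km * B * norm (F z)" if "z \<in> K" for z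
        using mult_mono[OF p_le[OF s01[OF \<open>i \<le> Suc N\<close>], of z] Bb[OF that \<open>i \<le> Suc N\<close>]] M C Km B by (simp add: abs_mult)
      show "p z (s N i) * Bernstein (Suc N) i (x z) = 0" if "z \<notin> K" for z
        using not_in_spt[of z u] that by (simp add: p_def K_def linear_0[OF lin] matrix_vector_mult_def zero_vec_def[symmetric])
    qed simp
    have e: "(LINT z|\<beta>. q z (s N i) * (ui i z \<bullet> \<nu> z)) - (LINT z|\<alpha>. q z (s N i) * (tdiv (ui i) z))
        = (LINT z|\<alpha>. p z (s N i) * Bernstein (Suc N) i (x z))" for i
    proof -
      have "bdry (\<lambda>z. \<eta> ((M * (2 * s N i - 1)) *\<^sub>R f z)) (ui i) = (LINT z|\<alpha>. Df (\<lambda>y. \<eta> ((M * (2 * s N i - 1)) *\<^sub>R y)) (f z) (F z *v ui i z))"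
        using parts admissible_scale[OF adm, of "M * (2 * s N i - 1)"] ui[of i] unfolding parts_def by blast
      moreover have "Df (\<lambda>y. \<eta> ((M * (2 * s N i - 1)) *\<^sub>R y)) (f z) (F z *v ui i z) = p z (s N i) * Bernstein (Suc N) i (x z)" for z
        by (simp add: frechet_derivative_scaled[OF sm\<eta>] p_def ui_def matrix_vector_mult_scaleR linear_scale[OF lin])
      ultimately show ?thesis by (simp add: bdry_def q_def)
    qed
    have "(\<Sum>i\<le>Suc N. (LINT z|\<beta>. q z (s N i) * (ui i z \<bullet> \<nu> z)) - (LINT z|\<alpha>. q z (s N i) * (tdiv (ui i) z)))
        = (\<Sum>i\<le>Suc N. LINT z|\<alpha>. p z (s N i) * Bernstein (Suc N) i (x z))"
      using e by simp
    moreover have "(\<Sum>i\<le>Suc N. LINT z|\<alpha>. p z (s N i) * Bernstein (Suc N) i (x z)) = (LINT z|\<alpha>. \<Xi> N z)"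
      unfolding \<Xi>_def by (rule Bochner_Integration.integral_sum[symmetric]) (use i4 in auto)
    moreover have "(\<Sum>i\<le>Suc N. LINT z|\<beta>. q z (s N i) * (ui i z \<bullet> \<nu> z)) = (LINT z|\<beta>. \<Phi> N z * (u z \<bullet> \<nu> z))"
    proof -
      have "(\<Sum>i\<le>Suc N. LINT z|\<beta>. q z (s N i) * (ui i z \<bullet> \<nu> z)) = (LINT z|\<beta>. (\<Sum>i\<le>Suc N. q z (s N i) * (ui i z \<bullet> \<nu> z)))"
        by (rule Bochner_Integration.integral_sum[symmetric]) (use i1(1) in auto)
      thus ?thesis by (simp only: \<Phi>_def ui_def sum_distrib_right inner_scaleR_left mult.assoc)
    qed
    moreover have "(\<Sum>i\<le>Suc N. LINT z|\<alpha>. q z (s N i) * (tdiv (ui i) z))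
        = (LINT z|\<alpha>. \<Phi> N z * (tdiv u z)) + (LINT z|\<alpha>. \<Psi> N z * (inverse (2 * M) * k z))"
    proof -
      have "(LINT z|\<alpha>. q z (s N i) * (tdiv (ui i) z)) =
        (LINT z|\<alpha>. q z (s N i) * Bernstein (Suc N) i (x z) * (tdiv u z)) + (LINT z|\<alpha>. q z (s N i) * D N i (x z) * (inverse (2 * M) * k z))"
        if "i \<le> Suc N" for i
        unfolding Bochner_Integration.integral_add[OF i2[OF that] i3[OF that], symmetric] jac
        by (simp only: distrib_left mult.assoc)
      hence "(\<Sum>i\<le>Suc N. LINT z|\<alpha>. q z (s N i) * (tdiv (ui i) z)) =
        (\<Sum>i\<le>Suc N. LINT z|\<alpha>. q z (s N i) * Bernstein (Suc N) i (x z) * (tdiv u z)) + (\<Sum>i\<le>Suc N. LINT z|\<alpha>. q z (s N i) * D N i (x z) * (inverse (2 * M) * k z))"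
        unfolding sum.distrib[symmetric] by (intro sum.cong) auto
      also have "(\<Sum>i\<le>Suc N. LINT z|\<alpha>. q z (s N i) * Bernstein (Suc N) i (x z) * (tdiv u z)) = (LINT z|\<alpha>. \<Phi> N z * (tdiv u z))"
        unfolding \<Phi>_def sum_distrib_right by (rule Bochner_Integration.integral_sum[symmetric]) (use i2 in auto)
      also have "(\<Sum>i\<le>Suc N. LINT z|\<alpha>. q z (s N i) * D N i (x z) * (inverse (2 * M) * k z)) = (LINT z|\<alpha>. \<Psi> N z * (inverse (2 * M) * k z))"
        unfolding \<Psi>_def sum_distrib_right by (rule Bochner_Integration.integral_sum[symmetric]) (use i3 in auto)
      finally show ?thesis .
    qed
    ultimately show ?thesis unfolding sum_subtractf by linarith
  qed
  have \<Phi>_le: "\<bar>\<Phi> N z\<bar> \<le> C" if "z \<in> K" for N z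
    unfolding \<Phi>_def by (rule Bernstein_average_bound[OF x01[OF that] q_le])
  have \<Phi>_0: "\<Phi> N z = 0" if "z \<in> K" "z \<notin> A" for N z
    unfolding \<Phi>_def using q_0[OF that s01] by (intro sum.neutral) auto
  have \<Phi>_lim: "(\<lambda>N. \<Phi> N z) \<longlonglongrightarrow> \<eta> (\<phi> z *\<^sub>R f z)" if "z \<in> K" for z
    using Bernstein_tendsto[OF q_cont x01[OF that], of z] unfolding \<Phi>_def s_def by (simp only: q_def x\<phi>)
  have lim1: "(\<lambda>N. LINT z|\<beta>. \<Phi> N z * (u z \<bullet> \<nu> z)) \<longlonglongrightarrow> (LINT z|\<beta>. \<eta> (\<phi> z *\<^sub>R f z) * (u z \<bullet> \<nu> z))"
  proof (rule integral_dominated_convergence[where w="\<lambda>z. C * (B * C\<nu>) * indicator A z"])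
    show "AE z in \<beta>. (\<lambda>N. \<Phi> N z * (u z \<bullet> \<nu> z)) \<longlonglongrightarrow> \<eta> (\<phi> z *\<^sub>R f z) * (u z \<bullet> \<nu> z)"
    proof (rule AE_I2)
      fix z show "(\<lambda>N. \<Phi> N z * (u z \<bullet> \<nu> z)) \<longlonglongrightarrow> \<eta> (\<phi> z *\<^sub>R f z) * (u z \<bullet> \<nu> z)"
        using \<Phi>_lim[of z] not_in_spt[of z u] by (cases "z \<in> K") (auto simp: K_def intro!: tendsto_mult_right)
    qed
    show "AE z in \<beta>. norm (\<Phi> N z * (u z \<bullet> \<nu> z)) \<le> C * (B * C\<nu>) * indicator A z" for N
    proof (rule AE_I2)
      fix z show "norm (\<Phi> N z * (u z \<bullet> \<nu> z)) \<le> C * (B * C\<nu>) * indicator A z"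
      proof (cases "z \<in> A")
        case True
        hence "z \<in> K" by (simp add: A_def)
        thus ?thesis using True mult_mono[OF \<Phi>_le[OF \<open>z \<in> K\<close>, of N] inner_\<nu>_le[OF B(2)[of z], of z]] C(1) by (simp add: abs_mult)
      next
        case False
        thus ?thesis using \<Phi>_0[of z N] not_in_spt[of z u] by (cases "z \<in> K") (auto simp: K_def)
      qed
    qed
  qed (use finA in auto)
  have lim2: "(\<lambda>N. LINT z|\<alpha>. \<Phi> N z * (tdiv u z)) \<longlonglongrightarrow> (LINT z|\<alpha>. \<eta> (\<phi> z *\<^sub>R f z) * (tdiv u z))"
  proof (rule integral_dominated_convergence[where w="\<lambda>z. C * (B * CP) * indicator A z"])
    show "AE z in \<alpha>. (\<lambda>N. \<Phi> N z * (tdiv u z)) \<longlonglongrightarrow> \<eta> (\<phi> z *\<^sub>R f z) * (tdiv u z)"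
    proof (rule AE_I2)
      fix z show "(\<lambda>N. \<Phi> N z * (tdiv u z)) \<longlonglongrightarrow> \<eta> (\<phi> z *\<^sub>R f z) * (tdiv u z)"
        using \<Phi>_lim[of z] jacobian_notin_spt[of z u] by (cases "z \<in> K") (auto simp: K_def intro!: tendsto_mult_right)
    qed
    show "AE z in \<alpha>. norm (\<Phi> N z * (tdiv u z)) \<le> C * (B * CP) * indicator A z" for N
    proof (rule AE_I2)
      fix z show "norm (\<Phi> N z * (tdiv u z)) \<le> C * (B * CP) * indicator A z"
      proof (cases "z \<in> A")
        case True
        hence "z \<in> K" by (simp add: A_def)
        thus ?thesis using True mult_mono[OF \<Phi>_le[OF \<open>z \<in> K\<close>, of N] inner_P_le[OF B(3)[of z], of z]] C(1) by (simp add: abs_mult)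
      next
        case False
        thus ?thesis using \<Phi>_0[of z N] jacobian_notin_spt[of z u] by (cases "z \<in> K") (auto simp: K_def)
      qed
    qed
  qed (use finA in auto)
  define c3 where "c3 = 2 * M * C * (inverse (2 * M) * (\<bar>L\<bar> * (B * CP * Kv)))"
  have wf1: "integrable \<alpha> (\<lambda>z. indicator K z * norm (f z))"
    by (rule loc_integrable_bound[OF fint K, of _ 1]) simp_all
  have wf2: "integrable \<alpha> (\<lambda>z. indicator K z * norm (F z))"
    by (rule loc_integrable_bound[OF Fint K, of _ 1]) simp_all
  note wf = wf1 wf2
  have bound3: "norm (g * (inverse (2 * M) * k z)) \<le> c3 * (indicator K z * norm (f z))" if "z \<in> K ==> \<bar>g\<bar> \<le> 2 * M * C * norm (f z)" for g z
  proof (cases "z \<in> K")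
    case True
    have "\<bar>inverse (2 * M) * k z\<bar> \<le> inverse (2 * M) * (\<bar>L\<bar> * (B * CP * Kv))"
      using k_le[of z] M(1) by (simp add: abs_mult)
    from mult_mono[OF that[OF True] this] show ?thesis using True M(1) C(1) by (simp add: abs_mult c3_def mult_ac)
  qed (simp add: k0)
  have \<Psi>_le: "\<bar>\<Psi> N z\<bar> \<le> 2 * M * C * norm (f z)" if "z \<in> K" for N z
    unfolding \<Psi>_def D_def s_def by (rule Bernstein_derivative_bound[OF qd x01[OF that] q'_le])
  have lim3: "(\<lambda>N. LINT z|\<alpha>. \<Psi> N z * (inverse (2 * M) * k z)) \<longlonglongrightarrow> (LINT z|\<alpha>. q' z (x z) * (inverse (2 * M) * k z))"
  proof (rule integral_dominated_convergence[where w="\<lambda>z. c3 * (indicator K z * norm (f z))"])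
    show "AE z in \<alpha>. (\<lambda>N. \<Psi> N z * (inverse (2 * M) * k z)) \<longlonglongrightarrow> q' z (x z) * (inverse (2 * M) * k z)"
    proof (rule AE_I2)
      fix z show "(\<lambda>N. \<Psi> N z * (inverse (2 * M) * k z)) \<longlonglongrightarrow> q' z (x z) * (inverse (2 * M) * k z)"
      proof (cases "z \<in> K")
        case True
        have "(\<lambda>N. \<Psi> N z) \<longlonglongrightarrow> q' z (x z)"
          unfolding \<Psi>_def D_def s_def by (rule Bernstein_derivative_tendsto[OF qd q'_cont x01[OF True]])
        thus ?thesis by (rule tendsto_mult_right)
      qed (simp add: k0)
    qed
    show "AE z in \<alpha>. norm (\<Psi> N z * (inverse (2 * M) * k z)) \<le> c3 * (indicator K z * norm (f z))" for N
      by (intro AE_I2 bound3 \<Psi>_le)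
  qed (use wf in auto)
  have \<Xi>_le: "norm (\<Xi> N z) \<le> M * C * Km * B * (indicator K z * norm (F z))" for N z
  proof (cases "z \<in> K")
    case True
    have "\<bar>\<Xi> N z\<bar> \<le> M * C * Km * B * norm (F z)"
      unfolding \<Xi>_def by (rule Bernstein_average_bound[OF x01[OF True]]) (rule p_le[OF s01])
    thus ?thesis using True by simp
  next
    case False
    hence "p z t = 0" for t
      using not_in_spt[of z u] by (simp add: p_def K_def linear_0[OF lin] matrix_vector_mult_def zero_vec_def[symmetric])
    thus ?thesis using False by (simp add: \<Xi>_def)
  qed
  have lim4: "(\<lambda>N. LINT z|\<alpha>. \<Xi> N z) \<longlonglongrightarrow> (LINT z|\<alpha>. p z (x z))"
  proof (rule integral_dominated_convergence[where w="\<lambda>z. M * C * Km * B * (indicator K z * norm (F z))"])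
    show "AE z in \<alpha>. (\<lambda>N. \<Xi> N z) \<longlonglongrightarrow> p z (x z)"
    proof (rule AE_I2)
      fix z show "(\<lambda>N. \<Xi> N z) \<longlonglongrightarrow> p z (x z)"
      proof (cases "z \<in> K")
        case True
        thus ?thesis unfolding \<Xi>_def s_def by (intro Bernstein_tendsto p_cont x01)
      next
        case False
        hence "p z t = 0" for t
          using not_in_spt[of z u] by (simp add: p_def K_def linear_0[OF lin] matrix_vector_mult_def zero_vec_def[symmetric])
        thus ?thesis by (simp add: \<Xi>_def)
      qed
    qed
  qed (use wf \<Xi>_le in auto)
  have "(LINT z|\<beta>. \<eta> (\<phi> z *\<^sub>R f z) * (u z \<bullet> \<nu> z)) - (LINT z|\<alpha>. \<eta> (\<phi> z *\<^sub>R f z) * (tdiv u z))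
      - (LINT z|\<alpha>. q' z (x z) * (inverse (2 * M) * k z)) = (LINT z|\<alpha>. p z (x z))"
    using LIMSEQ_unique[OF tendsto_diff[OF tendsto_diff[OF lim1 lim2] lim3]] lim4 by (simp only: eq)
  hence "bdry (\<lambda>z. \<eta> (\<phi> z *\<^sub>R f z)) u = (LINT z|\<alpha>. q' z (x z) * (inverse (2 * M) * k z)) + (LINT z|\<alpha>. p z (x z))"
    by (simp add: bdry_def)
  also have "\<dots> = (LINT z|\<alpha>. q' z (x z) * (inverse (2 * M) * k z) + p z (x z))"
  proof (rule Bochner_Integration.integral_add[symmetric])
    show "integrable \<alpha> (\<lambda>z. q' z (x z) * (inverse (2 * M) * k z))"
    proof (rule Bochner_Integration.integrable_bound[of _ "\<lambda>z. c3 * (indicator K z * norm (f z))"])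
      show "AE z in \<alpha>. norm (q' z (x z) * (inverse (2 * M) * k z)) \<le> norm (c3 * (indicator K z * norm (f z)))"
        by (intro AE_I2 order_trans[OF bound3[OF q'_le]]) (simp only: real_norm_def abs_ge_self)
    qed (use wf1 in auto)
    show "integrable \<alpha> (\<lambda>z. p z (x z))"
    proof (rule loc_integrable_bound[OF Fint K, of _ "M * C * Km * B"])
      show "norm (p z (x z)) \<le> M * C * Km * B * norm (F z)" if "z \<in> K" for z using p_le[OF x01[OF that]] by simp
      show "p z (x z) = 0" if "z \<notin> K" for z
        using not_in_spt[of z u] that by (simp add: p_def K_def linear_0[OF lin] matrix_vector_mult_def zero_vec_def[symmetric])
    qed simp
  qed
  also have "\<dots> = (LINT z|\<alpha>. Df \<eta> (\<phi> z *\<^sub>R f z) (\<phi> z *\<^sub>R (F z *v u z) + k z *\<^sub>R f z))"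
    using M(1) by (intro Bochner_Integration.integral_cong refl)
      (simp add: q'_def p_def x\<phi> linear_add[OF lin] linear_scale[OF lin])
  finally show ?thesis by (simp add: k_def)
qed

end

section \<open>Multiplication by Lipschitz functions\<close>

definition gradient :: "('a::euclidean_space => real) => 'a => 'a" where
  "gradient \<phi> z = (\<Sum>b\<in>Basis. Df \<phi> z b *\<^sub>R b)"

lemma inner_gradient:
  assumes "smooth \<phi>" shows "v \<bullet> gradient \<phi> z = Df \<phi> z v"
proof -
  have lin: "linear (Df \<phi> z)"
    using linear_frechet_derivative[OF smooth_differentiable[OF assms]] .
  have "Df \<phi> z (\<Sum>b\<in>Basis. (v \<bullet> b) *\<^sub>R b) = v \<bullet> gradient \<phi> z"
    by (simp add: linear_sum[OF lin] linear_scale[OF lin] gradient_def inner_sum_right mult.commute)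
  thus ?thesis by (simp add: euclidean_representation)
qed

lemma norm_gradient_le:
  assumes "smooth \<phi>" "\<And>v. \<bar>Df \<phi> z v\<bar> \<le> L * norm v"
  shows "norm (gradient \<phi> z) \<le> L"
proof (cases "gradient \<phi> z = 0")
  case True
  have "0 \<le> L"
    using assms(2)[of "SOME b. b \<in> Basis"] norm_Basis[OF someI_ex[of "\<lambda>b. b \<in> (Basis :: 'a set)"]] nonempty_Basis by fastforce
  thus ?thesis using True by simp
next
  case False
  have "norm (gradient \<phi> z) * norm (gradient \<phi> z) \<le> L * norm (gradient \<phi> z)"
    using assms(2)[of "gradient \<phi> z"] inner_gradient[OF assms(1), of "gradient \<phi> z" z]
    by (simp add: power2_norm_eq_inner[symmetric] power2_eq_square)
  thus ?thesis using False by simp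
qed

lemma gradient_measurable: "smooth \<phi> ==> gradient \<phi> \<in> Borel"
  unfolding gradient_def[abs_def]
  by (intro borel_measurable_sum borel_measurable_scaleR borel_measurable_const smooth_borel smooth_frechet_derivative)

lemma gradient_linear_combination:
  assumes "smooth \<phi>" "smooth \<psi>"
  shows "gradient (\<lambda>z. a * \<phi> z + b * \<psi> z) z = a *\<^sub>R gradient \<phi> z + b *\<^sub>R gradient \<psi> z"
    and "Df (\<lambda>z. a * \<phi> z + b * \<psi> z) z v =
      a * Df \<phi> z v + b * Df \<psi> z v"
proof -
  have "((\<lambda>z. a * \<phi> z + b * \<psi> z) has_derivative (\<lambda>v. a * Df \<phi> z v + b * Df \<psi> z v)) (at z)"
    by (intro has_derivative_add has_derivative_mult_right smooth_has_derivative assms)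
  from frechet_derivative_at[OF this, symmetric]
  have fd: "Df (\<lambda>z. a * \<phi> z + b * \<psi> z) z = (\<lambda>v. a * Df \<phi> z v + b * Df \<psi> z v)" .
  thus "Df (\<lambda>z. a * \<phi> z + b * \<psi> z) z v =
      a * Df \<phi> z v + b * Df \<psi> z v" by simp
  show "gradient (\<lambda>z. a * \<phi> z + b * \<psi> z) z = a *\<^sub>R gradient \<phi> z + b *\<^sub>R gradient \<psi> z"
    by (simp add: gradient_def fd scaleR_left_distrib sum.distrib scaleR_sum_right)
qed

text \<open>A substitute for the differentiability of Lipschitz functions along \<open>V\<close>: the approximating
  sets of smooth functions are convex, whence the gradients of almost minimisers of a weighted
  \<open>L\<^sub>2\<close> norm form a Cauchy sequence.\<close>

lemma (in open_measure) lipschitz_gradient_limit: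
  fixes g :: "'a => real"
  assumes X: "bounded X" and lip: "L-lipschitz_on X g"
  obtains \<phi> :: "nat => 'a => real" and \<Gamma> :: "'a => 'a" where
    "\<And>k. smooth (\<phi> k)" "\<And>k z v. \<bar>Df (\<phi> k) z v\<bar> \<le> L * norm v"
    "\<And>k z. z \<in> X ==> \<bar>\<phi> k z - g z\<bar> \<le> 1 / real (Suc k)"
    "\<Gamma> \<in> Borel" "\<And>z. norm (\<Gamma> z) \<le> L"
    "AE z in \<beta>. \<forall>v. (\<lambda>k. Df (\<phi> k) z v) \<longlonglongrightarrow> v \<bullet> \<Gamma> z"
proof -
  have L0: "0 \<le> L" using lip by (auto simp: lipschitz_on_def)
  obtain w :: "'a => real" where "w \<in> Borel \<and> (\<forall>z. 0 < w z) \<and> integrable \<beta> w \<and>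
      (\<forall>K. compact K \<longrightarrow> K \<subseteq> U \<longrightarrow> (\<exists>c>0. \<forall>z\<in>K. c \<le> w z))"
    using weight_exists by blast
  hence w [measurable]: "w \<in> Borel" and w_pos: "\<And>z. 0 < w z" and w_int: "integrable \<beta> w"
    by simp_all
  define Wt where "Wt = (LINT z|\<beta>. w z)"
  have W0: "0 \<le> Wt" unfolding Wt_def using w_pos by (intro Bochner_Integration.integral_nonneg) (auto simp: less_imp_le)
  define G where "G = {\<phi>::'a => real. smooth \<phi> \<and> (\<forall>z v. \<bar>Df \<phi> z v\<bar> \<le> L * norm v)}"
  \<comment> \<open>These sets are convex and decrease in \<open>k\<close>, so the infima
    \<open>a k\<close> of the energy increase; being bounded, they form a Cauchy sequence.\<close>
  define A where "A k = {\<phi> \<in> G. \<forall>z\<in>X. \<bar>\<phi> z - g z\<bar> \<le> 1 / real (Suc k)}" for k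
  have A_ne: "A k \<noteq> {}" for k
  proof -
    obtain \<phi> where "smooth \<phi>" "\<And>x v. \<bar>Df \<phi> x v\<bar> \<le> L * norm v"
      "\<And>x. x \<in> X ==> \<bar>\<phi> x - g x\<bar> \<le> 1 / real (Suc k)"
      using lipschitz_smooth_approx[OF X lip, of "1 / real (Suc k)"] by auto
    hence "\<phi> \<in> A k" by (simp add: A_def G_def del: of_nat_Suc)
    thus ?thesis by blast
  qed
  define Q where "Q \<phi> z = w z * (norm (gradient \<phi> z))\<^sup>2" for \<phi> z
  define q where "q \<phi> = (LINT z|\<beta>. Q \<phi> z)" for \<phi>
  have gm: "gradient \<phi> \<in> Borel" if "\<phi> \<in> G" for \<phi>
    using that by (auto simp: G_def intro: gradient_measurable)
  have gle: "norm (gradient \<phi> z) \<le> L" if "\<phi> \<in> G" for \<phi> z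
    using that by (intro norm_gradient_le) (auto simp: G_def)
  have bnd_int: "integrable \<beta> (\<lambda>z. w z * h z)" if [measurable]: "h \<in> Borel" and "\<And>z. \<bar>h z\<bar> \<le> c" for h c
  proof (rule Bochner_Integration.integrable_bound[of _ "\<lambda>z. c * w z"])
    show "AE z in \<beta>. norm (w z * h z) \<le> norm (c * w z)"
    proof (rule AE_I2)
      fix z show "norm (w z * h z) \<le> norm (c * w z)"
        using that(2)[of z] w_pos[of z] mult_left_mono[of "\<bar>h z\<bar>" "\<bar>c\<bar>" "w z"] by (simp add: abs_mult mult.commute)
    qed
  qed (use w_int in auto)
  have Q_int: "integrable \<beta> (\<lambda>z. Q \<phi> z)" if "\<phi> \<in> G" for \<phi>
    unfolding Q_def using gm[OF that] gle[OF that] by (intro bnd_int[of _ "L\<^sup>2"]) (auto intro!: power_mono)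
  have q_le: "q \<phi> \<le> L\<^sup>2 * Wt" if "\<phi> \<in> G" for \<phi>
  proof -
    have "q \<phi> \<le> (LINT z|\<beta>. L\<^sup>2 * w z)"
      unfolding q_def
    proof (rule integral_mono)
      show "Q \<phi> z \<le> L\<^sup>2 * w z" for z
        unfolding Q_def using w_pos[of z] gle[OF that] by (subst mult.commute) (intro mult_right_mono power_mono; simp)
    qed (use Q_int[OF that] w_int in auto)
    thus ?thesis by (simp add: Wt_def)
  qed
  have q0: "0 \<le> q \<phi>" for \<phi> unfolding q_def Q_def using w_pos
    by (intro Bochner_Integration.integral_nonneg) (auto simp: less_imp_le)
  define a where "a k = (INF \<phi>\<in>A k. q \<phi>)" for k
  have bdd: "bdd_below (q ` A k)" for k by (rule bdd_belowI2[OF q0])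
  have a_le: "a k \<le> q \<phi>" if "\<phi> \<in> A k" for \<phi> k unfolding a_def by (rule cINF_lower[OF bdd that])
  have A_dec: "A k \<subseteq> A i" if "i \<le> k" for i k
  proof -
    have "1 / real (Suc k) \<le> 1 / real (Suc i)" using that by (intro divide_left_mono) auto
    thus ?thesis by (auto simp: A_def simp del: of_nat_Suc intro: order_trans)
  qed
  have "\<exists>\<phi>\<in>A k. q \<phi> < a k + 1 / real (Suc k)" for k
  proof -
    have "(INF \<phi>\<in>A k. q \<phi>) < a k + 1 / real (Suc k)" by (simp add: a_def)
    thus ?thesis using A_ne[of k] by (subst (asm) cINF_less_iff[OF _ bdd]) auto
  qed
  then obtain \<phi> where \<phi>: "\<And>k. \<phi> k \<in> A k" "\<And>k. q (\<phi> k) < a k + 1 / real (Suc k)" by metis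
  have \<phi>G: "\<phi> k \<in> G" for k using \<phi>(1)[of k] by (simp add: A_def)
  have \<phi>s: "smooth (\<phi> k)" for k using \<phi>G[of k] by (simp add: G_def)
  have a_mono: "a i \<le> a k" if "i \<le> k" for i k
    unfolding a_def by (rule cINF_superset_mono[OF A_ne bdd A_dec[OF that]]) simp
  have "a k \<le> L\<^sup>2 * Wt" for k using a_le[OF \<phi>(1)] q_le[OF \<phi>G] by (rule order_trans)
  hence "\<forall>k. a k \<le> L\<^sup>2 * Wt" by blast
  moreover have "incseq a" using a_mono by (simp add: incseq_def)
  ultimately obtain l where "a \<longlonglongrightarrow> l" using incseq_convergent by blast
  hence Ca: "Cauchy a" by (rule LIMSEQ_imp_Cauchy)
  define qd where "qd i k = (LINT z|\<beta>. w z * (norm (gradient (\<phi> i) z - gradient (\<phi> k) z))\<^sup>2)" for i k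
  \<comment> \<open>For \<open>i \<le> k\<close> the midpoint of \<open>\<phi> i\<close> and
    \<open>\<phi> k\<close> belongs to \<open>A i\<close>, so its energy is at least
    \<open>a i\<close>; the parallelogram law then bounds the energy of the difference.\<close>
  have qd_le: "qd i k \<le> 2 * (a k - a i) + 2 / real (Suc i) + 2 / real (Suc k)" if ik: "i \<le> k" for i k
  proof -
    let ?m = "\<lambda>z. (1/2) * \<phi> i z + (1/2) * \<phi> k z"
    have gr: "gradient ?m z = (1/2) *\<^sub>R (gradient (\<phi> i) z + gradient (\<phi> k) z)" for z
      unfolding gradient_linear_combination(1)[OF \<phi>s \<phi>s] scaleR_right_distrib ..
    have mG: "?m \<in> G"
    proof -
      have "\<bar>frechet_derivative ?m (at z) v\<bar> \<le> L * norm v" for z v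
      proof -
        have "\<bar>Df (\<phi> i) z v\<bar> \<le> L * norm v" "\<bar>Df (\<phi> k) z v\<bar> \<le> L * norm v"
          using \<phi>G by (auto simp: G_def)
        thus ?thesis unfolding gradient_linear_combination(2)[OF \<phi>s \<phi>s] by linarith
      qed
      moreover have "smooth ?m" by (intro smooth_add smooth_mult smooth_const \<phi>s)
      ultimately show ?thesis unfolding G_def by blast
    qed
    have "?m \<in> A i"
    proof -
      have "\<bar>?m z - g z\<bar> \<le> 1 / real (Suc i)" if "z \<in> X" for z
      proof -
        have "\<bar>\<phi> i z - g z\<bar> \<le> 1 / real (Suc i)" "\<bar>\<phi> k z - g z\<bar> \<le> 1 / real (Suc i)"
          using \<phi>(1)[of i] \<phi>(1)[of k] A_dec[OF ik] that by (auto simp: A_def simp del: of_nat_Suc)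
        thus ?thesis by linarith
      qed
      thus ?thesis using mG by (simp add: A_def del: of_nat_Suc)
    qed
    hence am: "a i \<le> q ?m" by (rule a_le)
    have "w z * (norm (gradient (\<phi> i) z - gradient (\<phi> k) z))\<^sup>2 = 2 * Q (\<phi> i) z + 2 * Q (\<phi> k) z - 4 * Q ?m z" for z
      unfolding Q_def gr norm_sq_parallelogram[of "gradient (\<phi> i) z"] by (simp only: algebra_simps)
    hence "qd i k = 2 * q (\<phi> i) + 2 * q (\<phi> k) - 4 * q ?m"
      unfolding qd_def q_def using Q_int[OF \<phi>G] Q_int[OF mG] by simp
    thus ?thesis using am \<phi>(2)[of i] \<phi>(2)[of k] by simp
  qed
  have dm [measurable]: "gradient (\<phi> k) \<in> Borel" for k by (rule gm[OF \<phi>G])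
  have s_int: "integrable \<beta> (\<lambda>z. w z *\<^sub>R gradient (\<phi> k) z)" for k
  proof (rule Bochner_Integration.integrable_bound[of _ "\<lambda>z. L * w z"])
    show "AE z in \<beta>. norm (w z *\<^sub>R gradient (\<phi> k) z) \<le> norm (L * w z)"
    proof (rule AE_I2)
      fix z show "norm (w z *\<^sub>R gradient (\<phi> k) z) \<le> norm (L * w z)"
        using mult_right_mono[OF gle[OF \<phi>G[of k], of z], of "w z"] w_pos[of z] L0 by (simp add: abs_mult mult.commute)
    qed
  qed (use w_int in auto)
  have small: "\<exists>N. \<forall>i\<ge>N. \<forall>k\<ge>N. (LINT z|\<beta>. norm (w z *\<^sub>R gradient (\<phi> i) z - w z *\<^sub>R gradient (\<phi> k) z)) < e" if e: "0 < e" for e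
  proof -
    define s where "s = e / (Wt + 1)"
    have s: "0 < s" "s * Wt < e" using e W0 by (auto simp: s_def field_simps)
    obtain N1 where N1: "\<And>i k. N1 \<le> i ==> N1 \<le> k ==> \<bar>a i - a k\<bar> < s * e / 6"
      using CauchyD[OF Ca, of "s * e / 6"] s e by auto
    obtain N2 where N2: "12 / (s * e) < real N2" using reals_Archimedean2 by blast
    define N where "N = max N1 (max N2 1)"
    have small1: "qd i k < s * e" if "N \<le> i" "i \<le> k" for i k
    proof -
      have "real N2 \<le> real (Suc i)" "real N2 \<le> real (Suc k)" using that by (auto simp: N_def)
      hence "12 / (s * e) \<le> real (Suc i)" "12 / (s * e) \<le> real (Suc k)" using N2 by linarith+
      moreover have p: "0 < 12 / (s * e)" using s e by simp
      ultimately have "2 / real (Suc i) \<le> 2 / (12 / (s * e))" "2 / real (Suc k) \<le> 2 / (12 / (s * e))"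
        by (intro divide_left_mono mult_pos_pos; simp)+
      hence x: "2 / real (Suc i) \<le> s * e / 6" "2 / real (Suc k) \<le> s * e / 6" by (simp_all add: mult.commute)
      have gen: "u < c" if h: "u \<le> 2 * (b' - a') + x + y" "x \<le> c / 6" "y \<le> c / 6" "\<bar>a' - b'\<bar> < c / 6" "0 < c"
        for u a' b' x y c :: real
      proof -
        have "- (c / 6) < a' - b'" using h(4) unfolding abs_less_iff by linarith
        thus ?thesis using h by (simp add: field_simps)
      qed
      show ?thesis
        by (rule gen[OF qd_le[OF that(2)] x N1]) (use that s e in \<open>auto simp: N_def\<close>)
    qed
    have sym: "qd i k = qd k i" for i k unfolding qd_def by (simp add: norm_minus_commute)
    have L1: "(LINT z|\<beta>. norm (w z *\<^sub>R gradient (\<phi> i) z - w z *\<^sub>R gradient (\<phi> k) z)) \<le> (qd i k / s + s * Wt) / 2" for i k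
    proof -
      have int2: "integrable \<beta> (\<lambda>z. w z * (norm (gradient (\<phi> i) z - gradient (\<phi> k) z))\<^sup>2)"
      proof (rule bnd_int[of _ "(L + L)\<^sup>2"])
        show "\<bar>(norm (gradient (\<phi> i) z - gradient (\<phi> k) z))\<^sup>2\<bar> \<le> (L + L)\<^sup>2" for z
        proof -
          have "norm (gradient (\<phi> i) z - gradient (\<phi> k) z) \<le> L + L"
            using norm_triangle_ineq4[of "gradient (\<phi> i) z" "gradient (\<phi> k) z"] gle[OF \<phi>G[of i], of z] gle[OF \<phi>G[of k], of z]
            by linarith
          thus ?thesis unfolding abs_power2 by (rule power_mono) simp
        qed
      qed simp
      have "(LINT z|\<beta>. norm (w z *\<^sub>R gradient (\<phi> i) z - w z *\<^sub>R gradient (\<phi> k) z)) \<le>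
        (LINT z|\<beta>. (1 / s * (w z * (norm (gradient (\<phi> i) z - gradient (\<phi> k) z))\<^sup>2) + s * w z) / 2)"
      proof (rule integral_mono)
        fix z
        have "norm (w z *\<^sub>R gradient (\<phi> i) z - w z *\<^sub>R gradient (\<phi> k) z) = w z * norm (gradient (\<phi> i) z - gradient (\<phi> k) z)"
          using w_pos[of z] by (simp add: scaleR_diff_right[symmetric] less_imp_le)
        also have "\<dots> \<le> w z * (((norm (gradient (\<phi> i) z - gradient (\<phi> k) z))\<^sup>2 / s + s) / 2)"
          using real_le_add_half_sq[OF s(1)] w_pos[of z] by (intro mult_left_mono) (auto simp: less_imp_le)
        also have "\<dots> = (1 / s * (w z * (norm (gradient (\<phi> i) z - gradient (\<phi> k) z))\<^sup>2) + s * w z) / 2"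
          by (simp add: field_simps)
        finally show "norm (w z *\<^sub>R gradient (\<phi> i) z - w z *\<^sub>R gradient (\<phi> k) z) \<le>
          (1 / s * (w z * (norm (gradient (\<phi> i) z - gradient (\<phi> k) z))\<^sup>2) + s * w z) / 2" .
      next
        show "integrable \<beta> (\<lambda>z. (1 / s * (w z * (norm (gradient (\<phi> i) z - gradient (\<phi> k) z))\<^sup>2) + s * w z) / 2)"
          by (intro integrable_divide Bochner_Integration.integrable_add integrable_mult_right int2 w_int)
      qed (use s_int in auto)
      also have "\<dots> = (LINT z|\<beta>. 1 / s * (w z * (norm (gradient (\<phi> i) z - gradient (\<phi> k) z))\<^sup>2) + s * w z) / 2"
        by (rule integral_divide_zero)
      also have "\<dots> = (1 / s * qd i k + s * Wt) / 2"
        unfolding qd_def Wt_def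
        by (subst Bochner_Integration.integral_add[OF integrable_mult_right[OF int2] integrable_mult_right[OF w_int]]) (simp only: integral_mult_right_zero)
      finally show ?thesis by simp
    qed
    have "(LINT z|\<beta>. norm (w z *\<^sub>R gradient (\<phi> i) z - w z *\<^sub>R gradient (\<phi> k) z)) < e" if "N \<le> i" "N \<le> k" for i k
    proof -
      have "qd i k < s * e" using small1[of i k] small1[of k i] sym[of i k] that by (cases "i \<le> k") auto
      hence "qd i k / s < e" using s by (simp add: field_simps)
      thus ?thesis using L1[of i k] s(2) by simp
    qed
    thus ?thesis by blast
  qed
  obtain r where r: "strict_mono r" "AE z in \<beta>. Cauchy (\<lambda>i. w z *\<^sub>R gradient (\<phi> (r i)) z)"
    using cauchy_L1_AE_cauchy_subseq[OF s_int small] by blast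
  define \<Gamma>0 where "\<Gamma>0 z = lim (\<lambda>i. gradient (\<phi> (r i)) z)" for z
  have [measurable]: "\<Gamma>0 \<in> Borel" unfolding \<Gamma>0_def by measurable
  \<comment> \<open>Off the null set of divergence, \<open>\<Gamma>0\<close> satisfies the bound
    already.\<close>
  define \<Gamma> where "\<Gamma> z = (if norm (\<Gamma>0 z) \<le> L then \<Gamma>0 z else 0)" for z
  have \<Gamma>m: "\<Gamma> \<in> Borel" unfolding \<Gamma>_def by measurable
  have conv: "AE z in \<beta>. \<forall>v. (\<lambda>k. Df (\<phi> (r k)) z v) \<longlonglongrightarrow> v \<bullet> \<Gamma> z"
    using r(2)
  proof eventually_elim
    case (elim z)
    have "convergent (\<lambda>i. w z *\<^sub>R gradient (\<phi> (r i)) z)" using elim by (simp add: Cauchy_convergent_iff)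
    then obtain l where "(\<lambda>i. w z *\<^sub>R gradient (\<phi> (r i)) z) \<longlonglongrightarrow> l" by (auto simp: convergent_def)
    from tendsto_scaleR[OF tendsto_const[of "inverse (w z)"] this]
    have "(\<lambda>i. gradient (\<phi> (r i)) z) \<longlonglongrightarrow> inverse (w z) *\<^sub>R l" using w_pos[of z] by simp
    hence l: "(\<lambda>i. gradient (\<phi> (r i)) z) \<longlonglongrightarrow> \<Gamma>0 z" unfolding \<Gamma>0_def using limI by metis
    have "norm (\<Gamma>0 z) \<le> L"
      using gle[OF \<phi>G] by (intro Lim_bounded[OF tendsto_norm[OF l], of 0]) auto
    hence l': "(\<lambda>i. gradient (\<phi> (r i)) z) \<longlonglongrightarrow> \<Gamma> z" using l by (simp add: \<Gamma>_def)
    show ?case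
    proof
      fix v show "(\<lambda>k. Df (\<phi> (r k)) z v) \<longlonglongrightarrow> v \<bullet> \<Gamma> z"
        using tendsto_inner[OF tendsto_const[of v] l'] by (simp only: inner_gradient[OF \<phi>s])
    qed
  qed
  show ?thesis
  proof (rule that[of "\<lambda>k. \<phi> (r k)" \<Gamma>])
    show "smooth (\<phi> (r k))" for k by (rule \<phi>s)
    show "\<bar>Df (\<phi> (r k)) z v\<bar> \<le> L * norm v" for k z v using \<phi>G[of "r k"] by (simp add: G_def)
    show "\<bar>\<phi> (r k) z - g z\<bar> \<le> 1 / real (Suc k)" if "z \<in> X" for k z
    proof -
      have "\<bar>\<phi> (r k) z - g z\<bar> \<le> 1 / real (Suc (r k))" using \<phi>(1)[of "r k"] that by (simp add: A_def del: of_nat_Suc)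
      also have "\<dots> \<le> 1 / real (Suc k)" using seq_suble[OF r(1), of k] by (intro divide_left_mono) auto
      finally show ?thesis .
    qed
    show "norm (\<Gamma> z) \<le> L" for z using L0 by (simp add: \<Gamma>_def)
  qed (use \<Gamma>m conv in auto)
qed

context fv_data
begin

text \<open>\<Gamma> is chosen before \<open>flag\<close>, \<open>W\<close>, \<open>f\<close>,
  \<open>F\<close>, \<eta> and \<open>u\<close>, because the weak derivative in \<open>U\<close> and
  the boundary identity in a larger set must share one \<Gamma>. The integrability clauses permit
  summation over a partition of unity later.\<close>

lemma parts_lipschitz_local:
  fixes f :: "real^'n => real^'l" and F :: "real^'n => real^'n^'l" and g :: "real^'n => real"
  assumes g [measurable]: "g \<in> Borel" and K: "compact K" and lip: "L-lipschitz_on (U \<inter> K) g"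
  obtains \<Gamma> where "\<Gamma> \<in> Borel" "\<And>z. norm (\<Gamma> z) \<le> L"
    "\<And>flag W (f :: real^'n => real^'l) F \<eta> u. f \<in> Borel ==> F \<in> Borel ==>
      parts flag W f F ==> superlevel_finite flag W f ==>
      loc_integrable W f ==> loc_integrable W F ==> admissible flag \<eta> ==> u \<in> test_functions W ==> spt u \<subseteq> K ==>
      bdry (\<lambda>z. \<eta> (g z *\<^sub>R f z)) u = (LINT z|\<alpha>. Df \<eta> (g z *\<^sub>R f z)
        (g z *\<^sub>R (F z *v u z) + ((u z v* P z) \<bullet> \<Gamma> z) *\<^sub>R f z)) \<and>
      integrable \<alpha> (\<lambda>z. Df \<eta> (g z *\<^sub>R f z)
        (g z *\<^sub>R (F z *v u z) + ((u z v* P z) \<bullet> \<Gamma> z) *\<^sub>R f z)) \<and>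
      integrable \<beta> (\<lambda>z. \<eta> (g z *\<^sub>R f z) * (u z \<bullet> \<nu> z)) \<and>
      integrable \<alpha> (\<lambda>z. \<eta> (g z *\<^sub>R f z) * (tdiv u z))"
proof -
  have bX: "bounded (U \<inter> K)" using compact_imp_bounded[OF K] by (rule bounded_subset) auto
  obtain \<phi> :: "nat => real^'n => real" and \<Gamma> where \<phi>: "\<And>k. smooth (\<phi> k)" "\<And>k z v. \<bar>Df (\<phi> k) z v\<bar> \<le> L * norm v"
    "\<And>k z. z \<in> U \<inter> K ==> \<bar>\<phi> k z - g z\<bar> \<le> 1 / real (Suc k)"
    and \<Gamma> [measurable]: "\<Gamma> \<in> Borel" and \<Gamma>_le: "\<And>z. norm (\<Gamma> z) \<le> L"
    and conv: "AE z in \<alpha>. \<forall>v. (\<lambda>k. Df (\<phi> k) z v) \<longlonglongrightarrow> v \<bullet> \<Gamma> z"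
    using \<alpha>.lipschitz_gradient_limit[OF bX lip] by blast
  have L0: "0 \<le> L" using lip by (auto simp: lipschitz_on_def)
  have "bounded (g ` (U \<inter> K))"
    using lipschitz_on_uniformly_continuous[OF lip] bX by (rule bounded_uniformly_continuous_image)
  then obtain M0 where M0: "0 < M0" "\<And>z. z \<in> U \<inter> K ==> \<bar>g z\<bar> \<le> M0" by (auto simp: bounded_pos)
  \<comment> \<open>All approximations are within distance \<open>1\<close> of \<open>g\<close>, so
    one bound serves for them and for \<open>g\<close>.\<close>
  define M where "M = M0 + 1"
  have M: "0 < M" using M0 by (simp add: M_def)
  have g_le: "\<bar>g z\<bar> \<le> M" if "z \<in> U \<inter> K" for z using M0(2)[OF that] by (simp add: M_def)
  have \<phi>_le: "\<bar>\<phi> k z\<bar> \<le> M" if "z \<in> U \<inter> K" for k z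
  proof -
    have "\<bar>\<phi> k z - g z\<bar> \<le> 1" by (rule order_trans[OF \<phi>(3)[OF that, of k]]) simp
    thus ?thesis using M0(2)[OF that] unfolding M_def by linarith
  qed
  have \<phi>_lim: "(\<lambda>k. \<phi> k z) \<longlonglongrightarrow> g z" if "z \<in> U \<inter> K" for z
  proof (rule Lim_transform_bound[OF _ LIMSEQ_inverse_real_of_nat, THEN LIM_zero_cancel])
    show "\<forall>\<^sub>F k in sequentially. norm (\<phi> k z - g z) \<le> norm (inverse (real (Suc k)))"
      using \<phi>(3)[OF that] by (auto simp: inverse_eq_divide)
  qed
  show ?thesis
  proof (rule that[OF \<Gamma> \<Gamma>_le])
    fix flag W and f :: "real^'n => real^'l" and F and \<eta> :: "real^'l => real"
      and u :: "real^'n => real^'n"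
    assume f [measurable]: "f \<in> Borel" and F [measurable]: "F \<in> Borel"
      and parts: "parts flag W f F" and fin: "superlevel_finite flag W f"
      and fint: "loc_integrable W f" and Fint: "loc_integrable W F"
      and adm: "admissible flag \<eta>" and th: "u \<in> test_functions W" and sptK: "spt u \<subseteq> K"
    have Kt: "compact (spt u)" "spt u \<subseteq> W" using test_functionsD[OF th] by auto
    have KB [measurable]: "spt u \<in> sets borel" using Kt by (auto intro: borel_compact)
    have sm\<eta>: "smooth \<eta>" using adm by (simp add: admissible_def)
    note [measurable] = test_functions_borel[OF th] test_functions_borel[OF test_functions_jacobian[OF th]]
      smooth_borel[OF sm\<eta>] smooth_borel[OF \<phi>(1)]
    have lin: "linear (Df \<eta> y)" for y
      using linear_frechet_derivative[OF smooth_differentiable[OF sm\<eta>]] .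
    obtain B where B: "0 < B" "\<And>z. norm (u z) \<le> B" "\<And>z. norm (jacobian u (at z)) \<le> B"
      using test_bounds[OF th] by blast
    obtain C where C: "0 < C" "\<And>y. \<bar>\<eta> y\<bar> \<le> C" "\<And>y v. \<bar>Df \<eta> y v\<bar> \<le> C * norm v"
      using admissible_bounds[OF adm] by blast
    obtain Kv where Kv: "0 < Kv" "\<And>(v::real^'n) A::real^'n^'n. norm (v v* A) \<le> norm v * norm A * Kv"
      using bounded_bilinear.pos_bounded[OF bounded_bilinear_vector_matrix] by blast
    obtain Km where Km: "0 < Km" "\<And>(A::real^'n^'l) v. norm (A *v v) \<le> norm A * norm v * Km"
      using bounded_bilinear.pos_bounded[OF bounded_bilinear_matrix_vector] by blast
    have zero: "u z = 0" "jacobian u (at z) = 0" "F z *v u z = 0" "u z v* P z = 0" if "z \<notin> spt u" for z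
      using not_in_spt[OF that] jacobian_notin_spt[OF that]
      by (simp_all add: matrix_vector_mult_def vector_matrix_mult_def zero_vec_def[symmetric])
    obtain r where r: "0 < r" "\<And>z b. \<not> (flag \<longrightarrow> r \<le> norm (f z)) ==> \<bar>b\<bar> \<le> M ==> \<eta> (b *\<^sub>R f z) = 0"
    proof (cases flag)
      case True
      then obtain r0 where r0: "0 < r0" "\<And>y. norm y < r0 ==> \<eta> y = 0"
        using adm unfolding admissible_def by blast
      show ?thesis
      proof (rule that[of "r0 / M"])
        fix z b assume "\<not> (flag \<longrightarrow> r0 / M \<le> norm (f z))" "\<bar>b\<bar> \<le> M"
        hence "norm (f z) < r0 / M" by simp
        hence "M * norm (f z) < r0" using M by (simp add: field_simps)
        moreover have "\<bar>b\<bar> * norm (f z) \<le> M * norm (f z)" using \<open>\<bar>b\<bar> \<le> M\<close> by (intro mult_right_mono) auto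
        ultimately show "\<eta> (b *\<^sub>R f z) = 0" by (intro r0(2)) simp
      qed (use r0 M in simp)
    qed (use that[of 1] in simp)
    \<comment> \<open>Intersected with \<open>U\<close>, since only there are the
      \<open>\<phi> k\<close> known to be close to \<open>g\<close>; both measures vanish
      outside.\<close>
    define A where "A = U \<inter> {z \<in> spt u. flag \<longrightarrow> r \<le> norm (f z)}"
    have [measurable]: "U \<in> sets borel" using \<alpha>.open_U by simp
    have "{z \<in> spt u. flag \<longrightarrow> r \<le> norm (f z)} \<in> sets borel" by measurable
    hence A [measurable]: "A \<in> sets borel" unfolding A_def by (intro sets.Int) simp
    have finA: "emeasure \<alpha> A < \<infinity>" "emeasure \<beta> A < \<infinity>"
    proof -
      have "emeasure \<alpha> {z \<in> spt u. flag \<longrightarrow> r \<le> norm (f z)} < \<infinity>" "emeasure \<beta> {z \<in> spt u. flag \<longrightarrow> r \<le> norm (f z)} < \<infinity>"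
        using fin Kt r(1) unfolding superlevel_finite_def by blast+
      moreover have "emeasure \<alpha> A \<le> emeasure \<alpha> {z \<in> spt u. flag \<longrightarrow> r \<le> norm (f z)}" "emeasure \<beta> A \<le> emeasure \<beta> {z \<in> spt u. flag \<longrightarrow> r \<le> norm (f z)}"
        unfolding A_def by (intro emeasure_mono; simp)+
      ultimately show "emeasure \<alpha> A < \<infinity>" "emeasure \<beta> A < \<infinity>" by (auto simp: le_less_trans)
    qed
    have A0: "\<eta> (b *\<^sub>R f z) = 0" if "z \<in> U" "z \<in> spt u" "z \<notin> A" "\<bar>b\<bar> \<le> M" for z b
      using r(2)[OF _ that(4)] that by (auto simp: A_def)
    define k where "k z = u z v* P z" for z
    have k_le: "norm (k z) \<le> B * CP * Kv" for z
    proof -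
      have "norm (k z) \<le> norm (u z) * norm (P z) * Kv" unfolding k_def by (rule Kv)
      also have "\<dots> \<le> B * CP * Kv" using B(2)[of z] P_bound[of z] Kv(1) B(1) by (intro mult_right_mono mult_mono) auto
      finally show ?thesis .
    qed
    have [measurable]: "k \<in> Borel" unfolding k_def by measurable
    have Fth_le: "norm (F z *v u z) \<le> B * Km * norm (F z)" for z
    proof -
      have "norm (F z *v u z) \<le> norm (F z) * norm (u z) * Km" by (rule Km)
      also have "\<dots> \<le> norm (F z) * B * Km" using B(2)[of z] Km(1) by (intro mult_right_mono mult_left_mono) auto
      finally show ?thesis by (simp add: mult_ac)
    qed
    \<comment> \<open>Here integrability of \<open>f\<close> itself enters: the term with the
      gradient of the multiplier is bounded by a multiple of \<open>norm (f z)\<close>.\<close>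
    define wt where "wt z = C * (M * (B * Km)) * (indicator (spt u) z * norm (F z)) + C * (L * (B * CP * Kv)) * (indicator (spt u) z * norm (f z))" for z
    have wf1: "integrable \<alpha> (\<lambda>z. indicator (spt u) z * norm (f z))"
      by (rule loc_integrable_bound[OF fint Kt, of _ 1]) simp_all
    have wf2: "integrable \<alpha> (\<lambda>z. indicator (spt u) z * norm (F z))"
      by (rule loc_integrable_bound[OF Fint Kt, of _ 1]) simp_all
    have wt_int: "integrable \<alpha> wt" unfolding wt_def using wf1 wf2 by simp
    have D_le: "\<bar>Df \<eta> y (b *\<^sub>R (F z *v u z) + c *\<^sub>R f z)\<bar> \<le> wt z"
      if b: "z \<in> spt u ==> \<bar>b\<bar> \<le> M" and c: "\<bar>c\<bar> \<le> L * norm (k z)" for y b c z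
    proof (cases "z \<in> spt u")
      case True
      have "\<bar>Df \<eta> y (b *\<^sub>R (F z *v u z) + c *\<^sub>R f z)\<bar> \<le> C * norm (b *\<^sub>R (F z *v u z) + c *\<^sub>R f z)" by (rule C)
      also have "\<dots> \<le> C * (\<bar>b\<bar> * norm (F z *v u z) + \<bar>c\<bar> * norm (f z))"
        using C(1) norm_triangle_ineq[of "b *\<^sub>R (F z *v u z)" "c *\<^sub>R f z"] by (intro mult_left_mono) auto
      also have "\<dots> \<le> C * (M * (B * Km * norm (F z)) + (L * (B * CP * Kv)) * norm (f z))"
      proof (intro mult_left_mono add_mono mult_mono mult_right_mono)
        show "\<bar>c\<bar> \<le> L * (B * CP * Kv)" using c mult_left_mono[OF k_le L0] by (rule order_trans)
        show "0 \<le> L * (B * CP * Kv)" using L0 B Kv CP_nonneg by simp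
      qed (use b[OF True] Fth_le C M in auto)
      finally show ?thesis using True by (simp add: wt_def algebra_simps)
    next
      case False
      have "k z = 0" unfolding k_def by (rule zero(4)[OF False])
      thus ?thesis using False zero(3)[OF False] c by (simp add: wt_def linear_0[OF lin])
    qed
    have eq: "bdry (\<lambda>z. \<eta> (\<phi> i z *\<^sub>R f z)) u = (LINT z|\<alpha>. Df \<eta> (\<phi> i z *\<^sub>R f z)
     (\<phi> i z *\<^sub>R (F z *v u z) + Df (\<phi> i) z (k z) *\<^sub>R f z))" for i
    proof -
      have "bounded (\<phi> i ` spt u)"
        by (intro compact_imp_bounded compact_continuous_image continuous_on_subset[OF smooth_continuous[OF \<phi>(1)]] Kt) auto
      then obtain M' where "0 < M'" "\<And>z. z \<in> spt u ==> \<bar>\<phi> i z\<bar> \<le> M'" by (auto simp: bounded_pos)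
      thus ?thesis unfolding k_def
        by (intro parts_smooth_multiplier[OF f F parts fin fint Fint adm th \<phi>(1) _ _ \<phi>(2)]) auto
    qed
    have lim1: "(\<lambda>i. LINT z|\<beta>. \<eta> (\<phi> i z *\<^sub>R f z) * (u z \<bullet> \<nu> z)) \<longlonglongrightarrow> (LINT z|\<beta>. \<eta> (g z *\<^sub>R f z) * (u z \<bullet> \<nu> z))"
      and int1: "integrable \<beta> (\<lambda>z. \<eta> (g z *\<^sub>R f z) * (u z \<bullet> \<nu> z))"
    proof -
      have le: "norm (\<eta> (b *\<^sub>R f z) * (u z \<bullet> \<nu> z)) \<le> C * (B * C\<nu>) * indicator A z" if "z \<in> U" "z \<in> spt u ==> \<bar>b\<bar> \<le> M" for z b
      proof (cases "z \<in> A")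
        case True
        thus ?thesis using mult_mono[OF C(2)[of "b *\<^sub>R f z"] inner_\<nu>_le[OF B(2)[of z], of z]] C(1) by (simp add: abs_mult)
      next
        case False
        thus ?thesis using A0[OF that(1) _ False that(2)] zero(1)[of z] by (cases "z \<in> spt u") auto
      qed
      have c: "AE z in \<beta>. (\<lambda>i. \<eta> (\<phi> i z *\<^sub>R f z) * (u z \<bullet> \<nu> z)) \<longlonglongrightarrow> \<eta> (g z *\<^sub>R f z) * (u z \<bullet> \<nu> z)"
        using \<beta>.AE_U
      proof eventually_elim
        case (elim z)
        show ?case
        proof (cases "z \<in> spt u")
          case True
          have "(\<lambda>i. \<phi> i z *\<^sub>R f z) \<longlonglongrightarrow> g z *\<^sub>R f z" using True sptK elim by (intro tendsto_scaleR \<phi>_lim tendsto_const) auto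
          thus ?thesis using smooth_continuous[OF sm\<eta>]
            by (intro tendsto_mult_right continuous_on_tendsto_compose[of UNIV \<eta>]) auto
        qed (simp add: zero)
      qed
      have b: "AE z in \<beta>. norm (\<eta> (\<phi> i z *\<^sub>R f z) * (u z \<bullet> \<nu> z)) \<le> C * (B * C\<nu>) * indicator A z" for i
        using \<beta>.AE_U by eventually_elim (intro le, use \<phi>_le sptK in auto)
      have w: "integrable \<beta> (\<lambda>z. C * (B * C\<nu>) * indicator A z)" using finA by auto
      show "(\<lambda>i. LINT z|\<beta>. \<eta> (\<phi> i z *\<^sub>R f z) * (u z \<bullet> \<nu> z)) \<longlonglongrightarrow> (LINT z|\<beta>. \<eta> (g z *\<^sub>R f z) * (u z \<bullet> \<nu> z))"
        by (rule integral_dominated_convergence[OF _ _ w c b]) measurable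
      show "integrable \<beta> (\<lambda>z. \<eta> (g z *\<^sub>R f z) * (u z \<bullet> \<nu> z))"
        by (rule integrable_dominated_convergence[OF _ _ w c b]) measurable
    qed
    have lim2: "(\<lambda>i. LINT z|\<alpha>. \<eta> (\<phi> i z *\<^sub>R f z) * (tdiv u z)) \<longlonglongrightarrow> (LINT z|\<alpha>. \<eta> (g z *\<^sub>R f z) * (tdiv u z))"
      and int2: "integrable \<alpha> (\<lambda>z. \<eta> (g z *\<^sub>R f z) * (tdiv u z))"
    proof -
      have le: "norm (\<eta> (b *\<^sub>R f z) * (tdiv u z)) \<le> C * (B * CP) * indicator A z" if "z \<in> U" "z \<in> spt u ==> \<bar>b\<bar> \<le> M" for z b
      proof (cases "z \<in> A")
        case True
        thus ?thesis using mult_mono[OF C(2)[of "b *\<^sub>R f z"] inner_P_le[OF B(3)[of z], of z]] C(1) by (simp add: abs_mult)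
      next
        case False
        thus ?thesis using A0[OF that(1) _ False that(2)] zero(2)[of z] by (cases "z \<in> spt u") auto
      qed
      have c: "AE z in \<alpha>. (\<lambda>i. \<eta> (\<phi> i z *\<^sub>R f z) * (tdiv u z)) \<longlonglongrightarrow> \<eta> (g z *\<^sub>R f z) * (tdiv u z)"
        using \<alpha>.AE_U
      proof eventually_elim
        case (elim z)
        show ?case
        proof (cases "z \<in> spt u")
          case True
          have "(\<lambda>i. \<phi> i z *\<^sub>R f z) \<longlonglongrightarrow> g z *\<^sub>R f z" using True sptK elim by (intro tendsto_scaleR \<phi>_lim tendsto_const) auto
          thus ?thesis using smooth_continuous[OF sm\<eta>]
            by (intro tendsto_mult_right continuous_on_tendsto_compose[of UNIV \<eta>]) auto
        qed (simp add: zero)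
      qed
      have b: "AE z in \<alpha>. norm (\<eta> (\<phi> i z *\<^sub>R f z) * (tdiv u z)) \<le> C * (B * CP) * indicator A z" for i
        using \<alpha>.AE_U by eventually_elim (intro le, use \<phi>_le sptK in auto)
      have w: "integrable \<alpha> (\<lambda>z. C * (B * CP) * indicator A z)" using finA by auto
      show "(\<lambda>i. LINT z|\<alpha>. \<eta> (\<phi> i z *\<^sub>R f z) * (tdiv u z)) \<longlonglongrightarrow> (LINT z|\<alpha>. \<eta> (g z *\<^sub>R f z) * (tdiv u z))"
        by (rule integral_dominated_convergence[OF _ _ w c b]) measurable
      show "integrable \<alpha> (\<lambda>z. \<eta> (g z *\<^sub>R f z) * (tdiv u z))"
        by (rule integrable_dominated_convergence[OF _ _ w c b]) measurable
    qed
    let ?G = "\<lambda>z. Df \<eta> (g z *\<^sub>R f z) (g z *\<^sub>R (F z *v u z) + (k z \<bullet> \<Gamma> z) *\<^sub>R f z)"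
    let ?Gi = "\<lambda>i z. Df \<eta> (\<phi> i z *\<^sub>R f z) (\<phi> i z *\<^sub>R (F z *v u z) + Df (\<phi> i) z (k z) *\<^sub>R f z)"
    have c3: "AE z in \<alpha>. (\<lambda>i. ?Gi i z) \<longlonglongrightarrow> ?G z"
      using \<alpha>.AE_U conv
    proof eventually_elim
      case (elim z)
      show ?case
      proof (cases "z \<in> spt u")
        case True
        have p: "(\<lambda>i. \<phi> i z) \<longlonglongrightarrow> g z" using True sptK elim by (intro \<phi>_lim) auto
        have "(\<lambda>i. (\<phi> i z *\<^sub>R f z, \<phi> i z *\<^sub>R (F z *v u z) + Df (\<phi> i) z (k z) *\<^sub>R f z))
          \<longlonglongrightarrow> (g z *\<^sub>R f z, g z *\<^sub>R (F z *v u z) + (k z \<bullet> \<Gamma> z) *\<^sub>R f z)"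
          using elim by (intro tendsto_Pair tendsto_add tendsto_scaleR p tendsto_const) auto
        from continuous_on_tendsto_compose[OF smooth_continuous_derivative[OF sm\<eta>] this] show ?thesis by simp
      next
        case False
        thus ?thesis using zero(3,4)[OF False]
          by (simp add: k_def linear_0[OF lin] linear_0[OF linear_frechet_derivative[OF smooth_differentiable[OF \<phi>(1)]]])
      qed
    qed
    have b3: "AE z in \<alpha>. norm (?Gi i z) \<le> wt z" for i
      using \<alpha>.AE_U
    proof eventually_elim
      case (elim z)
      show ?case unfolding real_norm_def by (rule D_le[OF _ \<phi>(2)]) (use \<phi>_le sptK elim in auto)
    qed
    have m3: "?Gi i \<in> borel_measurable \<alpha>" for i
    proof -
      have [measurable]: "(\<lambda>z. Df (\<phi> i) z (k z)) \<in> borel_measurable \<alpha>"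
        by (intro derivative_measurable[OF \<phi>(1)]) measurable
      show ?thesis by (intro derivative_measurable[OF sm\<eta>]) measurable
    qed
    have m3': "?G \<in> borel_measurable \<alpha>" by (intro derivative_measurable[OF sm\<eta>]) measurable
    have lim3: "(\<lambda>i. LINT z|\<alpha>. ?Gi i z) \<longlonglongrightarrow> (LINT z|\<alpha>. ?G z)"
      by (rule integral_dominated_convergence[OF m3' m3 wt_int c3 b3])
    have int3: "integrable \<alpha> ?G"
      by (rule integrable_dominated_convergence[OF m3' m3 wt_int c3 b3])
    have "bdry (\<lambda>z. \<eta> (g z *\<^sub>R f z)) u = (LINT z|\<alpha>. ?G z)"
      using LIMSEQ_unique[OF tendsto_diff[OF lim1 lim2]] lim3 eq by (simp add: bdry_def)
    thus "bdry (\<lambda>z. \<eta> (g z *\<^sub>R f z)) u = (LINT z|\<alpha>. Df \<eta> (g z *\<^sub>R f z)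
        (g z *\<^sub>R (F z *v u z) + ((u z v* P z) \<bullet> \<Gamma> z) *\<^sub>R f z)) \<and>
      integrable \<alpha> (\<lambda>z. Df \<eta> (g z *\<^sub>R f z)
        (g z *\<^sub>R (F z *v u z) + ((u z v* P z) \<bullet> \<Gamma> z) *\<^sub>R f z)) \<and>
      integrable \<beta> (\<lambda>z. \<eta> (g z *\<^sub>R f z) * (u z \<bullet> \<nu> z)) \<and>
      integrable \<alpha> (\<lambda>z. \<eta> (g z *\<^sub>R f z) * (tdiv u z))"
      using int1 int2 int3 by (simp add: k_def)
  qed
qed

text \<open>The product rule: the second summand is the tensor product of \<open>f z\<close> with
  \<open>P z *v \<Gamma> z\<close>, which plays the part of the tangential gradient of
  \<open>g\<close>.\<close>

definition product_derivative :: "(real^'n => real) => (real^'n => real^'n) => (real^'n => real^'l) =>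
    (real^'n => real^'n^'l) => real^'n => real^'n^'l" where
  "product_derivative g \<Gamma> f F z = g z *\<^sub>R F z + (\<chi> i. (f z $ i) *\<^sub>R (P z *v \<Gamma> z))"

lemma product_derivative_apply:
  "product_derivative g \<Gamma> f F z *v v = g z *\<^sub>R (F z *v v) + ((v v* P z) \<bullet> \<Gamma> z) *\<^sub>R f z"
proof -
  have "(P z *v \<Gamma> z) \<bullet> v = (v v* P z) \<bullet> \<Gamma> z"
    using dot_lmul_matrix[of v "P z" "\<Gamma> z"] by (simp only: inner_commute[of "P z *v \<Gamma> z"])
  hence "(\<Sum>j\<in>UNIV. f z $ i * (P z *v \<Gamma> z) $ j * v $ j) = (v v* P z) \<bullet> \<Gamma> z * f z $ i" for i
  proof -
    have "(\<Sum>j\<in>UNIV. f z $ i * (P z *v \<Gamma> z) $ j * v $ j) = f z $ i * ((P z *v \<Gamma> z) \<bullet> v)"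
      by (simp add: inner_vec_def sum_distrib_left mult.assoc)
    thus ?thesis using \<open>(P z *v \<Gamma> z) \<bullet> v = (v v* P z) \<bullet> \<Gamma> z\<close> by simp
  qed
  thus ?thesis
    by (simp add: product_derivative_def vec_eq_iff matrix_vector_mult_def distrib_right sum.distrib sum_distrib_left mult.assoc)
qed

text \<open>Lipschitz constants exist on compact sets only, so local \<Gamma> are glued by a
  partition of unity. They need not agree on overlaps: the identity is linear in \<open>u\<close>,
  which is decomposed by the same partition.\<close>

theorem parts_lipschitz:
  fixes g :: "real^'n => real"
  assumes g [measurable]: "g \<in> Borel" and W0: "open W0"
    and lip: "\<And>K. compact K ==> K \<subseteq> W0 ==> \<exists>L. L-lipschitz_on (U \<inter> K) g"
  obtains \<Gamma> where "\<Gamma> \<in> Borel"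
    "\<And>K. compact K ==> K \<subseteq> W0 ==> \<exists>L. \<forall>z\<in>K. norm (\<Gamma> z) \<le> L"
    "\<And>flag W (f :: real^'n => real^'l) F. W \<subseteq> W0 ==> f \<in> Borel ==> F \<in> Borel ==>
      parts flag W f F ==> superlevel_finite flag W f ==> loc_integrable W f ==> loc_integrable W F ==>
      parts flag W (\<lambda>z. g z *\<^sub>R f z) (product_derivative g \<Gamma> f F)"
proof -
  obtain \<zeta> :: "nat => real^'n => real" where \<zeta>: "\<And>j. \<zeta> j \<in> test_functions W0" "\<And>j z. 0 \<le> \<zeta> j z" "\<And>j z. \<zeta> j z \<le> 1"
    "\<And>K. compact K ==> K \<subseteq> W0 ==> \<exists>N. \<forall>j\<ge>N. \<forall>z\<in>K. \<zeta> j z = 1"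
    using cutoff_sequence[OF W0] by metis
  \<comment> \<open>Differences of consecutive cutoffs: a telescoping partition of unity.\<close>
  define \<xi> where "\<xi> j z = \<zeta> j z - (if j = 0 then 0 else \<zeta> (j - 1) z)" for j z
  define Kj where "Kj j = spt (\<zeta> j) \<union> (if j = 0 then {} else spt (\<zeta> (j - 1)))" for j
  have \<xi>_smooth: "smooth (\<xi> j)" for j
    unfolding \<xi>_def using \<zeta>(1)[THEN test_functionsD(1)] by (cases "j = 0") (auto intro!: smooth_diff)
  have \<xi>_le: "\<bar>\<xi> j z\<bar> \<le> 1" for j z
    using \<zeta>(2,3)[of j z] \<zeta>(2,3)[of "j - 1" z] by (auto simp: \<xi>_def)
  have [measurable]: "\<xi> j \<in> Borel" for j using \<xi>_smooth by (rule smooth_borel)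
  have \<xi>_0: "\<xi> j z = 0" if "z \<notin> Kj j" for j z
    using that not_in_spt[of z "\<zeta> j"] not_in_spt[of z "\<zeta> (j - 1)"] by (auto simp: \<xi>_def Kj_def split: if_splits)
  have Kj: "compact (Kj j)" "Kj j \<subseteq> W0" for j
    using test_functionsD[OF \<zeta>(1)[of j]] test_functionsD[OF \<zeta>(1)[of "j - 1"]] by (auto simp: Kj_def)
  have \<xi>_sum: "(\<Sum>j\<le>N. \<xi> j z) = \<zeta> N z" for N z
    by (induction N) (auto simp: \<xi>_def)
  define Q where "Q j \<Gamma> L \<longleftrightarrow> \<Gamma> \<in> Borel \<and> (\<forall>z. norm (\<Gamma> z) \<le> L) \<and>
    (\<forall>flag W (f :: real^'n => real^'l) F \<eta> u. f \<in> Borel \<longrightarrow> F \<in> Borel \<longrightarrow>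
      parts flag W f F \<longrightarrow> superlevel_finite flag W f \<longrightarrow>
      loc_integrable W f \<longrightarrow> loc_integrable W F \<longrightarrow> admissible flag \<eta> \<longrightarrow> u \<in> test_functions W \<longrightarrow> spt u \<subseteq> Kj j \<longrightarrow>
      bdry (\<lambda>z. \<eta> (g z *\<^sub>R f z)) u = (LINT z|\<alpha>. Df \<eta> (g z *\<^sub>R f z)
        (g z *\<^sub>R (F z *v u z) + ((u z v* P z) \<bullet> \<Gamma> z) *\<^sub>R f z)) \<and>
      integrable \<alpha> (\<lambda>z. Df \<eta> (g z *\<^sub>R f z)
        (g z *\<^sub>R (F z *v u z) + ((u z v* P z) \<bullet> \<Gamma> z) *\<^sub>R f z)) \<and>
      integrable \<beta> (\<lambda>z. \<eta> (g z *\<^sub>R f z) * (u z \<bullet> \<nu> z)) \<and>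
      integrable \<alpha> (\<lambda>z. \<eta> (g z *\<^sub>R f z) * (tdiv u z)))" for j \<Gamma> L
  have "\<exists>\<Gamma> L. Q j \<Gamma> L" for j
  proof -
    obtain L where L: "L-lipschitz_on (U \<inter> Kj j) g" using lip[OF Kj] by blast
    show ?thesis
    proof (rule parts_lipschitz_local[OF g Kj(1) L])
      fix \<Gamma> assume *: "\<Gamma> \<in> Borel" "\<And>z. norm (\<Gamma> z) \<le> L"
       "\<And>flag W (f :: real^'n => real^'l) F \<eta> u. f \<in> Borel ==> F \<in> Borel ==>
      parts flag W f F ==> superlevel_finite flag W f ==>
      loc_integrable W f ==> loc_integrable W F ==> admissible flag \<eta> ==> u \<in> test_functions W ==> spt u \<subseteq> Kj j ==>
      bdry (\<lambda>z. \<eta> (g z *\<^sub>R f z)) u = (LINT z|\<alpha>. Df \<eta> (g z *\<^sub>R f z)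
        (g z *\<^sub>R (F z *v u z) + ((u z v* P z) \<bullet> \<Gamma> z) *\<^sub>R f z)) \<and>
      integrable \<alpha> (\<lambda>z. Df \<eta> (g z *\<^sub>R f z)
        (g z *\<^sub>R (F z *v u z) + ((u z v* P z) \<bullet> \<Gamma> z) *\<^sub>R f z)) \<and>
      integrable \<beta> (\<lambda>z. \<eta> (g z *\<^sub>R f z) * (u z \<bullet> \<nu> z)) \<and>
      integrable \<alpha> (\<lambda>z. \<eta> (g z *\<^sub>R f z) * (tdiv u z))"
      show ?thesis unfolding Q_def by (intro exI[of _ \<Gamma>] exI[of _ L] conjI allI impI *(1,2)) (use *(3) in blast)+
    qed
  qed
  then obtain \<Gamma>j Lj where Q: "\<And>j. Q j (\<Gamma>j j) (Lj j)" by metis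
  have [measurable]: "\<Gamma>j j \<in> Borel" and \<Gamma>j_le: "norm (\<Gamma>j j z) \<le> Lj j" for j z
    using Q[of j] by (auto simp: Q_def)
  define \<Gamma> where "\<Gamma> z = (\<Sum>j. \<xi> j z *\<^sub>R \<Gamma>j j z)" for z
  have \<Gamma>m: "\<Gamma> \<in> Borel" unfolding \<Gamma>_def by measurable
  \<comment> \<open>Once the cutoffs equal \<open>1\<close> on \<open>K\<close>, all later
    differences vanish there, so the series is a finite sum of uniform length on
    \<open>K\<close>.\<close>
  have fin_sum: "\<exists>N. \<forall>z\<in>K. \<zeta> N z = 1 \<and> \<Gamma> z = (\<Sum>j\<le>N. \<xi> j z *\<^sub>R \<Gamma>j j z)" if K: "compact K" "K \<subseteq> W0" for K
  proof -
    obtain N where N: "\<And>j z. N \<le> j ==> z \<in> K ==> \<zeta> j z = 1" using \<zeta>(4)[OF K] by blast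
    have "\<Gamma> z = (\<Sum>j\<le>N. \<xi> j z *\<^sub>R \<Gamma>j j z)" if z: "z \<in> K" for z
      unfolding \<Gamma>_def
    proof (rule suminf_finite)
      fix j assume "j \<notin> {..N}"
      hence "\<xi> j z = 0" using N[of j z] N[of "j - 1" z] z by (simp add: \<xi>_def)
      thus "\<xi> j z *\<^sub>R \<Gamma>j j z = 0" by simp
    qed simp
    thus ?thesis using N by blast
  qed
  show ?thesis
  proof (rule that[OF \<Gamma>m])
    fix K assume K: "compact K" "K \<subseteq> W0"
    obtain N where N: "\<And>z. z \<in> K ==> \<Gamma> z = (\<Sum>j\<le>N. \<xi> j z *\<^sub>R \<Gamma>j j z)" using fin_sum[OF K] by blast
    show "\<exists>L. \<forall>z\<in>K. norm (\<Gamma> z) \<le> L"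
    proof (intro exI ballI)
      fix z assume "z \<in> K"
      have "norm (\<Sum>j\<le>N. \<xi> j z *\<^sub>R \<Gamma>j j z) \<le> (\<Sum>j\<le>N. norm (\<xi> j z *\<^sub>R \<Gamma>j j z))" by (rule norm_sum)
      also have "\<dots> \<le> (\<Sum>j\<le>N. 1 * Lj j)"
        unfolding norm_scaleR using \<xi>_le \<Gamma>j_le by (intro sum_mono mult_mono) auto
      finally show "norm (\<Gamma> z) \<le> (\<Sum>j\<le>N. 1 * Lj j)" using N[OF \<open>z \<in> K\<close>] by simp
    qed
  next
    fix flag W and f :: "real^'n => real^'l" and F
    assume WW: "W \<subseteq> W0" and f: "f \<in> Borel" and F: "F \<in> Borel"
      and hyp: "parts flag W f F" "superlevel_finite flag W f" "loc_integrable W f" "loc_integrable W F"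
    show "parts flag W (\<lambda>z. g z *\<^sub>R f z) (product_derivative g \<Gamma> f F)"
      unfolding parts_def
    proof (intro allI impI)
      fix \<eta> :: "real^'l => real" and u :: "real^'n => real^'n" assume adm: "admissible flag \<eta>" and th: "u \<in> test_functions W"
      have sm: "smooth u" and sm\<eta>: "smooth \<eta>" using test_functionsD[OF th] adm by (auto simp: admissible_def)
      have lin: "linear (Df \<eta> y)" for y
        using linear_frechet_derivative[OF smooth_differentiable[OF sm\<eta>]] .
      have K: "compact (spt u)" "spt u \<subseteq> W0" using test_functionsD[OF th] WW by auto
      obtain N where N: "\<And>z. z \<in> spt u ==> \<zeta> N z = 1" "\<And>z. z \<in> spt u ==> \<Gamma> z = (\<Sum>j\<le>N. \<xi> j z *\<^sub>R \<Gamma>j j z)"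
        using fin_sum[OF K] by blast
      define uj where "uj j z = \<xi> j z *\<^sub>R u z" for j z
      have uj: "uj j \<in> test_functions W" for j unfolding uj_def by (rule test_functions_smult[OF th \<xi>_smooth])
      have uj_spt: "spt (uj j) \<subseteq> Kj j" for j
        by (rule spt_subset) (use Kj in \<open>auto simp: compact_imp_closed uj_def \<xi>_0\<close>)
      have sum: "u z = (\<Sum>j\<le>N. uj j z)" for z
        unfolding uj_def scaleR_sum_left[symmetric] \<xi>_sum using N(1)[of z] not_in_spt[of z u] by (cases "z \<in> spt u") auto
      have D: "bdry (\<lambda>z. \<eta> (g z *\<^sub>R f z)) (uj j) = (LINT z|\<alpha>. Df \<eta> (g z *\<^sub>R f z)
          (g z *\<^sub>R (F z *v uj j z) + ((uj j z v* P z) \<bullet> \<Gamma>j j z) *\<^sub>R f z))"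
        "integrable \<alpha> (\<lambda>z. Df \<eta> (g z *\<^sub>R f z)
          (g z *\<^sub>R (F z *v uj j z) + ((uj j z v* P z) \<bullet> \<Gamma>j j z) *\<^sub>R f z))"
        "integrable \<beta> (\<lambda>z. \<eta> (g z *\<^sub>R f z) * (uj j z \<bullet> \<nu> z))"
        "integrable \<alpha> (\<lambda>z. \<eta> (g z *\<^sub>R f z) * (tdiv (uj j) z))" for j
        using Q[of j] f F hyp adm uj[of j] uj_spt[of j] unfolding Q_def by blast+
      have jac: "jacobian u (at z) = (\<Sum>j\<le>N. jacobian (uj j) (at z))" for z
      proof -
        have "((\<lambda>z. \<Sum>j\<le>N. uj j z) has_derivative (\<lambda>v. \<Sum>j\<le>N. Df (uj j) z v)) (at z)"
          by (intro has_derivative_sum smooth_has_derivative test_functionsD(1)[OF uj])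
        moreover have "(\<lambda>z. \<Sum>j\<le>N. uj j z) = u" using sum by auto
        ultimately have "Df u z = (\<lambda>v. \<Sum>j\<le>N. Df (uj j) z v)"
          using frechet_derivative_at by metis
        thus ?thesis by (simp add: jacobian_def matrix_def vec_eq_iff)
      qed
      have e1: "(LINT z|\<beta>. \<eta> (g z *\<^sub>R f z) * (u z \<bullet> \<nu> z)) = (\<Sum>j\<le>N. LINT z|\<beta>. \<eta> (g z *\<^sub>R f z) * (uj j z \<bullet> \<nu> z))"
        unfolding sum inner_sum_left sum_distrib_left by (rule Bochner_Integration.integral_sum) (rule D(3))
      have e2: "(LINT z|\<alpha>. \<eta> (g z *\<^sub>R f z) * (tdiv u z)) = (\<Sum>j\<le>N. LINT z|\<alpha>. \<eta> (g z *\<^sub>R f z) * (tdiv (uj j) z))"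
        unfolding jac inner_sum_right sum_distrib_left by (rule Bochner_Integration.integral_sum) (rule D(4))
      have e3: "Df \<eta> (g z *\<^sub>R f z) (product_derivative g \<Gamma> f F z *v u z) =
        (\<Sum>j\<le>N. Df \<eta> (g z *\<^sub>R f z) (g z *\<^sub>R (F z *v uj j z) + ((uj j z v* P z) \<bullet> \<Gamma>j j z) *\<^sub>R f z))" for z
      proof -
        have a: "g z *\<^sub>R (F z *v u z) = (\<Sum>j\<le>N. g z *\<^sub>R (F z *v uj j z))"
          by (subst sum) (simp add: bounded_bilinear.sum_right[OF bounded_bilinear_matrix_vector] scaleR_sum_right)
        have sv: "(\<xi> j z *\<^sub>R u z) v* P z = \<xi> j z *\<^sub>R (u z v* P z)" for j
          using bounded_bilinear.scaleR_left[OF bounded_bilinear_vector_matrix] .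
        have b: "(u z v* P z) \<bullet> \<Gamma> z = (\<Sum>j\<le>N. (uj j z v* P z) \<bullet> \<Gamma>j j z)"
        proof (cases "z \<in> spt u")
          case True
          thus ?thesis by (simp add: N(2) inner_sum_right uj_def sv)
        next
          case False
          thus ?thesis by (simp add: not_in_spt uj_def bounded_bilinear.zero_left[OF bounded_bilinear_vector_matrix])
        qed
        show ?thesis
          unfolding product_derivative_apply a b scaleR_sum_left sum.distrib[symmetric] by (rule linear_sum[OF lin])
      qed
      have "bdry (\<lambda>z. \<eta> (g z *\<^sub>R f z)) u = (\<Sum>j\<le>N. bdry (\<lambda>z. \<eta> (g z *\<^sub>R f z)) (uj j))"
        unfolding bdry_def e1 e2 by (simp add: sum_subtractf)
      also have "\<dots> = (LINT z|\<alpha>. Df \<eta> (g z *\<^sub>R f z) (product_derivative g \<Gamma> f F z *v u z))"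
        unfolding D(1) e3 by (rule Bochner_Integration.integral_sum[symmetric]) (rule D(2))
      finally show "bdry (\<lambda>z. \<eta> (g z *\<^sub>R f z)) u = (LINT z|\<alpha>. Df \<eta> (g z *\<^sub>R f z) (product_derivative g \<Gamma> f F z *v u z))" .
    qed
  qed
qed

end

section \<open>Integration by parts versus boundaries of superlevel sets\<close>

section \<open>Superlevel sets\<close>

lemma frechet_derivative_compose_real:
  fixes h :: "real => real"
  assumes "smooth h" "smooth p"
  shows "Df (\<lambda>y. h (p y)) y v = Df h (p y) (Df p y v)"
  using frechet_derivative_at[OF has_derivative_compose[OF smooth_has_derivative[OF assms(2)] smooth_has_derivative[OF assms(1)]], of y]
  by (metis (mono_tags))

lemma frechet_derivative_affine_norm_sq:
  fixes y :: "'a::real_inner"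
  shows "Df (\<lambda>y. ((norm y)\<^sup>2 - a) * b) y v = 2 * (y \<bullet> v) * b"
proof -
  have "((\<lambda>y. (y \<bullet> y - a) * b) has_derivative (\<lambda>v. (y \<bullet> v + v \<bullet> y - 0) * b)) (at y)"
    by (intro has_derivative_mult_left has_derivative_diff has_derivative_const has_derivative_inner has_derivative_ident)
  from frechet_derivative_at[OF this, symmetric] show ?thesis
    by (simp add: power2_norm_eq_inner inner_commute)
qed

context fv_data
begin

lemma bdry_diff:
  assumes "u \<in> test_functions W" "u' \<in> test_functions W'"
    and "integrable \<beta> (\<lambda>z. \<phi> z * (u z \<bullet> \<nu> z))" "integrable \<alpha> (\<lambda>z. \<phi> z * (tdiv u z))"
    and "integrable \<beta> (\<lambda>z. \<phi> z * (u' z \<bullet> \<nu> z))" "integrable \<alpha> (\<lambda>z. \<phi> z * (tdiv u' z))"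
  shows "bdry \<phi> (\<lambda>z. u z - u' z) = bdry \<phi> u - bdry \<phi> u'"
proof -
  have "jacobian (\<lambda>z. u z - u' z) (at z) = jacobian u (at z) - jacobian u' (at z)" for z
  proof -
    have "((\<lambda>z. u z - u' z) has_derivative (\<lambda>v. Df u z v - Df u' z v)) (at z)"
      using assms(1,2) by (intro has_derivative_diff smooth_has_derivative test_functionsD(1))
    from frechet_derivative_at[OF this, symmetric] show ?thesis
      by (simp add: jacobian_def matrix_def vec_eq_iff)
  qed
  thus ?thesis
    using assms(3-) by (simp add: bdry_def inner_diff_left inner_diff_right right_diff_distrib)
qed

definition above :: "(real^'n => real^'l) => real => real^'n => real" where
  "above f t z = indicator {z. t < norm (f z)} z"

abbreviation level_limit :: "(nat => real^'n => real) => (real^'n => real^'l) => real => (real^'n => real^'n) => bool" where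
  "level_limit \<zeta> f t u \<equiv>
     (\<lambda>j. bdry (above f t) (\<lambda>z. \<zeta> j z *\<^sub>R u z)) \<longlonglongrightarrow> bdry (above f t) u"

text \<open>A lower derivative of \<open>t \<mapsto> \<integral> 1[|f| \<le> t] k d\<alpha>\<close>; it bounds the boundary of the superlevel sets.\<close>

definition slope :: "(real^'n => real^'l) => real => (real^'n => ennreal) => real => ennreal" where
  "slope f c k t = liminf (\<lambda>i. \<integral>\<^sup>+z. ennreal (c * 2 ^ i) * indicator {(t, z). t \<le> norm (f z) \<and> norm (f z) \<le> t + (1/2) ^ i} (t, z) * k z \<partial>\<alpha>)"

lemma slope_mono:
  assumes "c \<le> c'" "\<And>z. k z \<le> k' z"
  shows "slope f c k t \<le> slope f c' k' t"
proof -
  have "ennreal (c * 2 ^ i) \<le> ennreal (c' * 2 ^ i)" for i :: nat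
    using assms(1) by (intro ennreal_leI mult_right_mono) auto
  thus ?thesis
    unfolding slope_def using assms(2)
    by (intro Liminf_mono always_eventually allI nn_integral_mono mult_mono) auto
qed

lemma slope_integrand_measurable:
  fixes f :: "real^'n => real^'l"
  assumes f: "f \<in> Borel" and k: "k \<in> Borel"
  shows "(\<lambda>(t, z). ennreal (c * 2 ^ i) * indicator {(t, z). t \<le> norm (f z) \<and> norm (f z) \<le> t + (1/2) ^ i} (t, z) * k z)
      \<in> borel_measurable (lborel \<Otimes>\<^sub>M \<alpha>)"
proof -
  have "f \<in> borel_measurable \<alpha>" "k \<in> borel_measurable \<alpha>" using f k by measurable
  hence [measurable]: "(\<lambda>p. f (snd p)) \<in> borel_measurable (lborel \<Otimes>\<^sub>M \<alpha>)" "(\<lambda>p. k (snd p)) \<in> borel_measurable (lborel \<Otimes>\<^sub>M \<alpha>)"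
    by (auto intro: measurable_compose[OF measurable_snd])
  have [measurable]: "(\<lambda>p. fst p) \<in> borel_measurable (lborel \<Otimes>\<^sub>M \<alpha>)"
    using measurable_fst[of lborel \<alpha>] by simp
  have "{p \<in> space (lborel \<Otimes>\<^sub>M \<alpha>). fst p \<le> norm (f (snd p)) \<and> norm (f (snd p)) \<le> fst p + (1/2) ^ i} \<in> sets (lborel \<Otimes>\<^sub>M \<alpha>)"
    by (intro sets.sets_Collect_conj borel_measurable_le borel_measurable_add borel_measurable_norm borel_measurable_const) measurable
  also have "{p \<in> space (lborel \<Otimes>\<^sub>M \<alpha>). fst p \<le> norm (f (snd p)) \<and> norm (f (snd p)) \<le> fst p + (1/2) ^ i} = {(t, z). t \<le> norm (f z) \<and> norm (f z) \<le> t + (1/2) ^ i}"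
    by (auto simp: space_pair_measure)
  finally have S: "{(t, z). t \<le> norm (f z) \<and> norm (f z) \<le> t + (1/2) ^ i} \<in> sets (lborel \<Otimes>\<^sub>M \<alpha>)" .
  have "(\<lambda>p. ennreal (c * 2 ^ i) * indicator {(t, z). t \<le> norm (f z) \<and> norm (f z) \<le> t + (1/2) ^ i} p * k (snd p)) \<in> borel_measurable (lborel \<Otimes>\<^sub>M \<alpha>)"
    by (intro borel_measurable_times_ennreal borel_measurable_const borel_measurable_indicator S) measurable
  thus ?thesis by (simp add: split_beta')
qed

lemma slope_measurable:
  assumes f: "f \<in> Borel" and k: "k \<in> Borel"
  shows "slope f c k \<in> borel_measurable lborel"
  using \<alpha>.borel_measurable_nn_integral[OF slope_integrand_measurable[OF assms]]
  unfolding slope_def[abs_def] by (intro borel_measurable_liminf) simp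

text \<open>By Fatou's lemma and Fubini's theorem: for fixed \<open>z\<close>, the levels
  \<open>t\<close> that count form an interval of length \<open>(1/2) ^ i\<close>, which cancels the
  factor \<open>2 ^ i\<close>.\<close>

lemma slope_integral:
  assumes f [measurable]: "f \<in> Borel" and k [measurable]: "k \<in> Borel" and c: "0 \<le> c"
  shows "(\<integral>\<^sup>+t. slope f c k t \<partial>lborel) \<le> ennreal c * (\<integral>\<^sup>+z. k z \<partial>\<alpha>)"
proof -
  interpret pair_sigma_finite lborel \<alpha> ..
  let ?h = "\<lambda>i t z. ennreal (c * 2 ^ i) * indicator {(t, z). t \<le> norm (f z) \<and> norm (f z) \<le> t + (1/2) ^ i} (t, z) * k z"
  have m: "(\<lambda>(t, z). ?h i t z) \<in> borel_measurable (lborel \<Otimes>\<^sub>M \<alpha>)" for i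
    by (rule slope_integrand_measurable[OF f k])
  have "(\<integral>\<^sup>+t. slope f c k t \<partial>lborel) \<le> liminf (\<lambda>i. \<integral>\<^sup>+t. (\<integral>\<^sup>+z. ?h i t z \<partial>\<alpha>) \<partial>lborel)"
    unfolding slope_def using \<alpha>.borel_measurable_nn_integral[OF m] by (intro nn_integral_liminf) simp
  also have "\<dots> = liminf (\<lambda>i::nat. ennreal c * (\<integral>\<^sup>+z. k z \<partial>\<alpha>))"
  proof (intro arg_cong[of _ _ liminf] ext)
    fix i
    have "(\<integral>\<^sup>+t. (\<integral>\<^sup>+z. ?h i t z \<partial>\<alpha>) \<partial>lborel) = (\<integral>\<^sup>+z. (\<integral>\<^sup>+t. ?h i t z \<partial>lborel) \<partial>\<alpha>)"
      using Fubini'[OF m[of i]] by simp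
    also have "\<dots> = (\<integral>\<^sup>+z. ennreal c * k z \<partial>\<alpha>)"
    proof (rule nn_integral_cong)
      fix z
      have "(\<integral>\<^sup>+t. ?h i t z \<partial>lborel) = (\<integral>\<^sup>+t. (ennreal (c * 2 ^ i) * k z) * indicator {norm (f z) - (1/2) ^ i..norm (f z)} t \<partial>lborel)"
        by (intro nn_integral_cong) (auto simp: indicator_def mult_ac)
      also have "\<dots> = (ennreal (c * 2 ^ i) * k z) * ennreal ((1/2) ^ i)"
        by (subst nn_integral_cmult_indicator) auto
      also have "\<dots> = (ennreal (c * 2 ^ i) * ennreal ((1/2) ^ i)) * k z" by (simp only: mult_ac)
      also have "ennreal (c * 2 ^ i) * ennreal ((1/2) ^ i) = ennreal (c * 2 ^ i * (1/2) ^ i)"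
        using c by (intro ennreal_mult[symmetric]) auto
      also have "c * 2 ^ i * (1/2) ^ i = c" by (simp add: power_one_over)
      finally show "(\<integral>\<^sup>+t. ?h i t z \<partial>lborel) = ennreal c * k z" .
    qed
    also have "\<dots> = ennreal c * (\<integral>\<^sup>+z. k z \<partial>\<alpha>)" by (rule nn_integral_cmult) simp
    finally show "(\<integral>\<^sup>+t. (\<integral>\<^sup>+z. ?h i t z \<partial>\<alpha>) \<partial>lborel) = ennreal c * (\<integral>\<^sup>+z. k z \<partial>\<alpha>)" .
  qed
  also have "\<dots> = ennreal c * (\<integral>\<^sup>+z. k z \<partial>\<alpha>)" by (simp add: Liminf_const)
  finally show ?thesis .
qed

lemma above_integrable:
  fixes f :: "real^'n => real^'l"
  assumes [measurable]: "f \<in> Borel" and fin: "superlevel_finite True W f"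
    and th: "u \<in> test_functions W" and t: "0 < t"
  shows "integrable \<beta> (\<lambda>z. above f t z * (u z \<bullet> \<nu> z))" "integrable \<alpha> (\<lambda>z. above f t z * (tdiv u z))"
proof -
  have K: "compact (spt u)" "spt u \<subseteq> W" using test_functionsD[OF th] by auto
  have [measurable]: "spt u \<in> sets borel" using K by (auto intro: borel_compact)
  have m: "(\<lambda>z. above f t z) \<in> Borel" unfolding above_def by measurable
  have A: "{z \<in> spt u. t \<le> norm (f z)} \<in> sets borel" by measurable
  have fA: "emeasure \<alpha> {z \<in> spt u. t \<le> norm (f z)} < \<infinity>" "emeasure \<beta> {z \<in> spt u. t \<le> norm (f z)} < \<infinity>"
    using fin K t unfolding superlevel_finite_def by (force, force)
  show "integrable \<beta> (\<lambda>z. above f t z * (u z \<bullet> \<nu> z))" "integrable \<alpha> (\<lambda>z. above f t z * (tdiv u z))"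
    by (rule bdry_integrable[OF th m A fA, of 1]; simp add: above_def indicator_def)+
qed

text \<open>Integration by parts is applied to radial functions rising from \<open>0\<close> to
  \<open>1\<close> across the shell between \<open>t\<close> and \<open>t + (1/2) ^ i\<close>, whose
  gradients are of order \<open>2 ^ i\<close>. The parameter \<open>s\<close> makes the constant
  uniform for levels \<open>t \<ge> s\<close>, and \<open>c0\<close> depends on neither the
  functions nor the level.\<close>

lemma above_bound:
  fixes f :: "real^'n => real^'l" and F :: "real^'n => real^'n^'l"
  shows "\<exists>c0>0. \<forall>W f F u s t. f \<in> Borel \<longrightarrow> F \<in> Borel \<longrightarrow>
    parts True W (f :: real^'n => real^'l) F \<longrightarrow> superlevel_finite True W f \<longrightarrow> loc_integrable W F \<longrightarrow>
    u \<in> test_functions W \<longrightarrow> 0 < s \<longrightarrow> s \<le> t \<longrightarrow>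
    ennreal \<bar>bdry (above f t) u\<bar> \<le> slope f (c0 * (1 + 1 / s)) (\<lambda>z. ennreal (norm (u z) * norm (F z))) t"
proof -
  obtain Cs where Cs: "0 < Cs" "\<And>x v. \<bar>Df step x v\<bar> \<le> Cs * \<bar>v\<bar>"
    "\<And>x v. x \<notin> {0..1} ==> Df step x v = 0"
    using step_derivative_bounded by blast
  obtain Km where Km: "0 < Km" "\<And>(A::real^'n^'l) v. norm (A *v v) \<le> norm A * norm v * Km"
    using bounded_bilinear.pos_bounded[OF bounded_bilinear_matrix_vector] by blast
  show ?thesis
  proof (intro exI[of _ "Cs * Km"] conjI allI impI)
    show "0 < Cs * Km" using Cs Km by simp
    fix W and f :: "real^'n => real^'l" and F :: "real^'n => real^'n^'l" and u :: "real^'n => real^'n" and s t :: real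
    assume f [measurable]: "f \<in> Borel" and F [measurable]: "F \<in> Borel"
      and parts: "parts True W f F" and fin: "superlevel_finite True W f" and Fint: "loc_integrable W F"
      and th: "u \<in> test_functions W" and s: "0 < s" and st: "s \<le> t"
    have t: "0 < t" using s st by simp
    note [measurable] = test_functions_borel[OF th] test_functions_borel[OF test_functions_jacobian[OF th]]
    have K: "compact (spt u)" "spt u \<subseteq> W" using test_functionsD[OF th] by auto
    have [measurable]: "spt u \<in> sets borel" using K by (auto intro: borel_compact)
    \<comment> \<open>Chosen so that
      \<open>t\<^sup>2 + \<delta> i \<le> (t + (1/2) ^ i)\<^sup>2\<close>: the transition region of
      \<open>\<eta> i\<close> then lies in the shell that enters \<open>slope\<close>.\<close>
    define \<delta> where "\<delta> i = 2 * t * (1/2) ^ i" for i :: nat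
    have \<delta>: "0 < \<delta> i" for i using t by (simp add: \<delta>_def)
    define p where "p i y = ((norm y)\<^sup>2 - t\<^sup>2) * inverse (\<delta> i)" for i and y :: "real^'l"
    define \<eta> where "\<eta> i y = step (p i y)" for i y
    have p_sm: "smooth (p i)" for i unfolding p_def by (intro smooth_mult smooth_diff smooth_const smooth_norm_sq smooth_ident)
    have \<eta>_sm: "smooth (\<eta> i)" for i unfolding \<eta>_def by (intro smooth_step_compose p_sm)
    have D\<eta>: "Df (\<eta> i) y v = Df step (p i y) (2 * (y \<bullet> v) * inverse (\<delta> i))" for i y v
      unfolding \<eta>_def frechet_derivative_compose_real[OF smooth_step p_sm]
      unfolding p_def frechet_derivative_affine_norm_sq ..
    have p01: "t \<le> norm y \<and> norm y \<le> t + (1/2) ^ i" if "p i y \<in> {0..1}" for i y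
    proof -
      have "0 \<le> (norm y)\<^sup>2 - t\<^sup>2" "(norm y)\<^sup>2 - t\<^sup>2 \<le> \<delta> i"
        using that \<delta>[of i] by (auto simp: p_def field_simps zero_le_mult_iff)
      hence "t\<^sup>2 \<le> (norm y)\<^sup>2" "(norm y)\<^sup>2 \<le> t\<^sup>2 + \<delta> i" by simp_all
      moreover have "t\<^sup>2 + \<delta> i \<le> (t + (1/2) ^ i)\<^sup>2" by (simp add: \<delta>_def power2_sum)
      ultimately have "t\<^sup>2 \<le> (norm y)\<^sup>2" "(norm y)\<^sup>2 \<le> (t + (1/2) ^ i)\<^sup>2" by linarith+
      thus ?thesis using t by (auto dest!: power2_le_imp_le)
    qed
    have adm: "admissible True (\<eta> i)" for i
      unfolding admissible_def
    proof (intro conjI impI \<eta>_sm)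
      have "{y. Df (\<eta> i) y \<noteq> (\<lambda>_. 0)} \<subseteq> cball 0 (t + (1/2) ^ i)"
      proof (clarsimp)
        fix y assume "Df (\<eta> i) y \<noteq> (\<lambda>_. 0)"
        hence "p i y \<in> {0..1}" using Cs(3)[of "p i y"] by (auto simp: D\<eta> fun_eq_iff)
        thus "norm y \<le> t + (1/2) ^ i" using p01 by blast
      qed
      thus "compact (closure {y. Df (\<eta> i) y \<noteq> (\<lambda>_. 0)})"
        unfolding compact_closure_iff by (rule bounded_subset[OF bounded_cball])
      show "\<forall>y y'. norm y = norm y' \<longrightarrow> \<eta> i y = \<eta> i y'" by (simp add: \<eta>_def p_def)
      show "\<exists>r>0. \<forall>y. norm y < r \<longrightarrow> \<eta> i y = 0"
      proof (intro exI[of _ t] conjI allI impI t)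
        fix y :: "real^'l" assume "norm y < t"
        hence "(norm y)\<^sup>2 \<le> t\<^sup>2" by (intro power_mono) auto
        thus "\<eta> i y = 0" unfolding \<eta>_def p_def using \<delta>[of i] by (intro step_0 mult_nonpos_nonneg) auto
      qed
    qed
    have \<eta>_range: "0 \<le> \<eta> i y" "\<eta> i y \<le> 1" for i y unfolding \<eta>_def by (rule step_range)+
    have \<eta>_van: "\<eta> i y = 0" if "norm y \<le> t" for i y
    proof -
      have "(norm y)\<^sup>2 \<le> t\<^sup>2" using that by (intro power_mono) auto
      thus ?thesis unfolding \<eta>_def p_def using \<delta>[of i] by (intro step_0 mult_nonpos_nonneg) auto
    qed
    have \<delta>_lim: "\<delta> \<longlonglongrightarrow> 0" unfolding \<delta>_def
      using tendsto_mult_right_zero[OF LIMSEQ_power_zero[of "1/2::real"]] by simp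
    have \<eta>_lim: "(\<lambda>i. \<eta> i (f z)) \<longlonglongrightarrow> above f t z" for z
    proof (cases "t < norm (f z)")
      case True
      hence "0 < (norm (f z))\<^sup>2 - t\<^sup>2" using power_strict_mono[OF True, of 2] t by simp
      from order_tendstoD(2)[OF \<delta>_lim this]
      have "\<forall>\<^sub>F i in sequentially. \<eta> i (f z) = 1"
      proof eventually_elim
        case (elim i)
        thus ?case unfolding \<eta>_def p_def using \<delta>[of i] by (intro step_1) (simp add: field_simps)
      qed
      thus ?thesis using True by (simp add: above_def tendsto_eventually)
    next
      case False
      thus ?thesis by (simp add: \<eta>_van above_def)
    qed
    note [measurable] = smooth_borel[OF \<eta>_sm]
    have A [measurable]: "{z \<in> spt u. t \<le> norm (f z)} \<in> sets borel" by measurable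
    have fA: "emeasure \<alpha> {z \<in> spt u. t \<le> norm (f z)} < \<infinity>" "emeasure \<beta> {z \<in> spt u. t \<le> norm (f z)} < \<infinity>"
      using fin K t unfolding superlevel_finite_def by (force, force)
    let ?A = "{z \<in> spt u. t \<le> norm (f z)}"
    have am [measurable]: "above f t \<in> Borel" unfolding above_def[abs_def] by measurable
    have w: "integrable \<beta> (\<lambda>z. indicator ?A z * (u z \<bullet> \<nu> z))" "integrable \<alpha> (\<lambda>z. indicator ?A z * (tdiv u z))"
      by (rule bdry_integrable[OF th _ A fA, of _ 1]; simp add: indicator_def)+
    have dom: "\<bar>\<eta> i (f z) * x\<bar> \<le> \<bar>indicator ?A z * x\<bar>" if "z \<notin> spt u ==> x = 0" for i z x
      using \<eta>_range[of i "f z"] \<eta>_van[of "f z" i] that by (auto simp: indicator_def abs_mult intro: mult_left_le_one_le)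
    have lim1: "(\<lambda>i. LINT z|\<beta>. \<eta> i (f z) * (u z \<bullet> \<nu> z)) \<longlonglongrightarrow> (LINT z|\<beta>. above f t z * (u z \<bullet> \<nu> z))"
    proof (rule integral_dominated_convergence[where w="\<lambda>z. \<bar>indicator ?A z * (u z \<bullet> \<nu> z)\<bar>"])
      show "AE z in \<beta>. (\<lambda>i. \<eta> i (f z) * (u z \<bullet> \<nu> z)) \<longlonglongrightarrow> above f t z * (u z \<bullet> \<nu> z)"
        by (intro AE_I2 tendsto_mult_right \<eta>_lim)
      show "AE z in \<beta>. norm (\<eta> i (f z) * (u z \<bullet> \<nu> z)) \<le> \<bar>indicator ?A z * (u z \<bullet> \<nu> z)\<bar>" for i
        unfolding real_norm_def by (intro AE_I2 dom) (simp add: not_in_spt)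
    qed (use w in auto)
    have lim2: "(\<lambda>i. LINT z|\<alpha>. \<eta> i (f z) * (tdiv u z)) \<longlonglongrightarrow> (LINT z|\<alpha>. above f t z * (tdiv u z))"
    proof (rule integral_dominated_convergence[where w="\<lambda>z. \<bar>indicator ?A z * (tdiv u z)\<bar>"])
      show "AE z in \<alpha>. (\<lambda>i. \<eta> i (f z) * (tdiv u z)) \<longlonglongrightarrow> above f t z * (tdiv u z)"
        by (intro AE_I2 tendsto_mult_right \<eta>_lim)
      show "AE z in \<alpha>. norm (\<eta> i (f z) * (tdiv u z)) \<le> \<bar>indicator ?A z * (tdiv u z)\<bar>" for i
        unfolding real_norm_def by (intro AE_I2 dom) (simp add: jacobian_notin_spt)
    qed (use w in auto)
    let ?c = "Cs * Km * (1 + 1 / s)"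
    have est: "ennreal \<bar>bdry (\<lambda>z. \<eta> i (f z)) u\<bar> \<le> (\<integral>\<^sup>+z. ennreal (?c * 2 ^ i) * indicator {(t, z). t \<le> norm (f z) \<and> norm (f z) \<le> t + (1/2) ^ i} (t, z) * ennreal (norm (u z) * norm (F z)) \<partial>\<alpha>)" for i
    proof -
      have "bdry (\<lambda>z. \<eta> i (f z)) u = (LINT z|\<alpha>. Df (\<eta> i) (f z) (F z *v u z))"
        using parts adm th unfolding parts_def by blast
      hence "ennreal \<bar>bdry (\<lambda>z. \<eta> i (f z)) u\<bar> = ennreal (norm (LINT z|\<alpha>. Df (\<eta> i) (f z) (F z *v u z)))"
        by simp
      \<comment> \<open>This holds also if the integrand is not integrable, as the integral on the
        left is then \<open>0\<close>.\<close>
      also have "\<dots> \<le> (\<integral>\<^sup>+z. ennreal (norm (Df (\<eta> i) (f z) (F z *v u z))) \<partial>\<alpha>)"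
        by (cases "integrable \<alpha> (\<lambda>z. Df (\<eta> i) (f z) (F z *v u z))")
          (use integral_norm_bound_ennreal[of \<alpha> "\<lambda>z. Df (\<eta> i) (f z) (F z *v u z)"] in \<open>auto simp: not_integrable_integral_eq\<close>)
      also have "\<dots> \<le> (\<integral>\<^sup>+z. ennreal (?c * 2 ^ i) * indicator {(t, z). t \<le> norm (f z) \<and> norm (f z) \<le> t + (1/2) ^ i} (t, z) * ennreal (norm (u z) * norm (F z)) \<partial>\<alpha>)"
      proof (rule nn_integral_mono)
        fix z
        show "ennreal (norm (Df (\<eta> i) (f z) (F z *v u z))) \<le> ennreal (?c * 2 ^ i) * indicator {(t, z). t \<le> norm (f z) \<and> norm (f z) \<le> t + (1/2) ^ i} (t, z) * ennreal (norm (u z) * norm (F z))"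
        proof (cases "p i (f z) \<in> {0..1}")
          case True
          hence r: "t \<le> norm (f z)" "norm (f z) \<le> t + (1/2) ^ i" using p01 by blast+
          have "(1/2::real) ^ i \<le> 1" by (simp add: power_le_one)
          hence f1: "norm (f z) \<le> t + 1" using r by linarith
          have "\<bar>Df (\<eta> i) (f z) (F z *v u z)\<bar> \<le> Cs * \<bar>2 * (f z \<bullet> (F z *v u z)) * inverse (\<delta> i)\<bar>"
            unfolding D\<eta> by (rule Cs)
          also have "\<dots> = Cs * (2 * inverse (\<delta> i)) * \<bar>f z \<bullet> (F z *v u z)\<bar>"
            using \<delta>[of i] by (simp add: abs_mult)
          also have "\<dots> \<le> Cs * (2 * inverse (\<delta> i)) * ((t + 1) * (norm (F z) * norm (u z) * Km))"
            using Cs(1) \<delta>[of i] f1 Km(2)[of "F z" "u z"] t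
            by (intro mult_left_mono order_trans[OF Cauchy_Schwarz_ineq2] mult_mono) auto
          also have "2 * inverse (\<delta> i) = inverse t * 2 ^ i"
          proof -
            have "(1/2::real) ^ i = inverse (2 ^ i)" by (simp add: power_one_over inverse_eq_divide)
            hence "2 * inverse (\<delta> i) = 2 * (inverse 2 * inverse t * 2 ^ i)"
              unfolding \<delta>_def by (simp only: inverse_mult_distrib inverse_inverse_eq)
            thus ?thesis by simp
          qed
          \<comment> \<open>The factor \<open>1 + 1 / t\<close> stems from
            \<open>norm (f z) \<le> t + 1\<close> and from the factor \<open>t\<close> in
            \<open>\<delta> i\<close>.\<close>
          also have "Cs * (inverse t * 2 ^ i) * ((t + 1) * (norm (F z) * norm (u z) * Km)) = (Cs * Km * (1 + 1 / t) * 2 ^ i) * (norm (u z) * norm (F z))"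
            using t by (simp add: field_simps)
          also have "\<dots> \<le> (?c * 2 ^ i) * (norm (u z) * norm (F z))"
            using Cs(1) Km(1) s st t by (intro mult_right_mono mult_left_mono add_left_mono divide_left_mono) auto
          finally have "norm (Df (\<eta> i) (f z) (F z *v u z)) \<le> (?c * 2 ^ i) * (norm (u z) * norm (F z))" by simp
          moreover have "0 \<le> ?c * 2 ^ i" using Cs Km s by simp
          ultimately show ?thesis using r by (simp add: ennreal_mult[symmetric] ennreal_leI)
        next
          case False
          thus ?thesis by (simp add: D\<eta> Cs(3))
        qed
      qed
      finally show ?thesis .
    qed
    have "(\<lambda>i. bdry (\<lambda>z. \<eta> i (f z)) u) \<longlonglongrightarrow> bdry (above f t) u"
      unfolding bdry_def by (intro tendsto_diff lim1 lim2)
    hence "(\<lambda>i. ennreal \<bar>bdry (\<lambda>z. \<eta> i (f z)) u\<bar>) \<longlonglongrightarrow> ennreal \<bar>bdry (above f t) u\<bar>"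
      by (intro tendsto_ennrealI tendsto_rabs)
    hence "ennreal \<bar>bdry (above f t) u\<bar> = liminf (\<lambda>i. ennreal \<bar>bdry (\<lambda>z. \<eta> i (f z)) u\<bar>)"
      by (intro lim_imp_Liminf[symmetric]) auto
    also have "\<dots> \<le> slope f ?c (\<lambda>z. ennreal (norm (u z) * norm (F z))) t"
      unfolding slope_def by (intro Liminf_mono always_eventually allI est)
    finally show "ennreal \<bar>bdry (above f t) u\<bar> \<le> slope f ?c (\<lambda>z. ennreal (norm (u z) * norm (F z))) t" .
  qed
qed

end

context fv_data
begin

text \<open>If \<open>\<zeta> j\<close> are cutoff functions exhausting \<open>U\<close>, then for almost all levels \<open>t\<close> the
  convergence of \<open>bdry (above f t) (\<zeta> j u)\<close> expresses that the boundary of the superlevel set has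
  no part on \<open>\<partial>U \<inter> W\<close>.  It is equivalent to integration by parts in \<open>W\<close>.\<close>

lemma parts_from_levels:
  fixes f :: "real^'n => real^'l" and F :: "real^'n => real^'n^'l" and \<zeta> :: "nat => real^'n => real"
  assumes f [measurable]: "f \<in> Borel" and F [measurable]: "F \<in> Borel"
    and UW: "U \<subseteq> W" and partsU: "parts True U f F" and fin: "superlevel_finite True W f"
    and Fint: "loc_integrable W F"
    and \<zeta>: "\<And>j. \<zeta> j \<in> test_functions U" "\<And>j z. 0 \<le> \<zeta> j z" "\<And>j z. \<zeta> j z \<le> 1"
      "\<And>z. z \<in> U ==> (\<lambda>j. \<zeta> j z) \<longlonglongrightarrow> 1"
    and levels: "\<And>u. u \<in> test_functions W ==> AE t in lborel. 0 < t \<longrightarrow>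
      level_limit \<zeta> f t u"
  shows "parts True W f F"
  unfolding parts_def
proof (intro allI impI)
  fix \<eta> :: "real^'l => real" and u :: "real^'n => real^'n"
  assume adm: "admissible True \<eta>" and th: "u \<in> test_functions W"
  obtain c0 where c0p: "0 < c0" and c0_all: "\<forall>W f F u s t. f \<in> Borel \<longrightarrow> F \<in> Borel \<longrightarrow>
    parts True W (f :: real^'n => real^'l) F \<longrightarrow> superlevel_finite True W f \<longrightarrow> loc_integrable W F \<longrightarrow>
    u \<in> test_functions W \<longrightarrow> 0 < s \<longrightarrow> s \<le> t \<longrightarrow>
    ennreal \<bar>bdry (above f t) u\<bar> \<le> slope f (c0 * (1 + 1 / s)) (\<lambda>z. ennreal (norm (u z) * norm (F z))) t"
    using above_bound[where 'l='l] by blast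
  note c0 = c0p c0_all[rule_format]
  have finU: "superlevel_finite True U f" using fin UW unfolding superlevel_finite_def by blast
  have FintU: "loc_integrable U F" using Fint UW unfolding loc_integrable_def by blast
  have sm\<eta>: "smooth \<eta>" using adm by (simp add: admissible_def)
  note [measurable] = test_functions_borel[OF th] test_functions_borel[OF test_functions_jacobian[OF th]] smooth_borel[OF sm\<eta>]
  have lin: "linear (Df \<eta> y)" for y
    using linear_frechet_derivative[OF smooth_differentiable[OF sm\<eta>]] .
  have K: "compact (spt u)" "spt u \<subseteq> W" using test_functionsD[OF th] by auto
  have [measurable]: "spt u \<in> sets borel" using K by (auto intro: borel_compact)
  obtain B where B: "0 < B" "\<And>z. norm (u z) \<le> B" "\<And>z. norm (jacobian u (at z)) \<le> B"
    using test_bounds[OF th] by blast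
  obtain C where C: "0 < C" "\<And>y. \<bar>\<eta> y\<bar> \<le> C" "\<And>y v. \<bar>Df \<eta> y v\<bar> \<le> C * norm v"
    using admissible_bounds[OF adm] by blast
  obtain Km where Km: "0 < Km" "\<And>(A::real^'n^'l) v. norm (A *v v) \<le> norm A * norm v * Km"
    using bounded_bilinear.pos_bounded[OF bounded_bilinear_matrix_vector] by blast
  obtain r where r: "0 < r" "\<And>y. norm y < r ==> \<eta> y = 0"
    using adm unfolding admissible_def by blast
  have radial: "norm y = norm y' ==> \<eta> y = \<eta> y'" for y y' using adm unfolding admissible_def by blast
  obtain R where R: "\<And>y. Df \<eta> y \<noteq> (\<lambda>_. 0) ==> norm y \<le> R"
    using adm by (auto simp: admissible_def compact_closure_iff bounded_iff)
  obtain e :: "real^'l" where e: "norm e = 1" using vector_choose_size[of 1] by auto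
  \<comment> \<open>The derivative of the radial profile of \<eta> along an arbitrary unit vector
    \<open>e\<close>. The cut at \<open>r/2\<close> lies inside the ball on which \<eta> is known to
    vanish.\<close>
  define b where "b t = indicator {r/2..} t * Df \<eta> (t *\<^sub>R e) e" for t :: real
  have b_cont: "continuous_on UNIV (\<lambda>t::real. Df \<eta> (t *\<^sub>R e) e)"
    by (intro continuous_on_compose2[OF smooth_continuous[OF smooth_frechet_derivative[OF sm\<eta>]]] continuous_intros) auto
  have [measurable]: "b \<in> Borel"
    unfolding b_def using borel_measurable_continuous_onI[OF b_cont] by measurable
  have b_le: "\<bar>b t\<bar> \<le> C * indicator {r/2..max R 0} t" for t
  proof (cases "t \<in> {r/2..max R 0}")
    case True
    thus ?thesis using C(3)[of "t *\<^sub>R e" e] e C(1) by (auto simp: b_def indicator_def)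
  next
    case False
    show ?thesis
    proof (cases "r/2 \<le> t")
      case True
      hence "R < norm (t *\<^sub>R e)" using False e r(1) by auto
      hence "Df \<eta> (t *\<^sub>R e) = (\<lambda>_. 0)" using R[of "t *\<^sub>R e"] by auto
      thus ?thesis using C by (simp add: b_def)
    qed (use C in \<open>simp add: b_def\<close>)
  qed
  \<comment> \<open>The layer cake formula: the fundamental theorem of calculus for the profile
    between \<open>r/2\<close> and \<open>norm (f z)\<close>.\<close>
  have cake: "\<eta> (f z) = (LINT t|lborel. b t * above f t z)" for z
  proof -
    let ?x = "norm (f z)"
    have deriv: "((\<lambda>t. \<eta> (t *\<^sub>R e)) has_real_derivative Df \<eta> (t *\<^sub>R e) e) (at t)" for t
    proof -
      have "((\<lambda>t. \<eta> (t *\<^sub>R e)) has_derivative (\<lambda>s. Df \<eta> (t *\<^sub>R e) (s *\<^sub>R e))) (at t)"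
        by (rule has_derivative_compose[OF bounded_linear_imp_has_derivative[OF bounded_linear_scaleR_left] smooth_has_derivative[OF sm\<eta>]])
      thus ?thesis by (simp add: has_field_derivative_def linear_scale[OF lin] mult_commute_abs)
    qed
    have "\<eta> (f z) = \<eta> (?x *\<^sub>R e)" using e by (intro radial) simp
    also have "\<dots> = (LINT t|lborel. b t * above f t z)"
    proof (cases "r/2 \<le> ?x")
      case True
      have "(LINT t|lborel. indicator {r/2..?x} t *\<^sub>R Df \<eta> (t *\<^sub>R e) e) = \<eta> (?x *\<^sub>R e) - \<eta> ((r/2) *\<^sub>R e)"
        using True by (intro integral_FTC_atLeastAtMost)
          (auto intro: deriv[THEN has_field_derivative_at_within, unfolded has_real_derivative_iff_has_vector_derivative] continuous_on_subset[OF b_cont])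
      moreover have "\<eta> ((r/2) *\<^sub>R e) = 0" using e r by (intro r(2)) auto
      moreover have "(LINT t|lborel. b t * above f t z) = (LINT t|lborel. indicator {r/2..?x} t *\<^sub>R Df \<eta> (t *\<^sub>R e) e)"
      proof (rule integral_cong_AE)
        show "AE t in lborel. b t * above f t z = indicator {r/2..?x} t *\<^sub>R Df \<eta> (t *\<^sub>R e) e"
          using AE_lborel_singleton[of ?x] by eventually_elim (auto simp: b_def above_def indicator_def)
        show "(\<lambda>t. b t * above f t z) \<in> borel_measurable lborel" unfolding above_def by measurable
        show "(\<lambda>t. indicator {r/2..?x} t *\<^sub>R Df \<eta> (t *\<^sub>R e) e) \<in> borel_measurable lborel"
          using borel_measurable_continuous_onI[OF b_cont] by measurable
      qed
      ultimately show ?thesis by simp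
    next
      case False
      hence "\<eta> (?x *\<^sub>R e) = 0" using e r(1) by (intro r(2)) auto
      moreover have "b t * above f t z = 0" for t using False by (auto simp: b_def above_def indicator_def)
      ultimately show ?thesis by (simp only: Bochner_Integration.integral_zero)
    qed
    finally show ?thesis .
  qed
  \<comment> \<open>The boundary functional of \<eta> \<circ> f is a superposition, with signed
    weight \<open>b\<close>, of those of the superlevel sets.\<close>
  have fubini: "bdry (\<lambda>z. \<eta> (f z)) \<xi> = (LINT t|lborel. b t * bdry (above f t) \<xi>) \<and> (\<lambda>t. b t * bdry (above f t) \<xi>) \<in> borel_measurable lborel"
    if \<xi>: "\<xi> \<in> test_functions W" for \<xi>
  proof -
    have K\<xi>: "compact (spt \<xi>)" "spt \<xi> \<subseteq> W" using test_functionsD[OF \<xi>] by auto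
    have [measurable]: "spt \<xi> \<in> sets borel" using K\<xi> by (auto intro: borel_compact)
    note [measurable] = test_functions_borel[OF \<xi>] test_functions_borel[OF test_functions_jacobian[OF \<xi>]]
    obtain B where B: "0 < B" "\<And>z. norm (\<xi> z) \<le> B" "\<And>z. norm (jacobian \<xi> (at z)) \<le> B"
      using test_bounds[OF \<xi>] by blast
    define A where "A = {z \<in> spt \<xi>. r/2 \<le> norm (f z)}"
    have [measurable]: "A \<in> sets borel" unfolding A_def by measurable
    have "emeasure \<alpha> {z \<in> spt \<xi>. True \<longrightarrow> r/2 \<le> norm (f z)} < \<infinity> \<and> emeasure \<beta> {z \<in> spt \<xi>. True \<longrightarrow> r/2 \<le> norm (f z)} < \<infinity>"
      using fin K\<xi> half_gt_zero[OF r(1)] unfolding superlevel_finite_def by blast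
    hence finA: "emeasure \<alpha> A < \<infinity>" "emeasure \<beta> A < \<infinity>"
      by (auto simp: A_def)
    \<comment> \<open>Stated for a general measure in order to be applied to both \<alpha> and
      \<beta>.\<close>
    have swap: "(LINT z|\<mu>. \<eta> (f z) * h z) = (LINT t|lborel. b t * (LINT z|\<mu>. above f t z * h z)) \<and>
        (\<lambda>t. b t * (LINT z|\<mu>. above f t z * h z)) \<in> borel_measurable lborel \<and>
        integrable lborel (\<lambda>t. b t * (LINT z|\<mu>. above f t z * h z))"
      if mu: "open_measure U \<mu>" and h [measurable]: "h \<in> Borel" and hb: "\<And>z. \<bar>h z\<bar> \<le> D" and h0: "\<And>z. z \<notin> spt \<xi> ==> h z = 0"
        and fA: "emeasure \<mu> A < \<infinity>" for \<mu> h D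
    proof -
      interpret \<mu>: open_measure U \<mu> by fact
      interpret pair_sigma_finite lborel \<mu> ..
      have D0: "0 \<le> D" using hb[of 0] by linarith
      have fm: "f \<in> borel_measurable \<mu>" "h \<in> borel_measurable \<mu>" by measurable
      have bm: "b \<in> borel_measurable lborel" by measurable
      have m1: "(\<lambda>p. f (snd p)) \<in> borel_measurable (lborel \<Otimes>\<^sub>M \<mu>)" "(\<lambda>p. h (snd p)) \<in> borel_measurable (lborel \<Otimes>\<^sub>M \<mu>)" "(\<lambda>p. b (fst p)) \<in> borel_measurable (lborel \<Otimes>\<^sub>M \<mu>)"
        by (rule measurable_compose[OF measurable_snd fm(1)] measurable_compose[OF measurable_snd fm(2)] measurable_compose[OF measurable_fst bm])+
      have m2: "(\<lambda>p. fst p) \<in> borel_measurable (lborel \<Otimes>\<^sub>M \<mu>)"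
        using measurable_fst[of lborel \<mu>] by simp
      have "{p \<in> space (lborel \<Otimes>\<^sub>M \<mu>). fst p < norm (f (snd p))} \<in> sets (lborel \<Otimes>\<^sub>M \<mu>)"
        by (rule borel_measurable_less[OF m2 measurable_compose[OF m1(1) borel_measurable_norm]])
      hence S: "{p. fst p < norm (f (snd p))} \<in> sets (lborel \<Otimes>\<^sub>M \<mu>)" by (simp add: space_pair_measure)
      have ind: "above f t z = indicator {p. fst p < norm (f (snd p))} (t, z)" for t z by (simp add: above_def indicator_def)
      have m: "(\<lambda>p. b (fst p) * (above f (fst p) (snd p) * h (snd p))) \<in> borel_measurable (lborel \<Otimes>\<^sub>M \<mu>)"
        unfolding ind prod.collapse by (intro borel_measurable_times m1 borel_measurable_indicator S)
      have int: "integrable (lborel \<Otimes>\<^sub>M \<mu>) (\<lambda>(t, z). b t * (above f t z * h z))"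
      proof (rule integrableI_bounded_set[of "{r/2..max R 0} \<times> A" _ _ "C * D"])
        show "(\<lambda>(t, z). b t * (above f t z * h z)) \<in> borel_measurable (lborel \<Otimes>\<^sub>M \<mu>)" using m by (simp add: split_beta')
        show "{r/2..max R 0} \<times> A \<in> sets (lborel \<Otimes>\<^sub>M \<mu>)" by (intro pair_measureI) auto
        have "emeasure (lborel \<Otimes>\<^sub>M \<mu>) ({r/2..max R 0} \<times> A) = emeasure lborel {r/2..max R 0} * emeasure \<mu> A"
          by (intro \<mu>.emeasure_pair_measure_Times) auto
        also have "\<dots> < \<infinity>" using fA emeasure_lborel_cbox_finite[of "r/2" "max R 0"] by (simp add: ennreal_mult_less_top)
        finally show "emeasure (lborel \<Otimes>\<^sub>M \<mu>) ({r/2..max R 0} \<times> A) < \<infinity>" .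
        have eq0: "b t * (above f t z * h z) = 0" if "(t, z) \<notin> {r/2..max R 0} \<times> A" for t z
        proof (cases "t \<in> {r/2..max R 0}")
          case True
          hence "z \<notin> A" using that by auto
          hence "z \<notin> spt \<xi> \<or> \<not> t < norm (f z)" using True by (auto simp: A_def)
          thus ?thesis using h0 by (auto simp: above_def)
        next
          case False
          thus ?thesis using b_le[of t] by simp
        qed
        show "AE p in lborel \<Otimes>\<^sub>M \<mu>. p \<notin> {r/2..max R 0} \<times> A \<longrightarrow> (case p of (t, z) => b t * (above f t z * h z)) = 0"
          using eq0 by (intro AE_I2) (auto split: prod.split)
        have le: "\<bar>b t * (above f t z * h z)\<bar> \<le> C * D" for t z
        proof -
          have "\<bar>b t\<bar> \<le> C" using b_le[of t] C(1) by (cases "t \<in> {r/2..max R 0}") auto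
          moreover have "\<bar>above f t z * h z\<bar> \<le> D" using hb[of z] D0 by (auto simp: above_def indicator_def)
          ultimately show ?thesis unfolding abs_mult[of "b t"] using C(1) by (intro mult_mono) auto
        qed
        thus "AE p in lborel \<Otimes>\<^sub>M \<mu>. p \<in> {r/2..max R 0} \<times> A \<longrightarrow> norm (case p of (t, z) => b t * (above f t z * h z)) \<le> C * D"
          by (intro AE_I2) (auto split: prod.split)
      qed
      have "(LINT z|\<mu>. \<eta> (f z) * h z) = (LINT z|\<mu>. (LINT t|lborel. b t * (above f t z * h z)))"
        unfolding cake by (intro Bochner_Integration.integral_cong refl) (simp add: mult.assoc[symmetric])
      also have "\<dots> = (LINT t|lborel. (LINT z|\<mu>. b t * (above f t z * h z)))"
        using Fubini_integral[OF int] by simp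
      also have "\<dots> = (LINT t|lborel. b t * (LINT z|\<mu>. above f t z * h z))" by simp
      finally have 1: "(LINT z|\<mu>. \<eta> (f z) * h z) = (LINT t|lborel. b t * (LINT z|\<mu>. above f t z * h z))" .
      have "integrable lborel (\<lambda>t. LINT z|\<mu>. b t * (above f t z * h z))"
        using integrable_fst[OF int] by simp
      hence 2: "integrable lborel (\<lambda>t. b t * (LINT z|\<mu>. above f t z * h z))" by simp
      from 1 2 borel_measurable_integrable[OF 2] show ?thesis by blast
    qed
    have b1: "\<bar>\<xi> z \<bullet> \<nu> z\<bar> \<le> B * C\<nu>" for z by (rule inner_\<nu>_le[OF B(2)])
    have b2: "\<bar>tdiv \<xi> z\<bar> \<le> B * CP" for z by (rule inner_P_le[OF B(3)])
    have s1: "(LINT z|\<beta>. \<eta> (f z) * (\<xi> z \<bullet> \<nu> z)) = (LINT t|lborel. b t * (LINT z|\<beta>. above f t z * (\<xi> z \<bullet> \<nu> z))) \<and>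
        (\<lambda>t. b t * (LINT z|\<beta>. above f t z * (\<xi> z \<bullet> \<nu> z))) \<in> borel_measurable lborel \<and>
        integrable lborel (\<lambda>t. b t * (LINT z|\<beta>. above f t z * (\<xi> z \<bullet> \<nu> z)))"
      by (rule swap[OF \<beta>.open_measure_axioms _ b1 _ finA(2)]) (auto simp: not_in_spt)
    have s2: "(LINT z|\<alpha>. \<eta> (f z) * (tdiv \<xi> z)) = (LINT t|lborel. b t * (LINT z|\<alpha>. above f t z * (tdiv \<xi> z))) \<and>
        (\<lambda>t. b t * (LINT z|\<alpha>. above f t z * (tdiv \<xi> z))) \<in> borel_measurable lborel \<and>
        integrable lborel (\<lambda>t. b t * (LINT z|\<alpha>. above f t z * (tdiv \<xi> z)))"
      by (rule swap[OF \<alpha>.open_measure_axioms _ b2 _ finA(1)]) (auto simp: jacobian_notin_spt)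
    have bd: "b t * bdry (above f t) \<xi> = b t * (LINT z|\<beta>. above f t z * (\<xi> z \<bullet> \<nu> z)) - b t * (LINT z|\<alpha>. above f t z * (tdiv \<xi> z))" for t
      by (simp add: bdry_def right_diff_distrib)
    show ?thesis
      unfolding bd using s1 s2 by (auto simp: bdry_def)
  qed
  have uj: "(\<lambda>z. \<zeta> j z *\<^sub>R u z) \<in> test_functions U" for j
  proof (rule test_functionsI[of _ "spt (\<zeta> j)"])
    show "smooth (\<lambda>z. \<zeta> j z *\<^sub>R u z)" using test_functionsD(1)[OF \<zeta>(1)] test_functionsD(1)[OF th] by (rule smooth_scaleR)
  qed (use test_functionsD[OF \<zeta>(1)[of j]] in \<open>auto simp: not_in_spt\<close>)
  have ujW: "(\<lambda>z. \<zeta> j z *\<^sub>R u z) \<in> test_functions W" for j using test_functions_mono[OF UW uj] .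
  define k where "k z = ennreal (norm (u z) * norm (F z))" for z
  have [measurable]: "k \<in> Borel" unfolding k_def by measurable
  have kint: "(\<integral>\<^sup>+z. k z \<partial>\<alpha>) < \<infinity>"
  proof -
    have "integrable \<alpha> (\<lambda>z. norm (u z) * norm (F z))"
      by (rule loc_integrable_bound[OF Fint K, of _ B]) (use B in \<open>auto simp: not_in_spt intro: mult_right_mono\<close>)
    thus ?thesis unfolding k_def integrable_iff_bounded by simp
  qed
  \<comment> \<open>The weight \<open>b\<close> vanishes below \<open>r/2\<close>, so the constant
    of \<open>above_bound\<close> for \<open>s = r/2\<close> serves all levels that count.\<close>
  define c where "c = c0 * (1 + 1 / (r / 2))"
  have c: "0 \<le> c" using c0(1) r(1) by (simp add: c_def)
  have "(\<integral>\<^sup>+t. slope f c k t \<partial>lborel) < \<infinity>"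
    using slope_integral[OF f _ c, of k] kint by (simp add: ennreal_mult_less_top le_less_trans)
  hence sl_fin: "AE t in lborel. slope f c k t < \<infinity>" and sl_int: "integrable lborel (\<lambda>t. enn2real (slope f c k t))"
  proof -
    assume fin: "(\<integral>\<^sup>+t. slope f c k t \<partial>lborel) < \<infinity>"
    have m [measurable]: "slope f c k \<in> borel_measurable lborel" by (rule slope_measurable) measurable
    show "AE t in lborel. slope f c k t < \<infinity>"
      using nn_integral_noteq_infinite[OF m] fin by (simp add: less_top)
    have "(\<integral>\<^sup>+t. ennreal (enn2real (slope f c k t)) \<partial>lborel) \<le> (\<integral>\<^sup>+t. slope f c k t \<partial>lborel)"
      by (intro nn_integral_mono) (metis ennreal_enn2real_if order_refl zero_le)
    thus "integrable lborel (\<lambda>t. enn2real (slope f c k t))"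
      using fin by (intro integrableI_nonneg) (auto simp: le_less_trans)
  qed
  \<comment> \<open>One integrable function of \<open>t\<close>, the slope, dominates the boundary
    functionals of all \<open>\<zeta> j z *\<^sub>R u z\<close>; pointwise convergence for almost
    all levels is the hypothesis \<open>levels\<close>.\<close>
  have lim1: "(\<lambda>j. LINT t|lborel. b t * bdry (above f t) (\<lambda>z. \<zeta> j z *\<^sub>R u z)) \<longlonglongrightarrow> (LINT t|lborel. b t * bdry (above f t) u)"
  proof (rule integral_dominated_convergence[where w="\<lambda>t. C * enn2real (slope f c k t)"])
    show "AE t in lborel. (\<lambda>j. b t * bdry (above f t) (\<lambda>z. \<zeta> j z *\<^sub>R u z)) \<longlonglongrightarrow> b t * bdry (above f t) u"
      using levels[OF th]
    proof eventually_elim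
      case (elim t)
      show ?case
      proof (cases "r/2 \<le> t")
        case True
        thus ?thesis using elim r(1) by (intro tendsto_mult_left) auto
      qed (simp add: b_def)
    qed
    show "AE t in lborel. norm (b t * bdry (above f t) (\<lambda>z. \<zeta> j z *\<^sub>R u z)) \<le> C * enn2real (slope f c k t)" for j
      using sl_fin
    proof eventually_elim
      case (elim t)
      show ?case
      proof (cases "r/2 \<le> t")
        case True
        have "ennreal \<bar>bdry (above f t) (\<lambda>z. \<zeta> j z *\<^sub>R u z)\<bar> \<le> slope f c (\<lambda>z. ennreal (norm (\<zeta> j z *\<^sub>R u z) * norm (F z))) t"
          unfolding c_def using True r(1) by (intro c0(2)[OF f F partsU finU FintU uj]) auto
        also have "\<dots> \<le> slope f c k t"
          unfolding k_def using \<zeta>(2,3) by (intro slope_mono order_refl ennreal_leI mult_right_mono) (auto intro: mult_left_le_one_le)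
        finally have "ennreal \<bar>bdry (above f t) (\<lambda>z. \<zeta> j z *\<^sub>R u z)\<bar> \<le> ennreal (enn2real (slope f c k t))"
          using elim by simp
        hence "\<bar>bdry (above f t) (\<lambda>z. \<zeta> j z *\<^sub>R u z)\<bar> \<le> enn2real (slope f c k t)"
          by (subst (asm) ennreal_le_iff) auto
        moreover have "\<bar>b t\<bar> \<le> C" using b_le[of t] C(1) by (cases "t \<in> {r/2..max R 0}") auto
        ultimately show ?thesis using C(1) by (auto simp: abs_mult intro: mult_mono)
      qed (use C in \<open>simp add: b_def\<close>)
    qed
  qed (use fubini[OF th] fubini[OF ujW] sl_int in auto)
  have lim2: "(\<lambda>j. LINT z|\<alpha>. Df \<eta> (f z) (F z *v (\<zeta> j z *\<^sub>R u z))) \<longlonglongrightarrow> (LINT z|\<alpha>. Df \<eta> (f z) (F z *v u z))"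
  proof (rule integral_dominated_convergence[where w="\<lambda>z. C * (B * Km) * norm (indicator (spt u) z *\<^sub>R F z)"])
    have [measurable]: "\<zeta> j \<in> Borel" for j using test_functions_borel[OF \<zeta>(1)] .
    show "(\<lambda>z. Df \<eta> (f z) (F z *v u z)) \<in> borel_measurable \<alpha>"
      by (intro derivative_measurable[OF sm\<eta>]) measurable
    show "(\<lambda>z. Df \<eta> (f z) (F z *v (\<zeta> j z *\<^sub>R u z))) \<in> borel_measurable \<alpha>" for j
      by (intro derivative_measurable[OF sm\<eta>]) measurable
    have sc: "Df \<eta> (f z) (F z *v (\<zeta> j z *\<^sub>R u z)) = \<zeta> j z * Df \<eta> (f z) (F z *v u z)" for j z
      by (simp add: matrix_vector_mult_scaleR linear_scale[OF lin])
    show "AE z in \<alpha>. (\<lambda>j. Df \<eta> (f z) (F z *v (\<zeta> j z *\<^sub>R u z))) \<longlonglongrightarrow> Df \<eta> (f z) (F z *v u z)"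
      using \<alpha>.AE_U
    proof eventually_elim
      case (elim z)
      show ?case unfolding sc using tendsto_mult_right[OF \<zeta>(4)[OF elim]] by fastforce
    qed
    show "AE z in \<alpha>. norm (Df \<eta> (f z) (F z *v (\<zeta> j z *\<^sub>R u z))) \<le> C * (B * Km) * norm (indicator (spt u) z *\<^sub>R F z)" for j
    proof (rule AE_I2)
      fix z
      show "norm (Df \<eta> (f z) (F z *v (\<zeta> j z *\<^sub>R u z))) \<le> C * (B * Km) * norm (indicator (spt u) z *\<^sub>R F z)"
      proof (cases "z \<in> spt u")
        case True
        have "\<bar>\<zeta> j z * Df \<eta> (f z) (F z *v u z)\<bar> \<le> 1 * \<bar>Df \<eta> (f z) (F z *v u z)\<bar>"
          unfolding abs_mult using \<zeta>(2,3)[of j z] by (intro mult_right_mono) auto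
        also have "\<dots> \<le> C * (norm (F z) * norm (u z) * Km)"
          using C(3)[of "f z" "F z *v u z"] mult_left_mono[OF Km(2)[of "F z" "u z"], of C] C(1) by linarith
        also have "\<dots> \<le> C * (norm (F z) * B * Km)" using C(1) Km(1) B(2)[of z] by (intro mult_left_mono mult_right_mono) auto
        finally show ?thesis using True by (simp add: sc mult_ac)
      next
        case False
        thus ?thesis by (simp add: not_in_spt linear_0[OF lin] matrix_vector_mult_def zero_vec_def[symmetric])
      qed
    qed
    show "integrable \<alpha> (\<lambda>z. C * (B * Km) * norm (indicator (spt u) z *\<^sub>R F z))"
      using Fint K by (intro integrable_mult_right integrable_norm) (auto simp: loc_integrable_def)
  qed
  have "(LINT t|lborel. b t * bdry (above f t) (\<lambda>z. \<zeta> j z *\<^sub>R u z)) = (LINT z|\<alpha>. Df \<eta> (f z) (F z *v (\<zeta> j z *\<^sub>R u z)))" for j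
    using fubini[OF ujW[of j], THEN conjunct1, symmetric] partsU[unfolded parts_def, rule_format, OF adm uj[of j]] by (rule trans)
  hence "(LINT t|lborel. b t * bdry (above f t) u) = (LINT z|\<alpha>. Df \<eta> (f z) (F z *v u z))"
    using LIMSEQ_unique[OF lim1] lim2 by simp
  thus "bdry (\<lambda>z. \<eta> (f z)) u = (LINT z|\<alpha>. Df \<eta> (f z) (F z *v u z))"
    using fubini[OF th] by simp
qed

text \<open>The bound \<open>above_bound\<close> is applied to \<open>u\<close> and to (1 - \<zeta>
  j) u: slopes of integrable functions are finite at almost every level, and those of functions
  tending to \<open>0\<close> in mean come arbitrarily close to \<open>0\<close>. The exceptional
  levels must not depend on \<open>u\<close>, whence the countable families of compact sets
  \<open>Kn n\<close> and integers \<open>m\<close>.\<close>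

lemma levels_from_parts:
  fixes f :: "real^'n => real^'l" and F :: "real^'n => real^'n^'l" and \<zeta> :: "nat => real^'n => real"
  assumes f [measurable]: "f \<in> Borel" and F [measurable]: "F \<in> Borel"
    and W: "open W" and UW: "U \<subseteq> W" and parts: "parts True W f F" and fin: "superlevel_finite True W f"
    and Fint: "loc_integrable W F"
    and \<zeta>: "\<And>j. \<zeta> j \<in> test_functions U" "\<And>j z. 0 \<le> \<zeta> j z" "\<And>j z. \<zeta> j z \<le> 1"
      "\<And>i j z. i \<le> j ==> \<zeta> i z \<le> \<zeta> j z"
      "\<And>z. z \<in> U ==> (\<lambda>j. \<zeta> j z) \<longlonglongrightarrow> 1"
  shows "AE t in lborel. 0 < t \<longrightarrow>
      (\<forall>K. compact K \<longrightarrow> K \<subseteq> W \<longrightarrow> (\<exists>M. \<forall>u\<in>test_functions W. spt u \<subseteq> K \<longrightarrow> (\<forall>z. norm (u z) \<le> 1) \<longrightarrow> \<bar>bdry (above f t) u\<bar> \<le> M)) \<and>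
      (\<forall>u\<in>test_functions W. level_limit \<zeta> f t u)"
proof -
  obtain c0 where c0p: "0 < c0" and c0_all: "\<forall>W f F u s t. f \<in> Borel \<longrightarrow> F \<in> Borel \<longrightarrow>
    parts True W (f :: real^'n => real^'l) F \<longrightarrow> superlevel_finite True W f \<longrightarrow> loc_integrable W F \<longrightarrow>
    u \<in> test_functions W \<longrightarrow> 0 < s \<longrightarrow> s \<le> t \<longrightarrow>
    ennreal \<bar>bdry (above f t) u\<bar> \<le> slope f (c0 * (1 + 1 / s)) (\<lambda>z. ennreal (norm (u z) * norm (F z))) t"
    using above_bound[where 'l='l] by blast
  note c0 = c0p c0_all[rule_format]
  obtain Kn where Kn: "\<And>n::nat. compact (Kn n)" "\<And>n. Kn n \<subseteq> W" "\<And>K. \<lbrakk>compact K; K \<subseteq> W\<rbrakk> \<Longrightarrow> \<exists>N. \<forall>n\<ge>N. K \<subseteq> Kn n"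
    using open_Union_compact_subsets[OF W] by metis
  have [measurable]: "Kn n \<in> sets borel" for n using Kn(1) by (rule borel_compact)
  have [measurable]: "\<zeta> j \<in> Borel" for j using test_functions_borel[OF \<zeta>(1)] .
  \<comment> \<open>Majorant for the fields (1 - \<zeta> j) u with support in \<open>Kn n\<close>;
    it tends to \<open>0\<close> in mean because \<open>F\<close> is locally integrable in
    \<open>W\<close> and not merely in \<open>U\<close>.\<close>
  define k where "k n j z = ennreal (indicator (Kn n) z * ((1 - \<zeta> j z) * norm (F z)))" for n j z
  define k0 where "k0 n z = ennreal (indicator (Kn n) z * norm (F z))" for n z
  have km: "k n j \<in> Borel" for n j unfolding k_def[abs_def] by measurable
  have k0m: "k0 n \<in> Borel" for n unfolding k0_def[abs_def] by measurable
  have Fi: "integrable \<alpha> (\<lambda>z. indicator (Kn n) z *\<^sub>R F z)" for n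
    using Fint Kn unfolding loc_integrable_def by blast
  have k0_fin: "(\<integral>\<^sup>+z. k0 n z \<partial>\<alpha>) < \<infinity>" for n
    using Fi[of n] unfolding integrable_iff_bounded k0_def by (simp add: abs_mult)
  have k_lim: "(\<lambda>j. \<integral>\<^sup>+z. k n j z \<partial>\<alpha>) \<longlonglongrightarrow> 0" for n
  proof -
    have "(\<lambda>j. \<integral>\<^sup>+z. k n j z \<partial>\<alpha>) \<longlonglongrightarrow> (\<integral>\<^sup>+z. 0 \<partial>\<alpha>)"
    proof (rule nn_integral_dominated_convergence[where w="k0 n"])
      show "AE z in \<alpha>. k n j z \<le> k0 n z" for j
        unfolding k_def k0_def using \<zeta>(2,3)
        by (intro AE_I2 ennreal_leI mult_left_mono mult_left_le_one_le) auto
      show "AE z in \<alpha>. (\<lambda>j. k n j z) \<longlonglongrightarrow> 0"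
        using \<alpha>.AE_U
      proof eventually_elim
        case (elim z)
        have "(\<lambda>j. indicator (Kn n) z * ((1 - \<zeta> j z) * norm (F z))) \<longlonglongrightarrow> indicator (Kn n) z * ((1 - 1) * norm (F z))"
          by (intro tendsto_intros \<zeta>(5) elim)
        from tendsto_ennrealI[OF this] show ?case by (simp add: k_def)
      qed
    qed (use km k0m k0_fin in auto)
    thus ?thesis by simp
  qed
  have AE1: "AE t in lborel. \<forall>n (m::nat). slope f (real m) (k0 n) t < \<infinity>"
  proof -
    have "AE t in lborel. slope f (real m) (k0 n) t < \<infinity>" for n m :: nat
    proof -
      have "(\<integral>\<^sup>+t. slope f (real m) (k0 n) t \<partial>lborel) < \<infinity>"
        using slope_integral[OF f k0m, of "real m" n] k0_fin[of n] by (simp add: ennreal_mult_less_top le_less_trans)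
      thus ?thesis
        using nn_integral_noteq_infinite[OF slope_measurable[OF f k0m]] by (simp add: less_top)
    qed
    thus ?thesis by (simp only: AE_all_countable simp_thms)
  qed
  \<comment> \<open>For every \<open>j\<close>, the integral over \<open>t\<close> of the infimum is
    at most \<open>m\<close> times the integral of \<open>k n j\<close>, and the latter tends to
    \<open>0\<close>.\<close>
  have AE2: "AE t in lborel. \<forall>n (m::nat). (INF j. slope f (real m) (k n j) t) = 0"
  proof -
    have "AE t in lborel. (INF j. slope f (real m) (k n j) t) = 0" for n m :: nat
    proof -
      have meas: "(\<lambda>t. INF j. slope f (real m) (k n j) t) \<in> borel_measurable lborel"
        by (intro borel_measurable_INF slope_measurable f km) auto
      have "(\<integral>\<^sup>+t. (INF j. slope f (real m) (k n j) t) \<partial>lborel) \<le> ennreal (real m) * (\<integral>\<^sup>+z. k n j z \<partial>\<alpha>)" for j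
        by (rule order_trans[OF nn_integral_mono slope_integral[OF f km]]) (auto intro: INF_lower)
      moreover have "(\<lambda>j. ennreal (real m) * (\<integral>\<^sup>+z. k n j z \<partial>\<alpha>)) \<longlonglongrightarrow> ennreal (real m) * 0"
        by (intro ennreal_tendsto_cmult k_lim) simp
      ultimately have "(\<integral>\<^sup>+t. (INF j. slope f (real m) (k n j) t) \<partial>lborel) \<le> 0"
        by (intro LIMSEQ_le_const[of _ _ "\<integral>\<^sup>+t. (INF j. slope f (real m) (k n j) t) \<partial>lborel"]) auto
      thus ?thesis using nn_integral_0_iff_AE[OF meas] by simp
    qed
    thus ?thesis by (simp only: AE_all_countable simp_thms)
  qed
  show ?thesis
    using AE1 AE2
  proof eventually_elim
    case (elim t)
    show ?case
    proof (intro impI conjI allI ballI)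
      fix K assume t: "0 < t" and K: "compact K" "K \<subseteq> W"
      obtain n where n: "K \<subseteq> Kn n" using Kn(3)[OF K] by blast
      obtain m :: nat where m: "c0 * (1 + 1 / t) \<le> real m" using real_arch_simple by blast
      show "\<exists>M. \<forall>u\<in>test_functions W. spt u \<subseteq> K \<longrightarrow> (\<forall>z. norm (u z) \<le> 1) \<longrightarrow> \<bar>bdry (above f t) u\<bar> \<le> M"
      proof (intro exI[of _ "enn2real (slope f (real m) (k0 n) t)"] ballI impI)
        fix u :: "real^'n => real^'n" assume th: "u \<in> test_functions W" "spt u \<subseteq> K" "\<forall>z. norm (u z) \<le> 1"
        have "ennreal \<bar>bdry (above f t) u\<bar> \<le> slope f (c0 * (1 + 1 / t)) (\<lambda>z. ennreal (norm (u z) * norm (F z))) t"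
          by (rule c0(2)[OF f F parts fin Fint th(1) t order_refl])
        also have "\<dots> \<le> slope f (real m) (k0 n) t"
        proof (rule slope_mono[OF m])
          fix z
          have "norm (u z) \<le> indicator (Kn n) z"
            using th(2,3) n not_in_spt[of z u] by (auto simp: indicator_def)
          thus "ennreal (norm (u z) * norm (F z)) \<le> k0 n z"
            unfolding k0_def by (intro ennreal_leI mult_right_mono) auto
        qed
        also have "\<dots> = ennreal (enn2real (slope f (real m) (k0 n) t))" using elim(1) by simp
        finally show "\<bar>bdry (above f t) u\<bar> \<le> enn2real (slope f (real m) (k0 n) t)"
          by (subst (asm) ennreal_le_iff) auto
      qed
    next
      fix u :: "real^'n => real^'n" assume t: "0 < t" and th: "u \<in> test_functions W"
      have K: "compact (spt u)" "spt u \<subseteq> W" using test_functionsD[OF th] by auto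
      obtain n where n: "spt u \<subseteq> Kn n" using Kn(3)[OF K] by blast
      obtain B where B: "0 < B" "\<And>z. norm (u z) \<le> B" "\<And>z. norm (jacobian u (at z)) \<le> B"
        using test_bounds[OF th] by blast
      \<comment> \<open>An integer, since the exceptional set of levels has been fixed for integer
        constants; it absorbs the bound of \<open>u\<close> as well.\<close>
      obtain m :: nat where m: "c0 * (1 + 1 / t) * B \<le> real m" using real_arch_simple by blast
      show "level_limit \<zeta> f t u"
      proof (rule metric_LIMSEQ_I)
        fix e :: real assume e: "0 < e"
        have "(INF j. slope f (real m) (k n j) t) < ennreal e" using elim(2) e by simp
        then obtain j0 where j0: "slope f (real m) (k n j0) t < ennreal e" by (auto simp: INF_less_iff)
        show "\<exists>no. \<forall>j\<ge>no. dist (bdry (above f t) (\<lambda>z. \<zeta> j z *\<^sub>R u z)) (bdry (above f t) u) < e"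
        proof (intro exI[of _ j0] allI impI)
          fix j assume j: "j0 \<le> j"
          have sm: "smooth (\<zeta> j)" using test_functionsD(1)[OF \<zeta>(1)] .
          have th1: "(\<lambda>z. \<zeta> j z *\<^sub>R u z) \<in> test_functions W" by (rule test_functions_smult[OF th sm])
          have th2: "(\<lambda>z. u z - \<zeta> j z *\<^sub>R u z) \<in> test_functions W" by (rule test_functions_diff[OF th th1])
          have "bdry (above f t) (\<lambda>z. u z - \<zeta> j z *\<^sub>R u z) = bdry (above f t) u - bdry (above f t) (\<lambda>z. \<zeta> j z *\<^sub>R u z)"
            by (rule bdry_diff[OF th th1 above_integrable[OF f fin th t] above_integrable[OF f fin th1 t]])
          hence "dist (bdry (above f t) (\<lambda>z. \<zeta> j z *\<^sub>R u z)) (bdry (above f t) u) = \<bar>bdry (above f t) (\<lambda>z. u z - \<zeta> j z *\<^sub>R u z)\<bar>"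
            by (simp add: dist_real_def)
          moreover have "ennreal \<bar>bdry (above f t) (\<lambda>z. u z - \<zeta> j z *\<^sub>R u z)\<bar> < ennreal e"
          proof -
            have cp: "0 \<le> c0 * (1 + 1 / t)" using c0(1) t by simp
            have "ennreal \<bar>bdry (above f t) (\<lambda>z. u z - \<zeta> j z *\<^sub>R u z)\<bar> \<le> slope f (c0 * (1 + 1 / t)) (\<lambda>z. ennreal (norm (u z - \<zeta> j z *\<^sub>R u z) * norm (F z))) t"
              by (rule c0(2)[OF f F parts fin Fint th2 t order_refl])
            also have "\<dots> \<le> slope f (c0 * (1 + 1 / t)) (\<lambda>z. ennreal B * k n j0 z) t"
            proof (rule slope_mono[OF order_refl])
              fix z
              have "norm (u z - \<zeta> j z *\<^sub>R u z) = (1 - \<zeta> j z) * norm (u z)"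
                using \<zeta>(3)[of j z] by (metis abs_of_nonneg diff_ge_0_iff_ge norm_scaleR scaleR_left_diff_distrib scaleR_one)
              also have "\<dots> \<le> B * (indicator (Kn n) z * (1 - \<zeta> j0 z))"
              proof (cases "z \<in> spt u")
                case True
                have "(1 - \<zeta> j z) * norm (u z) \<le> (1 - \<zeta> j0 z) * B"
                  using \<zeta>(4)[OF j, of z] \<zeta>(3)[of j0 z] B(2)[of z] by (intro mult_mono) auto
                thus ?thesis using True n by (auto simp: indicator_def mult.commute)
              next
                case False
                thus ?thesis using \<zeta>(3)[of j0 z] B(1) by (simp add: not_in_spt)
              qed
              finally have "norm (u z - \<zeta> j z *\<^sub>R u z) * norm (F z) \<le> B * (indicator (Kn n) z * (1 - \<zeta> j0 z)) * norm (F z)"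
                by (rule mult_right_mono) simp
              hence "ennreal (norm (u z - \<zeta> j z *\<^sub>R u z) * norm (F z)) \<le> ennreal (B * (indicator (Kn n) z * ((1 - \<zeta> j0 z) * norm (F z))))"
                by (intro ennreal_leI) (simp add: mult.assoc)
              also have "\<dots> = ennreal B * k n j0 z"
                unfolding k_def using B(1) \<zeta>(3)[of j0 z] by (intro ennreal_mult) auto
              finally show "ennreal (norm (u z - \<zeta> j z *\<^sub>R u z) * norm (F z)) \<le> ennreal B * k n j0 z" .
            qed
            also have "\<dots> = slope f (c0 * (1 + 1 / t) * B) (k n j0) t"
            proof -
              have eq: "ennreal (d * 2 ^ i) * x * (ennreal B * y) = ennreal (d * B * 2 ^ i) * x * y" if "0 \<le> d" for d and i :: nat and x y :: ennreal
              proof -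
                have "ennreal (d * B * 2 ^ i) = ennreal (d * 2 ^ i) * ennreal B"
                  using that B(1) by (subst ennreal_mult[symmetric]) (auto simp: mult_ac)
                thus ?thesis by (simp add: mult_ac)
              qed
              show ?thesis unfolding slope_def eq[OF cp] ..
            qed
            also have "\<dots> \<le> slope f (real m) (k n j0) t" by (rule slope_mono[OF m order_refl])
            also have "\<dots> < ennreal e" by (rule j0)
            finally show ?thesis .
          qed
          ultimately show "dist (bdry (above f t) (\<lambda>z. \<zeta> j z *\<^sub>R u z)) (bdry (above f t) u) < e"
            using e by (simp add: ennreal_less_iff)
        qed
      qed
    qed
  qed
qed

end

section \<open>From varifolds to the data of \<open>fv_data\<close>\<close>

section \<open>The Grassmannian is compact\<close>

lemma orth_projection_eqI:
  fixes S :: "(real^'n) set"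
  assumes S: "subspace S" and A: "\<And>x. A *v x \<in> S" "\<And>x s. s \<in> S ==> (x - A *v x) \<bullet> s = 0"
  shows "orth_projection S = A"
proof -
  have "(THE y. y \<in> S \<and> (\<forall>s\<in>S. orthogonal (x - y) s)) = A *v x" for x
  proof (rule the_equality)
    show "A *v x \<in> S \<and> (\<forall>s\<in>S. orthogonal (x - A *v x) s)" using A by (simp add: orthogonal_def)
    fix y assume y: "y \<in> S \<and> (\<forall>s\<in>S. orthogonal (x - y) s)"
    hence d: "A *v x - y \<in> S" using A(1) S by (simp add: subspace_diff)
    have "(x - y) \<bullet> (A *v x - y) - (x - A *v x) \<bullet> (A *v x - y) = 0"
      using y d A(2)[OF d] by (simp add: orthogonal_def)
    hence "(A *v x - y) \<bullet> (A *v x - y) = 0" by (simp add: inner_diff_left[symmetric] del: inner_eq_zero_iff)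
    thus "y = A *v x" by simp
  qed
  thus ?thesis by (simp add: orth_projection_def)
qed

lemma orth_projection_orthonormal:
  fixes S :: "(real^'n) set"
  assumes "subspace S"
  obtains B where "finite B" "card B = dim S" "\<And>b c. b \<in> B ==> c \<in> B ==> b \<bullet> c = (if b = c then 1 else 0)"
    "orth_projection S = (\<chi> i j. \<Sum>b\<in>B. b $ i * b $ j)"
proof -
  obtain B where B: "B \<subseteq> S" "pairwise orthogonal B" "\<And>x. x \<in> B ==> norm x = 1"
      "independent B" "card B = dim S" "span B = S"
    using orthonormal_basis_subspace[OF assms] by blast
  have fin: "finite B" using B(4) by (rule independent_imp_finite)
  have ortho: "b \<bullet> c = (if b = c then 1 else 0)" if "b \<in> B" "c \<in> B" for b c
    using B(2,3) that by (auto simp: pairwise_def orthogonal_def norm_eq_1)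
  let ?A = "\<chi> i j. \<Sum>b\<in>B. b $ i * b $ j"
  have A: "?A *v x = (\<Sum>b\<in>B. (b \<bullet> x) *\<^sub>R b)" for x
  proof -
    have "(\<Sum>j\<in>UNIV. (\<Sum>b\<in>B. b $ i * b $ j) * x $ j) = (\<Sum>b\<in>B. (\<Sum>j\<in>UNIV. b $ j * x $ j) * b $ i)" for i
      unfolding sum_distrib_right by (subst sum.swap) (simp add: mult_ac)
    thus ?thesis by (simp add: matrix_vector_mult_def vec_eq_iff inner_vec_def)
  qed
  have "orth_projection S = ?A"
  proof (rule orth_projection_eqI[OF assms])
    show "?A *v x \<in> S" for x
      unfolding A B(6)[symmetric] by (intro span_sum span_scale span_base)
    have "orthogonal (x - ?A *v x) s" if s: "s \<in> span B" for x s
    proof (rule orthogonal_to_span[OF s])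
      fix c assume c: "c \<in> B"
      have "(\<Sum>b\<in>B. (b \<bullet> x) * (b \<bullet> c)) = (\<Sum>b\<in>B. if b = c then b \<bullet> x else 0)"
        using c by (intro sum.cong) (auto simp: ortho)
      thus "orthogonal (x - ?A *v x) c"
        using c fin unfolding orthogonal_def A inner_diff_left inner_sum_left by (simp add: inner_commute[of x])
    qed
    thus "(x - ?A *v x) \<bullet> s = 0" if "s \<in> S" for x s
      using that B(6) by (simp add: orthogonal_def)
  qed
  thus ?thesis using that fin B(5) ortho by blast
qed

text \<open>Symmetric idempotent matrices are the orthogonal projections onto their ranges, and the
  trace gives the dimension. These equations are continuous in \<open>A\<close>, so the image is
  closed.\<close>

lemma orth_projection_image:
  "orth_projection ` grassmannian m = {A :: real^'n^'n. transpose A = A \<and> A ** A = A \<and> trace A = real m}"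
proof (intro equalityI subsetI)
  fix A :: "real^'n^'n" assume "A \<in> orth_projection ` grassmannian m"
  then obtain S where S: "subspace S" "dim S = m" "A = orth_projection S" by (auto simp: grassmannian_def)
  obtain B where B: "finite B" "card B = dim S" "\<And>b c. b \<in> B ==> c \<in> B ==> b \<bullet> c = (if b = c then 1 else 0)"
    "orth_projection S = (\<chi> i j. \<Sum>b\<in>B. b $ i * b $ j)"
    using orth_projection_orthonormal[OF S(1)] by blast
  have "(\<Sum>k\<in>UNIV. (\<Sum>b\<in>B. b $ i * b $ k) * (\<Sum>c\<in>B. c $ k * c $ j)) = (\<Sum>b\<in>B. b $ i * b $ j)" for i j
  proof -
    have "(\<Sum>k\<in>UNIV. (\<Sum>b\<in>B. b $ i * b $ k) * (\<Sum>c\<in>B. c $ k * c $ j)) = (\<Sum>k\<in>UNIV. \<Sum>b\<in>B. \<Sum>c\<in>B. (b $ i * b $ k) * (c $ k * c $ j))"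
      by (simp only: sum_product)
    also have "\<dots> = (\<Sum>b\<in>B. \<Sum>k\<in>UNIV. \<Sum>c\<in>B. (b $ i * b $ k) * (c $ k * c $ j))" by (rule sum.swap)
    also have "\<dots> = (\<Sum>b\<in>B. \<Sum>c\<in>B. \<Sum>k\<in>UNIV. (b $ i * b $ k) * (c $ k * c $ j))" by (intro sum.cong refl sum.swap)
    also have "\<dots> = (\<Sum>b\<in>B. \<Sum>c\<in>B. b $ i * c $ j * (b \<bullet> c))"
      by (simp add: inner_vec_def sum_distrib_left mult_ac)
    also have "\<dots> = (\<Sum>b\<in>B. \<Sum>c\<in>B. if c = b then b $ i * c $ j else 0)"
      by (intro sum.cong refl) (auto simp: B(3))
    also have "\<dots> = (\<Sum>b\<in>B. b $ i * b $ j)" using B(1) by simp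
    finally show ?thesis .
  qed
  hence "A ** A = A" by (simp add: S(3) B(4) matrix_matrix_mult_def vec_eq_iff)
  moreover have "transpose A = A" by (simp add: S(3) B(4) transpose_def vec_eq_iff mult.commute)
  moreover have "trace A = real m"
  proof -
    have "trace A = (\<Sum>b\<in>B. b \<bullet> b)"
      unfolding S(3) B(4) trace_def inner_vec_def by (simp, rule sum.swap)
    also have "\<dots> = real m" using B(2) S(2) by (simp add: B(3))
    finally show ?thesis .
  qed
  ultimately show "A \<in> {A. transpose A = A \<and> A ** A = A \<and> trace A = real m}" by simp
next
  fix A :: "real^'n^'n" assume "A \<in> {A. transpose A = A \<and> A ** A = A \<and> trace A = real m}"
  hence A: "transpose A = A" "A ** A = A" "trace A = real m" by auto
  define S where "S = range (\<lambda>x. A *v x)"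
  have S: "subspace S" unfolding S_def by (intro linear_subspace_image matrix_vector_mul_linear subspace_UNIV)
  have P: "orth_projection S = A"
  proof (rule orth_projection_eqI[OF S])
    fix x s assume "s \<in> S"
    then obtain y where y: "s = A *v y" by (auto simp: S_def)
    have "(x - A *v x) \<bullet> (A *v y) = (A *v (x - A *v x)) \<bullet> y"
      by (metis A(1) dot_lmul_matrix transpose_matrix_vector)
    also have "A *v (x - A *v x) = 0"
      by (simp add: matrix_vector_mult_diff_distrib matrix_vector_mul_assoc A(2))
    finally show "(x - A *v x) \<bullet> s = 0" by (simp add: y)
  qed (simp add: S_def)
  obtain B where B: "finite B" "card B = dim S" "\<And>b c. b \<in> B ==> c \<in> B ==> b \<bullet> c = (if b = c then 1 else 0)"
    "orth_projection S = (\<chi> i j. \<Sum>b\<in>B. b $ i * b $ j)"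
    using orth_projection_orthonormal[OF S] by blast
  have "trace A = (\<Sum>b\<in>B. b \<bullet> b)"
    unfolding P[symmetric] B(4) trace_def inner_vec_def by (simp, rule sum.swap)
  also have "\<dots> = real (dim S)" using B(2) by (simp add: B(3))
  finally have "dim S = m" using A(3) by simp
  thus "A \<in> orth_projection ` grassmannian m" using S P by (auto simp: grassmannian_def)
qed

text \<open>The squared norm is the trace of \<open>A ** A\<close>, that is, of
  \<open>A\<close>.\<close>

lemma norm_orth_projection:
  assumes "S \<in> grassmannian m"
  shows "norm (orth_projection S :: real^'n^'n) = sqrt m"
proof -
  let ?A = "orth_projection S"
  have "?A \<in> orth_projection ` grassmannian m" using assms by blast
  hence A: "transpose ?A = ?A" "?A ** ?A = ?A" "trace ?A = real m" unfolding orth_projection_image by auto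
  have "?A \<bullet> ?A = real m" unfolding inner_matrix_eq_trace A ..
  thus ?thesis by (simp add: norm_eq_sqrt_inner)
qed

text \<open>The topology is pulled back along \<open>orth_projection\<close>, so open covers come
  from open covers of the image, which is a closed bounded set of matrices.\<close>

lemma compact_space_grassmannian: "compact_space (grassmannian_topology m :: (real^'n) set topology)"
proof -
  let ?P = "orth_projection :: (real^'n) set => _"
  have "closed (?P ` grassmannian m)"
    unfolding orth_projection_image vec_eq_iff transpose_def matrix_matrix_mult_def trace_def
    by (intro closed_Collect_conj closed_Collect_all closed_Collect_eq) (auto intro!: continuous_intros)
  moreover have "bounded (?P ` grassmannian m)"
    unfolding bounded_iff by (intro exI[of _ "sqrt m"]) (auto simp: norm_orth_projection[where m=m])
  ultimately have comp: "compact (?P ` grassmannian m)" by (simp add: compact_eq_bounded_closed)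
  have top: "topspace (grassmannian_topology m) = (grassmannian m :: (real^'n) set set)"
    by (simp add: grassmannian_topology_def topspace_pullback_topology)
  show ?thesis
    unfolding compact_space_alt top
  proof (intro allI impI)
    fix \<U> :: "(real^'n) set set set"
    assume U: "(\<forall>T\<in>\<U>. openin (grassmannian_topology m) T) \<and> grassmannian m \<subseteq> \<Union>\<U>"
    hence "\<forall>T\<in>\<U>. \<exists>Q. open Q \<and> T = ?P -` Q \<inter> grassmannian m"
      by (simp add: grassmannian_topology_def openin_pullback_topology)
    then obtain O' where O': "\<And>T. T \<in> \<U> ==> open (O' T)" "\<And>T. T \<in> \<U> ==> T = ?P -` O' T \<inter> grassmannian m"
      by metis
    have "?P ` grassmannian m \<subseteq> (\<Union>T\<in>\<U>. O' T)"
      using U O'(2) by blast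
    then obtain F where F: "F \<subseteq> \<U>" "finite F" "?P ` grassmannian m \<subseteq> (\<Union>T\<in>F. O' T)"
      using compactE_image[OF comp, of \<U> O'] O'(1) by blast
    have "grassmannian m \<subseteq> \<Union>F"
    proof
      fix S :: "(real^'n) set" assume S: "S \<in> grassmannian m"
      then obtain T where "T \<in> F" "?P S \<in> O' T" using F(3) by blast
      thus "S \<in> \<Union>F" using O'(2)[of T] F(1) S by blast
    qed
    thus "\<exists>\<F>. finite \<F> \<and> \<F> \<subseteq> \<U> \<and> grassmannian m \<subseteq> \<Union>\<F>" using F by blast
  qed
qed

section \<open>The weight and the tangent planes of a varifold\<close>

lemma measurable_borel_of:
  assumes "continuous_map X Y f"
  shows "f \<in> measurable (borel_of X) (borel_of Y)"
  unfolding borel_of_def[of Y]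
proof (rule measurable_measure_of)
  have sp: "space (borel_of X) = topspace X" by (simp add: borel_of_def space_measure_of_conv)
  show "{W. openin Y W} \<subseteq> Pow (topspace Y)" by (auto dest: openin_subset)
  show "f \<in> space (borel_of X) \<rightarrow> topspace Y" using assms by (auto simp: sp continuous_map_def)
  fix W assume "W \<in> {W. openin Y W}"
  hence "openin X {x \<in> topspace X. f x \<in> W}" using assms by (auto simp: continuous_map_def)
  moreover have "f -` W \<inter> space (borel_of X) = {x \<in> topspace X. f x \<in> W}" by (auto simp: sp)
  moreover have "{W. openin X W} \<subseteq> Pow (topspace X)" by (auto dest: openin_subset)
  ultimately show "f -` W \<inter> space (borel_of X) \<in> sets (borel_of X)" by (auto simp: borel_of_def)
qed

lemma borel_of_euclidean: "borel_of euclidean = (borel :: 'a::topological_space measure)"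
  by (simp add: borel_of_def borel_def)

locale varifold_within =
  fixes U :: "(real^'n) set" and m :: nat and V :: "((real^'n) \<times> (real^'n) set) measure"
  assumes open_U0: "open U" and varifold: "varifold U m V"
begin

lemma radon: "radon_measure_on (prod_topology (top_of_set U) (grassmannian_topology m)) V"
  using varifold by (simp add: varifold_def)

lemma topspace_grassmannian: "topspace (grassmannian_topology m) = (grassmannian m :: (real^'n) set set)"
  by (simp add: grassmannian_topology_def topspace_pullback_topology)

lemma space_V: "space V = U \<times> grassmannian m"
  using radon by (simp add: radon_measure_on_def topspace_grassmannian)

lemma sets_V: "sets V = sets (borel_of (prod_topology (top_of_set U) (grassmannian_topology m)))"
  using radon by (simp add: radon_measure_on_def)

lemma fst_measurable [measurable]: "fst \<in> measurable V (borel_of (top_of_set U))"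
  using measurable_borel_of[OF continuous_map_fst] measurable_cong_sets[OF sets_V refl] by blast

lemma orth_projection_measurable [measurable]: "(\<lambda>p. orth_projection (snd p)) \<in> borel_measurable V"
proof -
  have "continuous_map (grassmannian_topology m) euclidean (id \<circ> (orth_projection :: (real^'n) set => _))"
    unfolding grassmannian_topology_def by (rule continuous_map_pullback) simp
  hence "continuous_map (prod_topology (top_of_set U) (grassmannian_topology m)) euclidean ((id \<circ> (orth_projection :: (real^'n) set => _)) \<circ> snd)"
    by (rule continuous_map_compose[OF continuous_map_snd])
  from measurable_borel_of[OF this] show ?thesis
    using measurable_cong_sets[OF sets_V refl] by (auto simp: borel_of_euclidean comp_def)
qed

sublocale W: measure_within U "weight U V"
  by unfold_locales (simp_all add: open_U0 weight_def sets_borel_of_top_of_set)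

lemma fst_borel [measurable]: "fst \<in> borel_measurable V"
  using measurable_compose[OF fst_measurable, of "\<lambda>x. x" borel] W.id_M by (simp add: weight_def)

lemma weight_AE: "AE z in weight U V. Q z ==> AE p in V. Q (fst p)"
  unfolding weight_def by (rule AE_distrD[OF fst_measurable])

lemma V_integral:
  fixes h :: "real^'n => 'b::{banach, second_countable_topology}"
  assumes "h \<in> Borel"
  shows "(LINT p|V. h (fst p)) = integral\<^sup>L W.ext h" "integrable V (\<lambda>p. h (fst p)) \<longleftrightarrow> integrable W.ext h"
proof -
  have h: "h \<in> borel_measurable (borel_of (top_of_set U))" using W.borel_M[OF assms] by (simp add: weight_def)
  show "(LINT p|V. h (fst p)) = integral\<^sup>L W.ext h"
    unfolding W.integral_ext[OF assms] by (simp add: weight_def integral_distr[OF fst_measurable h])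
  show "integrable V (\<lambda>p. h (fst p)) \<longleftrightarrow> integrable W.ext h"
    unfolding W.integrable_ext[OF assms] by (simp add: weight_def integrable_distr_eq[OF fst_measurable h])
qed

sublocale \<alpha>: open_measure U W.ext
proof (rule W.open_measure_ext)
  fix K assume K: "compact K" "K \<subseteq> U"
  have KB: "K \<in> sets (borel_of (top_of_set U))"
    using K by (auto simp: sets_borel_of_top_of_set[OF open_U0] sets_restrict_space intro!: image_eqI[of _ _ K] borel_compact)
  have "emeasure (weight U V) K = emeasure V (fst -` K \<inter> space V)"
    unfolding weight_def by (rule emeasure_distr[OF fst_measurable KB])
  also have "fst -` K \<inter> space V = K \<times> grassmannian m" using K by (auto simp: space_V)
  also have "emeasure V \<dots> < \<infinity>"
  proof -
    \<comment> \<open>Compactness of the Grassmannian makes the cylinder over \<open>K\<close>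
      compact, so that the Radon property of \<open>V\<close> bounds the weight of
      \<open>K\<close>.\<close>
    have "compactin (grassmannian_topology m) (grassmannian m :: (real^'n) set set)"
      using compact_space_grassmannian[where 'n='n and m=m] unfolding compact_space_def topspace_grassmannian .
    hence "compactin (prod_topology (top_of_set U) (grassmannian_topology m)) (K \<times> (grassmannian m :: (real^'n) set set))"
      using K by (simp add: compactin_Times compactin_subtopology)
    thus ?thesis using radon unfolding radon_measure_on_def by blast
  qed
  finally show "emeasure (weight U V) K < \<infinity>" .
qed

lemma norm_plane: "p \<in> space V ==> norm (orth_projection (snd p) :: real^'n^'n) \<le> sqrt m"
  using norm_orth_projection[of "snd p" m] by (auto simp: space_V)

lemma plane_integrable:
  fixes \<psi> :: "real^'n => real^'n^'n"
  assumes [measurable]: "\<psi> \<in> Borel" and int: "integrable W.ext \<psi>"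
  shows "integrable V (\<lambda>p. \<psi> (fst p) \<bullet> orth_projection (snd p))"
    "\<bar>LINT p|V. \<psi> (fst p) \<bullet> orth_projection (snd p)\<bar> \<le> sqrt m * (LINT z|W.ext. norm (\<psi> z))"
proof -
  have [measurable]: "(\<lambda>p. \<psi> (fst p)) \<in> borel_measurable V" by (rule measurable_compose[OF fst_borel]) simp
  have le: "norm (\<psi> (fst p) \<bullet> orth_projection (snd p)) \<le> sqrt m * norm (\<psi> (fst p))" if "p \<in> space V" for p
  proof -
    have "norm (\<psi> (fst p) \<bullet> orth_projection (snd p)) \<le> norm (\<psi> (fst p)) * norm (orth_projection (snd p))"
      by (simp add: Cauchy_Schwarz_ineq2)
    also have "\<dots> \<le> norm (\<psi> (fst p)) * sqrt m" using norm_plane[OF that] by (rule mult_left_mono) simp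
    finally show ?thesis by (simp add: mult.commute)
  qed
  have nint: "integrable V (\<lambda>p. norm (\<psi> (fst p)))"
    using V_integral(2)[of \<psi>] int by simp
  show i: "integrable V (\<lambda>p. \<psi> (fst p) \<bullet> orth_projection (snd p))"
  proof (rule Bochner_Integration.integrable_bound[of _ "\<lambda>p. sqrt m * norm (\<psi> (fst p))"])
    show "AE p in V. norm (\<psi> (fst p) \<bullet> orth_projection (snd p)) \<le> norm (sqrt m * norm (\<psi> (fst p)))"
      by (rule AE_I2) (use le in \<open>auto simp: abs_mult\<close>)
  qed (use nint in auto)
  have "\<bar>LINT p|V. \<psi> (fst p) \<bullet> orth_projection (snd p)\<bar> \<le> (LINT p|V. norm (\<psi> (fst p) \<bullet> orth_projection (snd p)))"
    using integral_norm_bound[of V "\<lambda>p. \<psi> (fst p) \<bullet> orth_projection (snd p)"] by simp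
  also have "\<dots> \<le> (LINT p|V. sqrt m * norm (\<psi> (fst p)))"
    using i nint le by (intro integral_mono) auto
  also have "\<dots> = sqrt m * (LINT z|W.ext. norm (\<psi> z))"
    using V_integral(1)[of "\<lambda>z. norm (\<psi> z)"] by simp
  finally show "\<bar>LINT p|V. \<psi> (fst p) \<bullet> orth_projection (snd p)\<bar> \<le> sqrt m * (LINT z|W.ext. norm (\<psi> z))" .
qed

text \<open>The mean of the tangent planes with respect to the disintegration of \<open>V\<close>; it is obtained
  without disintegration by duality.\<close>

lemma mean_plane:
  obtains P :: "real^'n => real^'n^'n" where "P \<in> Borel" "\<And>z. norm (P z) \<le> sqrt m"
    "\<And>\<psi>. \<psi> \<in> Borel ==> integrable W.ext \<psi> ==>
      (LINT p|V. \<psi> (fst p) \<bullet> orth_projection (snd p)) = (LINT z|W.ext. \<psi> z \<bullet> P z)"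
proof -
  define S where "S \<Theta> = (LINT p|V. \<Theta> (fst p) \<bullet> orth_projection (snd p))" for \<Theta> :: "real^'n => real^'n^'n"
  have Si: "integrable V (\<lambda>p. \<Theta> (fst p) \<bullet> orth_projection (snd p))" if "\<Theta> \<in> test_functions U" for \<Theta> :: "real^'n => real^'n^'n"
    using plane_integrable(1)[OF test_functions_borel[OF that] \<alpha>.integrable_test[OF that]] .
  have "test_functional U S"
  proof
    show "S (\<lambda>z. u z + \<xi> z) = S u + S \<xi>" if "u \<in> test_functions U" "\<xi> \<in> test_functions U" for u \<xi>
      unfolding S_def using Si[OF that(1)] Si[OF that(2)] by (simp add: inner_add_left)
  qed (simp_all add: open_U0 S_def)
  moreover have "S \<Theta> \<le> sqrt m * (LINT z|W.ext. norm (\<Theta> z))" if "\<Theta> \<in> test_functions U" for \<Theta>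
    using plane_integrable(2)[OF test_functions_borel[OF that] \<alpha>.integrable_test[OF that]] unfolding S_def by linarith
  ultimately obtain P where P [measurable]: "P \<in> Borel" and Pb: "\<And>z. norm (P z) \<le> sqrt m"
    and rep: "\<And>u. u \<in> test_functions U ==> S u = (LINT z|W.ext. u z \<bullet> P z)"
    by (rule \<alpha>.riesz_representation) auto
  have "(LINT p|V. \<psi> (fst p) \<bullet> orth_projection (snd p)) = (LINT z|W.ext. \<psi> z \<bullet> P z)"
    if \<psi> [measurable]: "\<psi> \<in> Borel" and int: "integrable W.ext \<psi>" for \<psi>
  proof -
    have b: "norm (A \<bullet> P z) \<le> sqrt m * norm A" for A z
    proof -
      have "norm (A \<bullet> P z) \<le> norm A * norm (P z)" by (simp add: Cauchy_Schwarz_ineq2)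
      also have "\<dots> \<le> norm A * sqrt m" using Pb by (intro mult_left_mono) auto
      finally show ?thesis by (simp add: mult.commute)
    qed
    have iP: "integrable W.ext (\<lambda>z. \<xi> z \<bullet> P z)" if \<xi>: "\<xi> \<in> Borel" and "integrable W.ext \<xi>" for \<xi>
    proof (rule Bochner_Integration.integrable_bound[of _ "\<lambda>z. sqrt m * norm (\<xi> z)"])
      show "AE z in W.ext. norm (\<xi> z \<bullet> P z) \<le> norm (sqrt m * norm (\<xi> z))" using b by (auto simp: abs_mult)
      show "(\<lambda>z. \<xi> z \<bullet> P z) \<in> borel_measurable W.ext" using borel_measurable_inner[OF \<xi> P] by (simp only: measurable_cong_sets[OF W.sets_ext refl])
    qed (use that(2) in auto)
    have "\<bar>(LINT p|V. \<psi> (fst p) \<bullet> orth_projection (snd p)) - (LINT z|W.ext. \<psi> z \<bullet> P z)\<bar> \<le> e" if e: "0 < e" for e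
    proof -
      \<comment> \<open>Replacing \<psi> by a test function costs at most \<open>sqrt m * d\<close>
        on either side of the identity; the summand \<open>1\<close> covers
        \<open>m = 0\<close>.\<close>
      define d where "d = e / (2 * sqrt m + 1)"
      have d: "0 < d" using e by (simp add: d_def add_nonneg_pos)
      obtain \<Theta> where \<Theta>: "\<Theta> \<in> test_functions U" "(LINT z|W.ext. norm (\<Theta> z - \<psi> z)) < d"
        using \<alpha>.test_functions_dense[OF int d] by auto
      note [measurable] = test_functions_borel[OF \<Theta>(1)]
      have \<Theta>i: "integrable W.ext \<Theta>" by (rule \<alpha>.integrable_test[OF \<Theta>(1)])
      have di: "integrable W.ext (\<lambda>z. \<Theta> z - \<psi> z)" using \<Theta>i int by simp
      have "(LINT p|V. (\<Theta> (fst p) - \<psi> (fst p)) \<bullet> orth_projection (snd p)) = (LINT p|V. \<Theta> (fst p) \<bullet> orth_projection (snd p)) - (LINT p|V. \<psi> (fst p) \<bullet> orth_projection (snd p))"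
        using plane_integrable(1)[OF _ \<Theta>i] plane_integrable(1)[OF _ int] by (simp add: inner_diff_left)
      moreover have "\<bar>LINT p|V. (\<Theta> (fst p) - \<psi> (fst p)) \<bullet> orth_projection (snd p)\<bar> \<le> sqrt m * (LINT z|W.ext. norm (\<Theta> z - \<psi> z))"
        by (rule plane_integrable(2)[OF _ di]) simp
      moreover have "(LINT z|W.ext. (\<Theta> z - \<psi> z) \<bullet> P z) = (LINT z|W.ext. \<Theta> z \<bullet> P z) - (LINT z|W.ext. \<psi> z \<bullet> P z)"
        using iP[OF _ \<Theta>i] iP[OF _ int] by (simp add: inner_diff_left)
      moreover have "\<bar>LINT z|W.ext. (\<Theta> z - \<psi> z) \<bullet> P z\<bar> \<le> sqrt m * (LINT z|W.ext. norm (\<Theta> z - \<psi> z))"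
      proof -
        have "\<bar>LINT z|W.ext. (\<Theta> z - \<psi> z) \<bullet> P z\<bar> \<le> (LINT z|W.ext. norm ((\<Theta> z - \<psi> z) \<bullet> P z))"
          using integral_norm_bound[of W.ext "\<lambda>z. (\<Theta> z - \<psi> z) \<bullet> P z"] by simp
        also have "\<dots> \<le> (LINT z|W.ext. sqrt m * norm (\<Theta> z - \<psi> z))"
          using iP[OF _ di] di b by (intro integral_mono) auto
        finally show ?thesis by simp
      qed
      moreover have "sqrt m * (LINT z|W.ext. norm (\<Theta> z - \<psi> z)) \<le> sqrt m * d"
        using \<Theta>(2) by (intro mult_left_mono) auto
      moreover have "2 * (sqrt m * d) \<le> e"
        using mult_right_mono[of "2 * sqrt m" "2 * sqrt m + 1" d] d e by (simp add: d_def add_nonneg_pos less_imp_neq[symmetric])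
      ultimately show ?thesis using rep[OF \<Theta>(1)] unfolding S_def by linarith
    qed
    hence "\<bar>(LINT p|V. \<psi> (fst p) \<bullet> orth_projection (snd p)) - (LINT z|W.ext. \<psi> z \<bullet> P z)\<bar> \<le> 0"
      by (rule field_le_epsilon) simp
    thus ?thesis by simp
  qed
  thus ?thesis using that P Pb by blast
qed

end

section \<open>Functions defined almost everywhere\<close>

lemma completion_AE_set:
  assumes A: "A \<subseteq> space M" and B: "B \<in> sets M" and ae: "AE z in M. z \<in> A \<longleftrightarrow> z \<in> B"
  shows "A \<in> sets (completion M)" "emeasure (completion M) A = emeasure M B"
proof -
  have "(indicator A :: _ => real) \<in> borel_measurable (completion M)"
    by (rule measurable_completion_AE[of "indicator B"]) (use B ae in \<open>auto simp: indicator_def\<close>)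
  thus sA: "A \<in> sets (completion M)"
    using A by (simp add: borel_measurable_indicator_iff Int_absorb2)
  have "emeasure (completion M) A = emeasure (completion M) B"
    by (rule emeasure_eq_AE) (use AE_completion[OF ae] sA B in auto)
  thus "emeasure (completion M) A = emeasure M B" using B by simp
qed

lemma sum_measure:
  assumes "sets N = sets M"
  shows space_sum_measure: "space (sum_measure M N) = space M"
    and sets_sum_measure: "sets (sum_measure M N) = sets M"
    and emeasure_sum_measure: "A \<in> sets M ==> emeasure (sum_measure M N) A = emeasure M A + emeasure N A"
proof -
  show "space (sum_measure M N) = space M" by (simp add: sum_measure_def)
  show "sets (sum_measure M N) = sets M" by (simp add: sum_measure_def)
  show "emeasure (sum_measure M N) A = emeasure M A + emeasure N A" if A: "A \<in> sets M"
    unfolding sum_measure_def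
  proof (rule emeasure_measure_of_sigma[OF _ _ _ A])
    show "countably_additive (sets M) (\<lambda>A. emeasure M A + emeasure N A)"
    proof (rule countably_additiveI)
      fix A :: "nat => _" assume "range A \<subseteq> sets M" "disjoint_family A"
      thus "(\<Sum>i. emeasure M (A i) + emeasure N (A i)) = emeasure M (\<Union>i. A i) + emeasure N (\<Union>i. A i)"
        using assms by (simp add: suminf_add[symmetric] suminf_emeasure)
    qed
  qed (auto simp: positive_def sets.sigma_algebra_axioms)
qed

lemma AE_sum_measure:
  assumes s: "sets N = sets M"
  shows "(AE z in sum_measure M N. Q z) \<longleftrightarrow> (AE z in M. Q z) \<and> (AE z in N. Q z)"
proof -
  have sp: "space N = space M" using s by (rule sets_eq_imp_space_eq)
  have null: "A \<in> null_sets (sum_measure M N) \<longleftrightarrow> A \<in> null_sets M \<and> A \<in> null_sets N" for A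
    using emeasure_sum_measure[OF s] by (auto simp: null_sets_def sets_sum_measure[OF s] s)
  show ?thesis
  proof
    assume "AE z in sum_measure M N. Q z"
    thus "(AE z in M. Q z) \<and> (AE z in N. Q z)"
      by (auto simp: eventually_ae_filter null space_sum_measure[OF s] sp)
  next
    assume "(AE z in M. Q z) \<and> (AE z in N. Q z)"
    then obtain A B where A: "A \<in> null_sets M" "{x \<in> space M. \<not> Q x} \<subseteq> A"
      and B: "B \<in> null_sets N" "{x \<in> space M. \<not> Q x} \<subseteq> B"
      unfolding eventually_ae_filter sp by blast
    \<comment> \<open>Both sets contain the exceptional set, and their intersection is null for
      either measure.\<close>
    have "A \<inter> B \<in> null_sets M" "A \<inter> B \<in> null_sets N"
      using null_set_Int1[of A M B] null_set_Int1[of B N A] A(1) B(1) s by (auto simp: null_sets_def Int_commute)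
    thus "AE z in sum_measure M N. Q z"
      unfolding eventually_ae_filter space_sum_measure[OF s] using A(2) B(2) null[of "A \<inter> B"] by (intro bexI[of _ "A \<inter> B"]) auto
  qed
qed

lemma ae_measurableI:
  fixes f :: "'a => 'b::topological_space option"
  assumes dom: "dom f \<subseteq> space M" and h [measurable]: "h \<in> borel_measurable M" and ae: "AE z in M. f z = Some (h z)"
  shows "ae_measurable M f"
  unfolding ae_measurable_def
proof (intro conjI allI impI)
  show "AE z in M. z \<in> dom f" using ae by eventually_elim (simp add: domI)
  fix W :: "'b set" assume W: "open W"
  show "{z \<in> dom f. the (f z) \<in> W} \<in> sets (completion M)"
  proof (rule completion_AE_set(1))
    show "h -` W \<inter> space M \<in> sets M" using W by (intro measurable_sets[OF h]) simp
    show "AE z in M. z \<in> {z \<in> dom f. the (f z) \<in> W} \<longleftrightarrow> z \<in> h -` W \<inter> space M"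
      using ae AE_space by eventually_elim (auto simp: domI)
  qed (use dom in auto)
qed (use dom in auto)

lemma (in measure_within) ae_measurable_representative:
  fixes f :: "'a => 'b::euclidean_space option"
  assumes "ae_measurable M f"
  obtains h where "h \<in> Borel" "AE z in M. f z = Some (h z)"
proof -
  define k where "k z = (case f z of None => 0 | Some y => y)" for z
  have dom: "AE z in M. z \<in> dom f" and meas: "\<And>W. open W ==> {z \<in> dom f. the (f z) \<in> W} \<in> sets (completion M)"
    using assms by (auto simp: ae_measurable_def)
  have D: "dom f \<in> sets (completion M)" using meas[of UNIV] by simp
  have "k \<in> borel_measurable (completion M)"
  proof (rule borel_measurableI)
    fix W :: "'b set" assume W: "open W"
    have "k -` W \<inter> space (completion M) = {z \<in> dom f. the (f z) \<in> W} \<union> (if 0 \<in> W then space (completion M) - dom f else {})"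
      using sets.sets_into_space[OF D] by (auto simp: k_def split: option.splits)
    thus "k -` W \<inter> space (completion M) \<in> sets (completion M)" using meas[OF W] D by auto
  qed
  then obtain h where h: "h \<in> Borel" "AE z in M. k z = h z"
    using borel_representative by blast
  have "AE z in M. f z = Some (h z)" using h(2) dom by eventually_elim (auto simp: k_def)
  thus ?thesis using that h(1) by blast
qed

lemma (in measure_within) completion_emeasure:
  assumes A: "A \<subseteq> U" and B: "B \<in> sets borel" and ae: "AE z in M. z \<in> A \<longleftrightarrow> z \<in> B"
  shows "emeasure (completion M) A = emeasure ext B"
proof -
  have BU: "B \<inter> U \<in> sets M" unfolding sets_M sets_restrict_space using B by (auto simp: Int_commute)
  have "AE z in M. z \<in> A \<longleftrightarrow> z \<in> B \<inter> U" using ae AE_space by eventually_elim (auto simp: space_M)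
  from completion_AE_set(2)[OF _ BU this] A show ?thesis by (simp add: space_M emeasure_ext[OF B])
qed

lemma (in measure_within) completion_nn_integral:
  assumes "f \<in> Borel" "AE z in M. g z = f z"
  shows "integral\<^sup>N (completion M) g = integral\<^sup>N ext f"
  unfolding nn_integral_completion nn_integral_ext[OF assms(1)] using assms(2) by (rule nn_integral_cong_AE)

section \<open>Finiteness of the variation up to the boundary\<close>

text \<open>\<open>K\<close> may meet the boundary of \<open>U\<close>. The variation of
  \<open>U \<inter> K\<close> is at most that of the open set \<open>U \<inter> N\<close>, whose
  admissible fields have support in the fixed compact subset \<open>spt \<zeta>\<close> of
  \<open>W\<close>.\<close>

lemma (in test_functional) variation_finite:
  assumes W: "open W" "U \<subseteq> W" and K: "compact K" "K \<subseteq> W"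
    and bnd: "\<And>K. compact K ==> K \<subseteq> W ==> \<exists>M. \<forall>u\<in>test_functions U. spt u \<subseteq> K \<longrightarrow> (\<forall>z. norm (u z) \<le> 1) \<longrightarrow> S u \<le> M"
  shows "emeasure (variation U S) (U \<inter> K) < \<infinity>"
proof -
  obtain \<zeta> :: "'a => real" and N where \<zeta>: "\<zeta> \<in> test_functions W" "\<And>z. 0 \<le> \<zeta> z" "\<And>z. \<zeta> z \<le> 1" "open N" "K \<subseteq> N" "\<And>z. z \<in> N ==> \<zeta> z = 1"
    using cutoff_exists[OF K(1) W(1) K(2)] by blast
  have N: "N \<subseteq> spt \<zeta>" using \<zeta>(6) not_in_spt[of _ \<zeta>] by fastforce
  obtain M where M: "\<forall>u\<in>test_functions U. spt u \<subseteq> spt \<zeta> \<longrightarrow> (\<forall>z. norm (u z) \<le> 1) \<longrightarrow> S u \<le> M"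
    using bnd[of "spt \<zeta>"] test_functionsD[OF \<zeta>(1)] by blast
  have "U \<inter> K \<in> sets (borel_of (top_of_set U))"
    unfolding sets_borel_of_top_of_set[OF open_U] sets_restrict_space using borel_compact[OF K(1)] by blast
  hence "emeasure (variation U S) (U \<inter> K) = vout (U \<inter> K)" by (rule emeasure_variation)
  also have "\<dots> \<le> vout (U \<inter> N)" using \<zeta>(5) by (intro vout_mono) auto
  also have "\<dots> = vopen (U \<inter> N)" using \<zeta>(4) open_U by (intro vout_open) auto
  also have "\<dots> \<le> ennreal M"
    unfolding vopen_def
  proof (rule SUP_least)
    fix u assume "u \<in> adm (U \<inter> N)"
    hence "S u \<le> M" using M N by (auto simp: adm_def)
    thus "ennreal (S u) \<le> ennreal M" by (rule ennreal_leI)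
  qed
  also have "\<dots> < \<infinity>" by simp
  finally show ?thesis .
qed

lemma test_functions_cutoff:
  assumes "\<zeta> \<in> test_functions U" "u \<in> test_functions W"
  shows "(\<lambda>z. \<zeta> z *\<^sub>R u z) \<in> test_functions U"
  by (rule test_functionsI[of _ "spt \<zeta>"])
    (use test_functionsD[OF assms(1)] test_functionsD(1)[OF assms(2)] in \<open>auto simp: not_in_spt intro: smooth_scaleR\<close>)

text \<open>The extension of \<open>S\<close> to functions whose support may meet \<open>\<partial>U\<close> is computed by exhausting \<open>U\<close>.\<close>

lemma (in radon_functional) L1_extension_limit:
  fixes \<zeta> :: "nat => 'a => real"
  assumes th: "u \<in> test_functions W" and fin: "emeasure (variation U S) (U \<inter> spt u) < \<infinity>"
    and \<zeta>: "\<And>j. \<zeta> j \<in> test_functions U" "\<And>j z. 0 \<le> \<zeta> j z" "\<And>j z. \<zeta> j z \<le> 1"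
      "\<And>z. z \<in> U ==> (\<lambda>j. \<zeta> j z) \<longlonglongrightarrow> 1"
  shows "(\<lambda>j. S (\<lambda>z. \<zeta> j z *\<^sub>R u z)) \<longlonglongrightarrow> L1_extension U S u"
proof -
  obtain \<nu> :: "'a => 'b" where \<nu> [measurable]: "\<nu> \<in> Borel" and \<nu>b: "\<And>z. norm (\<nu> z) \<le> 16"
    and rep: "\<And>u. u \<in> test_functions U ==> S u = (LINT z|vm. u z \<bullet> \<nu> z)"
    by (rule representing_density) blast
  have K: "compact (spt u)" using test_functionsD[OF th] by blast
  note [measurable] = test_functions_borel[OF th] test_functions_borel[OF \<zeta>(1)]
  have vm_borel: "h \<in> Borel ==> h \<in> borel_measurable vm" for h :: "'a => 'c::topological_space"
    by (simp only: measurable_cong_sets[OF vm.sets_eq refl])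
  have "(\<lambda>z. u z \<bullet> \<nu> z) \<in> Borel" "(\<lambda>z. \<zeta> j z *\<^sub>R u z \<bullet> \<nu> z) \<in> Borel" for j by measurable
  note meas = this[THEN vm_borel]
  obtain B where B: "0 < B" "\<And>z. norm (u z) \<le> B" using test_functions_bounded[OF th] by blast
  have sK: "spt u \<in> sets borel" using K by (rule borel_compact)
  have int: "integrable vm u"
  proof (rule integrableI_bounded_set[of "spt u" _ _ B])
    show "emeasure vm (spt u) < \<infinity>"
      using fin by (simp add: vm_def var.emeasure_ext[OF sK] Int_commute)
  qed (use sK B vm_borel[OF test_functions_borel[OF th]] in \<open>auto simp: not_in_spt\<close>)
  have ext: "L1_extension U S u = (LINT z|vm. u z \<bullet> \<nu> z)"
    by (rule L1_extension_eq[OF \<nu> \<nu>b rep _ int]) auto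
  have le: "norm (\<zeta> j z *\<^sub>R u z \<bullet> \<nu> z) \<le> 16 * norm (u z)" for j z
  proof -
    have "norm (\<zeta> j z *\<^sub>R u z \<bullet> \<nu> z) = \<zeta> j z * \<bar>u z \<bullet> \<nu> z\<bar>" using \<zeta>(2)[of j z] by (simp add: abs_mult)
    also have "\<dots> \<le> 1 * (norm (u z) * norm (\<nu> z))"
      using \<zeta>(2,3)[of j z] by (intro mult_mono Cauchy_Schwarz_ineq2) auto
    also have "\<dots> \<le> 16 * norm (u z)" using mult_left_mono[OF \<nu>b[of z] norm_ge_zero[of "u z"]] by simp
    finally show ?thesis .
  qed
  have "(\<lambda>j. LINT z|vm. \<zeta> j z *\<^sub>R u z \<bullet> \<nu> z) \<longlonglongrightarrow> (LINT z|vm. u z \<bullet> \<nu> z)"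
  proof (rule integral_dominated_convergence[where w="\<lambda>z. 16 * norm (u z)"])
    show "AE z in vm. (\<lambda>j. \<zeta> j z *\<^sub>R u z \<bullet> \<nu> z) \<longlonglongrightarrow> u z \<bullet> \<nu> z"
      using vm.AE_U
    proof eventually_elim
      case (elim z)
      have "(\<lambda>j. \<zeta> j z *\<^sub>R u z \<bullet> \<nu> z) \<longlonglongrightarrow> 1 *\<^sub>R u z \<bullet> \<nu> z"
        by (intro tendsto_intros \<zeta>(4) elim)
      thus ?case by simp
    qed
  qed (use le int meas in \<open>simp_all only: integrable_mult_right integrable_norm AE_I2\<close>)
  thus ?thesis unfolding ext using rep[OF test_functions_cutoff[OF \<zeta>(1) th]] by simp
qed

lemma (in open_measure) integrable_restricted:
  fixes h :: "'a => 'b::{banach, second_countable_topology}"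
  assumes "h \<in> Borel" "A \<in> sets borel" "K \<in> sets borel" "\<And>z. norm (h z) \<le> B" "\<And>z. z \<notin> K ==> h z = 0"
    and fin: "emeasure \<beta> (A \<inter> K) < \<infinity>"
  shows "integrable \<beta> (\<lambda>z. indicator A z *\<^sub>R h z)"
proof (rule integrableI_bounded_set[of "A \<inter> K" _ _ B])
  have "(\<lambda>z. indicator A z *\<^sub>R h z) \<in> Borel"
    using assms(1,2) by measurable
  thus "(\<lambda>z. indicator A z *\<^sub>R h z) \<in> borel_measurable \<beta>" by simp
  show "AE z in \<beta>. z \<in> A \<inter> K \<longrightarrow> norm (indicator A z *\<^sub>R h z) \<le> B" using assms(4) by auto
  show "AE z in \<beta>. z \<notin> A \<inter> K \<longrightarrow> indicator A z *\<^sub>R h z = 0" using assms(5) by (intro AE_I2) (auto simp: indicator_def)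
qed (use assms in auto)

section \<open>The distributional definitions in terms of densities\<close>

lemma admissible_False:
  "admissible False \<eta> \<longleftrightarrow> smooth \<eta> \<and> compact (closure {y. Df \<eta> y \<noteq> (\<lambda>_. 0)})"
  unfolding admissible_def by blast

lemma jacobian_add:
  assumes "smooth u" "smooth \<xi>"
  shows "jacobian (\<lambda>z. u z + \<xi> z) (at z) = jacobian u (at z) + jacobian \<xi> (at z)"
proof -
  have "((\<lambda>z. u z + \<xi> z) has_derivative (\<lambda>v. Df u z v + Df \<xi> z v)) (at z)"
    using assms by (intro has_derivative_add smooth_has_derivative)
  from frechet_derivative_at[OF this, symmetric] show ?thesis
    by (simp add: jacobian_def matrix_def vec_eq_iff)
qed

lemma jacobian_scaleR:
  assumes "smooth u"
  shows "jacobian (\<lambda>z. c *\<^sub>R u z) (at z) = c *\<^sub>R jacobian u (at z)"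
proof -
  have "((\<lambda>z. c *\<^sub>R u z) has_derivative (\<lambda>v. c *\<^sub>R Df u z v)) (at z)"
    using assms by (intro has_derivative_scaleR_right smooth_has_derivative)
  from frechet_derivative_at[OF this, symmetric] show ?thesis
    by (simp add: jacobian_def matrix_def vec_eq_iff)
qed

text \<open>\<open>P\<close> is a mean tangent plane and \<nu> a density of the first variation with
  respect to its total variation, both chosen once as Borel functions defined everywhere;
  \<open>16\<close> is the constant of \<open>test_bound\<close>.\<close>

locale varifold_fv = varifold_within U m V + T: radon_functional U "first_variation V"
  for U :: "(real^'n) set" and m V +
  fixes P :: "real^'n => real^'n^'n" and \<nu> :: "real^'n => real^'n"
  assumes P0: "P \<in> Borel" "norm (P z) \<le> sqrt m"
    and \<nu>0: "\<nu> \<in> Borel" "norm (\<nu> z) \<le> 16"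
    and plane_mean: "\<psi> \<in> Borel ==> integrable W.ext \<psi> ==>
      (LINT p|V. \<psi> (fst p) \<bullet> orth_projection (snd p)) = (LINT z|W.ext. \<psi> z \<bullet> P z)"
    and density: "u \<in> test_functions U ==> first_variation V u = (LINT z|T.vm. u z \<bullet> \<nu> z)"

lemma ex_varifold_fv:
  assumes "open U" "varifold U m V" and "radon_measure_on (top_of_set U) (total_variation U V)"
  shows "\<exists>P \<nu>. varifold_fv U m V P \<nu>"
proof -
  interpret varifold_within U m V by unfold_locales fact+
  obtain P where P: "P \<in> Borel" "\<And>z. norm (P z) \<le> sqrt m"
    "\<And>\<psi>. \<psi> \<in> Borel ==> integrable W.ext \<psi> ==>
      (LINT p|V. \<psi> (fst p) \<bullet> orth_projection (snd p)) = (LINT z|W.ext. \<psi> z \<bullet> P z)"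
    by (rule mean_plane) blast
  have fv: "first_variation V u = (LINT p|V. jacobian u (at (fst p)) \<bullet> orth_projection (snd p))" for u
    by (simp add: first_variation_def split_beta')
  have int: "integrable V (\<lambda>p. jacobian u (at (fst p)) \<bullet> orth_projection (snd p))" if "u \<in> test_functions U" for u :: "real^'a => real^'a"
    using plane_integrable(1)[OF test_functions_borel \<alpha>.integrable_test, OF test_functions_jacobian test_functions_jacobian, OF that that] .
  interpret T: radon_functional U "first_variation V"
  proof
    show "first_variation V (\<lambda>z. u z + \<xi> z) = first_variation V u + first_variation V \<xi>"
      if "u \<in> test_functions U" "\<xi> \<in> test_functions U" for u \<xi>
      unfolding fv using int[OF that(1)] int[OF that(2)] test_functionsD(1)[OF that(1)] test_functionsD(1)[OF that(2)]
      by (simp add: jacobian_add inner_add_left)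
    show "first_variation V (\<lambda>z. c *\<^sub>R u z) = c * first_variation V u" if "u \<in> test_functions U" for u c
      unfolding fv using test_functionsD(1)[OF that] by (simp add: jacobian_scaleR)
    show "emeasure (variation U (first_variation V)) K < \<infinity>" if "compact K" "K \<subseteq> U" for K
      using assms(3) that unfolding radon_measure_on_def total_variation_def by (auto simp: compactin_subtopology)
  qed fact
  obtain \<nu> :: "real^'a => real^'a" where "\<nu> \<in> Borel" "\<And>z. norm (\<nu> z) \<le> 16"
    "\<And>u. u \<in> test_functions U ==> first_variation V u = (LINT z|T.vm. u z \<bullet> \<nu> z)"
    by (rule T.representing_density) blast
  hence "varifold_fv U m V P \<nu>" using P by unfold_locales auto
  thus ?thesis by blast
qed

context varifold_fv
begin

sublocale fv_data U W.ext T.vm P \<nu> "sqrt m" 16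
  using P0 \<nu>0 by unfold_locales auto

lemma sets_total: "sets (total_variation U V) = sets (weight U V)"
  using T.var.sets_M W.sets_M by (simp add: total_variation_def)

text \<open>One Borel function has to represent \<open>f\<close> for both measures: the extended
  first variation is an integral over the total variation, which may charge null sets of the weight,
  and the other terms are integrals over the weight.\<close>

definition represents :: "(real^'n => (real^'l) option) => (real^'n => real^'l) => bool" where
  "represents f f0 \<longleftrightarrow> dom f \<subseteq> U \<and> f0 \<in> Borel \<and>
     (AE z in weight U V. f z = Some (f0 z)) \<and> (AE z in total_variation U V. f z = Some (f0 z))"

lemma represents_borel: "represents f f0 ==> f0 \<in> Borel"
  by (simp add: represents_def)

lemma ae_measurable_iff_represented:
  "ae_measurable (sum_measure (weight U V) (total_variation U V)) f \<longleftrightarrow> (\<exists>f0. represents f f0)"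
proof -
  let ?M = "sum_measure (weight U V) (total_variation U V)"
  interpret S: measure_within U ?M
    by unfold_locales (simp_all add: open_U0 sets_sum_measure[OF sets_total] W.sets_M)
  show ?thesis
  proof
    assume a: "ae_measurable ?M f"
    then obtain h where "h \<in> Borel" "AE z in ?M. f z = Some (h z)"
      using S.ae_measurable_representative by blast
    moreover have "dom f \<subseteq> U" using a by (simp add: ae_measurable_def S.space_M)
    ultimately show "\<exists>f0. represents f f0"
      by (auto simp: represents_def AE_sum_measure[OF sets_total])
  next
    assume "\<exists>f0. represents f f0"
    then obtain f0 where "represents f f0" by blast
    thus "ae_measurable ?M f"
      by (intro ae_measurableI[of _ _ f0]) (auto simp: represents_def S.space_M AE_sum_measure[OF sets_total] intro: S.borel_M)
  qed
qed

lemma first_variation_ext_eq: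
  assumes "\<psi>' \<in> Borel" "integrable T.vm \<psi>'" "AE z in total_variation U V. \<psi> z = \<psi>' z"
  shows "first_variation_ext U V \<psi> = (LINT z|T.vm. \<psi>' z \<bullet> \<nu> z)"
  unfolding first_variation_ext_def
  by (rule T.L1_extension_eq[OF \<nu>0 density]) (use assms[unfolded total_variation_def] in auto)

lemma plane_integral:
  fixes \<psi> :: "real^'n => real^'n^'n"
  assumes \<psi>: "\<psi> \<in> Borel" and int: "integrable W.ext \<psi>" and ae: "AE z in weight U V. \<phi> z = \<psi> z"
  shows "(LINT p|completion V. \<phi> (fst p) \<bullet> orth_projection (snd p)) = (LINT z|W.ext. \<psi> z \<bullet> P z)"
proof -
  have m: "(\<lambda>p. \<psi> (fst p) \<bullet> orth_projection (snd p)) \<in> borel_measurable V"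
    using plane_integrable(1)[OF \<psi> int] by simp
  have ae': "AE p in V. \<phi> (fst p) \<bullet> orth_projection (snd p) = \<psi> (fst p) \<bullet> orth_projection (snd p)"
    using weight_AE[OF ae] by eventually_elim simp
  have "(LINT p|completion V. \<phi> (fst p) \<bullet> orth_projection (snd p)) = (LINT p|completion V. \<psi> (fst p) \<bullet> orth_projection (snd p))"
    using measurable_completion[OF m] measurable_completion_AE[OF m ae'] AE_completion[OF ae'] by (intro integral_cong_AE)
  also have "\<dots> = (LINT p|V. \<psi> (fst p) \<bullet> orth_projection (snd p))" using m by (rule integral_completion)
  finally show ?thesis by (simp add: plane_mean[OF \<psi> int])
qed

text \<open>\<open>bdry\<close> collects the extended first variation on the left and the integral
  over \<open>V\<close> on the right.\<close>

lemma weak_derivative_iff_parts: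
  fixes f :: "real^'n => (real^'l) option" and F :: "real^'n => (real^'n^'l) option"
  assumes f: "represents f f0" and F0: "F0 \<in> Borel" and F: "AE z in weight U V. F z = Some (F0 z)"
  shows "(\<forall>u \<in> test_functions U. \<forall>\<eta>. smooth \<eta> \<and> compact (closure {y. Df \<eta> y \<noteq> (\<lambda>_. 0)}) \<longrightarrow>
        first_variation_ext U V (\<lambda>z. \<eta> (the (f z)) *\<^sub>R u z) =
          (LINT (z, S)|completion V. \<eta> (the (f z)) * (orth_projection S \<bullet> jacobian u (at z))) +
          (LINT z|completion (weight U V). Df \<eta> (the (f z)) (the (F z) *v u z)))
     \<longleftrightarrow> parts False U f0 F0"
proof -
  have f0: "f0 \<in> Borel" and fw: "AE z in weight U V. f z = Some (f0 z)" and ft: "AE z in total_variation U V. f z = Some (f0 z)"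
    using f by (auto simp: represents_def)
  have "(first_variation_ext U V (\<lambda>z. \<eta> (the (f z)) *\<^sub>R u z) =
          (LINT (z, S)|completion V. \<eta> (the (f z)) * (orth_projection S \<bullet> jacobian u (at z))) +
          (LINT z|completion (weight U V). Df \<eta> (the (f z)) (the (F z) *v u z)))
     \<longleftrightarrow> bdry (\<lambda>z. \<eta> (f0 z)) u = (LINT z|W.ext. Df \<eta> (f0 z) (F0 z *v u z))"
    if th: "u \<in> test_functions U" and adm: "admissible False \<eta>" for u \<eta>
  proof -
    have sm: "smooth \<eta>" using adm by (simp add: admissible_False)
    note [measurable] = f0 F0 test_functions_borel[OF th] test_functions_borel[OF test_functions_jacobian[OF th]] smooth_borel[OF sm]
    have K: "compact (spt u)" "spt u \<subseteq> U" using test_functionsD[OF th] by auto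
    obtain B where B: "0 < B" "\<And>z. norm (u z) \<le> B" "\<And>z. norm (jacobian u (at z)) \<le> B"
      using test_bounds[OF th] by blast
    obtain C where C: "0 < C" "\<And>y. \<bar>\<eta> y\<bar> \<le> C" "\<And>y v. \<bar>Df \<eta> y v\<bar> \<le> C * norm v"
      using admissible_bounds[OF adm] by blast
    have le: "norm (\<eta> y *\<^sub>R v) \<le> C * B" if "norm v \<le> B" for y and v :: "'b::real_normed_vector"
      using mult_mono[OF C(2)[of y] that] C(1) by simp
    have "first_variation_ext U V (\<lambda>z. \<eta> (the (f z)) *\<^sub>R u z) = (LINT z|T.vm. (\<eta> (f0 z) *\<^sub>R u z) \<bullet> \<nu> z)"
    proof (rule first_variation_ext_eq)
      show "AE z in total_variation U V. \<eta> (the (f z)) *\<^sub>R u z = \<eta> (f0 z) *\<^sub>R u z"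
        using ft by eventually_elim simp
      show "integrable T.vm (\<lambda>z. \<eta> (f0 z) *\<^sub>R u z)"
        by (rule T.vm.integrable_bounded_compact[OF _ K le[OF B(2)]]) (measurable, simp add: not_in_spt)
    qed measurable
    hence 1: "first_variation_ext U V (\<lambda>z. \<eta> (the (f z)) *\<^sub>R u z) = (LINT z|T.vm. \<eta> (f0 z) * (u z \<bullet> \<nu> z))"
      by simp
    have "(LINT p|completion V. (\<eta> (the (f (fst p))) *\<^sub>R jacobian u (at (fst p))) \<bullet> orth_projection (snd p)) = (LINT z|W.ext. (\<eta> (f0 z) *\<^sub>R jacobian u (at z)) \<bullet> P z)"
    proof (rule plane_integral)
      show "AE z in weight U V. \<eta> (the (f z)) *\<^sub>R jacobian u (at z) = \<eta> (f0 z) *\<^sub>R jacobian u (at z)"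
        using fw by eventually_elim simp
      show "integrable W.ext (\<lambda>z. \<eta> (f0 z) *\<^sub>R jacobian u (at z))"
        by (rule \<alpha>.integrable_bounded_compact[OF _ K le[OF B(3)]]) (measurable, simp add: jacobian_notin_spt)
    qed measurable
    hence 2: "(LINT (z, S)|completion V. \<eta> (the (f z)) * (orth_projection S \<bullet> jacobian u (at z))) = (LINT z|W.ext. \<eta> (f0 z) * (tdiv u z))"
      by (simp add: split_beta' inner_commute)
    have 3: "(LINT z|completion (weight U V). Df \<eta> (the (f z)) (the (F z) *v u z)) = (LINT z|W.ext. Df \<eta> (f0 z) (F0 z *v u z))"
    proof (rule W.completion_integral(1))
      show "(\<lambda>z. Df \<eta> (f0 z) (F0 z *v u z)) \<in> Borel"
        by (intro derivative_measurable[OF sm] f0 matrix_vector_measurable F0 test_functions_borel[OF th])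
      show "AE z in weight U V. Df \<eta> (the (f z)) (the (F z) *v u z) = Df \<eta> (f0 z) (F0 z *v u z)"
        using fw F by eventually_elim simp
    qed
    show ?thesis unfolding 1 2 3 bdry_def by linarith
  qed
  thus ?thesis unfolding parts_def admissible_False[symmetric] by blast
qed

lemma superlevel_AE:
  assumes "represents f f0"
  shows "AE z in weight U V. z \<in> superlevel f t \<longleftrightarrow> z \<in> {z. t < norm (f0 z)}"
    "AE z in total_variation U V. z \<in> superlevel f t \<longleftrightarrow> z \<in> {z. t < norm (f0 z)}"
proof -
  have "AE z in weight U V. f z = Some (f0 z)" "AE z in total_variation U V. f z = Some (f0 z)"
    using assms by (auto simp: represents_def)
  moreover have "z \<in> superlevel f t \<longleftrightarrow> z \<in> {z. t < norm (f0 z)}" if "f z = Some (f0 z)" for z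
    using that by (auto simp: superlevel_def)
  ultimately show "AE z in weight U V. z \<in> superlevel f t \<longleftrightarrow> z \<in> {z. t < norm (f0 z)}"
    "AE z in total_variation U V. z \<in> superlevel f t \<longleftrightarrow> z \<in> {z. t < norm (f0 z)}"
    by (blast intro: eventually_mono)+
qed

lemma superlevel_emeasure:
  assumes f: "represents f f0" and K: "K \<in> sets borel"
  shows "emeasure (completion (weight U V)) (superlevel f t \<inter> K) = emeasure W.ext ({z. t < norm (f0 z)} \<inter> K)"
    "emeasure (completion (total_variation U V)) (superlevel f t \<inter> K) = emeasure T.vm ({z. t < norm (f0 z)} \<inter> K)"
proof -
  note [measurable] = represents_borel[OF f] K
  have 1: "superlevel f t \<inter> K \<subseteq> U" using f by (auto simp: represents_def superlevel_def)
  have 2: "{z. t < norm (f0 z)} \<inter> K \<in> sets borel" by measurable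
  show "emeasure (completion (weight U V)) (superlevel f t \<inter> K) = emeasure W.ext ({z. t < norm (f0 z)} \<inter> K)"
    by (rule W.completion_emeasure[OF 1 2 eventually_mono[OF superlevel_AE(1)[OF f, of t]]]) auto
  show "emeasure (completion (total_variation U V)) (superlevel f t \<inter> K) = emeasure T.vm ({z. t < norm (f0 z)} \<inter> K)"
    unfolding T.vm_def total_variation_def
    by (rule T.var.completion_emeasure[OF 1 2 eventually_mono[OF superlevel_AE(2)[OF f, of t, unfolded total_variation_def]]]) auto
qed

text \<open>\<open>E\<close> is measurable only up to null sets. For the Borel set \<open>E0\<close>
  the prescribed values are those of a density, hence countably additive, and
  \<open>measure_of\<close> reproduces them.\<close>

lemma varifold_restrict_eq:
  assumes E0: "E0 \<in> sets borel" and ae: "AE z in weight U V. z \<in> E \<longleftrightarrow> z \<in> E0"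
  shows "varifold_restrict V E = density V (\<lambda>p. ennreal (indicator E0 (fst p)))"
proof -
  let ?D = "density V (\<lambda>p. ennreal (indicator E0 (fst p)))"
  have E0V: "fst -` E0 \<inter> space V \<in> sets V" by (rule measurable_sets[OF fst_borel E0])
  have "emeasure (completion V) (a \<inter> (E \<times> UNIV)) = emeasure ?D a" if a: "a \<in> sets V" for a
  proof -
    have "emeasure (completion V) (a \<inter> (E \<times> UNIV)) = emeasure V (a \<inter> (fst -` E0 \<inter> space V))"
    proof (rule completion_AE_set(2))
      show "AE p in V. p \<in> a \<inter> (E \<times> UNIV) \<longleftrightarrow> p \<in> a \<inter> (fst -` E0 \<inter> space V)"
        using weight_AE[OF ae] AE_space by eventually_elim (auto simp: mem_Times_iff)
    qed (use a E0V sets.sets_into_space[OF a] in auto)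
    also have "\<dots> = (\<integral>\<^sup>+p. indicator (a \<inter> (fst -` E0 \<inter> space V)) p \<partial>V)" using a E0V by simp
    also have "\<dots> = (\<integral>\<^sup>+p. ennreal (indicator E0 (fst p)) * indicator a p \<partial>V)"
      by (intro nn_integral_cong) (auto simp: indicator_def)
    also have "\<dots> = emeasure ?D a"
      using a E0 by (subst emeasure_density) (auto intro!: measurable_compose[OF fst_borel])
    finally show ?thesis .
  qed
  hence "varifold_restrict V E = measure_of (space V) (sets V) (emeasure ?D)"
    unfolding varifold_restrict_def by (intro measure_of_eq sets.space_closed) (simp add: sets.sigma_sets_eq)
  also have "\<dots> = ?D" using measure_of_of_measure[of ?D] by simp
  finally show ?thesis .
qed

text \<open>For fields with compact support in \<open>U\<close> the functionals are integrals
  against bounded functions; fields reaching the boundary of \<open>U\<close> are the subject of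
  \<open>boundary_condition_iff\<close>.\<close>

lemma restrict_values:
  fixes f :: "real^'n => (real^'l) option"
  assumes f: "represents f f0" and th: "u \<in> test_functions U"
  shows "first_variation_restrict U V (superlevel f t) u = (LINT z|T.vm. above f0 t z * (u z \<bullet> \<nu> z))"
    and "varifold_boundary U V (superlevel f t) u = bdry (above f0 t) u"
    and "integrable T.vm (\<lambda>z. above f0 t z * (u z \<bullet> \<nu> z))"
    and "integrable W.ext (\<lambda>z. above f0 t z * (tdiv u z))"
proof -
  let ?E = "{z. t < norm (f0 z)}"
  note [measurable] = represents_borel[OF f] test_functions_borel[OF th] test_functions_borel[OF test_functions_jacobian[OF th]]
  have E [measurable]: "?E \<in> sets borel" by measurable
  have K: "compact (spt u)" "spt u \<subseteq> U" using test_functionsD[OF th] by auto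
  have KB: "spt u \<in> sets borel" using K(1) by (rule borel_compact)
  obtain B where B: "0 < B" "\<And>z. norm (u z) \<le> B" "\<And>z. norm (jacobian u (at z)) \<le> B"
    using test_bounds[OF th] by blast
  have ab: "above f0 t z = indicator ?E z" for z by (simp add: above_def)
  have i1: "integrable T.vm (\<lambda>z. indicator ?E z *\<^sub>R u z)"
    by (rule T.vm.integrable_bounded_compact[OF _ K, of _ B]) (use B in \<open>auto simp: not_in_spt indicator_def\<close>)
  have i2: "integrable W.ext (\<lambda>z. indicator ?E z *\<^sub>R jacobian u (at z))"
    by (rule \<alpha>.integrable_bounded_compact[OF _ K, of _ B]) (use B in \<open>auto simp: jacobian_notin_spt indicator_def\<close>)
  have "first_variation_ext U V (\<lambda>z. indicator (superlevel f t) z *\<^sub>R u z) = (LINT z|T.vm. (indicator ?E z *\<^sub>R u z) \<bullet> \<nu> z)"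
  proof (rule first_variation_ext_eq[OF _ i1])
    show "AE z in total_variation U V. indicator (superlevel f t) z *\<^sub>R u z = indicator ?E z *\<^sub>R u z"
      using superlevel_AE(2)[OF f, of t] by eventually_elim (simp add: indicator_def)
  qed measurable
  thus 1: "first_variation_restrict U V (superlevel f t) u = (LINT z|T.vm. above f0 t z * (u z \<bullet> \<nu> z))"
    by (simp add: first_variation_restrict_def ab)
  have "first_variation (varifold_restrict V (superlevel f t)) u = (LINT p|density V (\<lambda>p. ennreal (indicator ?E (fst p))). jacobian u (at (fst p)) \<bullet> orth_projection (snd p))"
    unfolding varifold_restrict_eq[OF E superlevel_AE(1)[OF f]] by (simp add: first_variation_def split_beta')
  also have "\<dots> = (LINT p|V. indicator ?E (fst p) *\<^sub>R (jacobian u (at (fst p)) \<bullet> orth_projection (snd p)))"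
  proof (rule integral_density)
    show "(\<lambda>p. indicator ?E (fst p) :: real) \<in> borel_measurable V" by (rule measurable_compose[OF fst_borel]) measurable
    show "(\<lambda>p. jacobian u (at (fst p)) \<bullet> orth_projection (snd p)) \<in> borel_measurable V"
      by (intro borel_measurable_inner measurable_compose[OF fst_borel] orth_projection_measurable) measurable
  qed simp
  also have "\<dots> = (LINT p|V. (indicator ?E (fst p) *\<^sub>R jacobian u (at (fst p))) \<bullet> orth_projection (snd p))" by simp
  also have "\<dots> = (LINT z|W.ext. (indicator ?E z *\<^sub>R jacobian u (at z)) \<bullet> P z)"
    by (rule plane_mean[OF _ i2]) measurable
  finally show "varifold_boundary U V (superlevel f t) u = bdry (above f0 t) u"
    by (simp add: varifold_boundary_def 1 bdry_def ab inner_commute)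
  have "superlevel_finite False U f0"
    unfolding superlevel_finite_def using \<alpha>.compact_finite T.vm.compact_finite by simp
  hence fin: "emeasure W.ext {z \<in> spt u. True} < \<infinity>" "emeasure T.vm {z \<in> spt u. True} < \<infinity>"
    using K \<alpha>.compact_finite T.vm.compact_finite by auto
  show "integrable T.vm (\<lambda>z. above f0 t z * (u z \<bullet> \<nu> z))" "integrable W.ext (\<lambda>z. above f0 t z * (tdiv u z))"
    by (rule bdry_integrable[OF th _ KB _ _, of _ 1]; use fin in \<open>simp add: ab[abs_def] indicator_def\<close>)+
qed

end

section \<open>Zero boundary values and their inheritance by products\<close>

section \<open>Zero boundary values\<close>

context varifold_fv
begin

lemma superlevel_functionals:
  fixes f :: "real^'n => (real^'l) option"
  assumes f: "represents f f0"
  shows "test_functional U (first_variation_restrict U V (superlevel f t))"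
    "test_functional U (varifold_boundary U V (superlevel f t))"
proof -
  note val = restrict_values[OF f]
  show "test_functional U (first_variation_restrict U V (superlevel f t))"
  proof
    show "first_variation_restrict U V (superlevel f t) (\<lambda>z. u z + \<xi> z) = first_variation_restrict U V (superlevel f t) u + first_variation_restrict U V (superlevel f t) \<xi>"
      if "u \<in> test_functions U" "\<xi> \<in> test_functions U" for u \<xi>
      using val(1,3)[OF that(1)] val(1,3)[OF that(2)] val(1)[OF test_functions_add[OF that]]
      by (simp add: inner_add_left distrib_left)
    show "first_variation_restrict U V (superlevel f t) (\<lambda>z. c *\<^sub>R u z) = c * first_variation_restrict U V (superlevel f t) u"
      if "u \<in> test_functions U" for u c
      using val(1)[OF that] val(1)[OF test_functions_scaleR[OF that]] by (simp add: mult.left_commute)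
  qed (rule open_U0)
  show "test_functional U (varifold_boundary U V (superlevel f t))"
  proof
    show "varifold_boundary U V (superlevel f t) (\<lambda>z. u z + \<xi> z) = varifold_boundary U V (superlevel f t) u + varifold_boundary U V (superlevel f t) \<xi>"
      if "u \<in> test_functions U" "\<xi> \<in> test_functions U" for u \<xi>
      using val(3,4)[OF that(1)] val(3,4)[OF that(2)] test_functionsD(1)[OF that(1)] test_functionsD(1)[OF that(2)]
      unfolding val(2)[OF that(1)] val(2)[OF that(2)] val(2)[OF test_functions_add[OF that]] bdry_def
      by (simp add: jacobian_add inner_add_left inner_add_right distrib_left)
    show "varifold_boundary U V (superlevel f t) (\<lambda>z. c *\<^sub>R u z) = c * varifold_boundary U V (superlevel f t) u"
      if "u \<in> test_functions U" for u c
      using test_functionsD(1)[OF that]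
      unfolding val(2)[OF that] val(2)[OF test_functions_scaleR[OF that]] bdry_def
      by (simp add: jacobian_scaleR mult.left_commute right_diff_distrib)
  qed (rule open_U0)
qed

lemma variation_int:
  assumes "U \<subseteq> W" "\<And>K. compact K ==> K \<subseteq> W ==> emeasure (variation U S) (U \<inter> K) < \<infinity>" "test_functional U S"
  shows "radon_functional U S"
proof -
  interpret test_functional U S by fact
  show ?thesis
  proof
    fix K assume "compact K" "K \<subseteq> U"
    thus "emeasure (variation U S) K < \<infinity>" using assms(1) assms(2)[of K] by (simp add: Int_absorb1)
  qed
qed

text \<open>Both extensions are limits along the fields \<zeta> j u. For the restricted first
  variation the limit is the expected integral, so the identity states that the extension of the
  boundary functional, the limit of its values at \<zeta> j u, equals
  \<open>bdry (above f0 t) u\<close>.\<close>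

lemma boundary_condition_iff:
  fixes f :: "real^'n => (real^'l) option" and \<zeta> :: "nat => real^'n => real"
  assumes f: "represents f f0" and W: "open W" "U \<subseteq> W"
    and fin: "\<And>K. compact K ==> K \<subseteq> W ==> emeasure W.ext ({z. t < norm (f0 z)} \<inter> K) < \<infinity>"
      "\<And>K. compact K ==> K \<subseteq> W ==> emeasure T.vm ({z. t < norm (f0 z)} \<inter> K) < \<infinity>"
      "\<And>K. compact K ==> K \<subseteq> W ==> emeasure (variation U (varifold_boundary U V (superlevel f t))) (U \<inter> K) < \<infinity>"
    and th: "u \<in> test_functions W"
    and \<zeta>: "\<And>j. \<zeta> j \<in> test_functions U" "\<And>j z. 0 \<le> \<zeta> j z" "\<And>j z. \<zeta> j z \<le> 1"
      "\<And>z. z \<in> U ==> (\<lambda>j. \<zeta> j z) \<longlonglongrightarrow> 1"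
  shows "(LINT (z, S):superlevel f t \<times> UNIV|completion V. jacobian u (at z) \<bullet> orth_projection S) =
      L1_extension U (first_variation_restrict U V (superlevel f t)) u - L1_extension U (varifold_boundary U V (superlevel f t)) u
    \<longleftrightarrow> level_limit \<zeta> f0 t u"
proof -
  let ?E = "{z. t < norm (f0 z)}" and ?R = "first_variation_restrict U V (superlevel f t)" and ?B = "varifold_boundary U V (superlevel f t)"
  note [measurable] = represents_borel[OF f] test_functions_borel[OF th] test_functions_borel[OF test_functions_jacobian[OF th]]
  have T_borel: "h \<in> Borel ==> h \<in> borel_measurable T.vm" for h :: "real^'n => real"
    by (simp only: measurable_cong_sets[OF T.vm.sets_eq refl])
  have E [measurable]: "?E \<in> sets borel" by measurable
  have "(\<lambda>z. indicator ?E z *\<^sub>R u z) \<in> Borel" by measurable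
  hence mE: "(\<lambda>z. (indicator ?E z *\<^sub>R u z) \<bullet> \<nu> z) \<in> Borel"
    by (rule borel_measurable_inner[OF _ \<nu>0(1)])
  have K: "compact (spt u)" "spt u \<subseteq> W" using test_functionsD[OF th] by auto
  have KB: "spt u \<in> sets borel" using K(1) by (rule borel_compact)
  obtain B where B: "0 < B" "\<And>z. norm (u z) \<le> B" "\<And>z. norm (jacobian u (at z)) \<le> B"
    using test_bounds[OF th] by blast
  have ab: "above f0 t z = indicator ?E z" for z by (simp add: above_def)
  have i1: "integrable T.vm (\<lambda>z. indicator ?E z *\<^sub>R u z)"
    by (rule T.vm.integrable_restricted[OF _ E KB B(2) _ fin(2)[OF K]]) (simp_all add: not_in_spt)
  have i2: "integrable W.ext (\<lambda>z. indicator ?E z *\<^sub>R jacobian u (at z))"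
    by (rule \<alpha>.integrable_restricted[OF _ E KB B(3) _ fin(1)[OF K]]) (simp_all add: jacobian_notin_spt)
  interpret R: test_functional U ?R by (rule superlevel_functionals(1)[OF f])
  \<comment> \<open>The density of the restricted first variation is bounded by \<open>16\<close>
    and lives on the superlevel set, whose part in \<open>K\<close> has finite measure.\<close>
  have R_fin: "emeasure (variation U ?R) (U \<inter> K) < \<infinity>" if "compact K" "K \<subseteq> W" for K
  proof (rule R.variation_finite[OF W that])
    fix K assume K: "compact K" "K \<subseteq> W"
    have KB: "K \<in> sets borel" using K(1) by (rule borel_compact)
    show "\<exists>M. \<forall>u\<in>test_functions U. spt u \<subseteq> K \<longrightarrow> (\<forall>z. norm (u z) \<le> 1) \<longrightarrow> ?R u \<le> M"
    proof (intro exI ballI impI)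
      fix u :: "real^'n => real^'n" assume th: "u \<in> test_functions U" "spt u \<subseteq> K" "\<forall>z. norm (u z) \<le> 1"
      have "?R u = (LINT z|T.vm. above f0 t z * (u z \<bullet> \<nu> z))" by (rule restrict_values(1)[OF f th(1)])
      also have "\<dots> \<le> (LINT z|T.vm. 16 * indicator (?E \<inter> K) z)"
      proof (rule integral_mono)
        show "integrable T.vm (\<lambda>z. above f0 t z * (u z \<bullet> \<nu> z))" by (rule restrict_values(3)[OF f th(1)])
        show "integrable T.vm (\<lambda>z. 16 * indicator (?E \<inter> K) z :: real)"
          using fin(2)[OF K] E KB by (intro integrable_mult_right integrable_real_indicator) auto
        fix z
        show "above f0 t z * (u z \<bullet> \<nu> z) \<le> 16 * indicator (?E \<inter> K) z"
        proof (cases "z \<in> K")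
          case True
          have "u z \<bullet> \<nu> z \<le> 16" using inner_\<nu>_le[of "u z" 1 z] th(3) by auto
          thus ?thesis using True by (simp add: ab indicator_def)
        next
          case False
          hence "u z = 0" using th(2) by (intro not_in_spt) blast
          thus ?thesis by (simp add: indicator_def)
        qed
      qed
      finally show "?R u \<le> (LINT z|T.vm. 16 * indicator (?E \<inter> K) z)" .
    qed
  qed
  interpret R: radon_functional U ?R by (rule variation_int[OF W(2) R_fin R.test_functional_axioms])
  interpret B: radon_functional U ?B by (rule variation_int[OF W(2) fin(3) superlevel_functionals(2)[OF f]])
  have \<zeta>u: "(\<lambda>z. \<zeta> j z *\<^sub>R u z) \<in> test_functions U" for j by (rule test_functions_cutoff[OF \<zeta>(1) th])
  have limB: "(\<lambda>j. bdry (above f0 t) (\<lambda>z. \<zeta> j z *\<^sub>R u z)) \<longlonglongrightarrow> L1_extension U ?B u"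
    using B.L1_extension_limit[OF th fin(3)[OF K] \<zeta>] by (simp add: restrict_values(2)[OF f \<zeta>u])
  have limR: "(\<lambda>j. LINT z|T.vm. \<zeta> j z * ((indicator ?E z *\<^sub>R u z) \<bullet> \<nu> z)) \<longlonglongrightarrow> L1_extension U ?R u"
  proof -
    have "?R (\<lambda>z. \<zeta> j z *\<^sub>R u z) = (LINT z|T.vm. \<zeta> j z * ((indicator ?E z *\<^sub>R u z) \<bullet> \<nu> z))" for j
      unfolding restrict_values(1)[OF f \<zeta>u] by (intro Bochner_Integration.integral_cong) (simp_all add: ab)
    thus ?thesis using R.L1_extension_limit[OF th R_fin[OF K] \<zeta>] by simp
  qed
  have i3: "integrable T.vm (\<lambda>z. (indicator ?E z *\<^sub>R u z) \<bullet> \<nu> z)"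
  proof (rule Bochner_Integration.integrable_bound[OF integrable_mult_right[OF integrable_norm[OF i1], of 16]])
    show "(\<lambda>z. (indicator ?E z *\<^sub>R u z) \<bullet> \<nu> z) \<in> borel_measurable T.vm" by (rule T_borel[OF mE])
    show "AE z in T.vm. norm ((indicator ?E z *\<^sub>R u z) \<bullet> \<nu> z) \<le> norm (16 * norm (indicator ?E z *\<^sub>R u z))"
    proof (rule AE_I2)
      fix z show "norm ((indicator ?E z *\<^sub>R u z) \<bullet> \<nu> z) \<le> norm (16 * norm (indicator ?E z *\<^sub>R u z))"
        using inner_\<nu>_le[OF order_refl, of "indicator ?E z *\<^sub>R u z" z]
        by (simp only: real_norm_def abs_mult abs_norm_cancel abs_numeral mult.commute)
    qed
  qed
  have "(\<lambda>j. LINT z|T.vm. \<zeta> j z * ((indicator ?E z *\<^sub>R u z) \<bullet> \<nu> z)) \<longlonglongrightarrow> (LINT z|T.vm. (indicator ?E z *\<^sub>R u z) \<bullet> \<nu> z)"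
  proof (rule integral_dominated_convergence[where w="\<lambda>z. \<bar>(indicator ?E z *\<^sub>R u z) \<bullet> \<nu> z\<bar>"])
    show "AE z in T.vm. (\<lambda>j. \<zeta> j z * ((indicator ?E z *\<^sub>R u z) \<bullet> \<nu> z)) \<longlonglongrightarrow> (indicator ?E z *\<^sub>R u z) \<bullet> \<nu> z"
      using T.vm.AE_U
    proof eventually_elim
      case (elim z)
      have "(\<lambda>j. \<zeta> j z * ((indicator ?E z *\<^sub>R u z) \<bullet> \<nu> z)) \<longlonglongrightarrow> 1 * ((indicator ?E z *\<^sub>R u z) \<bullet> \<nu> z)"
        by (intro tendsto_intros \<zeta>(4) elim)
      thus ?case by simp
    qed
    show "AE z in T.vm. norm (\<zeta> j z * ((indicator ?E z *\<^sub>R u z) \<bullet> \<nu> z)) \<le> \<bar>(indicator ?E z *\<^sub>R u z) \<bullet> \<nu> z\<bar>" for j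
      using \<zeta>(2,3) by (intro AE_I2) (auto simp: abs_mult intro: mult_left_le_one_le)
    show "(\<lambda>z. \<zeta> j z * ((indicator ?E z *\<^sub>R u z) \<bullet> \<nu> z)) \<in> borel_measurable T.vm" for j
    proof -
      have "(\<lambda>z. \<zeta> j z * ((indicator ?E z *\<^sub>R u z) \<bullet> \<nu> z)) \<in> Borel"
        by (rule borel_measurable_times[OF test_functions_borel[OF \<zeta>(1)] mE])
      thus ?thesis by (rule T_borel)
    qed
    show "(\<lambda>z. (indicator ?E z *\<^sub>R u z) \<bullet> \<nu> z) \<in> borel_measurable T.vm" by (rule borel_measurable_integrable[OF i3])
    show "integrable T.vm (\<lambda>z. \<bar>(indicator ?E z *\<^sub>R u z) \<bullet> \<nu> z\<bar>)" using i3 by (rule integrable_abs)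
  qed
  from LIMSEQ_unique[OF limR this] have extR: "L1_extension U ?R u = (LINT z|T.vm. above f0 t z * (u z \<bullet> \<nu> z))"
    by (simp add: ab)
  have "(LINT (z, S):superlevel f t \<times> UNIV|completion V. jacobian u (at z) \<bullet> orth_projection S) =
    (LINT p|completion V. (indicator (superlevel f t) (fst p) *\<^sub>R jacobian u (at (fst p))) \<bullet> orth_projection (snd p))"
    unfolding set_lebesgue_integral_def
    by (intro Bochner_Integration.integral_cong) (auto simp: indicator_def)
  also have "\<dots> = (LINT z|W.ext. (indicator ?E z *\<^sub>R jacobian u (at z)) \<bullet> P z)"
  proof (rule plane_integral[OF _ i2])
    show "AE z in weight U V. indicator (superlevel f t) z *\<^sub>R jacobian u (at z) = indicator ?E z *\<^sub>R jacobian u (at z)"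
      by (rule eventually_mono[OF superlevel_AE(1)[OF f, of t]]) (simp add: indicator_def)
  qed measurable
  finally have lhs: "(LINT (z, S):superlevel f t \<times> UNIV|completion V. jacobian u (at z) \<bullet> orth_projection S) = (LINT z|W.ext. above f0 t z * (tdiv u z))"
    by (simp add: ab inner_commute)
  have "(LINT z|W.ext. above f0 t z * (tdiv u z)) = L1_extension U ?R u - L1_extension U ?B u \<longleftrightarrow> L1_extension U ?B u = bdry (above f0 t) u"
    unfolding extR bdry_def by linarith
  moreover have "L1_extension U ?B u = bdry (above f0 t) u \<longleftrightarrow> level_limit \<zeta> f0 t u"
  proof
    assume "L1_extension U ?B u = bdry (above f0 t) u"
    thus "level_limit \<zeta> f0 t u" using limB by simp
  qed (rule LIMSEQ_unique[OF limB])
  ultimately show ?thesis unfolding lhs by (rule trans)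
qed

lemma product_derivative_measurable:
  fixes f :: "real^'n => real^'l"
  assumes "g \<in> Borel" "\<Gamma> \<in> Borel" "f \<in> Borel" "F \<in> Borel"
  shows "product_derivative g \<Gamma> f F \<in> Borel"
proof -
  have c: "continuous_on UNIV (\<lambda>p :: (real^'l) \<times> (real^'n). \<chi> i. (fst p $ i) *\<^sub>R snd p)"
    by (intro continuous_intros)
  have "(\<lambda>z. (f z, P z *v \<Gamma> z)) \<in> Borel"
    by (intro borel_measurable_Pair matrix_vector_measurable assms P0)
  from measurable_compose[OF this borel_measurable_continuous_onI[OF c]]
  have [measurable]: "(\<lambda>z. \<chi> i. (f z $ i) *\<^sub>R (P z *v \<Gamma> z)) \<in> Borel" by simp
  note [measurable] = assms
  show ?thesis unfolding product_derivative_def[abs_def] by measurable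
qed

text \<open>Since \<open>g\<close> and \<Gamma> are bounded on the compact sets in question, this
  makes the derivative of the product locally integrable up to the boundary.\<close>

lemma norm_product_derivative_le:
  "\<exists>c>0. \<forall>g \<Gamma> (f :: real^'n => real^'l) F z. norm (product_derivative g \<Gamma> f F z) \<le> \<bar>g z\<bar> * norm (F z) + c * (norm (\<Gamma> z) * norm (f z))"
proof -
  obtain Km where Km: "0 < Km" "\<And>(A::real^'n^'n) v. norm (A *v v) \<le> norm A * norm v * Km"
    using bounded_bilinear.pos_bounded[OF bounded_bilinear_matrix_vector] by blast
  let ?c = "real CARD('l) * (sqrt m * Km + 1)"
  have "norm (product_derivative g \<Gamma> f F z) \<le> \<bar>g z\<bar> * norm (F z) + ?c * (norm (\<Gamma> z) * norm (f z))" for g \<Gamma> F z and f :: "real^'n => real^'l"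
  proof -
    let ?v = "P z *v \<Gamma> z"
    have "norm ?v \<le> norm (P z) * norm (\<Gamma> z) * Km" by (rule Km(2))
    also have "\<dots> \<le> sqrt m * norm (\<Gamma> z) * Km" using P0(2) Km(1) by (intro mult_right_mono) auto
    also have "\<dots> \<le> (sqrt m * Km + 1) * norm (\<Gamma> z)" by (simp add: algebra_simps)
    finally have v: "norm ?v \<le> (sqrt m * Km + 1) * norm (\<Gamma> z)" .
    have "norm (\<chi> i. (f z $ i) *\<^sub>R ?v) \<le> (\<Sum>i\<in>UNIV. norm ((f z $ i) *\<^sub>R ?v))"
      using L2_set_le_sum[of UNIV "\<lambda>i. norm ((f z $ i) *\<^sub>R ?v)"] by (simp add: norm_vec_def)
    also have "\<dots> \<le> (\<Sum>i\<in>(UNIV :: 'l set). norm (f z) * ((sqrt m * Km + 1) * norm (\<Gamma> z)))"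
      using v component_le_norm_cart[of "f z"] by (intro sum_mono) (auto intro!: mult_mono)
    also have "\<dots> = ?c * (norm (\<Gamma> z) * norm (f z))" by (simp add: mult_ac)
    finally have "norm (\<chi> i. (f z $ i) *\<^sub>R ?v) \<le> ?c * (norm (\<Gamma> z) * norm (f z))" .
    thus ?thesis
      unfolding product_derivative_def using norm_triangle_ineq[of "g z *\<^sub>R F z" "\<chi> i. (f z $ i) *\<^sub>R ?v"] by simp
  qed
  moreover have "0 < ?c" using Km(1) by (simp add: add_nonneg_pos)
  ultimately show ?thesis by blast
qed

end

lemma (in measure_within) ext_borel: "h \<in> Borel ==> h \<in> borel_measurable ext"
  by (simp only: measurable_cong_sets[OF sets_ext refl])

context varifold_fv
begin

text \<open>With the integrability hypothesis, zero boundary values on \<open>G\<close> yield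
  \<open>parts True\<close> and finite superlevel sets in the open set \<open>- B\<close>, and
  conversely. In this form they pass from \<open>f\<close> to the product.\<close>

theorem zero_boundary_mult:
  fixes G B :: "(real^'n) set" and f :: "real^'n => (real^'l) option" and g :: "real^'n => real"
  assumes G: "openin (top_of_set (frontier U)) G" and B: "B = frontier U - G"
    and f: "f \<in> weakly_differentiable_zero_boundary U V G"
    and int: "\<And>K. compact K ==> K \<subseteq> - B ==>
           (\<integral>\<^sup>+z\<in>U \<inter> K. ennreal (norm (the (f z)) + norm (the (weak_derivative U V f z)))
              \<partial>completion (weight U V)) < \<infinity>"
    and lip: "\<And>K. compact K ==> K \<subseteq> - B ==> \<exists>L. L-lipschitz_on (U \<inter> K) g"
  shows "(\<lambda>z. map_option (\<lambda>y. g z *\<^sub>R y) (f z)) \<in> weakly_differentiable_zero_boundary U V G"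
proof -
  define W where "W = - B"
  have W: "open W" "U \<subseteq> W"
  proof -
    have "closed B"
      unfolding B using closedin_diff[OF closedin_topspace G] by (simp add: closedin_closed_trans)
    thus "open W" by (simp add: W_def open_Compl)
    show "U \<subseteq> W" using open_U0 by (auto simp: W_def B frontier_def interior_open)
  qed
  have UB: "U \<in> sets borel" using open_U0 by simp
  obtain \<zeta> :: "nat => real^'n => real" where \<zeta>0: "\<And>j. \<zeta> j \<in> test_functions U" "\<And>j z. 0 \<le> \<zeta> j z" "\<And>j z. \<zeta> j z \<le> 1"
      "\<And>i j z. i \<le> j ==> \<zeta> i z \<le> \<zeta> j z" and \<zeta>K: "\<And>K. compact K ==> K \<subseteq> U ==> \<exists>N. \<forall>j\<ge>N. \<forall>z\<in>K. \<zeta> j z = 1"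
    by (rule cutoff_sequence[OF open_U0]) blast
  have \<zeta>lim: "(\<lambda>j. \<zeta> j z) \<longlonglongrightarrow> 1" if z: "z \<in> U" for z
  proof -
    obtain N where "\<forall>j\<ge>N. \<zeta> j z = 1" using \<zeta>K[of "{z}"] z by auto
    thus ?thesis by (intro tendsto_eventually) (auto simp: eventually_sequentially)
  qed
  note \<zeta> = \<zeta>0(1-3) \<zeta>lim
  \<comment> \<open>The definition in terms of a Borel representative, with the boundary identity
    replaced by convergence along \<zeta>.\<close>
  have zero_iff: "h \<in> weakly_differentiable_zero_boundary U V G \<longleftrightarrow> h \<in> weakly_differentiable U V \<and>
      (AE t in lborel. 0 < t \<longrightarrow>
        (\<forall>K. compact K \<longrightarrow> K \<subseteq> W \<longrightarrow> emeasure W.ext ({z. t < norm (h0 z)} \<inter> K) < \<infinity> \<and> emeasure T.vm ({z. t < norm (h0 z)} \<inter> K) < \<infinity> \<and>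
            emeasure (variation U (varifold_boundary U V (superlevel h t))) (U \<inter> K) < \<infinity>) \<and>
        (\<forall>u\<in>test_functions W. level_limit \<zeta> h0 t u))"
    if h: "represents h h0" for h :: "real^'n => (real^'l) option" and h0
  proof -
    have "(let B = frontier U - G; E = superlevel h t in
           \<forall>K u. compact K \<and> K \<subseteq> - B \<and> u \<in> test_functions (- B) \<longrightarrow>
             emeasure (completion (weight U V)) (E \<inter> K)
               + emeasure (completion (total_variation U V)) (E \<inter> K)
               + emeasure (variation U (varifold_boundary U V E)) (U \<inter> K) < \<infinity> \<and>
             (LINT (z, S):E \<times> UNIV|completion V. jacobian u (at z) \<bullet> orth_projection S) =
               L1_extension U (first_variation_restrict U V E) u
                 - L1_extension U (varifold_boundary U V E) u) \<longleftrightarrow>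
        (\<forall>K. compact K \<longrightarrow> K \<subseteq> W \<longrightarrow> emeasure W.ext ({z. t < norm (h0 z)} \<inter> K) < \<infinity> \<and> emeasure T.vm ({z. t < norm (h0 z)} \<inter> K) < \<infinity> \<and>
            emeasure (variation U (varifold_boundary U V (superlevel h t))) (U \<inter> K) < \<infinity>) \<and>
        (\<forall>u\<in>test_functions W. level_limit \<zeta> h0 t u)"
      (is "?L \<longleftrightarrow> ?F \<and> ?R") for t
    proof -
      let ?fin = "\<lambda>K. emeasure W.ext ({z. t < norm (h0 z)} \<inter> K) < \<infinity> \<and> emeasure T.vm ({z. t < norm (h0 z)} \<inter> K) < \<infinity> \<and>
            emeasure (variation U (varifold_boundary U V (superlevel h t))) (U \<inter> K) < \<infinity>"
      let ?eq = "\<lambda>u. (LINT (z, S):superlevel h t \<times> UNIV|completion V. jacobian u (at z) \<bullet> orth_projection S) =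
               L1_extension U (first_variation_restrict U V (superlevel h t)) u
                 - L1_extension U (varifold_boundary U V (superlevel h t)) u"
      have fin_iff: "emeasure (completion (weight U V)) (superlevel h t \<inter> K)
               + emeasure (completion (total_variation U V)) (superlevel h t \<inter> K)
               + emeasure (variation U (varifold_boundary U V (superlevel h t))) (U \<inter> K) < \<infinity> \<longleftrightarrow> ?fin K" if "compact K" for K
        unfolding superlevel_emeasure[OF h borel_compact[OF that]] by (simp add: conj_assoc)
      have L: "?L \<longleftrightarrow> (\<forall>K u. compact K \<and> K \<subseteq> W \<and> u \<in> test_functions W \<longrightarrow> ?fin K \<and> ?eq u)"
        unfolding Let_def B[symmetric] W_def[symmetric] using fin_iff by blast
      have iff: "?eq u \<longleftrightarrow> level_limit \<zeta> h0 t u"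
        if "u \<in> test_functions W" ?F for u
        by (rule boundary_condition_iff[OF h W _ _ _ that(1) \<zeta>]) (use that(2) in blast)+
      show ?thesis
      proof
        assume ?L
        hence *: "\<And>K u. compact K ==> K \<subseteq> W ==> u \<in> test_functions W ==> ?fin K \<and> ?eq u" unfolding L by blast
        \<comment> \<open>The definition quantifies over the compact set and the field jointly; the
          zero field here and the empty compact set next separate the two conditions.\<close>
        have F: ?F using *[OF _ _ test_functions_zero] by blast
        have ?R using *[OF compact_empty] iff[OF _ F] by blast
        with F show "?F \<and> ?R" ..
      next
        assume "?F \<and> ?R"
        hence F: ?F and R: ?R by blast+
        have "?fin K \<and> ?eq u" if "compact K" "K \<subseteq> W" "u \<in> test_functions W" for K u
          using F that(1,2) R that(3) iff[OF that(3) F] by blast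
        thus ?L unfolding L by blast
      qed
    qed
    thus ?thesis unfolding weakly_differentiable_zero_boundary_def mem_Collect_eq by simp
  qed
  have fT: "f \<in> weakly_differentiable U V" using f by (simp add: weakly_differentiable_zero_boundary_def)
  then obtain f0 where f0: "represents f f0"
    using ae_measurable_iff_represented by (auto simp: weakly_differentiable_def)
  define F where "F = weak_derivative U V f"
  have F: "is_weak_derivative U V f F"
  proof -
    obtain F' where "is_weak_derivative U V f F'" using fT unfolding weakly_differentiable_def by blast
    thus ?thesis unfolding F_def weak_derivative_def by (rule someI[of "is_weak_derivative U V f"])
  qed
  hence "ae_measurable (weight U V) F" by (simp add: is_weak_derivative_def)
  then obtain F0 where F0 [measurable]: "F0 \<in> Borel" and FF0: "AE z in weight U V. F z = Some (F0 z)"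
    using W.ae_measurable_representative by blast
  note [measurable] = represents_borel[OF f0]
  have fw: "AE z in weight U V. f z = Some (f0 z)" and ft: "AE z in total_variation U V. f z = Some (f0 z)" and domf: "dom f \<subseteq> U"
    using f0 by (auto simp: represents_def)
  have partsF: "parts False U f0 F0"
    using F unfolding is_weak_derivative_def weak_derivative_iff_parts[OF f0 F0 FF0] by blast
  have "admissible True \<eta> ==> admissible False \<eta>" for \<eta> :: "real^'l => real" unfolding admissible_def by blast
  with partsF have partsT: "parts True U f0 F0" unfolding parts_def by blast
  have AE_f: "AE t in lborel. 0 < t \<longrightarrow>
        (\<forall>K. compact K \<longrightarrow> K \<subseteq> W \<longrightarrow> emeasure W.ext ({z. t < norm (f0 z)} \<inter> K) < \<infinity> \<and> emeasure T.vm ({z. t < norm (f0 z)} \<inter> K) < \<infinity> \<and>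
            emeasure (variation U (varifold_boundary U V (superlevel f t))) (U \<inter> K) < \<infinity>) \<and>
        (\<forall>u\<in>test_functions W. level_limit \<zeta> f0 t u)"
    using f zero_iff[OF f0] by blast
  have finf: "superlevel_finite True W f0"
    unfolding superlevel_finite_def
  proof (intro allI impI)
    fix K and r :: real assume K: "compact K" "K \<subseteq> W" and r: "0 < r"
    have KB [measurable]: "K \<in> sets borel" using K(1) by (rule borel_compact)
    \<comment> \<open>Almost every level has the finiteness property, so some level between
      \<open>0\<close> and \<open>r\<close> does.\<close>
    obtain t where t: "0 < t" "t < r" "emeasure W.ext ({z. t < norm (f0 z)} \<inter> K) < \<infinity>" "emeasure T.vm ({z. t < norm (f0 z)} \<inter> K) < \<infinity>"
    proof -
      have "\<exists>t\<in>{0<..<r}. emeasure W.ext ({z. t < norm (f0 z)} \<inter> K) < \<infinity> \<and> emeasure T.vm ({z. t < norm (f0 z)} \<inter> K) < \<infinity>"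
      proof (rule ccontr)
        assume none: "\<not> ?thesis"
        have "AE t in lborel. t \<notin> {0<..<r}" by (rule eventually_mono[OF AE_f]) (use none K in force)
        hence "emeasure lborel {0<..<r} = 0" by (subst (asm) AE_iff_measurable[of "{0<..<r}"]) auto
        thus False using r by simp
      qed
      thus ?thesis using that by auto
    qed
    have sub: "{z \<in> K. True \<longrightarrow> r \<le> norm (f0 z)} \<subseteq> {z. t < norm (f0 z)} \<inter> K" using t(2) by auto
    have S: "{z. t < norm (f0 z)} \<inter> K \<in> sets borel" by measurable
    show "emeasure W.ext {z \<in> K. True \<longrightarrow> r \<le> norm (f0 z)} < \<infinity> \<and> emeasure T.vm {z \<in> K. True \<longrightarrow> r \<le> norm (f0 z)} < \<infinity>"
      using emeasure_mono[OF sub, of W.ext] emeasure_mono[OF sub, of T.vm] t(3,4) S by (auto intro: le_less_trans)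
  qed
  have int0: "integrable W.ext (\<lambda>z. indicator K z *\<^sub>R f0 z)" "integrable W.ext (\<lambda>z. indicator K z *\<^sub>R F0 z)"
    if K: "compact K" "K \<subseteq> W" for K
  proof -
    have [measurable]: "K \<in> sets borel" using K(1) by (rule borel_compact)
    have "(\<integral>\<^sup>+z. ennreal (norm (the (f z)) + norm (the (F z))) * indicator (U \<inter> K) z \<partial>completion (weight U V)) =
        (\<integral>\<^sup>+z. ennreal (norm (f0 z) + norm (F0 z)) * indicator (U \<inter> K) z \<partial>W.ext)"
    proof (rule W.completion_nn_integral)
      show "(\<lambda>z. ennreal (norm (f0 z) + norm (F0 z)) * indicator (U \<inter> K) z) \<in> Borel"
        using UB by measurable
      show "AE z in weight U V. ennreal (norm (the (f z)) + norm (the (F z))) * indicator (U \<inter> K) z = ennreal (norm (f0 z) + norm (F0 z)) * indicator (U \<inter> K) z"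
        using fw FF0 by eventually_elim simp
    qed
    hence fin: "(\<integral>\<^sup>+z. ennreal (norm (f0 z) + norm (F0 z)) * indicator (U \<inter> K) z \<partial>W.ext) < \<infinity>"
      using int[of K] K by (simp add: W_def F_def)
    have le: "(\<integral>\<^sup>+z. ennreal (norm (indicator K z *\<^sub>R f0 z)) \<partial>W.ext) \<le> (\<integral>\<^sup>+z. ennreal (norm (f0 z) + norm (F0 z)) * indicator (U \<inter> K) z \<partial>W.ext)"
      "(\<integral>\<^sup>+z. ennreal (norm (indicator K z *\<^sub>R F0 z)) \<partial>W.ext) \<le> (\<integral>\<^sup>+z. ennreal (norm (f0 z) + norm (F0 z)) * indicator (U \<inter> K) z \<partial>W.ext)"
      by (intro nn_integral_mono_AE eventually_mono[OF \<alpha>.AE_U], auto simp: indicator_def intro!: ennreal_leI)+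
    have m: "(\<lambda>z. indicator K z *\<^sub>R f0 z) \<in> Borel" "(\<lambda>z. indicator K z *\<^sub>R F0 z) \<in> Borel"
      by measurable
    show "integrable W.ext (\<lambda>z. indicator K z *\<^sub>R f0 z)" "integrable W.ext (\<lambda>z. indicator K z *\<^sub>R F0 z)"
      using W.ext_borel[OF m(1)] W.ext_borel[OF m(2)] le_less_trans[OF le(1) fin] le_less_trans[OF le(2) fin]
      unfolding integrable_iff_bounded by blast+
  qed
  have fintW: "loc_integrable W f0" and FintW: "loc_integrable W F0"
    unfolding loc_integrable_def using int0 by auto
  have levels: "AE t in lborel. 0 < t \<longrightarrow> level_limit \<zeta> f0 t u"
    if "u \<in> test_functions W" for u
    by (rule eventually_mono[OF AE_f]) (use that in blast)
  have partsW: "parts True W f0 F0"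
    by (rule parts_from_levels[OF represents_borel[OF f0] F0 W(2) partsT finf FintW \<zeta> levels])
  \<comment> \<open>Off \<open>U\<close> the values of \<open>g\<close> are arbitrary;
    \<open>g0\<close> is a Borel function on the whole space because \<open>g\<close> is continuous
    on \<open>U\<close>.\<close>
  define g0 where "g0 z = indicator U z *\<^sub>R g z" for z
  have lip0: "\<exists>L. L-lipschitz_on (U \<inter> K) g0" if K: "compact K" "K \<subseteq> W" for K
  proof -
    obtain L where "L-lipschitz_on (U \<inter> K) g" using lip[of K] K by (auto simp: W_def)
    hence "L-lipschitz_on (U \<inter> K) g0" by (rule lipschitz_on_transform) (simp add: g0_def)
    thus ?thesis ..
  qed
  have "continuous_on U g"
  proof (subst continuous_on_eq_continuous_at[OF open_U0], intro ballI)
    fix x assume "x \<in> U"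
    then obtain e where e: "0 < e" "cball x e \<subseteq> U" using open_U0 open_contains_cball by blast
    then obtain L where "L-lipschitz_on (U \<inter> cball x e) g" using lip[of "cball x e"] W(2) by (auto simp: W_def)
    hence "continuous_on (U \<inter> cball x e) g" by (rule lipschitz_on_continuous_on)
    hence "continuous_on (ball x e) g" by (rule continuous_on_subset) (use e in auto)
    thus "continuous (at x) g" using e(1) by (simp add: continuous_on_eq_continuous_at)
  qed
  hence g0 [measurable]: "g0 \<in> Borel"
    unfolding g0_def using UB by (rule borel_measurable_continuous_on_indicator[rotated])
  have g_bound: "\<exists>M>0. \<forall>z\<in>K. \<bar>g0 z\<bar> \<le> M" if K: "compact K" "K \<subseteq> W" for K
  proof -
    obtain L where "L-lipschitz_on (U \<inter> K) g0" using lip0[OF K] by blast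
    hence "bounded (g0 ` (U \<inter> K))"
      using K(1) by (intro bounded_uniformly_continuous_image lipschitz_on_uniformly_continuous) (auto intro: bounded_subset compact_imp_bounded)
    then obtain M where M: "0 < M" "\<And>z. z \<in> U \<inter> K ==> \<bar>g0 z\<bar> \<le> M" by (auto simp: bounded_pos)
    have "\<bar>g0 z\<bar> \<le> M" if "z \<in> K" for z using M that by (cases "z \<in> U") (auto simp: g0_def)
    thus ?thesis using M(1) by blast
  qed
  \<comment> \<open>One \<Gamma> for both uses of \<open>product\<close>, so that the same
    \<open>H0\<close> is the weak derivative in \<open>U\<close> and satisfies the boundary identity
    in \<open>W\<close>.\<close>
  obtain \<Gamma> where \<Gamma>: "\<Gamma> \<in> Borel" "\<And>K. compact K ==> K \<subseteq> W ==> \<exists>L. \<forall>z\<in>K. norm (\<Gamma> z) \<le> L"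
    and product: "\<And>flag W' (f :: real^'n => real^'l) F. W' \<subseteq> W ==> f \<in> Borel ==> F \<in> Borel ==>
      parts flag W' f F ==> superlevel_finite flag W' f ==> loc_integrable W' f ==> loc_integrable W' F ==>
      parts flag W' (\<lambda>z. g0 z *\<^sub>R f z) (product_derivative g0 \<Gamma> f F)"
    using parts_lipschitz[OF g0 W(1) lip0, where 'l='l] by blast
  define h0 where "h0 z = g0 z *\<^sub>R f0 z" for z
  define H0 where "H0 = product_derivative g0 \<Gamma> f0 F0"
  define h where "h z = map_option (\<lambda>y. g z *\<^sub>R y) (f z)" for z
  \<comment> \<open>Undefined off \<open>U\<close>, since \<open>ae_measurable\<close> requires the
    domain to lie in the space of the measure.\<close>
  define H where "H z = (if z \<in> U then Some (H0 z) else None)" for z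
  have h0 [measurable]: "h0 \<in> Borel" unfolding h0_def[abs_def] by measurable
  have H0 [measurable]: "H0 \<in> Borel"
    unfolding H0_def by (rule product_derivative_measurable[OF g0 \<Gamma>(1) represents_borel[OF f0] F0])
  have "loc_integrable U f0" "loc_integrable U F0"
    using fintW FintW W(2) unfolding loc_integrable_def by blast+
  moreover have "superlevel_finite False U f0"
    unfolding superlevel_finite_def using \<alpha>.compact_finite T.vm.compact_finite by simp
  \<comment> \<open>General \<eta> with fields supported in \<open>U\<close> give weak
    differentiability; radial \<eta> with fields supported in \<open>W\<close>, treated next, give
    the boundary values.\<close>
  ultimately have partsHU: "parts False U h0 H0"
    unfolding h0_def[abs_def] H0_def by (intro product[OF W(2) represents_borel[OF f0] F0 partsF])
  have partsHW: "parts True W h0 H0"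
    unfolding h0_def[abs_def] H0_def by (intro product[OF order_refl represents_borel[OF f0] F0 partsW finf fintW FintW])
  have finh: "superlevel_finite True W h0"
    unfolding superlevel_finite_def
  proof (intro allI impI)
    fix K and r :: real assume K: "compact K" "K \<subseteq> W" and r: "0 < r"
    have [measurable]: "K \<in> sets borel" using K(1) by (rule borel_compact)
    obtain M where M: "0 < M" "\<And>z. z \<in> K ==> \<bar>g0 z\<bar> \<le> M" using g_bound[OF K] by blast
    have sub: "{z \<in> K. True \<longrightarrow> r \<le> norm (h0 z)} \<subseteq> {z \<in> K. True \<longrightarrow> r / M \<le> norm (f0 z)}"
    proof safe
      fix z assume z: "z \<in> K" "r \<le> norm (h0 z)"
      have "norm (h0 z) \<le> M * norm (f0 z)" using mult_right_mono[OF M(2)[OF z(1)] norm_ge_zero[of "f0 z"]] by (simp add: h0_def)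
      thus "r / M \<le> norm (f0 z)" using z(2) M(1) by (simp add: field_simps)
    qed
    have S: "{z \<in> K. True \<longrightarrow> r / M \<le> norm (f0 z)} \<in> sets borel" by measurable
    have "emeasure W.ext {z \<in> K. True \<longrightarrow> r / M \<le> norm (f0 z)} < \<infinity>" "emeasure T.vm {z \<in> K. True \<longrightarrow> r / M \<le> norm (f0 z)} < \<infinity>"
      using finf K divide_pos_pos[OF r M(1)] unfolding superlevel_finite_def by blast+
    thus "emeasure W.ext {z \<in> K. True \<longrightarrow> r \<le> norm (h0 z)} < \<infinity> \<and> emeasure T.vm {z \<in> K. True \<longrightarrow> r \<le> norm (h0 z)} < \<infinity>"
      using emeasure_mono[OF sub, of W.ext] emeasure_mono[OF sub, of T.vm] S by (auto intro: le_less_trans)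
  qed
  have HintW: "loc_integrable W H0"
    unfolding loc_integrable_def
  proof (intro allI impI)
    fix K assume K: "compact K" "K \<subseteq> W"
    have [measurable]: "K \<in> sets borel" using K(1) by (rule borel_compact)
    obtain M where M: "0 < M" "\<And>z. z \<in> K ==> \<bar>g0 z\<bar> \<le> M" using g_bound[OF K] by blast
    obtain L where L: "\<And>z. z \<in> K ==> norm (\<Gamma> z) \<le> L" using \<Gamma>(2)[OF K] by blast
    obtain c where c: "0 < c" "\<And>g \<Gamma> (f :: real^'n => real^'l) F z. norm (product_derivative g \<Gamma> f F z) \<le> \<bar>g z\<bar> * norm (F z) + c * (norm (\<Gamma> z) * norm (f z))"
      using norm_product_derivative_le[where 'l='l] by blast
    show "integrable W.ext (\<lambda>z. indicator K z *\<^sub>R H0 z)"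
    proof (rule Bochner_Integration.integrable_bound[of _ "\<lambda>z. M * norm (indicator K z *\<^sub>R F0 z) + c * L * norm (indicator K z *\<^sub>R f0 z)"])
      show "integrable W.ext (\<lambda>z. M * norm (indicator K z *\<^sub>R F0 z) + c * L * norm (indicator K z *\<^sub>R f0 z))"
        by (intro Bochner_Integration.integrable_add integrable_mult_right integrable_norm int0 K)
      have "(\<lambda>z. indicator K z *\<^sub>R H0 z) \<in> Borel" by measurable
      thus "(\<lambda>z. indicator K z *\<^sub>R H0 z) \<in> borel_measurable W.ext" by (rule W.ext_borel)
      show "AE z in W.ext. norm (indicator K z *\<^sub>R H0 z) \<le> norm (M * norm (indicator K z *\<^sub>R F0 z) + c * L * norm (indicator K z *\<^sub>R f0 z))"
      proof (rule AE_I2)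
        fix z show "norm (indicator K z *\<^sub>R H0 z) \<le> norm (M * norm (indicator K z *\<^sub>R F0 z) + c * L * norm (indicator K z *\<^sub>R f0 z))"
        proof (cases "z \<in> K")
          case True
          have "norm (H0 z) \<le> \<bar>g0 z\<bar> * norm (F0 z) + c * (norm (\<Gamma> z) * norm (f0 z))" unfolding H0_def by (rule c(2))
          also have "\<dots> \<le> M * norm (F0 z) + c * (L * norm (f0 z))"
            using c(1) by (intro add_mono mult_left_mono mult_right_mono M(2)[OF True] L[OF True]) auto
          finally show ?thesis using True by (simp add: mult.assoc)
        qed simp
      qed
    qed
  qed
  have h: "represents h h0"
  proof -
    have "h z = Some (h0 z)" if "f z = Some (f0 z)" for z
      using that domf by (auto simp: h_def h0_def g0_def)
    hence "AE z in weight U V. h z = Some (h0 z)" "AE z in total_variation U V. h z = Some (h0 z)"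
      using fw ft by (blast intro: eventually_mono)+
    moreover have "dom h = dom f" by (auto simp: h_def dom_def)
    ultimately show ?thesis using h0 domf by (simp add: represents_def)
  qed
  have Hae: "AE z in weight U V. H z = Some (H0 z)"
    using AE_space by eventually_elim (simp add: H_def W.space_M)
  have "is_weak_derivative U V h H"
    unfolding is_weak_derivative_def
  proof (intro conjI)
    have "dom H = U" by (auto simp: H_def dom_def)
    thus "ae_measurable (weight U V) H"
      by (intro ae_measurableI[OF _ W.borel_M[OF H0] Hae]) (simp add: W.space_M)
    show "\<forall>K s. compact K \<and> K \<subseteq> U \<and> 0 \<le> s \<longrightarrow>
        (\<integral>\<^sup>+z\<in>{z \<in> K \<inter> dom h. norm (the (h z)) \<le> s}. ennreal (norm (the (H z))) \<partial>completion (weight U V)) < \<infinity>"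
    proof (intro allI impI)
      fix K and s :: real assume K: "compact K \<and> K \<subseteq> U \<and> 0 \<le> s"
      hence K': "compact K" "K \<subseteq> W" using W(2) by auto
      have [measurable]: "K \<in> sets borel" using K'(1) by (rule borel_compact)
      have "(\<integral>\<^sup>+z\<in>{z \<in> K \<inter> dom h. norm (the (h z)) \<le> s}. ennreal (norm (the (H z))) \<partial>completion (weight U V))
          \<le> (\<integral>\<^sup>+z. ennreal (norm (indicator K z *\<^sub>R H0 z)) \<partial>completion (weight U V))"
        by (intro nn_integral_mono_AE eventually_mono[OF AE_completion[OF Hae]]) (auto simp: indicator_def)
      also have "\<dots> = (\<integral>\<^sup>+z. ennreal (norm (indicator K z *\<^sub>R H0 z)) \<partial>W.ext)"
      proof (rule W.completion_nn_integral)
        have "(\<lambda>z. indicator K z *\<^sub>R H0 z) \<in> Borel" by measurable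
        thus "(\<lambda>z. ennreal (norm (indicator K z *\<^sub>R H0 z))) \<in> Borel" by measurable
      qed simp
      also have "\<dots> < \<infinity>"
        using HintW K' unfolding loc_integrable_def integrable_iff_bounded by blast
      finally show "(\<integral>\<^sup>+z\<in>{z \<in> K \<inter> dom h. norm (the (h z)) \<le> s}. ennreal (norm (the (H z))) \<partial>completion (weight U V)) < \<infinity>" .
    qed
  qed (use partsHU weak_derivative_iff_parts[OF h H0 Hae] in blast)
  hence hT: "h \<in> weakly_differentiable U V"
    using ae_measurable_iff_represented[of h] h unfolding weakly_differentiable_def by blast
  have "AE t in lborel. 0 < t \<longrightarrow>
      (\<forall>K. compact K \<longrightarrow> K \<subseteq> W \<longrightarrow> (\<exists>M. \<forall>u\<in>test_functions W. spt u \<subseteq> K \<longrightarrow> (\<forall>z. norm (u z) \<le> 1) \<longrightarrow> \<bar>bdry (above h0 t) u\<bar> \<le> M)) \<and>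
      (\<forall>u\<in>test_functions W. level_limit \<zeta> h0 t u)"
    by (rule levels_from_parts[OF h0 H0 W partsHW finh HintW \<zeta>0 \<zeta>lim])
  hence "AE t in lborel. 0 < t \<longrightarrow>
        (\<forall>K. compact K \<longrightarrow> K \<subseteq> W \<longrightarrow> emeasure W.ext ({z. t < norm (h0 z)} \<inter> K) < \<infinity> \<and> emeasure T.vm ({z. t < norm (h0 z)} \<inter> K) < \<infinity> \<and>
            emeasure (variation U (varifold_boundary U V (superlevel h t))) (U \<inter> K) < \<infinity>) \<and>
        (\<forall>u\<in>test_functions W. level_limit \<zeta> h0 t u)"
  proof eventually_elim
    case (elim t)
    show ?case
    proof (intro impI conjI allI)
      fix K assume t: "0 < t" and K: "compact K" "K \<subseteq> W"
      have [measurable]: "K \<in> sets borel" using K(1) by (rule borel_compact)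
      have sub: "{z. t < norm (h0 z)} \<inter> K \<subseteq> {z \<in> K. True \<longrightarrow> t \<le> norm (h0 z)}" by auto
      have S: "{z \<in> K. True \<longrightarrow> t \<le> norm (h0 z)} \<in> sets borel" by measurable
      have "emeasure W.ext {z \<in> K. True \<longrightarrow> t \<le> norm (h0 z)} < \<infinity>" "emeasure T.vm {z \<in> K. True \<longrightarrow> t \<le> norm (h0 z)} < \<infinity>"
        using finh K t unfolding superlevel_finite_def by blast+
      thus "emeasure W.ext ({z. t < norm (h0 z)} \<inter> K) < \<infinity>" "emeasure T.vm ({z. t < norm (h0 z)} \<inter> K) < \<infinity>"
        using emeasure_mono[OF sub, of W.ext] emeasure_mono[OF sub, of T.vm] S by (auto intro: le_less_trans)
      interpret B: test_functional U "varifold_boundary U V (superlevel h t)"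
        by (rule superlevel_functionals(2)[OF h])
      show "emeasure (variation U (varifold_boundary U V (superlevel h t))) (U \<inter> K) < \<infinity>"
      proof (rule B.variation_finite[OF W K])
        fix K assume K: "compact K" "K \<subseteq> W"
        have "\<exists>M. \<forall>u\<in>test_functions W. spt u \<subseteq> K \<longrightarrow> (\<forall>z. norm (u z) \<le> 1) \<longrightarrow> \<bar>bdry (above h0 t) u\<bar> \<le> M"
          using elim[rule_format, OF t, THEN conjunct1, rule_format, OF K] .
        then obtain M where M: "\<forall>u\<in>test_functions W. spt u \<subseteq> K \<longrightarrow> (\<forall>z. norm (u z) \<le> 1) \<longrightarrow> \<bar>bdry (above h0 t) u\<bar> \<le> M" ..
        have "varifold_boundary U V (superlevel h t) u \<le> M"
          if th: "u \<in> test_functions U" "spt u \<subseteq> K" "\<forall>z. norm (u z) \<le> 1" for u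
          unfolding restrict_values(2)[OF h th(1)] using M[rule_format, OF test_functions_mono[OF W(2) th(1)] th(2) th(3)[rule_format]] by linarith
        thus "\<exists>M. \<forall>u\<in>test_functions U. spt u \<subseteq> K \<longrightarrow> (\<forall>z. norm (u z) \<le> 1) \<longrightarrow> varifold_boundary U V (superlevel h t) u \<le> M"
          by blast
      qed
    qed (use elim in blast)
  qed
  with hT have "h \<in> weakly_differentiable_zero_boundary U V G" using zero_iff[OF h] by blast
  thus ?thesis by (simp add: h_def[abs_def])
qed

end

theorem theorem7p13:
  fixes U G B :: "(real^'n) set" and m :: nat
    and V :: "((real^'n) \<times> (real^'n) set) measure"
    and f :: "real^'n \<Rightarrow> (real^'l) option" and g :: "real^'n \<Rightarrow> real"
  assumes "1 \<le> m" and "m \<le> CARD('n)"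
    and "open U"
    and "rectifiable_varifold U m V"
    and "radon_measure_on (top_of_set U) (total_variation U V)"
    and "openin (top_of_set (frontier U)) G"
    and "B = frontier U - G"
    and "f \<in> weakly_differentiable_zero_boundary U V G"
    and "\<And>K. compact K \<Longrightarrow> K \<subseteq> - B \<Longrightarrow>
           (\<integral>\<^sup>+z\<in>U \<inter> K. ennreal (norm (the (f z)) + norm (the (weak_derivative U V f z)))
              \<partial>completion (weight U V)) < \<infinity>"
    and "\<And>K. compact K \<Longrightarrow> K \<subseteq> - B \<Longrightarrow> \<exists>L. L-lipschitz_on (U \<inter> K) g"
  shows "(\<lambda>z. map_option (\<lambda>y. g z *\<^sub>R y) (f z)) \<in> weakly_differentiable_zero_boundary U V G"
proof -
  have "varifold U m V" using assms(4) by (simp add: rectifiable_varifold_def)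
  then obtain P \<nu> where "varifold_fv U m V P \<nu>" using ex_varifold_fv[OF assms(3) _ assms(5)] by blast
  then interpret varifold_fv U m V P \<nu> .
  show ?thesis by (rule zero_boundary_mult[OF assms(6-10)])
qed

end
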